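(* Consider the side-channel assisted MIMO full-duplex network described in the context with $M_{\mathrm{dl}},N_{\mathrm{ul}}\ge M_{\mathrm{ul}},N_{\mathrm{dl}}$, $\alpha_{\mathrm{ul}}=\alpha_{\mathrm{dl}}=1$, fixed $\alpha_{\mathrm{I}},\alpha_{\mathrm{S}}\ge0$, $W\ge0$, and full channel knowledge at all nodes. Let $\mathsf{GDoF}_{\mathrm{sum}}$ be the maximum of $\mathsf{DoF}_{\mathrm{dl}}+\mathsf{DoF}_{\mathrm{ul}}$ over the $\mathsf{GDoF}$ region, $m_X=\max(M_{\mathrm{ul}},N_{\mathrm{dl}})$, $m_{\mathrm{I}}=\min(M_{\mathrm{ul}},N_{\mathrm{dl}})$. Then \[ \frac{\mathsf{GDoF}_{\mathrm{sum}}}{\min(M_{\mathrm{ul}},N_{\mathrm{dl}})}=\begin{cases}\min\Big\{\frac{m_X}{m_{\mathrm{I}}}+1,\;\frac{m_X}{m_{\mathrm{I}}}+1-\alpha_{\mathrm{I}}+W\alpha_{\mathrm{S}}\Big\},&\alpha_{\mathrm{I}}<1,\\[2mm]\min\Big\{\frac{m_X}{m_{\mathrm{I}}}+1,\;\frac{m_X}{m_{\mathrm{I}}}-1+\alpha_{\mathrm{I}}+W\alpha_{\mathrm{S}}\Big\},&\alpha_{\mathrm{I}}\ge1.\end{cases} \]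
   Context: Network model: a full-duplex base station (BS) has $M_{\mathrm{dl}}$ transmit and $N_{\mathrm{ul}}$ receive antennas; an uplink mobile M1 with $M_{\mathrm{ul}}$ transmit antennas sends a message to the BS; a downlink mobile M2 with $N_{\mathrm{dl}}$ receive antennas receives a message from the BS. Main channel bandwidth $W_m$; orthogonal side-channel from M1 to M2 of bandwidth $W_s$, $W=W_s/W_m$. M1 devotes power fraction $\bar\lambda=1-\lambda$, $\lambda\in(0,1)$ fixed, to the main channel and $\lambda$ to the side-channel. Outputs per use: $Y_{\mathrm{ul}}=\sqrt{\bar\lambda\rho_{\mathrm{ul}}}H_{\mathrm{ul}}X_{\mathrm{ul}}+Z_{\mathrm{ul}}$ (at BS), $Y_{\mathrm{dl}}=\sqrt{\rho_{\mathrm{dl}}}H_{\mathrm{dl}}X_{\mathrm{dl}}+\sqrt{\bar\lambda\rho_{\mathrm{I}}}H_{\mathrm{I}}X_{\mathrm{ul}}+Z_{\mathrm{dl}}$ (at M2), $Y_{\mathrm{S}}=\sqrt{\lambda\rho_{\mathrm{S}}}H_{\mathrm{S}}X_{\mathrm{S}}+Z_{\mathrm{S}}$ (at M2 over the side-channel), with time-invariant generic (i.i.d. $\mathcal{CN}(0,1)$-drawn, full rank) matrices $H_{\mathrm{dl}}\in\mathbb C^{N_{\mathrm{dl}}\times M_{\mathrm{dl}}}$, $H_{\mathrm{ul}}\in\mathbb C^{N_{\mathrm{ul}}\times M_{\mathrm{ul}}}$, $H_{\mathrm{I}},H_{\mathrm{S}}\in\mathbb C^{N_{\mathrm{dl}}\times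 M_{\mathrm{ul}}}$, $Z_{\mathrm{ul}},Z_{\mathrm{dl}}$ i.i.d. $\mathcal{CN}(0,1)$ entries, $Z_{\mathrm{S}}$ i.i.d. $\mathcal{CN}(0,W)$ entries. Inputs obey average power constraint $\frac1L\sum_t\mathrm{Tr}\,\mathbb E[X(t)X(t)^\dagger]\le1$. The BS is full-duplex; M2 decodes from $(Y_{\mathrm{dl}}^n,Y_{\mathrm{S}}^n)$. Rates in bits/s. GDoF: nominal SNR $\rho\to\infty$, $\rho_i=\rho^{\alpha_i}$ for $i\in\{\mathrm{dl},\mathrm{ul},\mathrm{I},\mathrm{S}\}$; the GDoF region is the set of limits $(\lim R_{\mathrm{dl}}/(W_m\log\rho),\lim R_{\mathrm{ul}}/(W_m\log\rho))$ of rate pairs in the capacity region. *)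

theory Defs
  imports "HOL-Probability.Probability"
begin

definition cgauss :: "real \<Rightarrow> complex measure" where
  "cgauss s = density lborel (\<lambda>z. ennreal (exp (- ((cmod z) ^ 2) / s) / (pi * s)))"

text \<open>Vectors are functions nat => complex (entries below the dimension are used);
  matrices are functions nat => nat => complex (row, column).\<close>

record fdnet =
  n_Mdl :: nat
  n_Nul :: nat
  n_Mul :: nat
  n_Ndl :: nat
  Wm :: real
  Wr :: real
  lam :: real
  H_dl :: "nat \<Rightarrow> nat \<Rightarrow> complex"
  H_ul :: "nat \<Rightarrow> nat \<Rightarrow> complex"
  H_I :: "nat \<Rightarrow> nat \<Rightarrow> complex"
  H_S :: "nat \<Rightarrow> nat \<Rightarrow> complex"
  snr_dl :: real
  snr_ul :: real
  snr_I :: real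
  snr_S :: real

text \<open>Number of side-channel uses during n main-channel uses (ratio W = Ws/Wm).\<close>
definition side_len :: "fdnet \<Rightarrow> nat \<Rightarrow> nat" where
  "side_len N n = nat \<lfloor>Wr N * real n\<rfloor>"

text \<open>Noise samples indexed by (k,t,i): k=0 uplink (at BS), k=1 downlink (at M2),
  k=2 side channel (at M2, variance W).\<close>
definition noise_idx :: "fdnet \<Rightarrow> nat \<Rightarrow> (nat \<times> nat \<times> nat) set" where
  "noise_idx N n =
     ({0} \<times> {..<n} \<times> {..<n_Nul N}) \<union> ({1} \<times> {..<n} \<times> {..<n_Ndl N})
     \<union> ({2} \<times> {..<side_len N n} \<times> {..<n_Ndl N})"

definition noise_space :: "fdnet \<Rightarrow> nat \<Rightarrow> (nat \<times> nat \<times> nat \<Rightarrow> complex) measure" where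
  "noise_space N n = PiM (noise_idx N n) (\<lambda>(k,t,i). cgauss (if k = 2 then Wr N else 1))"

definition sqnorm :: "nat \<Rightarrow> (nat \<Rightarrow> complex) \<Rightarrow> real" where
  "sqnorm m v = (\<Sum>j<m. (cmod (v j)) ^ 2)"

definition y_ul :: "fdnet \<Rightarrow> nat \<Rightarrow> (nat \<Rightarrow> nat \<Rightarrow> complex) \<Rightarrow> (nat \<times> nat \<times> nat \<Rightarrow> complex)
    \<Rightarrow> nat \<Rightarrow> nat \<Rightarrow> complex" where
  "y_ul N n x \<omega> = (\<lambda>t i. if t < n \<and> i < n_Nul N then
      complex_of_real (sqrt ((1 - lam N) * snr_ul N)) * (\<Sum>j<n_Mul N. H_ul N i j * x t j) + \<omega> (0,t,i)
    else 0)"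

text \<open>Downlink input of the full-duplex BS: at time t it may depend on its message
  (already applied in f) and on the uplink outputs strictly before t.\<close>
definition x_dl :: "(nat \<Rightarrow> (nat \<Rightarrow> nat \<Rightarrow> complex) \<Rightarrow> nat \<Rightarrow> complex)
    \<Rightarrow> (nat \<Rightarrow> nat \<Rightarrow> complex) \<Rightarrow> nat \<Rightarrow> nat \<Rightarrow> complex" where
  "x_dl f yu = (\<lambda>t. f t (\<lambda>t' i. if t' < t then yu t' i else 0))"

definition y_dl :: "fdnet \<Rightarrow> nat \<Rightarrow> (nat \<Rightarrow> nat \<Rightarrow> complex) \<Rightarrow> (nat \<Rightarrow> nat \<Rightarrow> complex)
    \<Rightarrow> (nat \<times> nat \<times> nat \<Rightarrow> complex) \<Rightarrow> nat \<Rightarrow> nat \<Rightarrow> complex" where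
  "y_dl N n xd xu \<omega> = (\<lambda>t i. if t < n \<and> i < n_Ndl N then
      complex_of_real (sqrt (snr_dl N)) * (\<Sum>j<n_Mdl N. H_dl N i j * xd t j)
      + complex_of_real (sqrt ((1 - lam N) * snr_I N)) * (\<Sum>j<n_Mul N. H_I N i j * xu t j)
      + \<omega> (1,t,i)
    else 0)"

definition y_S :: "fdnet \<Rightarrow> nat \<Rightarrow> (nat \<Rightarrow> nat \<Rightarrow> complex)
    \<Rightarrow> (nat \<times> nat \<times> nat \<Rightarrow> complex) \<Rightarrow> nat \<Rightarrow> nat \<Rightarrow> complex" where
  "y_S N n xs \<omega> = (\<lambda>t i. if t < side_len N n \<and> i < n_Ndl N then
      complex_of_real (sqrt (lam N * snr_S N)) * (\<Sum>j<n_Mul N. H_S N i j * xs t j) + \<omega> (2,t,i)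
    else 0)"

text \<open>A code of block length n (main-channel uses): messages wd < Kd, wu < Ku;
  xul wu t / xs wu t: M1's main / side-channel inputs; fdl wd t past: BS downlink input;
  gul wd y: BS decoder (knows its own message); gdl y ys: M2 decoder.\<close>
definition err_event where
  "err_event N n xul xs fdl gul gdl wd wu =
    {\<omega> \<in> space (noise_space N n).
       gul wd (y_ul N n (xul wu) \<omega>) \<noteq> wu \<or>
       gdl (y_dl N n (x_dl (fdl wd) (y_ul N n (xul wu) \<omega>)) (xul wu) \<omega>) (y_S N n (xs wu) \<omega>) \<noteq> wd}"

definition valid_code ::
  "fdnet \<Rightarrow> nat \<Rightarrow> nat \<Rightarrow> nat \<Rightarrow> (nat \<Rightarrow> nat \<Rightarrow> nat \<Rightarrow> complex) \<Rightarrow> (nat \<Rightarrow> nat \<Rightarrow> nat \<Rightarrow> complex)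
   \<Rightarrow> (nat \<Rightarrow> nat \<Rightarrow> (nat \<Rightarrow> nat \<Rightarrow> complex) \<Rightarrow> nat \<Rightarrow> complex)
   \<Rightarrow> (nat \<Rightarrow> (nat \<Rightarrow> nat \<Rightarrow> complex) \<Rightarrow> nat)
   \<Rightarrow> ((nat \<Rightarrow> nat \<Rightarrow> complex) \<Rightarrow> (nat \<Rightarrow> nat \<Rightarrow> complex) \<Rightarrow> nat) \<Rightarrow> bool" where
  "valid_code N n Kd Ku xul xs fdl gul gdl \<longleftrightarrow>
     (\<forall>wd<Kd. \<forall>wu<Ku.
        err_event N n xul xs fdl gul gdl wd wu \<in> sets (noise_space N n) \<and>
        (\<forall>t<n. \<forall>j<n_Mdl N.
           (\<lambda>\<omega>. x_dl (fdl wd) (y_ul N n (xul wu) \<omega>) t j) \<in> borel_measurable (noise_space N n)))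
   \<and> (\<Sum>t<n. \<Sum>wu<Ku. sqnorm (n_Mul N) (xul wu t)) \<le> real n * real Ku
   \<and> (\<Sum>t<side_len N n. \<Sum>wu<Ku. sqnorm (n_Mul N) (xs wu t)) \<le> real (side_len N n) * real Ku
   \<and> (\<Sum>t<n. \<Sum>wd<Kd. \<Sum>wu<Ku.
        \<integral>\<^sup>+ \<omega>. ennreal (sqnorm (n_Mdl N) (x_dl (fdl wd) (y_ul N n (xul wu) \<omega>) t)) \<partial>noise_space N n)
      \<le> ennreal (real n * real Kd * real Ku)"

definition error_prob where
  "error_prob N n Kd Ku xul xs fdl gul gdl =
     (\<Sum>wd<Kd. \<Sum>wu<Ku. measure (noise_space N n) (err_event N n xul xs fdl gul gdl wd wu))
     / (real Kd * real Ku)"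

text \<open>Rates (Rdl, Rul) in bits/s; n main-channel uses last n / Wm seconds.\<close>
definition achievable :: "fdnet \<Rightarrow> real \<times> real \<Rightarrow> bool" where
  "achievable N R \<longleftrightarrow> 0 \<le> fst R \<and> 0 \<le> snd R \<and>
     (\<forall>\<epsilon>>0. \<exists>n0. \<forall>n\<ge>n0. \<exists>Kd Ku xul xs fdl gul gdl.
        real Kd \<ge> 2 powr (real n * fst R / Wm N) \<and>
        real Ku \<ge> 2 powr (real n * snd R / Wm N) \<and>
        valid_code N n Kd Ku xul xs fdl gul gdl \<and>
        error_prob N n Kd Ku xul xs fdl gul gdl \<le> \<epsilon>)"

definition capacity_region :: "fdnet \<Rightarrow> (real \<times> real) set" where
  "capacity_region N = closure {R. achievable N R}"

definition gdof_region :: "(real \<Rightarrow> fdnet) \<Rightarrow> real \<Rightarrow> (real \<times> real) set" where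
  "gdof_region net wm = {(d1, d2). \<exists>R :: real \<Rightarrow> real \<times> real.
      (\<forall>\<rho>>1. R \<rho> \<in> capacity_region (net \<rho>)) \<and>
      ((\<lambda>\<rho>. fst (R \<rho>) / (wm * log 2 \<rho>)) \<longlongrightarrow> d1) at_top \<and>
      ((\<lambda>\<rho>. snd (R \<rho>) / (wm * log 2 \<rho>)) \<longlongrightarrow> d2) at_top}"

definition is_max_sum :: "(real \<times> real) set \<Rightarrow> real \<Rightarrow> bool" where
  "is_max_sum D s \<longleftrightarrow> (\<exists>d\<in>D. fst d + snd d = s) \<and> (\<forall>d\<in>D. fst d + snd d \<le> s)"

text \<open>Entries (k,i,j): k=0 H_dl (Ndl x Mdl), k=1 H_ul (Nul x Mul), k=2 H_I (Ndl x Mul),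
  k=3 H_S (Ndl x Mul), all i.i.d. CN(0,1).\<close>
definition chan_idx :: "nat \<Rightarrow> nat \<Rightarrow> nat \<Rightarrow> nat \<Rightarrow> (nat \<times> nat \<times> nat) set" where
  "chan_idx mdl nul mul ndl =
     ({0} \<times> {..<ndl} \<times> {..<mdl}) \<union> ({1} \<times> {..<nul} \<times> {..<mul})
     \<union> ({2} \<times> {..<ndl} \<times> {..<mul}) \<union> ({3} \<times> {..<ndl} \<times> {..<mul})"

definition chan_measure :: "nat \<Rightarrow> nat \<Rightarrow> nat \<Rightarrow> nat \<Rightarrow> (nat \<times> nat \<times> nat \<Rightarrow> complex) measure" where
  "chan_measure mdl nul mul ndl = PiM (chan_idx mdl nul mul ndl) (\<lambda>_. cgauss 1)"

definition net_at ::
  "nat \<Rightarrow> nat \<Rightarrow> nat \<Rightarrow> nat \<Rightarrow> real \<Rightarrow> real \<Rightarrow> real \<Rightarrow> real \<Rightarrow> real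
   \<Rightarrow> (nat \<times> nat \<times> nat \<Rightarrow> complex) \<Rightarrow> real \<Rightarrow> fdnet" where
  "net_at mdl nul mul ndl wm w l aI aS h \<rho> =
     \<lparr> n_Mdl = mdl, n_Nul = nul, n_Mul = mul, n_Ndl = ndl, Wm = wm, Wr = w, lam = l,
       H_dl = (\<lambda>i j. h (0,i,j)), H_ul = (\<lambda>i j. h (1,i,j)),
       H_I = (\<lambda>i j. h (2,i,j)), H_S = (\<lambda>i j. h (3,i,j)),
       snr_dl = \<rho>, snr_ul = \<rho>, snr_I = \<rho> powr aI, snr_S = \<rho> powr aS \<rparr>"

end

theory Submission
  imports Defs "Jordan_Normal_Form.Determinant"
begin

text \<open>
  Converse: replace the true joint density of all outputs by a product of conditional Gaussian
  reference densities, chosen in the order in which the receivers could reconstruct the outputs.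
  Decoding sets of different messages have disjoint sections, so a fixed reference measure gives them
  total mass at most one, and \<open>ln r \<le> r - 1\<close> turns this into a bound on the
  number of messages by the expected log-ratio of the densities. By causality, the feedback through
  the base station acts on the noise as a triangular shift, which preserves the measure; what remains
  are second moments of residuals after cancelling the interference by linear combinations.

  Achievability: inverting the generic channel matrices splits the network into scalar streams. On
  each of them QAM grids, scaled so that wanted signal and interference form a digit expansion, are
  detected with constant error probability, and an outer code of Gilbert--Varshamov type with
  block-wise symbols drives the error to zero. The side channel conveys the digits of the uplink
  signal that are not resolvable at the downlink receiver.
\<close>

section \<open>Complex Gaussian measures and generic matrices\<close>

text \<open>The obstacle is the feedback: the base station's input may depend on past uplink
  outputs, which couples the noises of different links and slots. The sum bound therefore puts M2's
  outputs first, predicted without knowledge of any message. Once they reveal the downlink message,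
  the base station's input can be recomputed slot by slot from past uplink outputs and subtracted;
  what remains of M2's output is a noisy copy of the interfering uplink streams. It predicts
  \<open>m\<close> uplink outputs up to a variance of order \<rho> to the power max 0 (1 - aI), the
  source of the two regimes. In the scheme each uplink stream visible at M2 is a two-digit number.
  For aI < 1 the low digit arrives below M2's grid spacing and is harmless; for aI \<ge> 1 the high
  digit stands above the whole downlink signal and can be detected and removed. Only the other digit
  loads the side channel, with exponent 1 - min 1 \<bar>1 - aI\<bar>. All other constants are
  independent of \<rho> and vanish after division by log \<rho>.\<close>

definition cgauss_density :: "real \<Rightarrow> complex \<Rightarrow> real" where
  "cgauss_density s z = exp (- ((cmod z)\<^sup>2) / s) / (pi * s)"

lemma cgauss_density_measurable [measurable]: "cgauss_density s \<in> borel_measurable borel"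
  unfolding cgauss_density_def by measurable

lemma cgauss_eq_density: "cgauss s = density lborel (\<lambda>z. ennreal (cgauss_density s z))"
  unfolding cgauss_def cgauss_density_def by simp

lemma sets_cgauss [simp, measurable_cong]: "sets (cgauss s) = sets borel"
  by (simp add: cgauss_def)

lemma space_cgauss [simp]: "space (cgauss s) = UNIV"
  by (simp add: cgauss_def)

text \<open>Real and imaginary part are independent with variance \<open>s / 2\<close> each, which
  reduces all integrals of the complex Gaussian to those of the real normal density.\<close>

lemma cgauss_density_eq:
  assumes "0 < s"
  shows "cgauss_density s z = normal_density 0 (sqrt (s / 2)) (Re z) * normal_density 0 (sqrt (s / 2)) (Im z)"
proof -
  have "sqrt (2 * pi * (s / 2)) * sqrt (2 * pi * (s / 2)) = pi * s"
    using assms by simp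
  then show ?thesis
    using assms unfolding cgauss_density_def normal_density_def
    by (simp add: cmod_power2 exp_add [symmetric] field_simps)
qed

text \<open>Fubini with respect to the basis 1, i of the complex plane, in which Lebesgue measure is
  a product.\<close>

lemma nn_integral_complex_prod:
  fixes f g :: "real \<Rightarrow> real"
  assumes [measurable]: "f \<in> borel_measurable borel" "g \<in> borel_measurable borel"
    and "\<And>x. 0 \<le> f x" "\<And>x. 0 \<le> g x"
  shows "(\<integral>\<^sup>+z. ennreal (f (Re z) * g (Im z)) \<partial>lborel) = (\<integral>\<^sup>+x. f x \<partial>lborel) * (\<integral>\<^sup>+x. g x \<partial>lborel)"
proof -
  let ?h = "\<lambda>b :: complex. if b = 1 then (\<lambda>x. ennreal (f x)) else (\<lambda>x. ennreal (g x))"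
  have "(\<integral>\<^sup>+z. (\<Prod>b\<in>Basis. ?h b (inner z b)) \<partial>lborel) = (\<Prod>b\<in>Basis. \<integral>\<^sup>+x. ?h b x \<partial>lborel)"
    by (rule nn_integral_lborel_prod) auto
  then show ?thesis
    using assms by (simp add: Basis_complex_def ennreal_mult)
qed

lemma nn_integral_normal_density: "0 < \<sigma> \<Longrightarrow> (\<integral>\<^sup>+x. ennreal (normal_density \<mu> \<sigma> x) \<partial>lborel) = 1"
  by (subst nn_integral_eq_integral) auto

lemma nn_integral_cgauss_density:
  assumes "0 < s"
  shows "(\<integral>\<^sup>+z. ennreal (cgauss_density s z) \<partial>lborel) = 1"
  using assms by (simp add: cgauss_density_eq nn_integral_complex_prod nn_integral_normal_density)

lemma prob_space_cgauss: "0 < s \<Longrightarrow> prob_space (cgauss s)"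
  by (rule prob_spaceI) (simp add: cgauss_eq_density emeasure_density nn_integral_cgauss_density)

lemma cgauss_second_moment:
  assumes "0 < s"
  shows "(\<integral>\<^sup>+z. ennreal ((cmod z)\<^sup>2) \<partial>cgauss s) = ennreal s"
proof -
  define \<sigma> where "\<sigma> = sqrt (s / 2)"
  have \<sigma>: "0 < \<sigma>" "\<sigma>\<^sup>2 = s / 2" using assms by (auto simp: \<sigma>_def)
  let ?n = "normal_density 0 \<sigma>"
  have m: "(\<integral>\<^sup>+x. ennreal (?n x * x\<^sup>2) \<partial>lborel) = ennreal (s / 2)"
  proof (subst nn_integral_eq_integral)
    show "integrable lborel (\<lambda>x. ?n x * x\<^sup>2)"
      using integrable_normal_moment[OF \<sigma>(1), of 0 2] by simp
    show "ennreal (\<integral>x. ?n x * x\<^sup>2 \<partial>lborel) = ennreal (s / 2)"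
    proof -
      have "(\<integral>x. ?n x * x\<^sup>2 \<partial>lborel) = \<sigma>\<^sup>2"
        using integral_normal_moment_even[OF \<sigma>(1), of 0 1] by (simp add: fact_numeral)
      then show ?thesis by (simp only: \<sigma>(2))
    qed
  qed simp
  have "(\<integral>\<^sup>+z. ennreal ((cmod z)\<^sup>2) \<partial>cgauss s)
      = (\<integral>\<^sup>+z. ennreal (cgauss_density s z) * ennreal ((cmod z)\<^sup>2) \<partial>lborel)"
    unfolding cgauss_eq_density by (subst nn_integral_density) auto
  also have "\<dots> = (\<integral>\<^sup>+z. ennreal ((?n (Re z) * (Re z)\<^sup>2) * ?n (Im z)) + ennreal (?n (Re z) * (?n (Im z) * (Im z)\<^sup>2)) \<partial>lborel)"
    using assms by (intro nn_integral_cong)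
      (simp add: cgauss_density_eq \<sigma>_def [symmetric] cmod_power2 ennreal_mult [symmetric] ennreal_plus [symmetric] algebra_simps del: ennreal_plus)
  also have "\<dots> = (\<integral>\<^sup>+z. ennreal ((?n (Re z) * (Re z)\<^sup>2) * ?n (Im z)) \<partial>lborel)
                 + (\<integral>\<^sup>+z. ennreal (?n (Re z) * (?n (Im z) * (Im z)\<^sup>2)) \<partial>lborel)"
    by (rule nn_integral_add) auto
  also have "\<dots> = ennreal (s / 2) + ennreal (s / 2)"
    using nn_integral_complex_prod[of "\<lambda>x. ?n x * x\<^sup>2" ?n] nn_integral_complex_prod[of ?n "\<lambda>x. ?n x * x\<^sup>2"]
    by (simp add: m nn_integral_normal_density[OF \<sigma>(1)])
  also have "\<dots> = ennreal s" using assms by (simp add: ennreal_plus [symmetric] del: ennreal_plus)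
  finally show ?thesis .
qed

text \<open>Chebyshev is strong enough: detection only has to fail with a small constant
  probability, since the outer code removes the remaining errors.\<close>

lemma cgauss_tail:
  assumes "0 < s" "0 < g"
  shows "emeasure (cgauss s) {z. g < cmod z} \<le> ennreal (s / g\<^sup>2)"
proof -
  have "emeasure (cgauss s) {z. g < cmod z} = (\<integral>\<^sup>+z. indicator {z. g < cmod z} z \<partial>cgauss s)"
    by (rule nn_integral_indicator [symmetric]) measurable
  also have "\<dots> \<le> (\<integral>\<^sup>+z. ennreal (1 / g\<^sup>2) * ennreal ((cmod z)\<^sup>2) \<partial>cgauss s)"
    using assms by (intro nn_integral_mono)
      (auto simp: indicator_def ennreal_mult [symmetric] field_simps intro!: power_mono)
  also have "\<dots> = ennreal (1 / g\<^sup>2) * ennreal s"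
    by (subst nn_integral_cmult) (auto simp: cgauss_second_moment[OF assms(1)])
  finally show ?thesis using assms by (simp add: ennreal_mult [symmetric])
qed

lemma emeasure_cgauss_singleton: "emeasure (cgauss s) {z} = 0"
proof -
  have "emeasure (cgauss s) {z} = (\<integral>\<^sup>+w. ennreal (cgauss_density s w) * indicator {z} w \<partial>lborel)"
    unfolding cgauss_eq_density by (rule emeasure_density) auto
  also have "\<dots> = 0"
    by (rule nn_integral_null_set) (simp add: null_sets_def)
  finally show ?thesis .
qed

lemma measurable_det_PiM:
  assumes "\<And>i j. i < k \<Longrightarrow> j < k \<Longrightarrow> \<iota> i j \<in> I"
  shows "(\<lambda>h :: 'a \<Rightarrow> complex. det (mat k k (\<lambda>(i,j). h (\<iota> i j)))) \<in> borel_measurable (PiM I (\<lambda>_. cgauss s))"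
proof -
  have "(\<lambda>h :: 'a \<Rightarrow> complex. det (mat k k (\<lambda>(i,j). h (\<iota> i j)))) =
    (\<lambda>h. \<Sum>p | p permutes {0..<k}. signof p * (\<Prod>i=0..<k. h (\<iota> i (p i))))"
    unfolding Determinant.det_def by (auto simp: fun_eq_iff intro!: sum.cong prod.cong)
  moreover have "p i < k" if "p permutes {0..<k}" "i < k" for p i
    using permutes_in_image[OF that(1), of i] that(2) by simp
  ultimately show ?thesis
    using assms by (auto intro!: borel_measurable_sum borel_measurable_times borel_measurable_prod measurable_component_singleton
        simp: measurable_cong_sets[OF refl sets_cgauss, symmetric])
qed

text \<open>Given all other entries, the determinant is an affine function of the last diagonal
  entry whose slope is the determinant of the smaller block, nonzero by induction. So a single value
  of that entry is bad, and points are null sets. The index map \<open>\<iota>\<close> allows rows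
  taken from different channel matrices.\<close>

lemma AE_det_nonzero:
  fixes \<iota> :: "nat \<Rightarrow> nat \<Rightarrow> 'a"
  assumes "finite I" "inj_on (\<lambda>(i,j). \<iota> i j) ({..<k} \<times> {..<k})"
    and "\<And>i j. i < k \<Longrightarrow> j < k \<Longrightarrow> \<iota> i j \<in> I"
  shows "AE h in PiM I (\<lambda>_. cgauss 1). det (mat k k (\<lambda>(i,j). h (\<iota> i j))) \<noteq> (0 :: complex)"
  using assms
proof (induction k arbitrary: I)
  case 0
  then show ?case by simp
next
  case (Suc k)
  interpret cg: prob_space "cgauss 1" by (simp add: prob_space_cgauss)
  interpret P: product_sigma_finite "\<lambda>_ :: 'a. cgauss 1" by unfold_locales
  let ?M = "\<lambda>k h. mat k k (\<lambda>(i,j). h (\<iota> i j)) :: complex mat"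
  let ?D = "\<lambda>k h. det (?M k h)"
  define c where "c = \<iota> k k"
  define J where "J = I - {c}"
  have cI: "c \<in> I" using Suc.prems(3) by (simp add: c_def)
  then have IJ: "I = insert c J" "c \<notin> J" "finite J" using Suc.prems(1) by (auto simp: J_def)
  have ne: "\<iota> i j \<noteq> c" if "i \<le> k" "j \<le> k" "(i, j) \<noteq> (k, k)" for i j
    using inj_onD[OF Suc.prems(2), of "(i,j)" "(k,k)"] that by (auto simp: c_def)
  have sub: "\<iota> i j \<in> J" if "i \<le> k" "j \<le> k" "(i, j) \<noteq> (k, k)" for i j
    using ne[OF that] Suc.prems(3)[of i j] that by (auto simp: J_def)
  have IH: "AE h in PiM J (\<lambda>_. cgauss 1). ?D k h \<noteq> 0"
  proof (rule Suc.IH)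
    show "inj_on (\<lambda>(i, j). \<iota> i j) ({..<k} \<times> {..<k})"
      by (rule inj_on_subset[OF Suc.prems(2)]) auto
  qed (use IJ sub in auto)
  \<comment> \<open>Laplace expansion along the last column. By injectivity of
    \<open>\<iota>\<close> the coordinate \<open>c\<close> occurs only at position (k, k), so no
    cofactor of this column depends on \<open>z\<close>.\<close>
  have affine: "\<exists>b. \<forall>z. ?D (Suc k) (h(c := z)) = z * ?D k h + b" for h :: "'a \<Rightarrow> complex"
  proof -
    let ?A = "\<lambda>z. ?M (Suc k) (h(c := z))"
    have del: "mat_delete (?A z) i k = mat_delete (?A 0) i k" if "i \<le> k" for i z
      by (rule eq_matI) (use that ne in \<open>auto simp: mat_delete_def\<close>)
    have delk: "mat_delete (?A z) k k = ?M k h" for z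
      by (rule eq_matI) (use ne in \<open>auto simp: mat_delete_def\<close>)
    have "det (?A z) = z * ?D k h + (\<Sum>i<k. ?A 0 $$ (i, k) * cofactor (?A 0) i k)" for z
    proof -
      have "det (?A z) = (\<Sum>i<Suc k. ?A z $$ (i, k) * cofactor (?A z) i k)"
        by (rule laplace_expansion_column) auto
      also have "\<dots> = (\<Sum>i<k. ?A z $$ (i, k) * cofactor (?A z) i k) + z * ?D k h"
      proof -
        have "?A z $$ (k, k) * cofactor (?A z) k k = z * ?D k h"
          unfolding cofactor_def delk by (simp add: c_def)
        then show ?thesis by simp
      qed
      also have "(\<Sum>i<k. ?A z $$ (i, k) * cofactor (?A z) i k) = (\<Sum>i<k. ?A 0 $$ (i, k) * cofactor (?A 0) i k)"
      proof (rule sum.cong [OF refl])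
        fix i assume "i \<in> {..<k}"
        then have i: "i \<le> k" "i \<noteq> k" by auto
        have "?A z $$ (i, k) = ?A 0 $$ (i, k)" using i ne[of i k] by simp
        moreover have "cofactor (?A z) i k = cofactor (?A 0) i k"
          unfolding cofactor_def del[OF i(1), of z] ..
        ultimately
        show "?A z $$ (i, k) * cofactor (?A z) i k = ?A 0 $$ (i, k) * cofactor (?A 0) i k"
          by simp
      qed
      finally show ?thesis by simp
    qed
    then show ?thesis by blast
  qed
  have meas: "?D (Suc k) \<in> borel_measurable (PiM I (\<lambda>_. cgauss 1))"
    by (rule measurable_det_PiM) (use Suc.prems(3) in auto)
  have zero: "(\<integral>\<^sup>+h. indicator {h. ?D (Suc k) h = 0} h \<partial>PiM I (\<lambda>_. cgauss 1)) = 0"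
  proof -
    have "(\<integral>\<^sup>+h. indicator {h. ?D (Suc k) h = 0} h \<partial>PiM I (\<lambda>_. cgauss 1))
      = (\<integral>\<^sup>+h. (\<integral>\<^sup>+z. indicator {h. ?D (Suc k) h = 0} (h(c := z)) \<partial>cgauss 1) \<partial>PiM J (\<lambda>_. cgauss 1))"
      unfolding IJ(1) by (rule P.product_nn_integral_insert) (use IJ meas in \<open>auto simp: indicator_def [abs_def]\<close>)
    also have "\<dots> = (\<integral>\<^sup>+h. 0 \<partial>PiM J (\<lambda>_. cgauss 1))"
    proof (rule nn_integral_cong_AE, use IH in eventually_elim)
      fix h :: "'a \<Rightarrow> complex" assume nz: "?D k h \<noteq> 0"
      from affine[of h] obtain b where b: "\<And>z. ?D (Suc k) (h(c := z)) = z * ?D k h + b" by blast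
      have "(\<integral>\<^sup>+z. indicator {h. ?D (Suc k) h = 0} (h(c := z)) \<partial>cgauss 1)
          = (\<integral>\<^sup>+z. indicator {- b / ?D k h} z \<partial>cgauss 1)"
      proof (intro nn_integral_cong)
        fix z
        have "?D (Suc k) (h(c := z)) = 0 \<longleftrightarrow> z = - b / ?D k h"
          unfolding b using nz by (simp add: field_simps add_eq_0_iff)
        then show "indicator {h. ?D (Suc k) h = 0} (h(c := z)) = indicator {- b / ?D k h} z"
          by (simp only: indicator_def mem_Collect_eq singleton_iff)
      qed
      also have "\<dots> = 0" by (simp add: emeasure_cgauss_singleton)
      finally show "(\<integral>\<^sup>+z. indicator {h. ?D (Suc k) h = 0} (h(c := z)) \<partial>cgauss 1) = 0" .
    qed
    finally show ?thesis by simp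
  qed
  have "AE h in PiM I (\<lambda>_. cgauss 1). indicator {h. ?D (Suc k) h = 0} h = (0 :: ennreal)"
    using zero meas by (subst (asm) nn_integral_0_iff_AE) (auto simp: indicator_def [abs_def])
  then show ?case by eventually_elim (auto simp: indicator_def)
qed

text \<open>Two-sided inverses of the leading k x k block of matrices given as functions, the form
  in which the network model has them. Sub-blocks and blocks composed of several matrices then need
  no conversion.\<close>

definition inverse_pair :: "nat \<Rightarrow> (nat \<Rightarrow> nat \<Rightarrow> complex) \<Rightarrow> (nat \<Rightarrow> nat \<Rightarrow> complex) \<Rightarrow> bool" where
  "inverse_pair k A B \<longleftrightarrow> (\<forall>i<k. \<forall>j<k. (\<Sum>l<k. A i l * B l j) = (if i = j then 1 else 0)) \<and>
     (\<forall>i<k. \<forall>j<k. (\<Sum>l<k. B i l * A l j) = (if i = j then 1 else 0))"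

lemma inverse_pair_if_det:
  assumes "det (mat k k (\<lambda>(i,j). A i j)) \<noteq> (0 :: complex)"
  shows "\<exists>B. inverse_pair k A B"
proof -
  let ?A = "mat k k (\<lambda>(i,j). A i j)"
  from det_non_zero_imp_unit[of ?A k] assms
  obtain B where B: "B \<in> carrier_mat k k" "B * ?A = 1\<^sub>m k" "?A * B = 1\<^sub>m k"
    by (auto simp: Units_def ring_mat_def)
  have 1: "(\<Sum>l<k. A i l * B $$ (l, j)) = (if i = j then 1 else 0)" if "i < k" "j < k" for i j
    using arg_cong[OF B(3), of "\<lambda>X. X $$ (i, j)"] that B(1) by (simp add: scalar_prod_def atLeast0LessThan)
  have 2: "(\<Sum>l<k. B $$ (i, l) * A l j) = (if i = j then 1 else 0)" if "i < k" "j < k" for i j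
    using arg_cong[OF B(2), of "\<lambda>X. X $$ (i, j)"] that B(1) by (simp add: scalar_prod_def atLeast0LessThan)
  show ?thesis
    unfolding inverse_pair_def by (rule exI[of _ "\<lambda>l j. B $$ (l, j)"]) (auto simp: 1 2)
qed

lemma AE_inverse_pair:
  fixes \<iota> :: "nat \<Rightarrow> nat \<Rightarrow> 'a"
  assumes "finite I" "inj_on (\<lambda>(i,j). \<iota> i j) ({..<k} \<times> {..<k})"
    and "\<And>i j. i < k \<Longrightarrow> j < k \<Longrightarrow> \<iota> i j \<in> I"
  shows "AE h in PiM I (\<lambda>_. cgauss 1). \<exists>B. inverse_pair k (\<lambda>i j. h (\<iota> i j)) B"
proof -
  have "AE h in PiM I (\<lambda>_. cgauss 1). det (mat k k (\<lambda>(i,j). h (\<iota> i j))) \<noteq> (0 :: complex)"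
    by (rule AE_det_nonzero) (use assms in auto)
  then show ?thesis by (rule eventually_mono) (rule inverse_pair_if_det)
qed

section \<open>The information bound\<close>

abbreviation lborel_PiM :: "'i set \<Rightarrow> ('i \<Rightarrow> complex) measure" where
  "lborel_PiM I \<equiv> PiM I (\<lambda>_. lborel)"

interpretation lborel_PiM: product_sigma_finite "\<lambda>_. lborel :: complex measure"
  by unfold_locales

text \<open>The functions \<^term>\<open>c\<close> may only look at coordinates of strictly lower rank, so the map is a
  triangular shift and hence has Jacobian one.\<close>

lemma nn_integral_triangular_shift:
  fixes c :: "'i \<Rightarrow> ('i \<Rightarrow> complex) \<Rightarrow> complex" and r :: "'i \<Rightarrow> nat"
  assumes "finite I"
    and "\<And>i. i \<in> I \<Longrightarrow> c i \<in> borel_measurable (lborel_PiM I)"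
    and "\<And>i x y. i \<in> I \<Longrightarrow> (\<And>j. j \<in> I \<Longrightarrow> r j < r i \<Longrightarrow> x j = y j) \<Longrightarrow> c i x = c i y"
    and "f \<in> borel_measurable (lborel_PiM I)"
  shows "(\<integral>\<^sup>+x. f (\<lambda>i\<in>I. x i + c i x) \<partial>lborel_PiM I) = (\<integral>\<^sup>+x. f x \<partial>lborel_PiM I)"
  using assms
proof (induction "card I" arbitrary: I f)
  case 0
  have "I = {}" using 0(1,2) by simp
  then show ?case by (simp add: lborel_PiM.nn_integral_empty space_PiM_empty)
next
  case (Suc n)
  have "I \<noteq> {}" using Suc.hyps(2) by auto
  \<comment> \<open>A coordinate of maximal rank is read by no shift, not even its own. It can be
    integrated out innermost, where its shift is a constant and translation invariance
    applies.\<close>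
  then have "Max (r ` I) \<in> r ` I" using Suc.prems(1) by (intro Max_in) auto
  then obtain i where i: "i \<in> I" "r i = Max (r ` I)" by auto
  have imax: "r j \<le> r i" if "j \<in> I" for j
    using that Suc.prems(1) unfolding i(2) by (intro Max_ge) auto
  define J where "J = I - {i}"
  have J: "I = insert i J" "i \<notin> J" "finite J" "n = card J"
    using i(1) Suc.prems(1) Suc.hyps(2) by (auto simp: J_def)
  have low: "j \<in> J" if "j \<in> I" "r j < r k" "k \<in> I" for j k
    using imax[OF that(3)] that by (auto simp: J_def)
  note [measurable] = Suc.prems(2,4)
  have cJ: "c k (x(i := z)) = c k x" if "k \<in> I" for k x z
    using low that J(2) by (intro Suc.prems(3)) (auto simp: fun_upd_def)
  have c_meas: "c k \<in> borel_measurable (lborel_PiM J)" if "k \<in> I" for k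
  proof -
    have "(\<lambda>x. c k (x(i := 0))) \<in> borel_measurable (lborel_PiM J)"
      using Suc.prems(2)[OF that] unfolding J(1)
      by (rule measurable_compose_rev) (intro measurable_fun_upd[where J=J] J, auto)
    then show ?thesis by (simp add: cJ that)
  qed
  define g where "g x = (\<integral>\<^sup>+z. f (x(i := z)) \<partial>lborel)" for x
  have [measurable]: "f \<in> borel_measurable (lborel_PiM (insert i J))"
    using Suc.prems(4) J(1) by simp
  have upd: "(\<lambda>(x, z). x(i := z)) \<in> lborel_PiM J \<Otimes>\<^sub>M lborel \<rightarrow>\<^sub>M lborel_PiM (insert i J)"
    by (rule measurable_add_dim)
  have g_meas: "g \<in> borel_measurable (lborel_PiM J)"
    unfolding g_def using measurable_compose[OF upd, of f]
    by (intro lborel.borel_measurable_nn_integral) (simp add: split_beta')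
  have T_meas: "(\<lambda>x. \<lambda>k\<in>I. x k + c k x) \<in> lborel_PiM I \<rightarrow>\<^sub>M lborel_PiM I"
    by (intro measurable_restrict) measurable
  have "(\<integral>\<^sup>+x. f (\<lambda>k\<in>I. x k + c k x) \<partial>lborel_PiM I)
     = (\<integral>\<^sup>+x. (\<integral>\<^sup>+z. f (\<lambda>k\<in>I. (x(i := z)) k + c k (x(i := z))) \<partial>lborel) \<partial>lborel_PiM J)"
    unfolding J(1)
    by (rule lborel_PiM.product_nn_integral_insert)
      (use J(2,3) measurable_compose[OF T_meas Suc.prems(4)] in \<open>simp_all only: J(1)[symmetric] simp_thms\<close>)
  also have "\<dots> = (\<integral>\<^sup>+x. g (\<lambda>k\<in>J. x k + c k x) \<partial>lborel_PiM J)"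
  proof (rule nn_integral_cong)
    fix x assume x: "x \<in> space (lborel_PiM J)"
    let ?y = "\<lambda>k\<in>J. x k + c k x"
    have y: "?y \<in> space (lborel_PiM J)" by (auto simp: space_PiM)
    have eq: "(\<lambda>k\<in>I. (x(i := z)) k + c k (x(i := z))) = ?y(i := z + c i x)" for z
      using J by (auto simp: fun_eq_iff cJ)
    have "(\<integral>\<^sup>+z. f (?y(i := z + c i x)) \<partial>lborel) = (\<integral>\<^sup>+z. f (?y(i := z)) \<partial>lborel)"
      by (subst lborel_distr_plus[of "c i x", symmetric], subst nn_integral_distr)
        (use measurable_compose[OF measurable_Pair1'[OF y] measurable_compose[OF upd, of f]] in \<open>auto simp: add.commute\<close>)
    then show "(\<integral>\<^sup>+z. f (\<lambda>k\<in>I. (x(i := z)) k + c k (x(i := z))) \<partial>lborel) = g ?y"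
      by (simp only: eq g_def)
  qed
  also have "\<dots> = (\<integral>\<^sup>+x. g x \<partial>lborel_PiM J)"
  proof (rule Suc.hyps(1)[OF J(4) J(3)])
    show "c k x = c k y" if "k \<in> J" "\<And>j. j \<in> J \<Longrightarrow> r j < r k \<Longrightarrow> x j = y j" for k x y
      using that low J(1) by (intro Suc.prems(3)) auto
  qed (use c_meas g_meas J(1) in auto)
  also have "\<dots> = (\<integral>\<^sup>+x. f x \<partial>lborel_PiM I)"
    unfolding g_def J(1) by (rule lborel_PiM.product_nn_integral_insert[symmetric]) (use J in auto)
  finally show ?case .
qed

text \<open>A product of conditional densities is a probability density. Subtracting the means is a
  triangular shift, after which the integral factorises.\<close>

lemma nn_integral_triangular_density:
  fixes \<mu> :: "'i \<Rightarrow> ('i \<Rightarrow> complex) \<Rightarrow> complex" and r :: "'i \<Rightarrow> nat"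
  assumes "finite I" "\<And>i. i \<in> I \<Longrightarrow> 0 < \<sigma> i"
    and "\<And>i. i \<in> I \<Longrightarrow> \<mu> i \<in> borel_measurable (lborel_PiM I)"
    and "\<And>i x y. i \<in> I \<Longrightarrow> (\<And>j. j \<in> I \<Longrightarrow> r j < r i \<Longrightarrow> x j = y j) \<Longrightarrow> \<mu> i x = \<mu> i y"
  shows "(\<integral>\<^sup>+x. (\<Prod>i\<in>I. ennreal (cgauss_density (\<sigma> i) (x i - \<mu> i x))) \<partial>lborel_PiM I) = 1"
proof -
  let ?f = "\<lambda>x. \<Prod>i\<in>I. ennreal (cgauss_density (\<sigma> i) (x i))"
  have "(\<integral>\<^sup>+x. (\<Prod>i\<in>I. ennreal (cgauss_density (\<sigma> i) (x i - \<mu> i x))) \<partial>lborel_PiM I)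
      = (\<integral>\<^sup>+x. ?f (\<lambda>i\<in>I. x i + - \<mu> i x) \<partial>lborel_PiM I)"
    by (intro nn_integral_cong prod.cong) auto
  also have "\<dots> = (\<integral>\<^sup>+x. ?f x \<partial>lborel_PiM I)"
  proof (rule nn_integral_triangular_shift[where r = r])
    show "- \<mu> i x = - \<mu> i y" if "i \<in> I" "\<And>j. j \<in> I \<Longrightarrow> r j < r i \<Longrightarrow> x j = y j" for i x y
      using assms(4)[OF that] by simp
    show "(\<lambda>x. - \<mu> i x) \<in> borel_measurable (lborel_PiM I)" if "i \<in> I" for i
      using assms(3)[OF that] by measurable
    show "?f \<in> borel_measurable (lborel_PiM I)" by measurable
  qed fact
  also have "\<dots> = 1"
    using assms(1,2) by (subst lborel_PiM.product_nn_integral_prod) (auto simp: nn_integral_cgauss_density)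
  finally show ?thesis .
qed

lemma PiM_cgauss_eq_density:
  assumes "finite I" "\<And>i. i \<in> I \<Longrightarrow> 0 < s i"
  shows "PiM I (\<lambda>i. cgauss (s i)) = density (lborel_PiM I) (\<lambda>x. \<Prod>i\<in>I. ennreal (cgauss_density (s i) (x i)))"
proof -
  \<comment> \<open>Variance 1 is used outside \<open>I\<close> because
    \<open>product_sigma_finite\<close> makes a demand at every index.\<close>
  let ?s = "\<lambda>i. if i \<in> I then s i else 1"
  let ?D = "density (lborel_PiM I) (\<lambda>x. \<Prod>i\<in>I. ennreal (cgauss_density (s i) (x i)))"
  have pos: "0 < ?s i" for i using assms(2) by simp
  interpret product_sigma_finite "\<lambda>i. cgauss (?s i)"
    unfolding product_sigma_finite_def using prob_space_cgauss[OF pos] by (blast intro: prob_space_imp_sigma_finite)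
  have meas: "(\<lambda>x. \<Prod>i\<in>I. ennreal (cgauss_density (s i) (x i))) \<in> borel_measurable (lborel_PiM I)"
    by measurable
  have "?D = PiM I (\<lambda>i. cgauss (?s i))"
  proof (rule PiM_eqI)
    show "finite I" by fact
    show "sets ?D = sets (PiM I (\<lambda>i. cgauss (?s i)))"
      unfolding sets_density by (rule sets_PiM_cong) auto
    fix A assume A: "\<And>i. i \<in> I \<Longrightarrow> A i \<in> sets (cgauss (?s i))"
    have PA: "PiE I A \<in> sets (lborel_PiM I)"
      using A assms(1) by (intro sets_PiM_I_finite) auto
    have ind: "(\<Prod>i\<in>I. ennreal (cgauss_density (s i) (x i))) * indicator (PiE I A) x
        = (\<Prod>i\<in>I. ennreal (cgauss_density (s i) (x i)) * indicator (A i) (x i))"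
      if x: "x \<in> space (lborel_PiM I)" for x
    proof (cases "x \<in> PiE I A")
      case False
      with x obtain i where "i \<in> I" "x i \<notin> A i" by (auto simp: space_PiM PiE_iff)
      then show ?thesis using False assms(1) by (auto intro!: prod_zero bexI[of _ i])
    qed (simp add: PiE_iff cong: prod.cong)
    have "emeasure ?D (PiE I A) = (\<integral>\<^sup>+x. (\<Prod>i\<in>I. ennreal (cgauss_density (s i) (x i)) * indicator (A i) (x i)) \<partial>lborel_PiM I)"
      by (subst emeasure_density[OF meas PA]) (intro nn_integral_cong ind)
    also have "\<dots> = (\<Prod>i\<in>I. \<integral>\<^sup>+z. ennreal (cgauss_density (s i) z) * indicator (A i) z \<partial>lborel)"
      using assms(1) A by (subst lborel_PiM.product_nn_integral_prod) auto
    also have "\<dots> = (\<Prod>i\<in>I. emeasure (cgauss (?s i)) (A i))"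
      using A by (intro prod.cong) (auto simp: cgauss_eq_density emeasure_density)
    finally show "emeasure ?D (PiE I A) = (\<Prod>i\<in>I. emeasure (cgauss (?s i)) (A i))" .
  qed
  also have "\<dots> = PiM I (\<lambda>i. cgauss (s i))" by (rule PiM_cong) auto
  finally show ?thesis by simp
qed

text \<open>Only the sections over the common coordinates \<^term>\<open>J\<close> are disjoint, and these need not be measurable; it is
  enough that the indicator functions \<^term>\<open>F\<close> themselves are.\<close>

lemma sum_nn_integral_disjoint_sections_le:
  fixes F :: "'a \<Rightarrow> ('i \<Rightarrow> complex) \<Rightarrow> ennreal" and \<mu> :: "'a \<Rightarrow> 'i \<Rightarrow> ('i \<Rightarrow> complex) \<Rightarrow> complex"
    and r :: "'i \<Rightarrow> nat"
  assumes fin: "finite A" "finite J" "finite K" and JK: "J \<inter> K = {}"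
    and \<sigma>: "\<And>i. i \<in> J \<union> K \<Longrightarrow> 0 < \<sigma> i"
    and F_meas: "\<And>a. a \<in> A \<Longrightarrow> F a \<in> borel_measurable (lborel_PiM (J \<union> K))"
    and F_le: "\<And>a y. a \<in> A \<Longrightarrow> F a y \<le> 1"
    and \<mu>_meas: "\<And>a i. a \<in> A \<Longrightarrow> i \<in> J \<union> K \<Longrightarrow> \<mu> a i \<in> borel_measurable (lborel_PiM (J \<union> K))"
    and \<mu>_J: "\<And>a b i x y. a \<in> A \<Longrightarrow> b \<in> A \<Longrightarrow> i \<in> J \<Longrightarrow> (\<And>j. j \<in> J \<Longrightarrow> r j < r i \<Longrightarrow> x j = y j) \<Longrightarrow> \<mu> a i x = \<mu> b i y"
    and \<mu>_K: "\<And>a i x y. a \<in> A \<Longrightarrow> i \<in> K \<Longrightarrow> (\<And>j. j \<in> J \<Longrightarrow> x j = y j) \<Longrightarrow>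
        (\<And>j. j \<in> K \<Longrightarrow> r j < r i \<Longrightarrow> x j = y j) \<Longrightarrow> \<mu> a i x = \<mu> a i y"
    and disj: "\<And>a b x y. a \<in> A \<Longrightarrow> b \<in> A \<Longrightarrow> x \<in> space (lborel_PiM (J \<union> K)) \<Longrightarrow> y \<in> space (lborel_PiM (J \<union> K)) \<Longrightarrow>
        (\<And>j. j \<in> J \<Longrightarrow> x j = y j) \<Longrightarrow> F a x \<noteq> 0 \<Longrightarrow> F b y \<noteq> 0 \<Longrightarrow> a = b"
  shows "(\<Sum>a\<in>A. \<integral>\<^sup>+y. F a y * (\<Prod>i\<in>J \<union> K. ennreal (cgauss_density (\<sigma> i) (y i - \<mu> a i y))) \<partial>lborel_PiM (J \<union> K)) \<le> 1"
proof (cases "A = {}")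
  case False
  then obtain a0 where a0: "a0 \<in> A" by blast
  let ?m = "merge J K :: ('i \<Rightarrow> complex) \<times> ('i \<Rightarrow> complex) \<Rightarrow> 'i \<Rightarrow> complex"
  let ?d = "\<lambda>a y i. ennreal (cgauss_density (\<sigma> i) (y i - \<mu> a i y))"
  \<comment> \<open>On \<open>J\<close> the means depend neither on the message nor on the
    coordinates in \<open>K\<close>, by \<open>\<mu>_J\<close>. Fixing the message \<open>a0\<close>
    and zeros on \<open>K\<close> makes this explicit, so the density \<open>G\<close> of the
    \<open>J\<close> part is common to all messages.\<close>
  define \<nu> where "\<nu> i u = \<mu> a0 i (?m (u, \<lambda>i\<in>K. 0))" for i u
  define G where "G u = (\<Prod>i\<in>J. ennreal (cgauss_density (\<sigma> i) (u i - \<nu> i u)))" for u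
  have v0: "(\<lambda>i\<in>K. 0) \<in> space (lborel_PiM K)" by (auto simp: space_PiM)
  have [measurable]: "F a \<in> borel_measurable (lborel_PiM (J \<union> K))" if "a \<in> A" for a
    by (rule F_meas[OF that])
  have d_meas [measurable]: "(\<lambda>y. ?d a y i) \<in> borel_measurable (lborel_PiM (J \<union> K))" if "a \<in> A" "i \<in> J \<union> K" for a i
    using \<mu>_meas[OF that] that(2) by measurable
  have Q_meas: "(\<lambda>y. F a y * (\<Prod>i\<in>J \<union> K. ?d a y i)) \<in> borel_measurable (lborel_PiM (J \<union> K))" if "a \<in> A" for a
    using that by (intro borel_measurable_times_ennreal borel_measurable_prod_ennreal F_meas d_meas) auto
  have fix_u: "(\<lambda>v. ?m (u, v)) \<in> lborel_PiM K \<rightarrow>\<^sub>M lborel_PiM (J \<union> K)" if "u \<in> space (lborel_PiM J)" for u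
    using measurable_compose[OF measurable_Pair1'[OF that] measurable_merge] .
  have fix_v: "(\<lambda>u. ?m (u, \<lambda>i\<in>K. 0)) \<in> lborel_PiM J \<rightarrow>\<^sub>M lborel_PiM (J \<union> K)"
    using measurable_compose[OF measurable_Pair2'[OF v0] measurable_merge] .
  have mJ: "?m (u, v) j = u j" if "j \<in> J" for u v j using that by (simp add: merge_def)
  have mK: "?m (u, v) j = v j" if "j \<in> K" for u v j using that JK by (auto simp: merge_def)
  have m_space: "?m (u, v) \<in> space (lborel_PiM (J \<union> K))" for u v
    by (auto simp: space_PiM PiE_def merge_def extensional_def)
  define P where "P a u v = F a (?m (u, v)) * (G u * (\<Prod>i\<in>K. ?d a (?m (u, v)) i))" for a u v
  have split: "F a (?m (u, v)) * (\<Prod>i\<in>J \<union> K. ?d a (?m (u, v)) i) = P a u v" if "a \<in> A" for a u v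
  proof -
    have "\<mu> a i (?m (u, v)) = \<nu> i u" if "i \<in> J" for i
      unfolding \<nu>_def using \<open>a \<in> A\<close> a0 that by (intro \<mu>_J) (auto simp: mJ)
    then have "(\<Prod>i\<in>J. ?d a (?m (u, v)) i) = G u"
      unfolding G_def by (intro prod.cong) (simp_all add: mJ)
    then show ?thesis
      unfolding P_def prod.union_disjoint[OF fin(2,3) JK] by simp
  qed
  have fold: "(\<integral>\<^sup>+y. F a y * (\<Prod>i\<in>J \<union> K. ?d a y i) \<partial>lborel_PiM (J \<union> K)) = (\<integral>\<^sup>+u. (\<integral>\<^sup>+v. P a u v \<partial>lborel_PiM K) \<partial>lborel_PiM J)"
    if "a \<in> A" for a
    by (subst lborel_PiM.product_nn_integral_fold[OF JK fin(2,3) Q_meas[OF that]]) (simp add: split[OF that])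
  have P_meas: "(\<lambda>(u, v). P a u v) \<in> borel_measurable (lborel_PiM J \<Otimes>\<^sub>M lborel_PiM K)" if "a \<in> A" for a
    using measurable_compose[OF measurable_merge Q_meas[OF that]] by (simp add: split[OF that, symmetric] split_beta')
  interpret K: sigma_finite_measure "lborel_PiM K" by (rule lborel_PiM.sigma_finite[OF fin(3)])
  have inner_meas: "(\<lambda>u. \<integral>\<^sup>+v. P a u v \<partial>lborel_PiM K) \<in> borel_measurable (lborel_PiM J)" if "a \<in> A" for a
    using P_meas[OF that] by (intro K.borel_measurable_nn_integral)
  have one: "(\<integral>\<^sup>+v. P a u v \<partial>lborel_PiM K) \<le> G u" if u: "u \<in> space (lborel_PiM J)" and a: "a \<in> A" for a u
  proof -
    have \<mu>_u: "(\<lambda>v. \<mu> a i (?m (u, v))) \<in> borel_measurable (lborel_PiM K)" if "i \<in> K" for i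
      using that by (intro measurable_compose[OF fix_u[OF u] \<mu>_meas[OF a]]) simp
    have dens_u: "(\<lambda>v. ennreal (cgauss_density (\<sigma> i) (v i - \<mu> a i (?m (u, v))))) \<in> borel_measurable (lborel_PiM K)"
      if "i \<in> K" for i
    proof -
      have "(\<lambda>v. v i - \<mu> a i (?m (u, v))) \<in> borel_measurable (lborel_PiM K)"
        using measurable_component_singleton[OF that, of "\<lambda>_. lborel :: complex measure"] \<mu>_u[OF that]
        by (intro borel_measurable_diff) (simp_all add: measurable_cong_sets[OF refl sets_lborel])
      from measurable_compose[OF this, of "\<lambda>z. ennreal (cgauss_density (\<sigma> i) z)" borel] show ?thesis by simp
    qed
    have "(\<integral>\<^sup>+v. P a u v \<partial>lborel_PiM K) \<le> (\<integral>\<^sup>+v. G u * (\<Prod>i\<in>K. ennreal (cgauss_density (\<sigma> i) (v i - \<mu> a i (?m (u, v))))) \<partial>lborel_PiM K)"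
      unfolding P_def
    proof (rule nn_integral_mono)
      fix v
      let ?X = "G u * (\<Prod>i\<in>K. ennreal (cgauss_density (\<sigma> i) (v i - \<mu> a i (?m (u, v)))))"
      have "F a (?m (u, v)) * ?X \<le> 1 * ?X" by (rule mult_right_mono[OF F_le[OF a]]) simp
      then show "F a (?m (u, v)) * (G u * (\<Prod>i\<in>K. ?d a (?m (u, v)) i)) \<le> ?X"
        by (simp add: mK cong: prod.cong)
    qed
    also have "\<dots> = G u * (\<integral>\<^sup>+v. (\<Prod>i\<in>K. ennreal (cgauss_density (\<sigma> i) (v i - \<mu> a i (?m (u, v))))) \<partial>lborel_PiM K)"
      by (rule nn_integral_cmult) (intro borel_measurable_prod_ennreal dens_u)
    also have "(\<integral>\<^sup>+v. (\<Prod>i\<in>K. ennreal (cgauss_density (\<sigma> i) (v i - \<mu> a i (?m (u, v))))) \<partial>lborel_PiM K) = 1"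
    proof (rule nn_integral_triangular_density[where r = r])
      show "\<mu> a i (?m (u, x)) = \<mu> a i (?m (u, y))" if "i \<in> K" "\<And>j. j \<in> K \<Longrightarrow> r j < r i \<Longrightarrow> x j = y j" for i x y
        using that by (intro \<mu>_K[OF a]) (auto simp: mJ mK)
      show "0 < \<sigma> i" if "i \<in> K" for i using \<sigma> that by simp
    qed (fact fin \<mu>_u)+
    finally show ?thesis by simp
  qed
  have \<nu>_meas: "\<nu> i \<in> borel_measurable (lborel_PiM J)" if "i \<in> J" for i
    unfolding \<nu>_def [abs_def] using that by (intro measurable_compose[OF fix_v \<mu>_meas[OF a0]]) simp
  have "(\<Sum>a\<in>A. \<integral>\<^sup>+y. F a y * (\<Prod>i\<in>J \<union> K. ?d a y i) \<partial>lborel_PiM (J \<union> K))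
      = (\<integral>\<^sup>+u. (\<Sum>a\<in>A. \<integral>\<^sup>+v. P a u v \<partial>lborel_PiM K) \<partial>lborel_PiM J)"
  proof -
    have "(\<Sum>a\<in>A. \<integral>\<^sup>+y. F a y * (\<Prod>i\<in>J \<union> K. ?d a y i) \<partial>lborel_PiM (J \<union> K))
        = (\<Sum>a\<in>A. \<integral>\<^sup>+u. (\<integral>\<^sup>+v. P a u v \<partial>lborel_PiM K) \<partial>lborel_PiM J)"
      by (rule sum.cong[OF refl fold])
    also have "\<dots> = (\<integral>\<^sup>+u. (\<Sum>a\<in>A. \<integral>\<^sup>+v. P a u v \<partial>lborel_PiM K) \<partial>lborel_PiM J)"
      by (rule nn_integral_sum[symmetric]) (rule inner_meas)
    finally show ?thesis .
  qed
  also have "\<dots> \<le> (\<integral>\<^sup>+u. G u \<partial>lborel_PiM J)"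
  proof (rule nn_integral_mono)
    fix u assume u: "u \<in> space (lborel_PiM J)"
    show "(\<Sum>a\<in>A. \<integral>\<^sup>+v. P a u v \<partial>lborel_PiM K) \<le> G u"
    \<comment> \<open>Over a fixed \<open>u\<close> at most one message has a nonempty section, so
      the sum over messages collapses to one term, which \<open>one\<close> bounds by
      \<open>G u\<close>.\<close>
    proof (cases "\<exists>a\<in>A. \<exists>v. F a (?m (u, v)) \<noteq> 0")
      case True
      then obtain a v where a: "a \<in> A" "F a (?m (u, v)) \<noteq> 0" by blast
      have "P b u w = 0" if "b \<in> A - {a}" for b w
      proof (rule ccontr)
        assume "P b u w \<noteq> 0"
        then have "F b (?m (u, w)) \<noteq> 0" by (auto simp: P_def)
        then have "a = b" using a that by (intro disj[OF _ _ m_space m_space _ a(2)]) (auto simp: mJ)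
        then show False using that by simp
      qed
      then have "(\<integral>\<^sup>+v. P b u v \<partial>lborel_PiM K) = 0" if "b \<in> A - {a}" for b
        using that by (subst nn_integral_cong[of _ _ "\<lambda>_. 0"]) auto
      then have "(\<Sum>b\<in>A - {a}. \<integral>\<^sup>+v. P b u v \<partial>lborel_PiM K) = 0"
        by (intro sum.neutral) auto
      then have "(\<Sum>b\<in>A. \<integral>\<^sup>+v. P b u v \<partial>lborel_PiM K) = (\<integral>\<^sup>+v. P a u v \<partial>lborel_PiM K)"
        using sum.remove[OF fin(1) a(1), of "\<lambda>b. \<integral>\<^sup>+v. P b u v \<partial>lborel_PiM K"] by simp
      then show ?thesis using one[OF u a(1)] by simp
    next
      case False
      then have "(\<integral>\<^sup>+v. P a u v \<partial>lborel_PiM K) = 0" if "a \<in> A" for a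
        using that by (subst nn_integral_cong[of _ _ "\<lambda>_. 0"]) (auto simp: P_def)
      then show ?thesis by simp
    qed
  qed
  also have "\<dots> = 1"
    unfolding G_def
  proof (rule nn_integral_triangular_density[where r = r])
    show "\<nu> i x = \<nu> i y" if "i \<in> J" "\<And>j. j \<in> J \<Longrightarrow> r j < r i \<Longrightarrow> x j = y j" for i x y
      unfolding \<nu>_def using that by (intro \<mu>_J[OF a0 a0]) (auto simp: mJ)
    show "0 < \<sigma> i" if "i \<in> J" for i using \<sigma> that by simp
  qed (fact fin \<nu>_meas)+
  finally show ?thesis .
qed simp

text \<open>The quadratic term of the noise density has the favourable sign and is dropped. What is
  left is the energy of the residual and the log-ratio of the variances.\<close>

lemma ln_cgauss_density_ratio:
  assumes "0 < v" "v \<le> \<sigma>"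
  shows "- ((cmod e)\<^sup>2 / \<sigma>) - ln (\<sigma> / v) \<le> ln (cgauss_density \<sigma> e) - ln (cgauss_density v w)"
proof -
  have l: "ln (cgauss_density s z) = - ((cmod z)\<^sup>2 / s) - ln (pi * s)" if "0 < s" for s z
    using that unfolding cgauss_density_def by (subst ln_div) auto
  have "ln (pi * \<sigma>) - ln (pi * v) = ln (\<sigma> / v)"
    using assms by (simp add: ln_mult ln_div)
  moreover have "0 \<le> (cmod w)\<^sup>2 / v" using assms by simp
  moreover have "0 < \<sigma>" using assms by simp
  ultimately show ?thesis unfolding l[OF assms(1)] l[OF \<open>0 < \<sigma>\<close>] by linarith
qed

lemma cgauss_density_pos: "0 < s \<Longrightarrow> 0 < cgauss_density s z"
  by (simp add: cgauss_density_def)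

lemma sum_sum_ennreal:
  assumes "\<And>a b. 0 \<le> f a b"
  shows "(\<Sum>a\<in>A. \<Sum>b\<in>B. ennreal (f a b)) = ennreal (\<Sum>a\<in>A. \<Sum>b\<in>B. f a b)"
  using assms by (simp add: sum_nonneg)

section \<open>Channel outputs as a change of variables of the noise\<close>

locale noise_model =
  fixes N :: fdnet and n :: nat
  assumes W_nonneg: "0 \<le> Wr N"
begin

abbreviation "I \<equiv> noise_idx N n"

definition var :: "nat \<times> nat \<times> nat \<Rightarrow> real" where
  "var i = (if fst i = 2 then Wr N else 1)"

lemma idx_cases:
  assumes "i \<in> I"
  obtains (ul) t j where "i = (0, t, j)" "t < n" "j < n_Nul N"
    | (dl) t j where "i = (1, t, j)" "t < n" "j < n_Ndl N"
    | (side) t j where "i = (2, t, j)" "t < side_len N n" "j < n_Ndl N"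
  using assms unfolding noise_idx_def by auto

lemma idx_iff:
  "(0, t, j) \<in> I \<longleftrightarrow> t < n \<and> j < n_Nul N"
  "(Suc 0, t, j) \<in> I \<longleftrightarrow> t < n \<and> j < n_Ndl N"
  "(2, t, j) \<in> I \<longleftrightarrow> t < side_len N n \<and> j < n_Ndl N"
  unfolding noise_idx_def by auto

lemma finite_I: "finite I"
  unfolding noise_idx_def by auto

text \<open>If \<open>Wr N = 0\<close> there are no side-channel uses, so the degenerate variance 0
  is attained at no index.\<close>

lemma var_pos: "i \<in> I \<Longrightarrow> 0 < var i"
proof (erule idx_cases)
  fix t j assume i: "i = (2, t, j)" "t < side_len N n"
  then have "Wr N \<noteq> 0" by (auto simp: side_len_def)
  then show "0 < var i" using i W_nonneg by (simp add: var_def)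
qed (simp_all add: var_def)

lemma noise_space_eq: "noise_space N n = PiM I (\<lambda>i. cgauss (var i))"
  unfolding noise_space_def var_def by (intro PiM_cong) auto

lemma noise_density:
  "noise_space N n = density (lborel_PiM I) (\<lambda>x. \<Prod>i\<in>I. ennreal (cgauss_density (var i) (x i)))"
  unfolding noise_space_eq by (rule PiM_cgauss_eq_density[OF finite_I var_pos])

lemma sets_noise [measurable_cong, simp]: "sets (noise_space N n) = sets (lborel_PiM I)"
  unfolding noise_density by simp

lemma space_noise [simp]: "space (noise_space N n) = extensional I"
  unfolding noise_density by (simp add: space_PiM PiE_def)

lemma prob_noise: "prob_space (noise_space N n)"
proof -
  have "noise_space N n = PiM I (\<lambda>i. cgauss (if i \<in> I then var i else 1))"
    unfolding noise_space_eq by (rule PiM_cong) auto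
  moreover have "prob_space (PiM I (\<lambda>i. cgauss (if i \<in> I then var i else 1)))"
    by (intro prob_space_PiM prob_space_cgauss) (auto simp: var_pos)
  ultimately show ?thesis by simp
qed

lemma component_measurable: "i \<in> I \<Longrightarrow> (\<lambda>y. y i) \<in> borel_measurable (lborel_PiM I)"
  by (rule measurable_component_singleton[of i I "\<lambda>_. lborel :: complex measure",
        unfolded measurable_cong_sets[OF refl sets_lborel]])

end

locale network_code = noise_model N n for N :: fdnet and n :: nat +
  fixes Kd Ku :: nat and xul xs :: "nat \<Rightarrow> nat \<Rightarrow> nat \<Rightarrow> complex"
    and fdl :: "nat \<Rightarrow> nat \<Rightarrow> (nat \<Rightarrow> nat \<Rightarrow> complex) \<Rightarrow> nat \<Rightarrow> complex"
    and gul :: "nat \<Rightarrow> (nat \<Rightarrow> nat \<Rightarrow> complex) \<Rightarrow> nat"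
    and gdl :: "(nat \<Rightarrow> nat \<Rightarrow> complex) \<Rightarrow> (nat \<Rightarrow> nat \<Rightarrow> complex) \<Rightarrow> nat"
  assumes valid: "valid_code N n Kd Ku xul xs fdl gul gdl"
    and K_pos: "0 < Kd" "0 < Ku"
begin

definition YU :: "(nat \<times> nat \<times> nat \<Rightarrow> complex) \<Rightarrow> nat \<Rightarrow> nat \<Rightarrow> complex" where
  "YU y = (\<lambda>t j. if t < n \<and> j < n_Nul N then y (0, t, j) else 0)"

definition YD :: "(nat \<times> nat \<times> nat \<Rightarrow> complex) \<Rightarrow> nat \<Rightarrow> nat \<Rightarrow> complex" where
  "YD y = (\<lambda>t j. if t < n \<and> j < n_Ndl N then y (1, t, j) else 0)"

definition YS :: "(nat \<times> nat \<times> nat \<Rightarrow> complex) \<Rightarrow> nat \<Rightarrow> nat \<Rightarrow> complex" where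
  "YS y = (\<lambda>t j. if t < side_len N n \<and> j < n_Ndl N then y (2, t, j) else 0)"

text \<open>The noiseless part of each output, written as a function of all outputs: through the feedback to
  the base station, downlink outputs depend on earlier uplink outputs.\<close>

definition sig :: "nat \<Rightarrow> nat \<Rightarrow> (nat \<times> nat \<times> nat \<Rightarrow> complex) \<Rightarrow> nat \<times> nat \<times> nat \<Rightarrow> complex" where
  "sig wd wu y = (\<lambda>(k, t, i).
     if k = 0 then complex_of_real (sqrt ((1 - lam N) * snr_ul N)) * (\<Sum>j<n_Mul N. H_ul N i j * xul wu t j)
     else if k = 1 then complex_of_real (sqrt (snr_dl N)) * (\<Sum>j<n_Mdl N. H_dl N i j * x_dl (fdl wd) (YU y) t j)
        + complex_of_real (sqrt ((1 - lam N) * snr_I N)) * (\<Sum>j<n_Mul N. H_I N i j * xul wu t j)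
     else complex_of_real (sqrt (lam N * snr_S N)) * (\<Sum>j<n_Mul N. H_S N i j * xs wu t j))"

text \<open>All outputs are packed into one function on the noise index set, which makes the channel
  a self-map of the noise space.\<close>

definition Y :: "nat \<Rightarrow> nat \<Rightarrow> (nat \<times> nat \<times> nat \<Rightarrow> complex) \<Rightarrow> nat \<times> nat \<times> nat \<Rightarrow> complex" where
  "Y wd wu \<omega> = (\<lambda>i\<in>I. case i of (k, t, j) \<Rightarrow>
     if k = 0 then y_ul N n (xul wu) \<omega> t j
     else if k = 1 then y_dl N n (x_dl (fdl wd) (y_ul N n (xul wu) \<omega>)) (xul wu) \<omega> t j
     else y_S N n (xs wu) \<omega> t j)"

text \<open>Since \<open>sig\<close> is expressed through the outputs, inverting the channel needs
  no recursion: the signal that the outputs themselves would cause is subtracted.\<close>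

definition Yinv :: "nat \<Rightarrow> nat \<Rightarrow> (nat \<times> nat \<times> nat \<Rightarrow> complex) \<Rightarrow> nat \<times> nat \<times> nat \<Rightarrow> complex" where
  "Yinv wd wu y = (\<lambda>i\<in>I. y i + - sig wd wu y i)"

definition succ :: "nat \<Rightarrow> nat \<Rightarrow> (nat \<times> nat \<times> nat \<Rightarrow> complex) set" where
  "succ wd wu = space (noise_space N n) - err_event N n xul xs fdl gul gdl wd wu"

lemma YU_Y: "YU (Y wd wu \<omega>) = y_ul N n (xul wu) \<omega>"
  unfolding YU_def Y_def by (auto simp: fun_eq_iff idx_iff y_ul_def)

lemma YD_Y: "YD (Y wd wu \<omega>) = y_dl N n (x_dl (fdl wd) (y_ul N n (xul wu) \<omega>)) (xul wu) \<omega>"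
  unfolding YD_def Y_def by (auto simp: fun_eq_iff idx_iff y_dl_def)

lemma YS_Y: "YS (Y wd wu \<omega>) = y_S N n (xs wu) \<omega>"
  unfolding YS_def Y_def by (auto simp: fun_eq_iff idx_iff y_S_def)

lemma Y_eq: "i \<in> I \<Longrightarrow> Y wd wu \<omega> i = sig wd wu (Y wd wu \<omega>) i + \<omega> i"
  by (erule idx_cases)
    (simp_all add: sig_def YU_Y, simp_all add: Y_def idx_iff y_ul_def y_dl_def y_S_def)

lemma sig_cong:
  assumes "\<And>t j. t < n \<Longrightarrow> j < n_Nul N \<Longrightarrow> x (0, t, j) = y (0, t, j)"
  shows "sig wd wu x = sig wd wu y"
proof -
  have "YU x = YU y" using assms by (auto simp: YU_def fun_eq_iff)
  then show ?thesis by (simp only: sig_def)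
qed

lemma sig_ul: "sig wd wu x (0, t, j) = sig wd wu y (0, t, j)"
  by (simp add: sig_def)

text \<open>Uplink signals depend on no output, so the uplink outputs agree first. All other signals
  read only uplink outputs, so they agree as well.\<close>

lemma Y_Yinv:
  assumes "y \<in> extensional I"
  shows "Y wd wu (Yinv wd wu y) = y"
proof -
  have ul: "Y wd wu (Yinv wd wu y) (0, t, j) = y (0, t, j)" if "t < n" "j < n_Nul N" for t j
    using that Y_eq[of "(0, t, j)" wd wu "Yinv wd wu y"]
      sig_ul[of wd wu "Y wd wu (Yinv wd wu y)" t j y] by (simp add: idx_iff Yinv_def)
  have "sig wd wu (Y wd wu (Yinv wd wu y)) = sig wd wu y" by (rule sig_cong) (rule ul)
  then have "Y wd wu (Yinv wd wu y) i = y i" if "i \<in> I" for i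
    using Y_eq[OF that, of wd wu "Yinv wd wu y"] that by (simp add: Yinv_def)
  moreover have "Y wd wu (Yinv wd wu y) i = y i" if "i \<notin> I" for i
    using that extensional_arb[OF assms that] by (simp add: Y_def)
  ultimately show ?thesis by blast
qed

lemma succD:
  assumes "\<omega> \<in> succ wd wu"
  shows "gul wd (YU (Y wd wu \<omega>)) = wu" "gdl (YD (Y wd wu \<omega>)) (YS (Y wd wu \<omega>)) = wd"
  using assms unfolding succ_def err_event_def YU_Y YD_Y YS_Y by auto

lemma succ_sets: "wd < Kd \<Longrightarrow> wu < Ku \<Longrightarrow> succ wd wu \<in> sets (lborel_PiM I)"
  using valid sets.compl_sets[of "err_event N n xul xs fdl gul gdl wd wu" "noise_space N n"]
  unfolding succ_def valid_code_def by simp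

text \<open>\<open>valid_code\<close> gives measurability of the base station's input only as a
  function of the noise. But every block of uplink outputs is the one that message 0 produces under
  a suitably shifted noise \<open>z y\<close>, and the shift is measurable.\<close>

lemma x_dl_measurable:
  assumes "wd < Kd" "t < n" "j < n_Mdl N"
  shows "(\<lambda>y. x_dl (fdl wd) (YU y) t j) \<in> borel_measurable (lborel_PiM I)"
proof -
  have m: "(\<lambda>\<omega>. x_dl (fdl wd) (y_ul N n (xul 0) \<omega>) t j) \<in> borel_measurable (lborel_PiM I)"
    using valid assms K_pos unfolding valid_code_def by (simp add: measurable_cong_sets[OF sets_noise refl])
  define z where "z y = (\<lambda>i\<in>I. if fst i = 0 then y i - sig 0 0 (\<lambda>_. 0) i else y i)" for y :: "nat \<times> nat \<times> nat \<Rightarrow> complex"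
  have "z \<in> lborel_PiM I \<rightarrow>\<^sub>M lborel_PiM I"
    unfolding z_def by (intro measurable_restrict) (use component_measurable in \<open>auto simp: measurable_cong_sets[OF refl sets_lborel]\<close>)
  from measurable_compose[OF this m]
  have "(\<lambda>y. x_dl (fdl wd) (y_ul N n (xul 0) (z y)) t j) \<in> borel_measurable (lborel_PiM I)" .
  moreover have "y_ul N n (xul 0) (z y) = YU y" for y
    by (auto simp: fun_eq_iff y_ul_def YU_def z_def idx_iff sig_def)
  ultimately show ?thesis by simp
qed

lemma sig_measurable:
  assumes "wd < Kd" "i \<in> I"
  shows "(\<lambda>y. sig wd wu y i) \<in> borel_measurable (lborel_PiM I)"
  using assms(2)
proof (cases rule: idx_cases)
  case (dl t j)
  have [measurable]: "(\<lambda>y. x_dl (fdl wd) (YU y) t l) \<in> borel_measurable (lborel_PiM I)" if "l \<in> {..<n_Mdl N}" for l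
    using x_dl_measurable[OF assms(1) dl(2)] that by simp
  show ?thesis unfolding sig_def dl(1) by simp
qed (simp_all add: sig_def)

lemma Yinv_measurable:
  assumes "wd < Kd"
  shows "Yinv wd wu \<in> lborel_PiM I \<rightarrow>\<^sub>M lborel_PiM I"
  unfolding Yinv_def [abs_def]
  using component_measurable sig_measurable[OF assms]
  by (intro measurable_restrict) (simp add: measurable_cong_sets[OF refl sets_lborel])

lemma Y_measurable:
  assumes "wd < Kd" "wu < Ku"
  shows "Y wd wu \<in> lborel_PiM I \<rightarrow>\<^sub>M lborel_PiM I"
proof -
  have 0: "(\<lambda>\<omega>. Y wd wu \<omega> (0, t, j)) \<in> borel_measurable (lborel_PiM I)" if "t < n" "j < n_Nul N" for t j
    using that component_measurable[of "(0, t, j)"] by (simp add: Y_def idx_iff y_ul_def)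
  have 1: "(\<lambda>\<omega>. Y wd wu \<omega> (1, t, j)) \<in> borel_measurable (lborel_PiM I)" if "t < n" "j < n_Ndl N" for t j
  proof -
    have [measurable]: "(\<lambda>\<omega>. x_dl (fdl wd) (y_ul N n (xul wu) \<omega>) t l) \<in> borel_measurable (lborel_PiM I)" if "l \<in> {..<n_Mdl N}" for l
      using valid assms that \<open>t < n\<close> unfolding valid_code_def by (simp add: measurable_cong_sets[OF sets_noise refl])
    show ?thesis
      using that component_measurable[of "(1, t, j)"] by (simp add: Y_def idx_iff y_dl_def)
  qed
  have 2: "(\<lambda>\<omega>. Y wd wu \<omega> (2, t, j)) \<in> borel_measurable (lborel_PiM I)" if "t < side_len N n" "j < n_Ndl N" for t j
    using that component_measurable[of "(2, t, j)"] by (simp add: Y_def idx_iff y_S_def)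
  have "(\<lambda>\<omega>. Y wd wu \<omega> i) \<in> borel_measurable (lborel_PiM I)" if "i \<in> I" for i
    by (cases rule: idx_cases[OF that]) (use 0 1 2 in simp_all)
  then have "(\<lambda>\<omega>. \<lambda>i\<in>I. Y wd wu \<omega> i) \<in> lborel_PiM I \<rightarrow>\<^sub>M lborel_PiM I"
    by (intro measurable_restrict) (simp add: measurable_cong_sets[OF refl sets_lborel])
  moreover have "(\<lambda>\<omega>. \<lambda>i\<in>I. Y wd wu \<omega> i) = Y wd wu"
    by (auto simp: fun_eq_iff Y_def)
  ultimately show ?thesis by simp
qed

text \<open>Two ranks suffice for the triangular shift: uplink signals are constant in the outputs,
  and all other signals read nothing but uplink outputs.\<close>

lemma nn_integral_Yinv:
  assumes "wd < Kd" "f \<in> borel_measurable (lborel_PiM I)"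
  shows "(\<integral>\<^sup>+y. f (Yinv wd wu y) \<partial>lborel_PiM I) = (\<integral>\<^sup>+y. f y \<partial>lborel_PiM I)"
  unfolding Yinv_def
proof (rule nn_integral_triangular_shift[where r = "\<lambda>i. if fst i = 0 then 0 else 1"])
  fix i and x y :: "nat \<times> nat \<times> nat \<Rightarrow> complex" assume i: "i \<in> I"
    and eq: "\<And>j. j \<in> I \<Longrightarrow> (if fst j = 0 then 0 else 1) < (if fst i = 0 then 0 else (1::nat)) \<Longrightarrow> x j = y j"
  have "sig wd wu x i = sig wd wu y i"
  proof (cases "fst i = 0")
    case True
    then show ?thesis by (cases i) (simp add: sig_def)
  next
    case False
    then have "sig wd wu x = sig wd wu y" using eq by (intro sig_cong) (auto simp: idx_iff)
    then show ?thesis by simp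
  qed
  then show "- sig wd wu x i = - sig wd wu y i" by simp
next
  fix i assume "i \<in> I"
  then show "(\<lambda>y. - sig wd wu y i) \<in> borel_measurable (lborel_PiM I)"
    using sig_measurable[OF assms(1)] by simp
qed (use assms(2) finite_I in simp_all)

text \<open>This takes the role of Fano's inequality, without entropies. \<open>\<mu>\<close> and
  \<open>\<sigma>\<close> describe a reference density for the outputs, and \<open>K\<close> is the
  number of messages to be told apart: by \<open>dec\<close> a reference density gives the correct
  decisions an average mass of at most \<open>1 / K\<close>. The price is the log-ratio of the
  variances and the mean energy \<open>C\<close> of the residuals.\<close>

theorem information_bound:
  fixes \<sigma> :: "nat \<times> nat \<times> nat \<Rightarrow> real" and C K \<epsilon> :: real
    and \<mu> :: "nat \<Rightarrow> nat \<Rightarrow> nat \<times> nat \<times> nat \<Rightarrow> (nat \<times> nat \<times> nat \<Rightarrow> complex) \<Rightarrow> complex"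
  assumes K: "1 \<le> K" and C: "0 \<le> C" and \<sigma>: "\<And>i. i \<in> I \<Longrightarrow> var i \<le> \<sigma> i"
    and \<mu>_meas: "\<And>wd wu i. wd < Kd \<Longrightarrow> wu < Ku \<Longrightarrow> i \<in> I \<Longrightarrow> \<mu> wd wu i \<in> borel_measurable (lborel_PiM I)"
    and mass: "\<And>wd wu. wd < Kd \<Longrightarrow> wu < Ku \<Longrightarrow>
      (\<integral>\<^sup>+y. (\<Prod>i\<in>I. ennreal (cgauss_density (\<sigma> i) (y i - \<mu> wd wu i y))) \<partial>lborel_PiM I) \<le> 1"
    and dec: "(\<Sum>wd<Kd. \<Sum>wu<Ku. \<integral>\<^sup>+y. indicator (succ wd wu) (Yinv wd wu y) *
        (\<Prod>i\<in>I. ennreal (cgauss_density (\<sigma> i) (y i - \<mu> wd wu i y))) \<partial>lborel_PiM I) \<le> ennreal (real Kd * real Ku / K)"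
    and res: "(\<Sum>wd<Kd. \<Sum>wu<Ku. \<integral>\<^sup>+\<omega>. ennreal (\<Sum>i\<in>I. (cmod (Y wd wu \<omega> i - \<mu> wd wu i (Y wd wu \<omega>)))\<^sup>2 / \<sigma> i)
        \<partial>noise_space N n) \<le> ennreal (C * (real Kd * real Ku))"
    and err: "error_prob N n Kd Ku xul xs fdl gul gdl \<le> \<epsilon>"
  shows "(1 - \<epsilon>) * ln K \<le> 1 + (\<Sum>i\<in>I. ln (\<sigma> i / var i)) + C"
proof -
  interpret P: prob_space "noise_space N n" by (rule prob_noise)
  have e1: "emeasure (noise_space N n) (extensional I) = 1"
    using P.emeasure_space_1 by simp
  define G where "G = (\<Sum>i\<in>I. ln (\<sigma> i / var i))"
  have \<sigma>_pos: "0 < \<sigma> i" if "i \<in> I" for i using var_pos[OF that] \<sigma>[OF that] by simp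
  have G: "0 \<le> G"
    unfolding G_def using var_pos \<sigma> by (intro sum_nonneg ln_ge_zero) (simp add: divide_simps)
  define E where "E wd wu y = (\<Sum>i\<in>I. (cmod (y i - \<mu> wd wu i y))\<^sup>2 / \<sigma> i)" for wd wu y
  define p where "p \<omega> = (\<Prod>i\<in>I. cgauss_density (var i) (\<omega> i))" for \<omega>
  define q where "q wd wu y = (\<Prod>i\<in>I. cgauss_density (\<sigma> i) (y i - \<mu> wd wu i y))" for wd wu y
  have E_nonneg: "0 \<le> E wd wu y" for wd wu y
    unfolding E_def using \<sigma>_pos by (intro sum_nonneg) (simp add: less_imp_le)
  have p_pos: "0 < p \<omega>" for \<omega> unfolding p_def by (intro prod_pos cgauss_density_pos var_pos)
  have q_pos: "0 < q wd wu y" for wd wu y unfolding q_def by (intro prod_pos cgauss_density_pos \<sigma>_pos)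
  have q_enn: "(\<Prod>i\<in>I. ennreal (cgauss_density (\<sigma> i) (y i - \<mu> wd wu i y))) = ennreal (q wd wu y)" for wd wu y
    unfolding q_def using cgauss_density_pos[OF \<sigma>_pos] by (intro prod_ennreal) (simp add: less_imp_le)
  have p_enn: "(\<Prod>i\<in>I. ennreal (cgauss_density (var i) (\<omega> i))) = ennreal (p \<omega>)" for \<omega>
    unfolding p_def using cgauss_density_pos[OF var_pos] by (intro prod_ennreal) (simp add: less_imp_le)
  have ratio: "- E wd wu (Y wd wu \<omega>) - G \<le> ln (q wd wu (Y wd wu \<omega>)) - ln (p \<omega>)" for wd wu \<omega>
  proof -
    let ?e = "\<lambda>i. Y wd wu \<omega> i - \<mu> wd wu i (Y wd wu \<omega>)"
    have "- E wd wu (Y wd wu \<omega>) - G = (\<Sum>i\<in>I. - ((cmod (?e i))\<^sup>2 / \<sigma> i) - ln (\<sigma> i / var i))"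
      by (simp add: E_def G_def sum_subtractf sum_negf)
    also have "\<dots> \<le> (\<Sum>i\<in>I. ln (cgauss_density (\<sigma> i) (?e i)) - ln (cgauss_density (var i) (\<omega> i)))"
      by (intro sum_mono ln_cgauss_density_ratio var_pos \<sigma>)
    also have "\<dots> = ln (q wd wu (Y wd wu \<omega>)) - ln (p \<omega>)"
      unfolding p_def q_def sum_subtractf
      by (subst (1 2) ln_prod) (use finite_I cgauss_density_pos var_pos \<sigma>_pos in \<open>auto simp: less_imp_neq[symmetric]\<close>)
    finally show ?thesis .
  qed
  \<comment> \<open>Used with \<open>c = K\<close> on the success event and with
    \<open>c = 1\<close> off it. A decoding error then costs no more than the total mass of the
    reference density, which accounts for the summand 1 in the conclusion.\<close>
  have tangent: "p \<omega> * (1 + ln c) \<le> c * q wd wu (Y wd wu \<omega>) + p \<omega> * (E wd wu (Y wd wu \<omega>) + G)" if "1 \<le> c" for c wd wu \<omega>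
  proof -
    let ?q = "q wd wu (Y wd wu \<omega>)" and ?p = "p \<omega>"
    have "ln (c * ?q / ?p) \<le> c * ?q / ?p - 1"
      using that p_pos q_pos by (intro ln_le_minus_one) simp
    moreover have "ln (c * ?q / ?p) = ln c + (ln ?q - ln ?p)"
      using that p_pos[of \<omega>] q_pos[of wd wu "Y wd wu \<omega>"] by (simp add: ln_mult ln_div)
    ultimately have "1 + ln c \<le> c * ?q / ?p + (E wd wu (Y wd wu \<omega>) + G)"
      using ratio[of wd wu \<omega>] by simp
    from mult_left_mono[OF this, of ?p] show ?thesis using p_pos[of \<omega>] by (simp add: distrib_left)
  qed
  have single: "1 + ennreal (ln K) * emeasure (noise_space N n) (succ wd wu)
      \<le> ennreal K * (\<integral>\<^sup>+y. indicator (succ wd wu) (Yinv wd wu y) * ennreal (q wd wu y) \<partial>lborel_PiM I) + 1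
        + ((\<integral>\<^sup>+\<omega>. ennreal (E wd wu (Y wd wu \<omega>)) \<partial>noise_space N n) + ennreal G)"
    if w: "wd < Kd" "wu < Ku" for wd wu
  proof -
    note [measurable] = Y_measurable[OF w] Yinv_measurable[OF w(1), of wu] succ_sets[OF w]
    have e_meas: "(\<lambda>y. y i - \<mu> wd wu i y) \<in> borel_measurable (lborel_PiM I)" if "i \<in> I" for i
      using component_measurable[OF that] \<mu>_meas[OF w that] by measurable
    have [measurable]: "q wd wu \<in> borel_measurable (lborel_PiM I)"
      unfolding q_def [abs_def] using measurable_compose[OF e_meas cgauss_density_measurable] by (rule borel_measurable_prod)
    have [measurable]: "E wd wu \<in> borel_measurable (lborel_PiM I)"
      unfolding E_def [abs_def] by (intro borel_measurable_sum) (use e_meas in measurable)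
    have [measurable]: "p \<in> borel_measurable (lborel_PiM I)"
      unfolding p_def [abs_def] using measurable_compose[OF component_measurable cgauss_density_measurable] by (rule borel_measurable_prod)
    let ?S = "succ wd wu" and ?y = "\<lambda>\<omega>. Y wd wu \<omega>"
    have P_int: "(\<integral>\<^sup>+\<omega>. f \<omega> \<partial>noise_space N n) = (\<integral>\<^sup>+\<omega>. ennreal (p \<omega>) * f \<omega> \<partial>lborel_PiM I)"
      if "f \<in> borel_measurable (lborel_PiM I)" for f
      unfolding noise_density p_enn using that by (subst nn_integral_density) auto
    have "1 + ennreal (ln K) * emeasure (noise_space N n) ?S
        = (\<integral>\<^sup>+\<omega>. 1 + ennreal (ln K) * indicator ?S \<omega> \<partial>noise_space N n)"
      by (subst nn_integral_add) (auto simp: nn_integral_cmult e1)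
    also have "\<dots> = (\<integral>\<^sup>+\<omega>. ennreal (p \<omega>) * (1 + ennreal (ln K) * indicator ?S \<omega>) \<partial>lborel_PiM I)"
      by (rule P_int) measurable
    also have "\<dots> \<le> (\<integral>\<^sup>+\<omega>. ennreal K * (indicator ?S \<omega> * ennreal (q wd wu (?y \<omega>))) + ennreal (q wd wu (?y \<omega>))
        + ennreal (p \<omega>) * (ennreal (E wd wu (?y \<omega>)) + ennreal G) \<partial>lborel_PiM I)"
    proof (rule nn_integral_mono)
      fix \<omega>
      have pe: "ennreal (p \<omega>) * (ennreal (E wd wu (?y \<omega>)) + ennreal G) = ennreal (p \<omega> * (E wd wu (?y \<omega>) + G))"
        using p_pos[of \<omega>] E_nonneg G by (simp add: ennreal_mult ennreal_plus less_imp_le)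
      show "ennreal (p \<omega>) * (1 + ennreal (ln K) * indicator ?S \<omega>) \<le> ennreal K * (indicator ?S \<omega> * ennreal (q wd wu (?y \<omega>)))
          + ennreal (q wd wu (?y \<omega>)) + ennreal (p \<omega>) * (ennreal (E wd wu (?y \<omega>)) + ennreal G)"
      proof (cases "\<omega> \<in> ?S")
        case True
        have "ennreal (p \<omega>) * (1 + ennreal (ln K)) = ennreal (p \<omega> * (1 + ln K))"
          using K p_pos[of \<omega>] by (simp add: ennreal_mult less_imp_le)
        also have "\<dots> \<le> ennreal (K * q wd wu (?y \<omega>) + p \<omega> * (E wd wu (?y \<omega>) + G))"
          by (intro ennreal_leI tangent K)
        also have "\<dots> = ennreal K * ennreal (q wd wu (?y \<omega>)) + ennreal (p \<omega> * (E wd wu (?y \<omega>) + G))"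
          using K p_pos[of \<omega>] q_pos[of wd wu "?y \<omega>"] E_nonneg[of wd wu "?y \<omega>"] G
          by (simp add: ennreal_mult[symmetric] ennreal_plus[symmetric] less_imp_le del: ennreal_plus)
        also have "\<dots> \<le> ennreal K * ennreal (q wd wu (?y \<omega>)) + ennreal (q wd wu (?y \<omega>)) + ennreal (p \<omega> * (E wd wu (?y \<omega>) + G))"
          by (intro add_mono) auto
        finally show ?thesis using True by (simp add: pe)
      next
        case False
        have "ennreal (p \<omega>) \<le> ennreal (q wd wu (?y \<omega>) + p \<omega> * (E wd wu (?y \<omega>) + G))"
          using tangent[of 1 \<omega> wd wu] by (intro ennreal_leI) simp
        also have "\<dots> = ennreal (q wd wu (?y \<omega>)) + ennreal (p \<omega> * (E wd wu (?y \<omega>) + G))"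
          using p_pos[of \<omega>] q_pos[of wd wu "?y \<omega>"] E_nonneg[of wd wu "?y \<omega>"] G
          by (intro ennreal_plus) (auto simp: less_imp_le)
        finally show ?thesis using False by (simp add: pe)
      qed
    qed
    also have "\<dots> = ennreal K * (\<integral>\<^sup>+\<omega>. indicator ?S \<omega> * ennreal (q wd wu (?y \<omega>)) \<partial>lborel_PiM I)
        + (\<integral>\<^sup>+\<omega>. ennreal (q wd wu (?y \<omega>)) \<partial>lborel_PiM I)
        + (\<integral>\<^sup>+\<omega>. ennreal (p \<omega>) * (ennreal (E wd wu (?y \<omega>)) + ennreal G) \<partial>lborel_PiM I)"
      by (subst nn_integral_add, measurable, subst nn_integral_add, measurable, subst nn_integral_cmult, measurable)
    also have "(\<integral>\<^sup>+\<omega>. ennreal (p \<omega>) * (ennreal (E wd wu (?y \<omega>)) + ennreal G) \<partial>lborel_PiM I)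
        = (\<integral>\<^sup>+\<omega>. ennreal (E wd wu (?y \<omega>)) + ennreal G \<partial>noise_space N n)"
      by (rule P_int[symmetric]) measurable
    also have "\<dots> = (\<integral>\<^sup>+\<omega>. ennreal (E wd wu (?y \<omega>)) \<partial>noise_space N n) + ennreal G"
      by (subst nn_integral_add) (auto simp: e1)
    \<comment> \<open>From integrals over the noise to integrals over the outputs. There the
      decoding sets become sets of output vectors, as \<open>dec\<close> and \<open>mass\<close>
      require.\<close>
    also have "(\<integral>\<^sup>+\<omega>. indicator ?S \<omega> * ennreal (q wd wu (?y \<omega>)) \<partial>lborel_PiM I)
        = (\<integral>\<^sup>+y. indicator ?S (Yinv wd wu y) * ennreal (q wd wu (?y (Yinv wd wu y))) \<partial>lborel_PiM I)"
      by (rule nn_integral_Yinv[OF w(1), symmetric]) measurable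
    also have "\<dots> = (\<integral>\<^sup>+y. indicator ?S (Yinv wd wu y) * ennreal (q wd wu y) \<partial>lborel_PiM I)"
      by (intro nn_integral_cong) (simp add: Y_Yinv space_PiM PiE_def)
    also have "(\<integral>\<^sup>+\<omega>. ennreal (q wd wu (?y \<omega>)) \<partial>lborel_PiM I)
        = (\<integral>\<^sup>+y. ennreal (q wd wu (?y (Yinv wd wu y))) \<partial>lborel_PiM I)"
      by (rule nn_integral_Yinv[OF w(1), symmetric]) measurable
    also have "\<dots> = (\<integral>\<^sup>+y. ennreal (q wd wu y) \<partial>lborel_PiM I)"
      by (intro nn_integral_cong) (simp add: Y_Yinv space_PiM PiE_def)
    also have "\<dots> \<le> 1" using mass[OF w] by (simp add: q_enn)
    finally show ?thesis by (simp add: add_mono)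
  qed
  define A where "A = (\<Sum>wd<Kd. \<Sum>wu<Ku. P.prob (succ wd wu))"
  have A_nonneg: "0 \<le> A" unfolding A_def by (intro sum_nonneg) simp
  let ?KK = "real Kd * real Ku"
  have KK: "0 < ?KK" using K_pos by simp
  have "ennreal (?KK + ln K * A) = (\<Sum>wd<Kd. \<Sum>wu<Ku. 1 + ennreal (ln K) * emeasure (noise_space N n) (succ wd wu))"
  proof -
    have nn: "0 \<le> 1 + ln K * P.prob X" for X
      using K by (intro add_nonneg_nonneg mult_nonneg_nonneg ln_ge_zero) simp_all
    have "?KK + ln K * A = (\<Sum>wd<Kd. \<Sum>wu<Ku. 1 + ln K * P.prob (succ wd wu))"
      by (simp add: A_def sum.distrib sum_distrib_left)
    then have "ennreal (?KK + ln K * A) = (\<Sum>wd<Kd. \<Sum>wu<Ku. ennreal (1 + ln K * P.prob (succ wd wu)))"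
      by (simp only: sum_sum_ennreal[OF nn])
    moreover have "ennreal (1 + ln K * P.prob X) = 1 + ennreal (ln K) * emeasure (noise_space N n) X" for X
      using K by (simp add: P.emeasure_eq_measure ennreal_mult)
    ultimately show ?thesis by (simp only:)
  qed
  also have "\<dots> \<le> (\<Sum>wd<Kd. \<Sum>wu<Ku. ennreal K * (\<integral>\<^sup>+y. indicator (succ wd wu) (Yinv wd wu y) * ennreal (q wd wu y) \<partial>lborel_PiM I) + 1
        + ((\<integral>\<^sup>+\<omega>. ennreal (E wd wu (Y wd wu \<omega>)) \<partial>noise_space N n) + ennreal G))"
    by (intro sum_mono single) auto
  also have "\<dots> = ennreal K * (\<Sum>wd<Kd. \<Sum>wu<Ku. (\<integral>\<^sup>+y. indicator (succ wd wu) (Yinv wd wu y) * ennreal (q wd wu y) \<partial>lborel_PiM I))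
      + ennreal ?KK + ((\<Sum>wd<Kd. \<Sum>wu<Ku. (\<integral>\<^sup>+\<omega>. ennreal (E wd wu (Y wd wu \<omega>)) \<partial>noise_space N n)) + ennreal ?KK * ennreal G)"
    by (simp add: sum.distrib sum_distrib_left ennreal_mult ennreal_of_nat_eq_real_of_nat[symmetric] mult.assoc)
  also have "\<dots> \<le> ennreal K * ennreal (?KK / K) + ennreal ?KK + (ennreal (C * ?KK) + ennreal ?KK * ennreal G)"
    using dec res unfolding q_enn E_def by (intro add_mono mult_left_mono) auto
  also have "\<dots> = ennreal (K * (?KK / K) + ?KK + (C * ?KK + ?KK * G))"
    using K C G KK by (simp add: ennreal_mult[symmetric] ennreal_plus[symmetric] del: ennreal_plus)
  finally have "?KK + ln K * A \<le> K * (?KK / K) + ?KK + (C * ?KK + ?KK * G)"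
    using K C G KK by (subst (asm) ennreal_le_iff) auto
  then have main: "ln K * A \<le> ?KK * (1 + G + C)"
    using K by (simp add: algebra_simps)
  have "P.prob (succ wd wu) = 1 - P.prob (err_event N n xul xs fdl gul gdl wd wu)" if "wd < Kd" "wu < Ku" for wd wu
    unfolding succ_def using valid that by (intro P.prob_compl) (auto simp: valid_code_def)
  then have "A = ?KK - (\<Sum>wd<Kd. \<Sum>wu<Ku. P.prob (err_event N n xul xs fdl gul gdl wd wu))"
    by (simp add: A_def sum_subtractf)
  then have "(1 - \<epsilon>) * ?KK \<le> A"
    using err KK unfolding error_prob_def by (simp add: field_simps)
  then have "ln K * ((1 - \<epsilon>) * ?KK) \<le> ?KK * (1 + G + C)"
    using main K by (meson ln_ge_zero mult_left_mono order_trans)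
  then have "?KK * ((1 - \<epsilon>) * ln K) \<le> ?KK * (1 + G + C)" by (simp add: ac_simps)
  then show ?thesis by (simp only: mult_le_cancel_left_pos[OF KK] G_def)
qed

end

section \<open>Input and noise energies and the residual term of the bound\<close>

lemma sum_sum_sum_ennreal:
  fixes f :: "'a \<Rightarrow> 'b \<Rightarrow> 'c \<Rightarrow> real"
  assumes "\<And>a b c. 0 \<le> f a b c"
  shows "(\<Sum>a\<in>A. \<Sum>b\<in>B. \<Sum>c\<in>C. ennreal (f a b c)) = ennreal (\<Sum>a\<in>A. \<Sum>b\<in>B. \<Sum>c\<in>C. f a b c)"
  using assms by (simp add: sum_nonneg)

context noise_model
begin

lemma sum_I:
  fixes f :: "nat \<times> nat \<times> nat \<Rightarrow> 'b :: comm_monoid_add"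
  shows "(\<Sum>i\<in>I. f i) = (\<Sum>t<n. \<Sum>j<n_Nul N. f (0, t, j)) + (\<Sum>t<n. \<Sum>j<n_Ndl N. f (1, t, j))
    + (\<Sum>t<side_len N n. \<Sum>j<n_Ndl N. f (2, t, j))"
proof -
  have block: "sum f ({k} \<times> {..<a} \<times> {..<b}) = (\<Sum>t<a. \<Sum>j<b. f (k, t, j))" for k a b
    unfolding sum.cartesian_product by (rule sum.reindex_bij_witness[of _ "\<lambda>(t, j). (k, t, j)" snd]) auto
  show ?thesis
    unfolding noise_idx_def by (subst sum.union_disjoint, (force+)[3])+ (simp only: block)
qed

lemma noise_second_moment:
  assumes "i \<in> I"
  shows "(\<integral>\<^sup>+\<omega>. ennreal ((cmod (\<omega> i))\<^sup>2) \<partial>noise_space N n) = ennreal (var i)"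
proof -
  define M where "M = (\<lambda>j. cgauss (if j \<in> I then var j else 1))"
  have eq: "noise_space N n = PiM I M"
    unfolding noise_space_eq M_def by (rule PiM_cong) auto
  interpret product_prob_space M I
    unfolding M_def product_prob_space_def product_sigma_finite_def product_prob_space_axioms_def
    using prob_space_cgauss var_pos by (auto intro: prob_space_imp_sigma_finite)
  have "(\<integral>\<^sup>+\<omega>. ennreal ((cmod (\<omega> i))\<^sup>2) \<partial>PiM I M) = (\<integral>\<^sup>+z. ennreal ((cmod z)\<^sup>2) \<partial>distr (PiM I M) (M i) (\<lambda>\<omega>. \<omega> i))"
    using assms by (subst nn_integral_distr) (auto simp: M_def)
  also have "distr (PiM I M) (M i) (\<lambda>\<omega>. \<omega> i) = M i"
    using assms by (rule PiM_component)
  also have "(\<integral>\<^sup>+z. ennreal ((cmod z)\<^sup>2) \<partial>M i) = ennreal (var i)"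
    using assms by (simp add: M_def cgauss_second_moment var_pos)
  finally show ?thesis by (simp add: eq)
qed

end

context network_code
begin

text \<open>Every residual at time \<open>t\<close> will be a fixed linear combination of these
  inputs and noises. A multiple of their total energy therefore bounds its square pointwise, and the
  mean of this energy is controlled by the power constraint.\<close>

definition main_energy :: "nat \<Rightarrow> nat \<Rightarrow> nat \<Rightarrow> (nat \<times> nat \<times> nat \<Rightarrow> complex) \<Rightarrow> real" where
  "main_energy wd wu t \<omega> = sqnorm (n_Mdl N) (x_dl (fdl wd) (y_ul N n (xul wu) \<omega>) t) + sqnorm (n_Mul N) (xul wu t)
     + (\<Sum>j<n_Nul N. (cmod (\<omega> (0, t, j)))\<^sup>2) + (\<Sum>j<n_Ndl N. (cmod (\<omega> (1, t, j)))\<^sup>2)"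

definition side_energy :: "nat \<Rightarrow> nat \<Rightarrow> (nat \<times> nat \<times> nat \<Rightarrow> complex) \<Rightarrow> real" where
  "side_energy wu t \<omega> = sqnorm (n_Mul N) (xs wu t) + (\<Sum>j<n_Ndl N. (cmod (\<omega> (2, t, j)))\<^sup>2)"

text \<open>Number of outputs in a slot times the mean energy of the slot, for main and side
  channel. The summands 2 and 1 are the power constraints of the inputs, the others the noise
  variances.\<close>

definition energy_const :: real where
  "energy_const = real (n_Nul N + n_Ndl N) * (2 + real (n_Nul N + n_Ndl N)) + real (n_Ndl N) * (1 + real (n_Ndl N) * Wr N)"

lemma sqnorm_nonneg: "0 \<le> sqnorm k v"
  unfolding sqnorm_def by (intro sum_nonneg) simp

lemma main_energy_nonneg: "0 \<le> main_energy wd wu t \<omega>"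
  unfolding main_energy_def by (intro add_nonneg_nonneg sqnorm_nonneg sum_nonneg) auto

lemma side_energy_nonneg: "0 \<le> side_energy wu t \<omega>"
  unfolding side_energy_def by (intro add_nonneg_nonneg sqnorm_nonneg sum_nonneg) auto

lemma x_dl_Y_measurable:
  assumes "wd < Kd" "wu < Ku" "t < n"
  shows "(\<lambda>\<omega>. sqnorm (n_Mdl N) (x_dl (fdl wd) (y_ul N n (xul wu) \<omega>) t)) \<in> borel_measurable (lborel_PiM I)"
proof -
  have [measurable]: "(\<lambda>\<omega>. x_dl (fdl wd) (y_ul N n (xul wu) \<omega>) t l) \<in> borel_measurable (lborel_PiM I)" if "l \<in> {..<n_Mdl N}" for l
    using valid assms that unfolding valid_code_def by (simp add: measurable_cong_sets[OF sets_noise refl])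
  show ?thesis unfolding sqnorm_def by measurable
qed

lemma main_energy_expectation:
  "(\<Sum>t<n. \<Sum>wd<Kd. \<Sum>wu<Ku. \<integral>\<^sup>+\<omega>. ennreal (main_energy wd wu t \<omega>) \<partial>noise_space N n)
    \<le> ennreal (real n * (2 + real (n_Nul N + n_Ndl N)) * (real Kd * real Ku))"
proof -
  interpret P: prob_space "noise_space N n" by (rule prob_noise)
  have e1: "emeasure (noise_space N n) (extensional I) = 1"
    using P.emeasure_space_1 by simp
  let ?X = "\<lambda>t wd wu. \<integral>\<^sup>+\<omega>. ennreal (sqnorm (n_Mdl N) (x_dl (fdl wd) (y_ul N n (xul wu) \<omega>) t)) \<partial>noise_space N n"
  have one: "(\<integral>\<^sup>+\<omega>. ennreal (main_energy wd wu t \<omega>) \<partial>noise_space N n) =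
      ?X t wd wu + ennreal (sqnorm (n_Mul N) (xul wu t) + real (n_Nul N + n_Ndl N))"
    if "wd < Kd" "wu < Ku" "t < n" for wd wu t
  proof -
    have m: "(\<lambda>\<omega>. \<omega> (k, t, j)) \<in> borel_measurable (noise_space N n)" if "(k, t, j) \<in> I" for k j
      using component_measurable[OF that] by (simp add: measurable_cong_sets[OF sets_noise refl])
    have [measurable]: "(\<lambda>\<omega>. \<omega> (0, t, j)) \<in> borel_measurable (noise_space N n)" if "j \<in> {..<n_Nul N}" for j
      using that \<open>t < n\<close> by (intro m) (simp add: idx_iff)
    have [measurable]: "(\<lambda>\<omega>. \<omega> (Suc 0, t, j)) \<in> borel_measurable (noise_space N n)" if "j \<in> {..<n_Ndl N}" for j
      using that \<open>t < n\<close> by (intro m) (simp add: idx_iff)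
    have [measurable]: "(\<lambda>\<omega>. sqnorm (n_Mdl N) (x_dl (fdl wd) (y_ul N n (xul wu) \<omega>) t)) \<in> borel_measurable (noise_space N n)"
      using x_dl_Y_measurable[OF that] by (simp add: measurable_cong_sets[OF sets_noise refl])
    have "(\<integral>\<^sup>+\<omega>. ennreal (main_energy wd wu t \<omega>) \<partial>noise_space N n) =
      (\<integral>\<^sup>+\<omega>. ennreal (sqnorm (n_Mdl N) (x_dl (fdl wd) (y_ul N n (xul wu) \<omega>) t)) + (ennreal (sqnorm (n_Mul N) (xul wu t))
        + ((\<Sum>j<n_Nul N. ennreal ((cmod (\<omega> (0, t, j)))\<^sup>2)) + (\<Sum>j<n_Ndl N. ennreal ((cmod (\<omega> (1, t, j)))\<^sup>2)))) \<partial>noise_space N n)"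
      unfolding main_energy_def
      by (intro nn_integral_cong) (simp add: sqnorm_nonneg sum_nonneg add.assoc)
    also have "\<dots> = ?X t wd wu + (ennreal (sqnorm (n_Mul N) (xul wu t))
        + ((\<Sum>j<n_Nul N. \<integral>\<^sup>+\<omega>. ennreal ((cmod (\<omega> (0, t, j)))\<^sup>2) \<partial>noise_space N n)
         + (\<Sum>j<n_Ndl N. \<integral>\<^sup>+\<omega>. ennreal ((cmod (\<omega> (1, t, j)))\<^sup>2) \<partial>noise_space N n)))"
      by (simp add: nn_integral_add nn_integral_sum e1 del: sum_ennreal)
    also have "\<dots> = ?X t wd wu + (ennreal (sqnorm (n_Mul N) (xul wu t)) + ((\<Sum>j<n_Nul N. ennreal 1) + (\<Sum>j<n_Ndl N. ennreal 1)))"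
      using \<open>t < n\<close> by (simp add: noise_second_moment idx_iff var_def)
    also have "\<dots> = ?X t wd wu + ennreal (sqnorm (n_Mul N) (xul wu t) + real (n_Nul N + n_Ndl N))"
      by (simp add: sqnorm_nonneg ennreal_of_nat_eq_real_of_nat)
    finally show ?thesis .
  qed
  have "(\<Sum>t<n. \<Sum>wd<Kd. \<Sum>wu<Ku. \<integral>\<^sup>+\<omega>. ennreal (main_energy wd wu t \<omega>) \<partial>noise_space N n)
     = (\<Sum>t<n. \<Sum>wd<Kd. \<Sum>wu<Ku. ?X t wd wu + ennreal (sqnorm (n_Mul N) (xul wu t) + real (n_Nul N + n_Ndl N)))"
    by (intro sum.cong refl one) auto
  also have "\<dots> = (\<Sum>t<n. \<Sum>wd<Kd. \<Sum>wu<Ku. ?X t wd wu)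
     + ennreal (\<Sum>t<n. \<Sum>wd<Kd. \<Sum>wu<Ku. sqnorm (n_Mul N) (xul wu t) + real (n_Nul N + n_Ndl N))"
  proof -
    have nn: "0 \<le> sqnorm (n_Mul N) (xul wu t) + real (n_Nul N + n_Ndl N)" for t wd wu
      using sqnorm_nonneg[of "n_Mul N" "xul wu t"] by simp
    show ?thesis
      by (subst sum_sum_sum_ennreal[symmetric, of "\<lambda>t wd wu. sqnorm (n_Mul N) (xul wu t) + real (n_Nul N + n_Ndl N)", OF nn])
        (simp only: sum.distrib)
  qed
  also have "\<dots> \<le> ennreal (real n * real Kd * real Ku) + ennreal (real Kd * (real n * real Ku) + real n * (real Kd * (real Ku * real (n_Nul N + n_Ndl N))))"
  proof (intro add_mono ennreal_leI)
    show "(\<Sum>t<n. \<Sum>wd<Kd. \<Sum>wu<Ku. ?X t wd wu) \<le> ennreal (real n * real Kd * real Ku)"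
      using valid unfolding valid_code_def by blast
    have "(\<Sum>t<n. \<Sum>wu<Ku. sqnorm (n_Mul N) (xul wu t)) \<le> real n * real Ku"
      using valid unfolding valid_code_def by blast
    from mult_left_mono[OF this, of "real Kd"]
    show "(\<Sum>t<n. \<Sum>wd<Kd. \<Sum>wu<Ku. sqnorm (n_Mul N) (xul wu t) + real (n_Nul N + n_Ndl N))
        \<le> real Kd * (real n * real Ku) + real n * (real Kd * (real Ku * real (n_Nul N + n_Ndl N)))"
      by (simp add: sum.distrib sum_distrib_left[symmetric] distrib_left)
  qed
  also have "\<dots> = ennreal (real n * (2 + real (n_Nul N + n_Ndl N)) * (real Kd * real Ku))"
    by (subst ennreal_plus[symmetric]) (auto simp: algebra_simps)
  finally show ?thesis .
qed

lemma side_energy_expectation: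
  "(\<Sum>t<side_len N n. \<Sum>wd<Kd. \<Sum>wu<Ku. \<integral>\<^sup>+\<omega>. ennreal (side_energy wu t \<omega>) \<partial>noise_space N n)
    \<le> ennreal (real (side_len N n) * (1 + real (n_Ndl N) * Wr N) * (real Kd * real Ku))"
proof -
  interpret P: prob_space "noise_space N n" by (rule prob_noise)
  have e1: "emeasure (noise_space N n) (extensional I) = 1"
    using P.emeasure_space_1 by simp
  have one: "(\<integral>\<^sup>+\<omega>. ennreal (side_energy wu t \<omega>) \<partial>noise_space N n) =
      ennreal (sqnorm (n_Mul N) (xs wu t) + real (n_Ndl N) * Wr N)"
    if "t < side_len N n" for wu t
  proof -
    have [measurable]: "(\<lambda>\<omega>. \<omega> (2, t, j)) \<in> borel_measurable (noise_space N n)" if "j \<in> {..<n_Ndl N}" for j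
      using that \<open>t < side_len N n\<close> component_measurable[of "(2, t, j)"]
      by (simp add: idx_iff measurable_cong_sets[OF sets_noise refl])
    have "(\<integral>\<^sup>+\<omega>. ennreal (side_energy wu t \<omega>) \<partial>noise_space N n) =
      (\<integral>\<^sup>+\<omega>. ennreal (sqnorm (n_Mul N) (xs wu t)) + (\<Sum>j<n_Ndl N. ennreal ((cmod (\<omega> (2, t, j)))\<^sup>2)) \<partial>noise_space N n)"
      unfolding side_energy_def
      by (intro nn_integral_cong) (simp add: sqnorm_nonneg sum_nonneg ennreal_plus)
    also have "\<dots> = ennreal (sqnorm (n_Mul N) (xs wu t))
        + (\<Sum>j<n_Ndl N. \<integral>\<^sup>+\<omega>. ennreal ((cmod (\<omega> (2, t, j)))\<^sup>2) \<partial>noise_space N n)"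
      by (simp add: nn_integral_add nn_integral_sum e1 del: sum_ennreal)
    also have "\<dots> = ennreal (sqnorm (n_Mul N) (xs wu t)) + (\<Sum>j<n_Ndl N. ennreal (Wr N))"
      using \<open>t < side_len N n\<close> by (simp add: noise_second_moment idx_iff var_def)
    also have "\<dots> = ennreal (sqnorm (n_Mul N) (xs wu t) + real (n_Ndl N) * Wr N)"
      using W_nonneg by (simp add: sqnorm_nonneg ennreal_of_nat_eq_real_of_nat ennreal_mult)
    finally show ?thesis .
  qed
  have "(\<Sum>t<side_len N n. \<Sum>wd<Kd. \<Sum>wu<Ku. \<integral>\<^sup>+\<omega>. ennreal (side_energy wu t \<omega>) \<partial>noise_space N n)
     = (\<Sum>t<side_len N n. \<Sum>wd<Kd. \<Sum>wu<Ku. ennreal (sqnorm (n_Mul N) (xs wu t) + real (n_Ndl N) * Wr N))"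
    by (intro sum.cong refl one) auto
  also have "\<dots> = ennreal (\<Sum>t<side_len N n. \<Sum>wd<Kd. \<Sum>wu<Ku. sqnorm (n_Mul N) (xs wu t) + real (n_Ndl N) * Wr N)"
    by (rule sum_sum_sum_ennreal[of "\<lambda>t wd wu. sqnorm (n_Mul N) (xs wu t) + real (n_Ndl N) * Wr N"])
      (simp add: sqnorm_nonneg W_nonneg)
  also have "\<dots> \<le> ennreal (real (side_len N n) * (1 + real (n_Ndl N) * Wr N) * (real Kd * real Ku))"
  proof (rule ennreal_leI)
    have "(\<Sum>t<side_len N n. \<Sum>wu<Ku. sqnorm (n_Mul N) (xs wu t)) \<le> real (side_len N n) * real Ku"
      using valid unfolding valid_code_def by blast
    from mult_left_mono[OF this, of "real Kd"]
    show "(\<Sum>t<side_len N n. \<Sum>wd<Kd. \<Sum>wu<Ku. sqnorm (n_Mul N) (xs wu t) + real (n_Ndl N) * Wr N)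
      \<le> real (side_len N n) * (1 + real (n_Ndl N) * Wr N) * (real Kd * real Ku)"
      by (simp add: sum.distrib sum_distrib_left algebra_simps)
  qed
  finally show ?thesis .
qed

text \<open>Pointwise residual bounds relative to \<open>\<sigma>\<close> turn the residual term
  into a constant per channel use. If \<open>B\<close> does not depend on the SNR, this constant is
  negligible against ln \<rho>, and only the log-ratio of the variances matters.\<close>

lemma information_bound_energy:
  fixes \<sigma> :: "nat \<times> nat \<times> nat \<Rightarrow> real" and B K \<epsilon> :: real
    and \<mu> :: "nat \<Rightarrow> nat \<Rightarrow> nat \<times> nat \<times> nat \<Rightarrow> (nat \<times> nat \<times> nat \<Rightarrow> complex) \<Rightarrow> complex"
  assumes K: "1 \<le> K" and B: "0 \<le> B" and \<sigma>: "\<And>i. i \<in> I \<Longrightarrow> var i \<le> \<sigma> i"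
    and \<mu>_meas: "\<And>wd wu i. wd < Kd \<Longrightarrow> wu < Ku \<Longrightarrow> i \<in> I \<Longrightarrow> \<mu> wd wu i \<in> borel_measurable (lborel_PiM I)"
    and mass: "\<And>wd wu. wd < Kd \<Longrightarrow> wu < Ku \<Longrightarrow>
      (\<integral>\<^sup>+y. (\<Prod>i\<in>I. ennreal (cgauss_density (\<sigma> i) (y i - \<mu> wd wu i y))) \<partial>lborel_PiM I) \<le> 1"
    and dec: "(\<Sum>wd<Kd. \<Sum>wu<Ku. \<integral>\<^sup>+y. indicator (succ wd wu) (Yinv wd wu y) *
        (\<Prod>i\<in>I. ennreal (cgauss_density (\<sigma> i) (y i - \<mu> wd wu i y))) \<partial>lborel_PiM I) \<le> ennreal (real Kd * real Ku / K)"
    and main: "\<And>k wd wu t j \<omega>. k < 2 \<Longrightarrow> wd < Kd \<Longrightarrow> wu < Ku \<Longrightarrow> (k, t, j) \<in> I \<Longrightarrow>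
      (cmod (Y wd wu \<omega> (k, t, j) - \<mu> wd wu (k, t, j) (Y wd wu \<omega>)))\<^sup>2 \<le> \<sigma> (k, t, j) * (B * main_energy wd wu t \<omega>)"
    and side: "\<And>wd wu t j \<omega>. wd < Kd \<Longrightarrow> wu < Ku \<Longrightarrow> (2, t, j) \<in> I \<Longrightarrow>
      (cmod (Y wd wu \<omega> (2, t, j) - \<mu> wd wu (2, t, j) (Y wd wu \<omega>)))\<^sup>2 \<le> \<sigma> (2, t, j) * (B * side_energy wu t \<omega>)"
    and err: "error_prob N n Kd Ku xul xs fdl gul gdl \<le> \<epsilon>"
  shows "(1 - \<epsilon>) * ln K \<le> 1 + (\<Sum>i\<in>I. ln (\<sigma> i / var i)) + B * energy_const * (real n + real (side_len N n))"
proof (rule information_bound[OF K _ \<sigma> \<mu>_meas mass dec _ err])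
  let ?C = "B * energy_const * (real n + real (side_len N n))"
  show "0 \<le> ?C" using B W_nonneg unfolding energy_const_def by simp
  define a where "a = B * real (n_Nul N + n_Ndl N)"
  define b where "b = B * real (n_Ndl N)"
  have ab: "0 \<le> a" "0 \<le> b" using B by (auto simp: a_def b_def)
  have \<sigma>_pos: "0 < \<sigma> i" if "i \<in> I" for i using var_pos[OF that] \<sigma>[OF that] by simp
  let ?e = "\<lambda>wd wu \<omega> i. (cmod (Y wd wu \<omega> i - \<mu> wd wu i (Y wd wu \<omega>)))\<^sup>2 / \<sigma> i"
  have pointwise: "(\<Sum>i\<in>I. ?e wd wu \<omega> i) \<le> (\<Sum>t<n. a * main_energy wd wu t \<omega>) + (\<Sum>t<side_len N n. b * side_energy wu t \<omega>)"
    if w: "wd < Kd" "wu < Ku" for wd wu \<omega>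
  proof -
    have m: "?e wd wu \<omega> (k, t, j) \<le> B * main_energy wd wu t \<omega>" if "k < 2" "(k, t, j) \<in> I" for k t j
      using main[OF that(1) w that(2), of \<omega>] \<sigma>_pos[OF that(2)] by (simp add: pos_divide_le_eq mult.commute)
    have s: "?e wd wu \<omega> (2, t, j) \<le> B * side_energy wu t \<omega>" if "(2, t, j) \<in> I" for t j
      using side[OF w that, of \<omega>] \<sigma>_pos[OF that] by (simp add: pos_divide_le_eq mult.commute)
    have "(\<Sum>i\<in>I. ?e wd wu \<omega> i) \<le> (\<Sum>t<n. \<Sum>j<n_Nul N. B * main_energy wd wu t \<omega>) + (\<Sum>t<n. \<Sum>j<n_Ndl N. B * main_energy wd wu t \<omega>)
        + (\<Sum>t<side_len N n. \<Sum>j<n_Ndl N. B * side_energy wu t \<omega>)"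
      unfolding sum_I by (intro add_mono sum_mono m s) (auto simp: idx_iff)
    also have "\<dots> = (\<Sum>t<n. a * main_energy wd wu t \<omega>) + (\<Sum>t<side_len N n. b * side_energy wu t \<omega>)"
      by (simp add: a_def b_def sum.distrib[symmetric] algebra_simps)
    finally show ?thesis .
  qed
  have "(\<Sum>wd<Kd. \<Sum>wu<Ku. \<integral>\<^sup>+\<omega>. ennreal (\<Sum>i\<in>I. ?e wd wu \<omega> i) \<partial>noise_space N n)
     \<le> (\<Sum>wd<Kd. \<Sum>wu<Ku. (\<Sum>t<n. ennreal a * (\<integral>\<^sup>+\<omega>. ennreal (main_energy wd wu t \<omega>) \<partial>noise_space N n))
         + (\<Sum>t<side_len N n. ennreal b * (\<integral>\<^sup>+\<omega>. ennreal (side_energy wu t \<omega>) \<partial>noise_space N n)))"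
  proof (intro sum_mono)
    fix wd wu assume "wd \<in> {..<Kd}" "wu \<in> {..<Ku}"
    then have w: "wd < Kd" "wu < Ku" by auto
    have comp: "(\<lambda>\<omega>. \<omega> i) \<in> borel_measurable (noise_space N n)" if "i \<in> I" for i
      using component_measurable[OF that] by (simp add: measurable_cong_sets[OF sets_noise refl])
    have mm: "(\<lambda>\<omega>. main_energy wd wu t \<omega>) \<in> borel_measurable (noise_space N n)" if "t < n" for t
      unfolding main_energy_def
      by (intro borel_measurable_add borel_measurable_sum borel_measurable_power borel_measurable_norm comp
          borel_measurable_const x_dl_Y_measurable[OF w that, unfolded measurable_cong_sets[OF sets_noise[symmetric] refl]])
        (use that in \<open>auto simp: idx_iff\<close>)
    have ms: "(\<lambda>\<omega>. side_energy wu t \<omega>) \<in> borel_measurable (noise_space N n)" if "t < side_len N n" for t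
      unfolding side_energy_def
      by (intro borel_measurable_add borel_measurable_sum borel_measurable_power borel_measurable_norm comp borel_measurable_const)
        (use that in \<open>auto simp: idx_iff\<close>)
    have "(\<integral>\<^sup>+\<omega>. ennreal (\<Sum>i\<in>I. ?e wd wu \<omega> i) \<partial>noise_space N n)
       \<le> (\<integral>\<^sup>+\<omega>. (\<Sum>t<n. ennreal a * ennreal (main_energy wd wu t \<omega>)) + (\<Sum>t<side_len N n. ennreal b * ennreal (side_energy wu t \<omega>)) \<partial>noise_space N n)"
    proof (rule nn_integral_mono)
      fix \<omega>
      have "ennreal (\<Sum>i\<in>I. ?e wd wu \<omega> i) \<le> ennreal ((\<Sum>t<n. a * main_energy wd wu t \<omega>) + (\<Sum>t<side_len N n. b * side_energy wu t \<omega>))"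
        by (intro ennreal_leI pointwise w)
      also have "\<dots> = (\<Sum>t<n. ennreal a * ennreal (main_energy wd wu t \<omega>)) + (\<Sum>t<side_len N n. ennreal b * ennreal (side_energy wu t \<omega>))"
        using ab main_energy_nonneg side_energy_nonneg
        by (simp add: ennreal_mult[symmetric] sum_ennreal sum_nonneg)
      finally show "ennreal (\<Sum>i\<in>I. ?e wd wu \<omega> i) \<le> \<dots>" .
    qed
    also have "\<dots> = (\<Sum>t<n. ennreal a * (\<integral>\<^sup>+\<omega>. ennreal (main_energy wd wu t \<omega>) \<partial>noise_space N n))
         + (\<Sum>t<side_len N n. ennreal b * (\<integral>\<^sup>+\<omega>. ennreal (side_energy wu t \<omega>) \<partial>noise_space N n))"
    proof -
      have mm': "(\<lambda>\<omega>. ennreal (main_energy wd wu t \<omega>)) \<in> borel_measurable (noise_space N n)" if "t \<in> {..<n}" for t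
        using mm that by (intro measurable_compose[OF _ measurable_ennreal]) simp
      have ms': "(\<lambda>\<omega>. ennreal (side_energy wu t \<omega>)) \<in> borel_measurable (noise_space N n)" if "t \<in> {..<side_len N n}" for t
        using ms that by (intro measurable_compose[OF _ measurable_ennreal]) simp
      note [measurable] = mm' ms'
      show ?thesis
        by (subst nn_integral_add, measurable) (simp add: nn_integral_sum nn_integral_cmult mm' ms')
    qed
    finally show "(\<integral>\<^sup>+\<omega>. ennreal (\<Sum>i\<in>I. ?e wd wu \<omega> i) \<partial>noise_space N n) \<le> \<dots>" .
  qed
  also have "\<dots> = ennreal a * (\<Sum>t<n. \<Sum>wd<Kd. \<Sum>wu<Ku. \<integral>\<^sup>+\<omega>. ennreal (main_energy wd wu t \<omega>) \<partial>noise_space N n)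
      + ennreal b * (\<Sum>t<side_len N n. \<Sum>wd<Kd. \<Sum>wu<Ku. \<integral>\<^sup>+\<omega>. ennreal (side_energy wu t \<omega>) \<partial>noise_space N n)"
  proof -
    have swap: "(\<Sum>wd<Kd. \<Sum>wu<Ku. \<Sum>t<k. c * f t wd wu) = c * (\<Sum>t<k. \<Sum>wd<Kd. \<Sum>wu<Ku. f t wd wu)"
      for f :: "nat \<Rightarrow> nat \<Rightarrow> nat \<Rightarrow> ennreal" and k c
    proof -
      have "(\<Sum>wd<Kd. \<Sum>wu<Ku. \<Sum>t<k. c * f t wd wu) = (\<Sum>wd<Kd. \<Sum>t<k. \<Sum>wu<Ku. c * f t wd wu)"
        by (intro sum.cong refl sum.swap)
      also have "\<dots> = (\<Sum>t<k. \<Sum>wd<Kd. \<Sum>wu<Ku. c * f t wd wu)" by (rule sum.swap)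
      finally show ?thesis by (simp add: sum_distrib_left)
    qed
    show ?thesis by (simp only: sum.distrib swap)
  qed
  also have "\<dots> \<le> ennreal a * ennreal (real n * (2 + real (n_Nul N + n_Ndl N)) * (real Kd * real Ku))
      + ennreal b * ennreal (real (side_len N n) * (1 + real (n_Ndl N) * Wr N) * (real Kd * real Ku))"
    by (intro add_mono mult_left_mono main_energy_expectation side_energy_expectation) auto
  also have "\<dots> = ennreal ((a * (real n * (2 + real (n_Nul N + n_Ndl N))) + b * (real (side_len N n) * (1 + real (n_Ndl N) * Wr N))) * (real Kd * real Ku))"
    using ab W_nonneg by (simp add: ennreal_mult[symmetric] ennreal_plus[symmetric] algebra_simps del: ennreal_plus)
  also have "\<dots> \<le> ennreal (?C * (real Kd * real Ku))"
  proof (intro ennreal_leI mult_right_mono)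
    let ?u = "B * (real (n_Nul N + n_Ndl N) * (2 + real (n_Nul N + n_Ndl N)))" and ?v = "B * (real (n_Ndl N) * (1 + real (n_Ndl N) * Wr N))"
    have gen: "u * x + v * y \<le> (u + v) * (x + y)" if "0 \<le> u * y" "0 \<le> v * x" for u v x y :: real
      using that by (simp add: algebra_simps)
    have "?u * real n + ?v * real (side_len N n) \<le> (?u + ?v) * (real n + real (side_len N n))"
      by (rule gen) (use B W_nonneg in simp_all)
    also have "?u + ?v = B * energy_const" by (simp add: energy_const_def distrib_left)
    finally show "a * (real n * (2 + real (n_Nul N + n_Ndl N))) + b * (real (side_len N n) * (1 + real (n_Ndl N) * Wr N)) \<le> ?C"
      by (simp add: a_def b_def mult.assoc mult.left_commute mult.commute)
  qed simp
  finally show "(\<Sum>wd<Kd. \<Sum>wu<Ku. \<integral>\<^sup>+\<omega>. ennreal (\<Sum>i\<in>I. ?e wd wu \<omega> i) \<partial>noise_space N n) \<le> ennreal (?C * (real Kd * real Ku))" .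
qed

end

section \<open>Bounds for both messages jointly, for the downlink and for the uplink\<close>

lemma indicator_le_1_ennreal: "indicator A x \<le> (1 :: ennreal)"
  by (simp add: indicator_def)

context network_code
begin

lemma YU_cong: "(\<And>j. j \<in> I \<Longrightarrow> fst j = 0 \<Longrightarrow> x j = y j) \<Longrightarrow> YU x = YU y"
  by (auto simp: YU_def fun_eq_iff idx_iff)

lemma YD_cong: "(\<And>j. j \<in> I \<Longrightarrow> fst j \<noteq> 0 \<Longrightarrow> x j = y j) \<Longrightarrow> YD x = YD y"
  by (auto simp: YD_def fun_eq_iff idx_iff)

lemma YS_cong: "(\<And>j. j \<in> I \<Longrightarrow> fst j \<noteq> 0 \<Longrightarrow> x j = y j) \<Longrightarrow> YS x = YS y"
  by (auto simp: YS_def fun_eq_iff idx_iff)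

text \<open>Under the noise \<open>Yinv wd wu y\<close> the decoders see \<open>y\<close> itself.
  Restricting \<open>y\<close> to the index set changes nothing that they read.\<close>

lemma succ_Yinv:
  assumes "Yinv wd wu y \<in> succ wd wu"
  shows "gul wd (YU y) = wu" "gdl (YD y) (YS y) = wd"
proof -
  let ?y = "restrict y I"
  have "sig wd wu ?y = sig wd wu y" by (rule sig_cong) (simp add: idx_iff)
  then have "Yinv wd wu ?y = Yinv wd wu y" by (auto simp: Yinv_def fun_eq_iff)
  then have "Y wd wu (Yinv wd wu y) = Y wd wu (Yinv wd wu ?y)" by (simp only:)
  also have "\<dots> = ?y" by (rule Y_Yinv) simp
  finally have "Y wd wu (Yinv wd wu y) = ?y" .
  moreover have "YU ?y = YU y" "YD ?y = YD y" "YS ?y = YS y"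
    by (rule YU_cong YD_cong YS_cong; simp)+
  ultimately show "gul wd (YU y) = wu" "gdl (YD y) (YS y) = wd"
    using succD[OF assms] by simp_all
qed

lemma indicator_succ_measurable:
  assumes "wd < Kd" "wu < Ku"
  shows "(\<lambda>y. indicator (succ wd wu) (Yinv wd wu y) :: ennreal) \<in> borel_measurable (lborel_PiM I)"
  using measurable_compose[OF Yinv_measurable[OF assms(1)] borel_measurable_indicator[OF succ_sets[OF assms]]] .

text \<open>The sections are taken over M2's outputs \<open>J\<close>, whose means know no message,
  so disjointness over \<open>J\<close> separates the downlink messages. The means of the uplink
  outputs may then use the downlink message and everything M2 received. For a fixed downlink message
  the base station accepts at most one uplink message, so the sum of indicators over
  \<open>wu\<close> is at most 1.\<close>

lemma joint_bound:
  fixes \<sigma> :: "nat \<times> nat \<times> nat \<Rightarrow> real" and B \<epsilon> :: real and r :: "nat \<times> nat \<times> nat \<Rightarrow> nat"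
    and \<mu> :: "nat \<Rightarrow> nat \<times> nat \<times> nat \<Rightarrow> (nat \<times> nat \<times> nat \<Rightarrow> complex) \<Rightarrow> complex"
  assumes B: "0 \<le> B" and \<sigma>: "\<And>i. i \<in> I \<Longrightarrow> var i \<le> \<sigma> i"
    and \<mu>_meas: "\<And>wd i. wd < Kd \<Longrightarrow> i \<in> I \<Longrightarrow> \<mu> wd i \<in> borel_measurable (lborel_PiM I)"
    and \<mu>_out: "\<And>wd wd' i x y. wd < Kd \<Longrightarrow> wd' < Kd \<Longrightarrow> i \<in> I \<Longrightarrow> fst i \<noteq> 0 \<Longrightarrow>
        (\<And>j. j \<in> I \<Longrightarrow> fst j \<noteq> 0 \<Longrightarrow> r j < r i \<Longrightarrow> x j = y j) \<Longrightarrow> \<mu> wd i x = \<mu> wd' i y"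
    and \<mu>_ul: "\<And>wd i x y. wd < Kd \<Longrightarrow> i \<in> I \<Longrightarrow> fst i = 0 \<Longrightarrow> (\<And>j. j \<in> I \<Longrightarrow> fst j \<noteq> 0 \<Longrightarrow> x j = y j) \<Longrightarrow>
        (\<And>j. j \<in> I \<Longrightarrow> fst j = 0 \<Longrightarrow> r j < r i \<Longrightarrow> x j = y j) \<Longrightarrow> \<mu> wd i x = \<mu> wd i y"
    and main: "\<And>k wd wu t j \<omega>. k < 2 \<Longrightarrow> wd < Kd \<Longrightarrow> wu < Ku \<Longrightarrow> (k, t, j) \<in> I \<Longrightarrow>
      (cmod (Y wd wu \<omega> (k, t, j) - \<mu> wd (k, t, j) (Y wd wu \<omega>)))\<^sup>2 \<le> \<sigma> (k, t, j) * (B * main_energy wd wu t \<omega>)"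
    and side: "\<And>wd wu t j \<omega>. wd < Kd \<Longrightarrow> wu < Ku \<Longrightarrow> (2, t, j) \<in> I \<Longrightarrow>
      (cmod (Y wd wu \<omega> (2, t, j) - \<mu> wd (2, t, j) (Y wd wu \<omega>)))\<^sup>2 \<le> \<sigma> (2, t, j) * (B * side_energy wu t \<omega>)"
    and err: "error_prob N n Kd Ku xul xs fdl gul gdl \<le> \<epsilon>"
  shows "(1 - \<epsilon>) * ln (real Kd * real Ku) \<le> 1 + (\<Sum>i\<in>I. ln (\<sigma> i / var i)) + B * energy_const * (real n + real (side_len N n))"
proof -
  define J where "J = {i \<in> I. fst i \<noteq> 0}"
  define K where "K = {i \<in> I. fst i = 0}"
  have JK: "J \<union> K = I" "J \<inter> K = {}" "finite J" "finite K"
    using finite_I by (auto simp: J_def K_def)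
  have \<sigma>_pos: "0 < \<sigma> i" if "i \<in> I" for i using var_pos[OF that] \<sigma>[OF that] by simp
  have sections: "(\<Sum>wd\<in>A. \<integral>\<^sup>+y. F wd y * (\<Prod>i\<in>I. ennreal (cgauss_density (\<sigma> i) (y i - \<mu> wd i y))) \<partial>lborel_PiM I) \<le> 1"
    if "A \<subseteq> {..<Kd}" "\<And>wd. wd \<in> A \<Longrightarrow> F wd \<in> borel_measurable (lborel_PiM I)" "\<And>wd y. wd \<in> A \<Longrightarrow> F wd y \<le> (1 :: ennreal)"
      "\<And>a b x y. a \<in> A \<Longrightarrow> b \<in> A \<Longrightarrow> (\<And>j. j \<in> J \<Longrightarrow> x j = y j) \<Longrightarrow> F a x \<noteq> 0 \<Longrightarrow> F b y \<noteq> 0 \<Longrightarrow> a = b"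
    for A F
  proof (rule sum_nn_integral_disjoint_sections_le[of A J K \<sigma> F \<mu> r, unfolded JK(1)])
    show "finite A" using that(1) finite_subset by blast
    show "\<mu> a i x = \<mu> b i y" if "a \<in> A" "b \<in> A" "i \<in> J" "\<And>j. j \<in> J \<Longrightarrow> r j < r i \<Longrightarrow> x j = y j" for a b i x y
      using that \<open>A \<subseteq> {..<Kd}\<close> by (intro \<mu>_out) (auto simp: J_def)
    show "\<mu> a i x = \<mu> a i y" if "a \<in> A" "i \<in> K" "\<And>j. j \<in> J \<Longrightarrow> x j = y j" "\<And>j. j \<in> K \<Longrightarrow> r j < r i \<Longrightarrow> x j = y j" for a i x y
      using that \<open>A \<subseteq> {..<Kd}\<close> by (intro \<mu>_ul) (auto simp: J_def K_def)
    show "\<mu> a i \<in> borel_measurable (lborel_PiM I)" if "a \<in> A" "i \<in> I" for a i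
      using that \<open>A \<subseteq> {..<Kd}\<close> by (intro \<mu>_meas) auto
    show "a = b" if "a \<in> A" "b \<in> A" "\<And>j. j \<in> J \<Longrightarrow> x j = y j" "F a x \<noteq> 0" "F b y \<noteq> 0" for a b x y
      using \<open>\<And>a b x y. a \<in> A \<Longrightarrow> b \<in> A \<Longrightarrow> (\<And>j. j \<in> J \<Longrightarrow> x j = y j) \<Longrightarrow> F a x \<noteq> 0 \<Longrightarrow> F b y \<noteq> 0 \<Longrightarrow> a = b\<close>[OF that] .
  qed (fact JK that \<sigma>_pos)+
  show ?thesis
  proof (rule information_bound_energy[where \<mu> = "\<lambda>wd wu. \<mu> wd", OF _ B \<sigma> \<mu>_meas _ _ main side err])
    have "1 \<le> Kd * Ku" using K_pos by (simp add: Suc_le_eq)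
    then show "1 \<le> real Kd * real Ku" by (metis of_nat_1 of_nat_le_iff of_nat_mult)
    show "(\<integral>\<^sup>+y. (\<Prod>i\<in>I. ennreal (cgauss_density (\<sigma> i) (y i - \<mu> wd i y))) \<partial>lborel_PiM I) \<le> 1"
      if "wd < Kd" for wd
      using sections[of "{wd}" "\<lambda>_ _. 1"] that by simp
    define F where "F wd y = (\<Sum>wu<Ku. indicator (succ wd wu) (Yinv wd wu y) :: ennreal)" for wd y
    have F_meas: "F wd \<in> borel_measurable (lborel_PiM I)" if "wd < Kd" for wd
      unfolding F_def using indicator_succ_measurable[OF that] by (intro borel_measurable_sum) auto
    have Q_meas: "(\<lambda>y. \<Prod>i\<in>I. ennreal (cgauss_density (\<sigma> i) (y i - \<mu> wd i y))) \<in> borel_measurable (lborel_PiM I)" if "wd < Kd" for wd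
    proof (rule borel_measurable_prod_ennreal)
      fix i assume "i \<in> I"
      from component_measurable[OF this] \<mu>_meas[OF that this]
      have "(\<lambda>y. y i - \<mu> wd i y) \<in> borel_measurable (lborel_PiM I)" by measurable
      then show "(\<lambda>y. ennreal (cgauss_density (\<sigma> i) (y i - \<mu> wd i y))) \<in> borel_measurable (lborel_PiM I)"
        by measurable
    qed
    have sum_F: "(\<Sum>wd<Kd. \<Sum>wu<Ku. \<integral>\<^sup>+y. indicator (succ wd wu) (Yinv wd wu y) *
        (\<Prod>i\<in>I. ennreal (cgauss_density (\<sigma> i) (y i - \<mu> wd i y))) \<partial>lborel_PiM I)
      = (\<Sum>wd<Kd. \<integral>\<^sup>+y. F wd y * (\<Prod>i\<in>I. ennreal (cgauss_density (\<sigma> i) (y i - \<mu> wd i y))) \<partial>lborel_PiM I)"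
    proof (rule sum.cong[OF refl])
      fix wd assume "wd \<in> {..<Kd}"
      then have wd: "wd < Kd" by simp
      show "(\<Sum>wu<Ku. \<integral>\<^sup>+y. indicator (succ wd wu) (Yinv wd wu y) *
          (\<Prod>i\<in>I. ennreal (cgauss_density (\<sigma> i) (y i - \<mu> wd i y))) \<partial>lborel_PiM I)
        = (\<integral>\<^sup>+y. F wd y * (\<Prod>i\<in>I. ennreal (cgauss_density (\<sigma> i) (y i - \<mu> wd i y))) \<partial>lborel_PiM I)"
        unfolding F_def sum_distrib_right
      proof (rule nn_integral_sum[symmetric])
        fix wu assume "wu \<in> {..<Ku}"
        then have "wu < Ku" by simp
        from borel_measurable_times_ennreal[OF indicator_succ_measurable[OF wd this] Q_meas[OF wd]]
        show "(\<lambda>y. indicator (succ wd wu) (Yinv wd wu y) *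
          (\<Prod>i\<in>I. ennreal (cgauss_density (\<sigma> i) (y i - \<mu> wd i y)))) \<in> borel_measurable (lborel_PiM I)" .
      qed
    qed
    have F1: "F wd y \<le> 1" for wd y
      proof -
        have "F wd y \<le> (\<Sum>wu<Ku. if wu = gul wd (YU y) then 1 else 0)"
          unfolding F_def
        proof (rule sum_mono)
          fix wu
          show "indicator (succ wd wu) (Yinv wd wu y) \<le> (if wu = gul wd (YU y) then 1 else 0 :: ennreal)"
            using succ_Yinv(1)[of wd wu y] by (cases "Yinv wd wu y \<in> succ wd wu") simp_all
        qed
        also have "\<dots> = (if gul wd (YU y) < Ku then 1 else 0)" by simp
        also have "\<dots> \<le> 1" by simp
        finally show ?thesis .
      qed
    have F_disj: "a = b" if "a \<in> {..<Kd}" "b \<in> {..<Kd}" "\<And>j. j \<in> J \<Longrightarrow> x j = y j" "F a x \<noteq> 0" "F b y \<noteq> 0" for a b x y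
      proof -
        have "gdl (YD y) (YS y) = a" if "F a y \<noteq> 0" for a y
        proof -
          have "\<exists>wu. Yinv a wu y \<in> succ a wu"
          proof (rule ccontr)
            assume "\<nexists>wu. Yinv a wu y \<in> succ a wu"
            then have "F a y = 0" unfolding F_def by simp
            then show False using that by simp
          qed
          then show ?thesis using succ_Yinv(2) by blast
        qed
        from this[OF that(4)] this[OF that(5)]
        have "gdl (YD x) (YS x) = a" "gdl (YD y) (YS y) = b" .
        moreover have "YD x = YD y" "YS x = YS y"
          using that(3) by (auto simp: J_def intro: YD_cong YS_cong)
        ultimately show ?thesis by simp
      qed
    have "(\<Sum>wd<Kd. \<integral>\<^sup>+y. F wd y * (\<Prod>i\<in>I. ennreal (cgauss_density (\<sigma> i) (y i - \<mu> wd i y))) \<partial>lborel_PiM I) \<le> 1"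
      by (rule sections[of "{..<Kd}" F, OF subset_refl F_meas F1 F_disj]) simp_all
    then show "(\<Sum>wd<Kd. \<Sum>wu<Ku. \<integral>\<^sup>+y. indicator (succ wd wu) (Yinv wd wu y) *
        (\<Prod>i\<in>I. ennreal (cgauss_density (\<sigma> i) (y i - \<mu> wd i y))) \<partial>lborel_PiM I)
      \<le> ennreal (real Kd * real Ku / (real Kd * real Ku))"
      unfolding sum_F
      using K_pos by simp
  qed
qed

text \<open>The uplink message is given away: the means \<open>c\<close> may depend on
  \<open>wu\<close>, so the interference can be subtracted at no cost. For each \<open>wu\<close>
  the decoding sets of the downlink messages are disjoint over M2's outputs.\<close>

lemma downlink_bound:
  fixes \<sigma> :: "nat \<times> nat \<times> nat \<Rightarrow> real" and B \<epsilon> :: real and c :: "nat \<Rightarrow> nat \<times> nat \<times> nat \<Rightarrow> complex"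
  assumes B: "0 \<le> B" and \<sigma>: "\<And>i. i \<in> I \<Longrightarrow> var i \<le> \<sigma> i"
    and main: "\<And>k wd wu t j \<omega>. k < 2 \<Longrightarrow> wd < Kd \<Longrightarrow> wu < Ku \<Longrightarrow> (k, t, j) \<in> I \<Longrightarrow>
      (cmod (Y wd wu \<omega> (k, t, j) - c wu (k, t, j)))\<^sup>2 \<le> \<sigma> (k, t, j) * (B * main_energy wd wu t \<omega>)"
    and side: "\<And>wd wu t j \<omega>. wd < Kd \<Longrightarrow> wu < Ku \<Longrightarrow> (2, t, j) \<in> I \<Longrightarrow>
      (cmod (Y wd wu \<omega> (2, t, j) - c wu (2, t, j)))\<^sup>2 \<le> \<sigma> (2, t, j) * (B * side_energy wu t \<omega>)"
    and err: "error_prob N n Kd Ku xul xs fdl gul gdl \<le> \<epsilon>"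
  shows "(1 - \<epsilon>) * ln (real Kd) \<le> 1 + (\<Sum>i\<in>I. ln (\<sigma> i / var i)) + B * energy_const * (real n + real (side_len N n))"
proof (rule information_bound_energy[where \<mu> = "\<lambda>wd wu i y. c wu i", OF _ B \<sigma> _ _ _ main side err])
  define J where "J = {i \<in> I. fst i \<noteq> 0}"
  define K where "K = {i \<in> I. fst i = 0}"
  have JK: "J \<union> K = I" "J \<inter> K = {}" "finite J" "finite K"
    using finite_I by (auto simp: J_def K_def)
  have \<sigma>_pos: "0 < \<sigma> i" if "i \<in> I" for i using var_pos[OF that] \<sigma>[OF that] by simp
  show "1 \<le> real Kd" using K_pos by simp
  have sections: "(\<Sum>wd\<in>A. \<integral>\<^sup>+y. F wd y * (\<Prod>i\<in>I. ennreal (cgauss_density (\<sigma> i) (y i - c wu i))) \<partial>lborel_PiM I) \<le> 1"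
    if "finite A" "\<And>wd. wd \<in> A \<Longrightarrow> F wd \<in> borel_measurable (lborel_PiM I)" "\<And>wd y. wd \<in> A \<Longrightarrow> F wd y \<le> (1 :: ennreal)"
      "\<And>a b x y. a \<in> A \<Longrightarrow> b \<in> A \<Longrightarrow> (\<And>j. j \<in> J \<Longrightarrow> x j = y j) \<Longrightarrow> F a x \<noteq> 0 \<Longrightarrow> F b y \<noteq> 0 \<Longrightarrow> a = b"
    for A :: "nat set" and F wu
  proof (rule sum_nn_integral_disjoint_sections_le[of A J K \<sigma> F "\<lambda>_ i _. c wu i" "\<lambda>_. 0", unfolded JK(1)])
    show "a = b" if "a \<in> A" "b \<in> A" "\<And>j. j \<in> J \<Longrightarrow> x j = y j" "F a x \<noteq> 0" "F b y \<noteq> 0" for a b x y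
      using \<open>\<And>a b x y. a \<in> A \<Longrightarrow> b \<in> A \<Longrightarrow> (\<And>j. j \<in> J \<Longrightarrow> x j = y j) \<Longrightarrow> F a x \<noteq> 0 \<Longrightarrow> F b y \<noteq> 0 \<Longrightarrow> a = b\<close>[OF that] .
  qed (fact JK that \<sigma>_pos | simp)+
  show "(\<integral>\<^sup>+y. (\<Prod>i\<in>I. ennreal (cgauss_density (\<sigma> i) (y i - c wu i))) \<partial>lborel_PiM I) \<le> 1" for wu
    using sections[of "{0}" "\<lambda>_ _. 1" wu] by simp
  have one: "(\<Sum>wd<Kd. \<integral>\<^sup>+y. indicator (succ wd wu) (Yinv wd wu y) *
      (\<Prod>i\<in>I. ennreal (cgauss_density (\<sigma> i) (y i - c wu i))) \<partial>lborel_PiM I) \<le> 1" if "wu < Ku" for wu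
  proof (rule sections[of "{..<Kd}" "\<lambda>wd y. indicator (succ wd wu) (Yinv wd wu y)" wu])
    show "a = b" if "\<And>j. j \<in> J \<Longrightarrow> x j = y j" "indicator (succ a wu) (Yinv a wu x) \<noteq> (0 :: ennreal)"
      "indicator (succ b wu) (Yinv b wu y) \<noteq> (0 :: ennreal)" for a b x y
    proof -
      have "gdl (YD x) (YS x) = a" "gdl (YD y) (YS y) = b"
        using that(2,3) succ_Yinv(2)[of a wu x] succ_Yinv(2)[of b wu y] by (simp_all add: indicator_eq_0_iff)
      moreover have "YD x = YD y" "YS x = YS y"
        using that(1) by (auto simp: J_def intro: YD_cong YS_cong)
      ultimately show ?thesis by simp
    qed
  qed (simp_all add: indicator_succ_measurable that indicator_le_1_ennreal)
  have "(\<Sum>wd<Kd. \<Sum>wu<Ku. \<integral>\<^sup>+y. indicator (succ wd wu) (Yinv wd wu y) *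
      (\<Prod>i\<in>I. ennreal (cgauss_density (\<sigma> i) (y i - c wu i))) \<partial>lborel_PiM I) \<le> (\<Sum>wu<Ku. 1)"
    by (subst sum.swap) (intro sum_mono one, simp)
  also have "\<dots> = ennreal (real Kd * real Ku / real Kd)"
    using K_pos by (simp add: ennreal_of_nat_eq_real_of_nat)
  finally show "(\<Sum>wd<Kd. \<Sum>wu<Ku. \<integral>\<^sup>+y. indicator (succ wd wu) (Yinv wd wu y) *
      (\<Prod>i\<in>I. ennreal (cgauss_density (\<sigma> i) (y i - c wu i))) \<partial>lborel_PiM I) \<le> ennreal (real Kd * real Ku / real Kd)" .
qed (assumption | rule borel_measurable_const)+

text \<open>The downlink message is given away. M2's outputs come last and have their true
  conditional law: mean \<open>sig\<close>, which may read the uplink outputs, and variance equal to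
  that of the noise. They contribute nothing to the log-ratio, and the conditions on
  \<open>B\<close> let their noise count as an admissible residual.\<close>

lemma uplink_bound:
  fixes \<sigma> :: "nat \<times> nat \<times> nat \<Rightarrow> real" and B \<epsilon> :: real and r :: "nat \<times> nat \<times> nat \<Rightarrow> nat"
    and \<nu> :: "nat \<times> nat \<times> nat \<Rightarrow> (nat \<times> nat \<times> nat \<Rightarrow> complex) \<Rightarrow> complex"
  assumes B: "0 \<le> B" and \<sigma>: "\<And>i. i \<in> I \<Longrightarrow> var i \<le> \<sigma> i"
    and \<sigma>_noise: "\<And>i. i \<in> I \<Longrightarrow> fst i \<noteq> 0 \<Longrightarrow> \<sigma> i = var i" and B1: "1 \<le> B" "1 \<le> B * Wr N \<or> Wr N = 0"
    and \<nu>_meas: "\<And>i. i \<in> I \<Longrightarrow> fst i = 0 \<Longrightarrow> \<nu> i \<in> borel_measurable (lborel_PiM I)"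
    and \<nu>_ul: "\<And>i x y. i \<in> I \<Longrightarrow> fst i = 0 \<Longrightarrow> (\<And>j. j \<in> I \<Longrightarrow> fst j = 0 \<Longrightarrow> r j < r i \<Longrightarrow> x j = y j) \<Longrightarrow> \<nu> i x = \<nu> i y"
    and main: "\<And>wd wu t j \<omega>. wd < Kd \<Longrightarrow> wu < Ku \<Longrightarrow> (0, t, j) \<in> I \<Longrightarrow>
      (cmod (Y wd wu \<omega> (0, t, j) - \<nu> (0, t, j) (Y wd wu \<omega>)))\<^sup>2 \<le> \<sigma> (0, t, j) * (B * main_energy wd wu t \<omega>)"
    and err: "error_prob N n Kd Ku xul xs fdl gul gdl \<le> \<epsilon>"
  shows "(1 - \<epsilon>) * ln (real Ku) \<le> 1 + (\<Sum>i\<in>I. ln (\<sigma> i / var i)) + B * energy_const * (real n + real (side_len N n))"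
proof -
  define \<mu> where "\<mu> wd wu i y = (if fst i = 0 then \<nu> i y else sig wd wu y i)" for wd wu i y
  define J where "J = {i \<in> I. fst i = 0}"
  define K where "K = {i \<in> I. fst i \<noteq> 0}"
  have JK: "J \<union> K = I" "J \<inter> K = {}" "finite J" "finite K"
    using finite_I by (auto simp: J_def K_def)
  have \<sigma>_pos: "0 < \<sigma> i" if "i \<in> I" for i using var_pos[OF that] \<sigma>[OF that] by simp
  have \<mu>_meas: "\<mu> wd wu i \<in> borel_measurable (lborel_PiM I)" if "wd < Kd" "i \<in> I" for wd wu i
    unfolding \<mu>_def using \<nu>_meas[OF that(2)] sig_measurable[OF that] by (cases "fst i = 0") simp_all
  have sections: "(\<Sum>wu\<in>A. \<integral>\<^sup>+y. F wu y * (\<Prod>i\<in>I. ennreal (cgauss_density (\<sigma> i) (y i - \<mu> wd wu i y))) \<partial>lborel_PiM I) \<le> 1"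
    if wd: "wd < Kd" and "finite A" "\<And>wu. wu \<in> A \<Longrightarrow> F wu \<in> borel_measurable (lborel_PiM I)" "\<And>wu y. wu \<in> A \<Longrightarrow> F wu y \<le> (1 :: ennreal)"
      "\<And>a b x y. a \<in> A \<Longrightarrow> b \<in> A \<Longrightarrow> (\<And>j. j \<in> J \<Longrightarrow> x j = y j) \<Longrightarrow> F a x \<noteq> 0 \<Longrightarrow> F b y \<noteq> 0 \<Longrightarrow> a = b"
    for A :: "nat set" and F wd
  proof (rule sum_nn_integral_disjoint_sections_le[of A J K \<sigma> F "\<mu> wd" r, unfolded JK(1)])
    show "\<mu> wd a i x = \<mu> wd b i y" if "i \<in> J" "\<And>j. j \<in> J \<Longrightarrow> r j < r i \<Longrightarrow> x j = y j" for a b i x y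
      using that \<nu>_ul[of i x y] by (simp add: J_def \<mu>_def)
    show "\<mu> wd a i x = \<mu> wd a i y" if "i \<in> K" "\<And>j. j \<in> J \<Longrightarrow> x j = y j" for a i x y
    proof -
      have "sig wd a x = sig wd a y" using that(2) by (intro sig_cong) (auto simp: J_def idx_iff)
      then show ?thesis using that(1) by (simp add: K_def \<mu>_def)
    qed
    show "\<mu> wd a i \<in> borel_measurable (lborel_PiM I)" if "i \<in> I" for a i
      using that wd by (rule \<mu>_meas[rotated])
    show "a = b" if "a \<in> A" "b \<in> A" "\<And>j. j \<in> J \<Longrightarrow> x j = y j" "F a x \<noteq> 0" "F b y \<noteq> 0" for a b x y
      using \<open>\<And>a b x y. a \<in> A \<Longrightarrow> b \<in> A \<Longrightarrow> (\<And>j. j \<in> J \<Longrightarrow> x j = y j) \<Longrightarrow> F a x \<noteq> 0 \<Longrightarrow> F b y \<noteq> 0 \<Longrightarrow> a = b\<close>[OF that] .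
  qed (fact JK that \<sigma>_pos)+
  have noise_res: "Y wd wu \<omega> i - \<mu> wd wu i (Y wd wu \<omega>) = \<omega> i" if "i \<in> I" "fst i \<noteq> 0" for wd wu \<omega> i
    using Y_eq[OF that(1)] that(2) by (simp add: \<mu>_def)
  show ?thesis
  proof (rule information_bound_energy[OF _ B \<sigma> \<mu>_meas _ _ _ _ err])
    show "1 \<le> real Ku" using K_pos by simp
    show "(\<integral>\<^sup>+y. (\<Prod>i\<in>I. ennreal (cgauss_density (\<sigma> i) (y i - \<mu> wd wu i y))) \<partial>lborel_PiM I) \<le> 1" if "wd < Kd" for wd wu
      using sections[OF that, of "{wu}" "\<lambda>_ _. 1"] by simp
    have one: "(\<Sum>wu<Ku. \<integral>\<^sup>+y. indicator (succ wd wu) (Yinv wd wu y) *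
        (\<Prod>i\<in>I. ennreal (cgauss_density (\<sigma> i) (y i - \<mu> wd wu i y))) \<partial>lborel_PiM I) \<le> 1" if "wd < Kd" for wd
    proof (rule sections[OF that, of "{..<Ku}" "\<lambda>wu y. indicator (succ wd wu) (Yinv wd wu y)"])
      show "a = b" if "\<And>j. j \<in> J \<Longrightarrow> x j = y j" "indicator (succ wd a) (Yinv wd a x) \<noteq> (0 :: ennreal)"
        "indicator (succ wd b) (Yinv wd b y) \<noteq> (0 :: ennreal)" for a b x y
      proof -
        have "gul wd (YU x) = a" "gul wd (YU y) = b"
          using that(2,3) succ_Yinv(1)[of wd a x] succ_Yinv(1)[of wd b y] by (simp_all add: indicator_eq_0_iff)
        moreover have "YU x = YU y"
          using that(1) by (auto simp: J_def intro: YU_cong)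
        ultimately show ?thesis by simp
      qed
    qed (simp_all add: indicator_succ_measurable that indicator_le_1_ennreal)
    have "(\<Sum>wd<Kd. \<Sum>wu<Ku. \<integral>\<^sup>+y. indicator (succ wd wu) (Yinv wd wu y) *
        (\<Prod>i\<in>I. ennreal (cgauss_density (\<sigma> i) (y i - \<mu> wd wu i y))) \<partial>lborel_PiM I) \<le> (\<Sum>wd<Kd. 1)"
      by (intro sum_mono one) simp
    also have "\<dots> = ennreal (real Kd * real Ku / real Ku)"
      using K_pos by (simp add: ennreal_of_nat_eq_real_of_nat)
    finally show "(\<Sum>wd<Kd. \<Sum>wu<Ku. \<integral>\<^sup>+y. indicator (succ wd wu) (Yinv wd wu y) *
        (\<Prod>i\<in>I. ennreal (cgauss_density (\<sigma> i) (y i - \<mu> wd wu i y))) \<partial>lborel_PiM I) \<le> ennreal (real Kd * real Ku / real Ku)" .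
  next
    fix k wd wu t j and \<omega> :: "nat \<times> nat \<times> nat \<Rightarrow> complex" assume w: "k < (2 :: nat)" "wd < Kd" "wu < Ku" "(k, t, j) \<in> I"
    show "(cmod (Y wd wu \<omega> (k, t, j) - \<mu> wd wu (k, t, j) (Y wd wu \<omega>)))\<^sup>2 \<le> \<sigma> (k, t, j) * (B * main_energy wd wu t \<omega>)"
    proof (cases "k = 0")
      case True
      then show ?thesis using main[of wd wu t j \<omega>] w by (simp add: \<mu>_def)
    next
      case False
      then have "k = 1" using w(1) by simp
      with w(4) have k: "k = 1" "j < n_Ndl N" by (simp_all add: idx_iff)
      have "(cmod (\<omega> (1, t, j)))\<^sup>2 \<le> (\<Sum>j<n_Ndl N. (cmod (\<omega> (1, t, j)))\<^sup>2)"
        using k(2) by (intro member_le_sum) auto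
      also have "\<dots> \<le> main_energy wd wu t \<omega>"
        unfolding main_energy_def using sqnorm_nonneg by (simp add: sum_nonneg)
      also have "\<dots> \<le> B * main_energy wd wu t \<omega>"
        using mult_right_mono[OF B1(1) main_energy_nonneg[of wd wu t \<omega>]] by simp
      finally show ?thesis
        using noise_res[OF w(4)] \<sigma>_noise[OF w(4)] k by (simp add: var_def)
    qed
  next
    fix wd wu t j and \<omega> :: "nat \<times> nat \<times> nat \<Rightarrow> complex" assume w: "wd < Kd" "wu < Ku" "(2, t, j) \<in> I"
    have j: "j < n_Ndl N" using w(3) by (simp add: idx_iff)
    have W: "1 \<le> B * Wr N" using B1(2) var_pos[OF w(3)] by (simp add: var_def)
    have "(cmod (\<omega> (2, t, j)))\<^sup>2 \<le> (\<Sum>j<n_Ndl N. (cmod (\<omega> (2, t, j)))\<^sup>2)"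
      using j by (intro member_le_sum) auto
    also have "\<dots> \<le> side_energy wu t \<omega>"
      unfolding side_energy_def using sqnorm_nonneg by simp
    also have "\<dots> \<le> (B * Wr N) * side_energy wu t \<omega>"
      using mult_right_mono[OF W side_energy_nonneg[of wu t \<omega>]] by simp
    finally show "(cmod (Y wd wu \<omega> (2, t, j) - \<mu> wd wu (2, t, j) (Y wd wu \<omega>)))\<^sup>2 \<le> \<sigma> (2, t, j) * (B * side_energy wu t \<omega>)"
      using noise_res[OF w(3)] \<sigma>_noise[OF w(3)] by (simp add: var_def ac_simps)
  qed
qed

end

lemma inverse_pair_row:
  assumes "inverse_pair k A B" "j < k"
  shows "(\<Sum>l<k. (\<Sum>p<k. x p * B p l) * A l j) = x j"
proof -
  have "(\<Sum>l<k. (\<Sum>p<k. x p * B p l) * A l j) = (\<Sum>l<k. \<Sum>p<k. x p * (B p l * A l j))"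
    by (simp add: sum_distrib_right mult.assoc)
  also have "\<dots> = (\<Sum>p<k. x p * (\<Sum>l<k. B p l * A l j))"
    by (subst sum.swap) (simp add: sum_distrib_left)
  also have "\<dots> = (\<Sum>p<k. x p * (if p = j then 1 else 0))"
    using assms by (intro sum.cong) (auto simp: inverse_pair_def)
  also have "\<dots> = x j" using assms(2) by (simp add: if_distrib cong: if_cong)
  finally show ?thesis .
qed

lemma cmod_sum_le:
  assumes "\<And>j. j < k \<Longrightarrow> cmod (x j) \<le> r"
  shows "cmod (\<Sum>j<k. a j * x j) \<le> (\<Sum>j<(k::nat). cmod (a j)) * r"
proof -
  have "cmod (\<Sum>j<k. a j * x j) \<le> (\<Sum>j<k. cmod (a j * x j))" by (rule norm_sum)
  also have "\<dots> \<le> (\<Sum>j<k. cmod (a j) * r)"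
    using assms by (intro sum_mono) (auto simp: norm_mult intro: mult_left_mono)
  finally show ?thesis by (simp add: sum_distrib_right)
qed

lemma cmod_le_sqrt_sum:
  assumes "j < k" "(\<Sum>j<k. (cmod (x j))\<^sup>2) \<le> E"
  shows "cmod (x (j::nat)) \<le> sqrt E"
proof -
  have "(cmod (x j))\<^sup>2 \<le> (\<Sum>j<k. (cmod (x j))\<^sup>2)" using assms(1) by (intro member_le_sum) auto
  then show ?thesis using assms(2) by (intro real_le_rsqrt) simp
qed

text \<open>A linear dependence between signals passes to the outputs up to noise. This is why
  receive antennas beyond the rank of the transmitted signal contribute only bounded terms.\<close>

lemma combination_residual:
  fixes y s w :: "nat \<Rightarrow> complex"
  assumes "y i = s i + w i" "\<And>l. l < m \<Longrightarrow> y l = s l + w l" "s i = (\<Sum>l<m. a l * s l)"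
  shows "y i - (\<Sum>l<m. a l * y l) = w i - (\<Sum>l<m. a l * w l)"
proof -
  have "(\<Sum>l<m. a l * y l) = (\<Sum>l<m. a l * s l + a l * w l)"
    by (intro sum.cong) (auto simp: assms(2) distrib_left)
  then show ?thesis by (simp add: assms(1,3) sum.distrib)
qed

section \<open>Converse\<close>

text \<open>\<open>V\<close> inverts the top \<open>min Mul Ndl\<close> rows of the interference matrix completed by uplink
  rows: with respect to it the uplink signal splits into streams seen by the downlink receiver, one per
  top row, and streams invisible to it.\<close>

locale channel =
  fixes Mdl Nul Mul Ndl :: nat and wm W lam aI aS :: real
    and h :: "nat \<times> nat \<times> nat \<Rightarrow> complex" and V U S D :: "nat \<Rightarrow> nat \<Rightarrow> complex"
  assumes dims: "Mul \<le> Mdl" "Ndl \<le> Mdl" "Mul \<le> Nul" "Ndl \<le> Nul" "1 \<le> Mul" "1 \<le> Ndl"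
    and params: "0 < lam" "lam < 1" "0 < wm" "0 \<le> W" "0 \<le> aI" "0 \<le> aS"
    and V: "inverse_pair Mul (\<lambda>i j. if i < min Mul Ndl then h (2, i, j) else h (1, i - min Mul Ndl, j)) V"
    and U: "inverse_pair Mul (\<lambda>i j. h (1, i, j)) U"
    and S: "inverse_pair (min Mul Ndl) (\<lambda>i j. h (3, i, j)) S"
    and D: "inverse_pair Ndl (\<lambda>i j. h (0, i, j)) D"
begin

definition m :: nat where "m = min Mul Ndl"

definition net :: "real \<Rightarrow> fdnet" where
  "net \<rho> = net_at Mdl Nul Mul Ndl wm W lam aI aS h \<rho>"

lemma net_simps [simp]:
  "n_Mdl (net \<rho>) = Mdl" "n_Nul (net \<rho>) = Nul" "n_Mul (net \<rho>) = Mul" "n_Ndl (net \<rho>) = Ndl"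
  "Wm (net \<rho>) = wm" "Wr (net \<rho>) = W" "fdnet.lam (net \<rho>) = lam"
  "H_dl (net \<rho>) i j = h (0, i, j)" "H_ul (net \<rho>) i j = h (1, i, j)"
  "H_I (net \<rho>) i j = h (2, i, j)" "H_S (net \<rho>) i j = h (3, i, j)"
  "snr_dl (net \<rho>) = \<rho>" "snr_ul (net \<rho>) = \<rho>" "snr_I (net \<rho>) = \<rho> powr aI" "snr_S (net \<rho>) = \<rho> powr aS"
  by (simp_all add: net_def net_at_def)

lemma m_le: "m \<le> Mul" "m \<le> Ndl" "m \<le> Nul" "1 \<le> m"
  using dims by (auto simp: m_def)

text \<open>Coordinates of channel rows with respect to the inverted blocks: interference and uplink
  rows in the mixed basis of \<open>V\<close>, side-channel rows in the basis of \<open>S\<close>,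
  uplink rows in the basis of \<open>U\<close>.\<close>

definition coef_I :: "nat \<Rightarrow> nat \<Rightarrow> complex" where "coef_I i l = (\<Sum>p<Mul. h (2, i, p) * V p l)"
definition coef_S :: "nat \<Rightarrow> nat \<Rightarrow> complex" where "coef_S i l = (\<Sum>p<m. h (3, i, p) * S p l)"
definition coef_V :: "nat \<Rightarrow> nat \<Rightarrow> complex" where "coef_V i l = (\<Sum>p<Mul. h (1, i, p) * V p l)"
definition coef_U :: "nat \<Rightarrow> nat \<Rightarrow> complex" where "coef_U i l = (\<Sum>p<Mul. h (1, i, p) * U p l)"

text \<open>Rows beyond \<open>m\<close> exist only if \<open>m = Mul\<close>. In that case the top
  \<open>m\<close> interference rows are a full basis of the row space.\<close>

lemma row_I:
  assumes "m \<le> i" "i < Ndl" "k < Mul"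
  shows "h (2, i, k) = (\<Sum>l<m. coef_I i l * h (2, l, k))"
proof -
  have mM: "m = Mul" using assms(1,2) by (auto simp: m_def)
  show ?thesis
    using inverse_pair_row[OF V assms(3), of "\<lambda>p. h (2, i, p)"] mM
    by (simp add: coef_I_def m_def[symmetric])
qed

lemma row_S:
  assumes "m \<le> i" "i < Ndl" "k < Mul"
  shows "h (3, i, k) = (\<Sum>l<m. coef_S i l * h (3, l, k))"
proof -
  have mM: "m = Mul" using assms(1,2) by (auto simp: m_def)
  show ?thesis
    using inverse_pair_row[OF S, of k "\<lambda>p. h (3, i, p)"] mM assms(3)
    by (simp add: coef_S_def m_def[symmetric])
qed

lemma row_U: "k < Mul \<Longrightarrow> h (1, i, k) = (\<Sum>l<Mul. coef_U i l * h (1, l, k))"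
  using inverse_pair_row[OF U, of k "\<lambda>p. h (1, i, p)"] by (simp add: coef_U_def)

text \<open>The linear algebra behind the sum bound: an uplink output is determined, up to noise, by
  \<open>m\<close> interference signals at M2 and the first \<open>Mul - m\<close> uplink
  signals.\<close>

lemma row_V:
  assumes "k < Mul"
  shows "h (1, i, k) = (\<Sum>l<m. coef_V i l * h (2, l, k)) + (\<Sum>l<Mul - m. coef_V i (m + l) * h (1, l, k))"
proof -
  let ?f = "\<lambda>l. coef_V i l * (if l < m then h (2, l, k) else h (1, l - m, k))"
  have "h (1, i, k) = (\<Sum>l<m + (Mul - m). ?f l)"
    using inverse_pair_row[OF V[folded m_def] assms, of "\<lambda>p. h (1, i, p)"] m_le by (simp add: coef_V_def)
  also have "\<dots> = (\<Sum>l<m. ?f l) + (\<Sum>l<Mul - m. ?f (m + l))"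
    by (simp add: lessThan_atLeast0 sum.atLeastLessThan_concat[of 0 m "m + (Mul - m)", symmetric]
        sum.atLeastLessThan_shift_0[of _ m "m + (Mul - m)"] add.commute)
  finally show ?thesis by simp
qed

definition row_norm :: "nat \<Rightarrow> nat \<Rightarrow> nat \<Rightarrow> real" where
  "row_norm k i q = (\<Sum>j<q. cmod (h (k, i, j)))"

text \<open>Row-wise constants that dominate the coefficients of every residual estimate for uplink,
  downlink and side-channel outputs respectively. They depend on the channel matrices but not on the
  SNR.\<close>

definition R0 :: "nat \<Rightarrow> real" where
  "R0 i = 1 + row_norm 1 i Mul + ((\<Sum>l<m. cmod (coef_V i l)) + (\<Sum>l<Mul - m. cmod (coef_V i (m + l)))) + (\<Sum>l<Mul. cmod (coef_U i l))"
definition R1 :: "nat \<Rightarrow> real" where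
  "R1 i = 1 + row_norm 0 i Mdl + row_norm 2 i Mul + (\<Sum>l<m. cmod (coef_I i l) * (1 + row_norm 0 l Mdl))"
definition R2 :: "nat \<Rightarrow> real" where
  "R2 i = 1 + row_norm 3 i Mul + (\<Sum>l<m. cmod (coef_S i l))"
definition A :: real where
  "A = 1 + (\<Sum>i<Nul. R0 i) + (\<Sum>i<Ndl. R1 i) + (\<Sum>i<Ndl. R2 i)"
text \<open>The second summand compensates the side-channel noise variance \<open>W\<close>, by
  which reference variances there are scaled. For \<open>W = 0\<close> it is 0 by the convention for
  division, and no side-channel output exists.\<close>

definition B :: real where "B = A\<^sup>2 + A\<^sup>2 / W"

lemma row_norm_nonneg: "0 \<le> row_norm k i q"
  unfolding row_norm_def by (intro sum_nonneg) simp

lemma R_ge_1: "1 \<le> R0 i" "1 \<le> R1 i" "1 \<le> R2 i"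
  unfolding R0_def R1_def R2_def using row_norm_nonneg
  by (auto intro!: add_nonneg_nonneg sum_nonneg mult_nonneg_nonneg simp: add.assoc)

lemma R_le_A:
  "i < Nul \<Longrightarrow> R0 i \<le> A" "i < Ndl \<Longrightarrow> R1 i \<le> A" "i < Ndl \<Longrightarrow> R2 i \<le> A"
proof -
  have nn: "0 \<le> R0 i" "0 \<le> R1 i" "0 \<le> R2 i" for i
    using R_ge_1[of i] by linarith+
  have s: "0 \<le> (\<Sum>i<Nul. R0 i)" "0 \<le> (\<Sum>i<Ndl. R1 i)" "0 \<le> (\<Sum>i<Ndl. R2 i)"
    using nn by (auto intro: sum_nonneg)
  show "R0 i \<le> A" if "i < Nul"
    using member_le_sum[of i "{..<Nul}" R0] nn s that unfolding A_def by simp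
  show "R1 i \<le> A" if "i < Ndl"
    using member_le_sum[of i "{..<Ndl}" R1] nn s that unfolding A_def by simp
  show "R2 i \<le> A" if "i < Ndl"
    using member_le_sum[of i "{..<Ndl}" R2] nn s that unfolding A_def by simp
qed

lemma A_ge_1: "1 \<le> A"
proof -
  have nn: "0 \<le> R0 i" "0 \<le> R1 i" "0 \<le> R2 i" for i
    using R_ge_1[of i] by linarith+
  then have s: "0 \<le> (\<Sum>i<Nul. R0 i)" "0 \<le> (\<Sum>i<Ndl. R1 i)" "0 \<le> (\<Sum>i<Ndl. R2 i)"
    by (auto intro: sum_nonneg)
  then show ?thesis unfolding A_def by linarith
qed

lemma B_props: "0 \<le> B" "1 \<le> B" "1 \<le> B * W \<or> W = 0"
proof -
  have "1 \<le> A\<^sup>2" using A_ge_1 by (simp add: one_le_power)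
  moreover have "0 \<le> A\<^sup>2 / W" using params by simp
  ultimately show "0 \<le> B" "1 \<le> B" unfolding B_def by linarith+
  show "1 \<le> B * W \<or> W = 0"
  proof (cases "W = 0")
    case False
    then have "B * W = A\<^sup>2 * W + A\<^sup>2" by (simp add: B_def field_simps)
    then show ?thesis using \<open>1 \<le> A\<^sup>2\<close> params by (simp add: add_increasing)
  qed simp
qed

lemma square_bound:
  assumes "cmod e \<le> sqrt \<sigma> * R * sqrt E" "0 \<le> \<sigma>" "0 \<le> R" "R \<le> A" "0 \<le> E"
  shows "(cmod e)\<^sup>2 \<le> \<sigma> * (B * E)"
proof -
  have "(cmod e)\<^sup>2 \<le> (sqrt \<sigma> * R * sqrt E)\<^sup>2"
    using assms by (intro power_mono) auto
  also have "\<dots> = \<sigma> * (R\<^sup>2 * E)" using assms by (simp add: power_mult_distrib)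
  also have "\<dots> \<le> \<sigma> * (B * E)"
  proof (intro mult_left_mono mult_right_mono)
    have "R\<^sup>2 \<le> A\<^sup>2" using assms by (intro power_mono) auto
    then show "R\<^sup>2 \<le> B" unfolding B_def using params by (simp add: add_increasing2)
  qed (use assms in auto)
  finally show ?thesis .
qed

lemma square_bound_side:
  assumes "cmod e \<le> sqrt \<sigma> * R * sqrt E" "0 \<le> \<sigma>" "0 \<le> R" "R \<le> A" "0 \<le> E" "0 < W"
  shows "(cmod e)\<^sup>2 \<le> (W * \<sigma>) * (B * E)"
proof -
  have "(cmod e)\<^sup>2 \<le> (sqrt \<sigma> * R * sqrt E)\<^sup>2"
    using assms by (intro power_mono) auto
  also have "\<dots> = \<sigma> * (R\<^sup>2 * E)" using assms by (simp add: power_mult_distrib)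
  also have "\<dots> \<le> \<sigma> * ((W * B) * E)"
  proof (intro mult_left_mono mult_right_mono)
    have "R\<^sup>2 \<le> A\<^sup>2" using assms by (intro power_mono) auto
    moreover have "W * B = W * A\<^sup>2 + A\<^sup>2" using assms by (simp add: B_def field_simps)
    ultimately show "R\<^sup>2 \<le> W * B" using assms by (simp add: add_increasing)
  qed (use assms in auto)
  finally show ?thesis by (simp add: ac_simps)
qed

end

section \<open>Residuals of the outputs after cancellation\<close>

lemma combination_rows:
  fixes a x :: "nat \<Rightarrow> complex"
  assumes "\<And>q. q < k \<Longrightarrow> a q = (\<Sum>l<p. c l * b l q)"
  shows "(\<Sum>q<k. a q * x q) = (\<Sum>l<p. c l * (\<Sum>q<k. b l q * x q))"
proof -
  have "(\<Sum>q<k. a q * x q) = (\<Sum>q<k. \<Sum>l<p. c l * b l q * x q)"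
    using assms by (intro sum.cong) (auto simp: sum_distrib_right)
  also have "\<dots> = (\<Sum>l<p. \<Sum>q<k. c l * b l q * x q)" by (rule sum.swap)
  finally show ?thesis by (simp add: sum_distrib_left mult.assoc)
qed

lemma combination_rows2:
  fixes a x :: "nat \<Rightarrow> complex"
  assumes "\<And>q. q < k \<Longrightarrow> a q = (\<Sum>l<p. c l * b l q) + (\<Sum>l<p'. c' l * b' l q)"
  shows "(\<Sum>q<k. a q * x q) = (\<Sum>l<p. c l * (\<Sum>q<k. b l q * x q)) + (\<Sum>l<p'. c' l * (\<Sum>q<k. b' l q * x q))"
proof -
  have "(\<Sum>q<k. a q * x q) = (\<Sum>q<k. (\<Sum>l<p. c l * b l q) * x q + (\<Sum>l<p'. c' l * b' l q) * x q)"
    using assms by (intro sum.cong) (auto simp: distrib_right)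
  also have "\<dots> = (\<Sum>q<k. (\<Sum>l<p. c l * b l q) * x q) + (\<Sum>q<k. (\<Sum>l<p'. c' l * b' l q) * x q)"
    by (rule sum.distrib)
  finally show ?thesis
    using combination_rows[of k "\<lambda>q. \<Sum>l<p. c l * b l q" c b p x]
      combination_rows[of k "\<lambda>q. \<Sum>l<p'. c' l * b' l q" c' b' p' x] by simp
qed

locale channel_code = channel Mdl Nul Mul Ndl wm W lam aI aS h V U S D +
  C: network_code "net \<rho>" n Kd Ku xul xs fdl gul gdl
  for Mdl Nul Mul Ndl :: nat and wm W lam aI aS :: real and h V U S D
    and \<rho> :: real and n Kd Ku xul xs fdl gul gdl +
  assumes \<rho>: "1 < \<rho>"
begin

abbreviation "xdl wd wu \<omega> t q \<equiv> x_dl (fdl wd) (y_ul (net \<rho>) n (xul wu) \<omega>) t q"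
abbreviation "sx \<equiv> complex_of_real (sqrt ((1 - lam) * \<rho>))"
abbreviation "sI \<equiv> complex_of_real (sqrt ((1 - lam) * \<rho> powr aI))"
abbreviation "sS \<equiv> complex_of_real (sqrt (lam * \<rho> powr aS))"
abbreviation "sd \<equiv> complex_of_real (sqrt \<rho>)"

lemma Y0:
  "t < n \<Longrightarrow> i < Nul \<Longrightarrow> C.Y wd wu \<omega> (0, t, i) = sx * (\<Sum>q<Mul. h (1, i, q) * xul wu t q) + \<omega> (0, t, i)"
  by (subst C.Y_eq) (simp_all add: C.idx_iff C.sig_def)

lemma Y1:
  "t < n \<Longrightarrow> i < Ndl \<Longrightarrow> C.Y wd wu \<omega> (1, t, i) = sd * (\<Sum>q<Mdl. h (0, i, q) * xdl wd wu \<omega> t q)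
     + sI * (\<Sum>q<Mul. h (2, i, q) * xul wu t q) + \<omega> (1, t, i)"
  by (subst C.Y_eq) (simp_all add: C.idx_iff C.sig_def C.YU_Y)

lemma Y2:
  "t < side_len (net \<rho>) n \<Longrightarrow> i < Ndl \<Longrightarrow> C.Y wd wu \<omega> (2, t, i) = sS * (\<Sum>q<Mul. h (3, i, q) * xs wu t q) + \<omega> (2, t, i)"
  by (subst C.Y_eq) (simp_all add: C.idx_iff C.sig_def)

lemma energy_main:
  "q < Mdl \<Longrightarrow> cmod (xdl wd wu \<omega> t q) \<le> sqrt (C.main_energy wd wu t \<omega>)"
  "q < Mul \<Longrightarrow> cmod (xul wu t q) \<le> sqrt (C.main_energy wd wu t \<omega>)"
  "j < Nul \<Longrightarrow> cmod (\<omega> (0, t, j)) \<le> sqrt (C.main_energy wd wu t \<omega>)"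
  "j < Ndl \<Longrightarrow> cmod (\<omega> (1, t, j)) \<le> sqrt (C.main_energy wd wu t \<omega>)"
proof -
  have s: "0 \<le> (\<Sum>q<Mdl. (cmod (xdl wd wu \<omega> t q))\<^sup>2)" "0 \<le> (\<Sum>q<Mul. (cmod (xul wu t q))\<^sup>2)"
    "0 \<le> (\<Sum>j<Nul. (cmod (\<omega> (0, t, j)))\<^sup>2)" "0 \<le> (\<Sum>j<Ndl. (cmod (\<omega> (1, t, j)))\<^sup>2)"
    by (auto intro: sum_nonneg)
  show "q < Mdl \<Longrightarrow> cmod (xdl wd wu \<omega> t q) \<le> sqrt (C.main_energy wd wu t \<omega>)"
    by (erule cmod_le_sqrt_sum) (use s in \<open>simp add: C.main_energy_def sqnorm_def\<close>)
  show "q < Mul \<Longrightarrow> cmod (xul wu t q) \<le> sqrt (C.main_energy wd wu t \<omega>)"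
    by (erule cmod_le_sqrt_sum) (use s in \<open>simp add: C.main_energy_def sqnorm_def\<close>)
  show "j < Nul \<Longrightarrow> cmod (\<omega> (0, t, j)) \<le> sqrt (C.main_energy wd wu t \<omega>)"
    by (erule cmod_le_sqrt_sum[of j _ "\<lambda>j. \<omega> (0, t, j)"]) (use s in \<open>simp add: C.main_energy_def sqnorm_def\<close>)
  show "j < Ndl \<Longrightarrow> cmod (\<omega> (1, t, j)) \<le> sqrt (C.main_energy wd wu t \<omega>)"
    by (erule cmod_le_sqrt_sum[of j _ "\<lambda>j. \<omega> (1, t, j)"]) (use s in \<open>simp add: C.main_energy_def sqnorm_def\<close>)
qed

lemma energy_side:
  "q < Mul \<Longrightarrow> cmod (xs wu t q) \<le> sqrt (C.side_energy wu t \<omega>)"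
  "j < Ndl \<Longrightarrow> cmod (\<omega> (2, t, j)) \<le> sqrt (C.side_energy wu t \<omega>)"
proof -
  have s: "0 \<le> (\<Sum>q<Mul. (cmod (xs wu t q))\<^sup>2)" "0 \<le> (\<Sum>j<Ndl. (cmod (\<omega> (2, t, j)))\<^sup>2)"
    by (auto intro: sum_nonneg)
  show "q < Mul \<Longrightarrow> cmod (xs wu t q) \<le> sqrt (C.side_energy wu t \<omega>)"
    by (erule cmod_le_sqrt_sum) (use s in \<open>simp add: C.side_energy_def sqnorm_def\<close>)
  show "j < Ndl \<Longrightarrow> cmod (\<omega> (2, t, j)) \<le> sqrt (C.side_energy wu t \<omega>)"
    by (erule cmod_le_sqrt_sum[of j _ "\<lambda>j. \<omega> (2, t, j)"]) (use s in \<open>simp add: C.side_energy_def sqnorm_def\<close>)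
qed

lemma cmod_amplitudes:
  "cmod sx \<le> sqrt \<rho>" "cmod sI \<le> sqrt (\<rho> powr aI)" "cmod sS \<le> sqrt (\<rho> powr aS)" "cmod sd = sqrt \<rho>"
  using params \<rho> by (auto simp: mult_left_le_one_le)

lemma powr_ge_1: "0 \<le> x \<Longrightarrow> 1 \<le> \<rho> powr x"
  using \<rho> by (simp add: ge_one_powr_ge_zero)

lemma scaled_row_bound:
  assumes "\<And>q. q < k \<Longrightarrow> cmod (x q) \<le> E" "cmod c \<le> s" "0 \<le> E"
  shows "cmod (c * (\<Sum>q<k. h (a, i, q) * x q)) \<le> s * row_norm a i k * E"
proof -
  have "cmod (\<Sum>q<k. h (a, i, q) * x q) \<le> row_norm a i k * E"
    unfolding row_norm_def using assms(1) by (rule cmod_sum_le)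
  moreover have "0 \<le> s" using norm_ge_zero assms(2) by (rule order_trans)
  ultimately have "cmod c * cmod (\<Sum>q<k. h (a, i, q) * x q) \<le> s * (row_norm a i k * E)"
    using assms(2) by (intro mult_mono) auto
  then show ?thesis by (simp add: norm_mult mult.assoc)
qed

lemma Y0_bound:
  assumes "t < n" "i < Nul"
  shows "cmod (C.Y wd wu \<omega> (0, t, i)) \<le> sqrt \<rho> * R0 i * sqrt (C.main_energy wd wu t \<omega>)"
proof -
  let ?E = "sqrt (C.main_energy wd wu t \<omega>)"
  have E: "0 \<le> ?E" using C.main_energy_nonneg by simp
  have s1: "1 \<le> sqrt \<rho>" using \<rho> by simp
  have "cmod (C.Y wd wu \<omega> (0, t, i)) \<le> sqrt \<rho> * row_norm 1 i Mul * ?E + sqrt \<rho> * ?E"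
    unfolding Y0[OF assms]
  proof (intro order_trans[OF norm_triangle_ineq] add_mono scaled_row_bound energy_main(2) cmod_amplitudes(1) E)
    show "cmod (\<omega> (0, t, i)) \<le> sqrt \<rho> * ?E"
      using energy_main(3)[OF assms(2), of \<omega> t wd wu] mult_right_mono[OF s1 E] by simp
  qed
  also have "\<dots> = sqrt \<rho> * (1 + row_norm 1 i Mul) * ?E" by (simp add: algebra_simps)
  also have "\<dots> \<le> sqrt \<rho> * R0 i * ?E"
    unfolding R0_def using \<rho> E by (intro mult_right_mono mult_left_mono) (auto intro!: add_nonneg_nonneg sum_nonneg)
  finally show ?thesis .
qed

text \<open>For antennas from \<open>Mul\<close> on, the uplink signal is a combination of the first
  \<open>Mul\<close> ones, so only noise is left and the antenna adds no degrees of freedom.\<close>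

lemma Y0_tail:
  assumes "t < n" "i < Nul"
  shows "C.Y wd wu \<omega> (0, t, i) - (\<Sum>l<Mul. coef_U i l * C.Y wd wu \<omega> (0, t, l)) = \<omega> (0, t, i) - (\<Sum>l<Mul. coef_U i l * \<omega> (0, t, l))"
proof (rule combination_residual[of "\<lambda>i. C.Y wd wu \<omega> (0, t, i)" i "\<lambda>i. sx * (\<Sum>q<Mul. h (1, i, q) * xul wu t q)"])
  show "sx * (\<Sum>q<Mul. h (1, i, q) * xul wu t q) = (\<Sum>l<Mul. coef_U i l * (sx * (\<Sum>q<Mul. h (1, l, q) * xul wu t q)))"
    using combination_rows[of Mul "\<lambda>q. h (1, i, q)" "coef_U i" "\<lambda>l q. h (1, l, q)" Mul "xul wu t", OF row_U]
    by (simp add: sum_distrib_left mult.left_commute)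
qed (use assms dims in \<open>auto intro!: Y0[simplified]\<close>)

lemma Y0_tail_bound:
  assumes "t < n" "i < Nul"
  shows "cmod (C.Y wd wu \<omega> (0, t, i) - (\<Sum>l<Mul. coef_U i l * C.Y wd wu \<omega> (0, t, l))) \<le> sqrt 1 * R0 i * sqrt (C.main_energy wd wu t \<omega>)"
proof -
  let ?E = "sqrt (C.main_energy wd wu t \<omega>)"
  have E: "0 \<le> ?E" using C.main_energy_nonneg by simp
  have "cmod (\<omega> (0, t, i) - (\<Sum>l<Mul. coef_U i l * \<omega> (0, t, l))) \<le> ?E + (\<Sum>l<Mul. cmod (coef_U i l)) * ?E"
    using assms dims
    by (intro order_trans[OF norm_triangle_ineq4] add_mono cmod_sum_le energy_main(3)) auto
  also have "\<dots> = (1 + (\<Sum>l<Mul. cmod (coef_U i l))) * ?E" by (simp add: algebra_simps)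
  also have "\<dots> \<le> R0 i * ?E"
    unfolding R0_def using E row_norm_nonneg by (intro mult_right_mono) (auto intro!: add_nonneg_nonneg sum_nonneg)
  finally show ?thesis by (simp add: Y0_tail[OF assms])
qed

text \<open>Ratio of the amplitudes with which the uplink input reaches the base station and M2.
  Rescaling M2's interference by it multiplies M2's noise variance by \<rho> to the power 1 -
  aI.\<close>

definition \<kappa> :: complex where "\<kappa> = complex_of_real (\<rho> powr ((1 - aI) / 2))"

lemma \<kappa>_sI: "\<kappa> * sI = sx"
proof -
  have "\<rho> powr ((1 - aI) / 2) * sqrt (\<rho> powr aI) = \<rho> powr ((1 - aI) / 2) * \<rho> powr (aI / 2)"
    using \<rho> by (simp add: powr_half_sqrt[symmetric] powr_powr)
  also have "\<dots> = \<rho> powr (1 / 2)" by (simp add: powr_add[symmetric] diff_divide_distrib)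
  also have "\<dots> = sqrt \<rho>" using \<rho> by (simp add: powr_half_sqrt)
  finally show ?thesis
    unfolding \<kappa>_def of_real_mult[symmetric] real_sqrt_mult by (simp add: mult.left_commute)
qed

text \<open>With the downlink message known, the base station's input is a function of past uplink
  outputs and can be removed from M2's output. The remaining interference, rescaled by
  \<open>\<kappa>\<close>, supplies the first summand of \<open>row_V\<close>; the second comes from
  uplink outputs of the same slot. Every signal cancels and only noise is left.\<close>

lemma Y0_mid:
  assumes "t < n" "i < Nul"
  shows "C.Y wd wu \<omega> (0, t, i) - ((\<Sum>l<m. coef_V i l * (\<kappa> * (C.Y wd wu \<omega> (1, t, l) - sd * (\<Sum>q<Mdl. h (0, l, q) * xdl wd wu \<omega> t q))))
      + (\<Sum>l<Mul - m. coef_V i (m + l) * C.Y wd wu \<omega> (0, t, l)))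
    = \<omega> (0, t, i) - ((\<Sum>l<m. coef_V i l * (\<kappa> * \<omega> (1, t, l))) + (\<Sum>l<Mul - m. coef_V i (m + l) * \<omega> (0, t, l)))"
proof -
  let ?P = "\<lambda>k i. \<Sum>q<Mul. h (k, i, q) * xul wu t q"
  have "?P 1 i = (\<Sum>l<m. coef_V i l * ?P 2 l) + (\<Sum>l<Mul - m. coef_V i (m + l) * ?P 1 l)"
    by (rule combination_rows2[of Mul "\<lambda>q. h (1, i, q)" "coef_V i" "\<lambda>l q. h (2, l, q)" m "\<lambda>l. coef_V i (m + l)" "\<lambda>l q. h (1, l, q)"])
      (rule row_V)
  then have P: "sx * ?P 1 i = (\<Sum>l<m. coef_V i l * (sx * ?P 2 l)) + (\<Sum>l<Mul - m. coef_V i (m + l) * (sx * ?P 1 l))"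
    by (simp add: sum_distrib_left distrib_left mult.left_commute)
  have 1: "(\<Sum>l<m. coef_V i l * (\<kappa> * (C.Y wd wu \<omega> (1, t, l) - sd * (\<Sum>q<Mdl. h (0, l, q) * xdl wd wu \<omega> t q))))
      = (\<Sum>l<m. coef_V i l * (sx * ?P 2 l)) + (\<Sum>l<m. coef_V i l * (\<kappa> * \<omega> (1, t, l)))"
    unfolding sum.distrib[symmetric]
  proof (rule sum.cong[OF refl])
    fix l assume "l \<in> {..<m}"
    then have l: "l < Ndl" using m_le by simp
    have "C.Y wd wu \<omega> (1, t, l) - sd * (\<Sum>q<Mdl. h (0, l, q) * xdl wd wu \<omega> t q) = sI * ?P 2 l + \<omega> (1, t, l)"
      unfolding Y1[OF assms(1) l] by simp
    then show "coef_V i l * (\<kappa> * (C.Y wd wu \<omega> (1, t, l) - sd * (\<Sum>q<Mdl. h (0, l, q) * xdl wd wu \<omega> t q)))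
        = coef_V i l * (sx * ?P 2 l) + coef_V i l * (\<kappa> * \<omega> (1, t, l))"
      unfolding \<kappa>_sI[symmetric] by (simp add: algebra_simps)
  qed
  have 2: "(\<Sum>l<Mul - m. coef_V i (m + l) * C.Y wd wu \<omega> (0, t, l))
      = (\<Sum>l<Mul - m. coef_V i (m + l) * (sx * ?P 1 l)) + (\<Sum>l<Mul - m. coef_V i (m + l) * \<omega> (0, t, l))"
    unfolding sum.distrib[symmetric]
  proof (rule sum.cong[OF refl])
    fix l assume "l \<in> {..<Mul - m}"
    then have l: "l < Nul" using dims by simp
    show "coef_V i (m + l) * C.Y wd wu \<omega> (0, t, l) = coef_V i (m + l) * (sx * ?P 1 l) + coef_V i (m + l) * \<omega> (0, t, l)"
      unfolding Y0[OF assms(1) l] by (simp add: distrib_left)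
  qed
  show ?thesis unfolding 1 2 Y0[OF assms] P by simp
qed

lemma Y0_mid_bound:
  assumes "t < n" "i < Nul"
  shows "cmod (C.Y wd wu \<omega> (0, t, i) - ((\<Sum>l<m. coef_V i l * (\<kappa> * (C.Y wd wu \<omega> (1, t, l) - sd * (\<Sum>q<Mdl. h (0, l, q) * xdl wd wu \<omega> t q))))
      + (\<Sum>l<Mul - m. coef_V i (m + l) * C.Y wd wu \<omega> (0, t, l))))
    \<le> sqrt (max 1 (\<rho> powr (1 - aI))) * R0 i * sqrt (C.main_energy wd wu t \<omega>)"
proof -
  let ?E = "sqrt (C.main_energy wd wu t \<omega>)" and ?s = "sqrt (max 1 (\<rho> powr (1 - aI)))"
  let ?c1 = "\<Sum>l<m. cmod (coef_V i l)" and ?c2 = "\<Sum>l<Mul - m. cmod (coef_V i (m + l))"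
  have E: "0 \<le> ?E" using C.main_energy_nonneg by simp
  have s1: "1 \<le> ?s" by simp
  have c: "0 \<le> ?c1" "0 \<le> ?c2" by (auto intro: sum_nonneg)
  have "cmod \<kappa> = sqrt (\<rho> powr (1 - aI))"
    using \<rho> by (simp add: \<kappa>_def powr_half_sqrt[symmetric] powr_powr)
  then have \<kappa>s: "cmod \<kappa> \<le> ?s" by simp
  have w1: "cmod (\<kappa> * \<omega> (1, t, l)) \<le> ?s * ?E" if "l < m" for l
    using that m_le \<kappa>s energy_main(4)[of l \<omega> t wd wu] s1 unfolding norm_mult by (intro mult_mono) auto
  have w0: "cmod (\<omega> (0, t, l)) \<le> ?s * ?E" if "l < Nul" for l
    using energy_main(3)[OF that, of \<omega> t wd wu] mult_right_mono[OF s1 E] by simp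
  have "cmod (\<omega> (0, t, i) - ((\<Sum>l<m. coef_V i l * (\<kappa> * \<omega> (1, t, l))) + (\<Sum>l<Mul - m. coef_V i (m + l) * \<omega> (0, t, l))))
      \<le> ?s * ?E + (?c1 * (?s * ?E) + ?c2 * (?s * ?E))"
    using assms dims
    by (intro order_trans[OF norm_triangle_ineq4] add_mono order_trans[OF norm_triangle_ineq] cmod_sum_le w0 w1) auto
  also have "\<dots> = ?s * (1 + (?c1 + ?c2)) * ?E" by (simp add: algebra_simps)
  also have "\<dots> \<le> ?s * R0 i * ?E"
  proof (intro mult_right_mono mult_left_mono)
    have "0 \<le> (\<Sum>l<Mul. cmod (coef_U i l))" by (intro sum_nonneg) simp
    then show "1 + (?c1 + ?c2) \<le> R0 i" unfolding R0_def using row_norm_nonneg[of 1 i Mul] by linarith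
  qed (use E s1 in auto)
  finally show ?thesis by (simp only: Y0_mid[OF assms])
qed

lemma R1_parts:
  "1 + row_norm 0 i Mdl + row_norm 2 i Mul \<le> R1 i"
  "1 + row_norm 0 i Mdl + (\<Sum>l<m. cmod (coef_I i l) * (1 + row_norm 0 l Mdl)) \<le> R1 i"
proof -
  have "0 \<le> (\<Sum>l<m. cmod (coef_I i l) * (1 + row_norm 0 l Mdl))"
    using row_norm_nonneg by (intro sum_nonneg mult_nonneg_nonneg add_nonneg_nonneg) auto
  then show "1 + row_norm 0 i Mdl + row_norm 2 i Mul \<le> R1 i"
    "1 + row_norm 0 i Mdl + (\<Sum>l<m. cmod (coef_I i l) * (1 + row_norm 0 l Mdl)) \<le> R1 i"
    unfolding R1_def using row_norm_nonneg[of 2 i Mul] by linarith+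
qed

lemma sqrt_powr_mono: "x \<le> y \<Longrightarrow> sqrt (\<rho> powr x) \<le> sqrt (\<rho> powr y)"
  using \<rho> by (simp add: powr_mono)

lemma Y1_bound:
  assumes "t < n" "i < Ndl"
  shows "cmod (C.Y wd wu \<omega> (1, t, i)) \<le> sqrt (\<rho> powr max 1 aI) * R1 i * sqrt (C.main_energy wd wu t \<omega>)"
proof -
  let ?E = "sqrt (C.main_energy wd wu t \<omega>)" and ?s = "sqrt (\<rho> powr max 1 aI)"
  have E: "0 \<le> ?E" using C.main_energy_nonneg by simp
  have s1: "1 \<le> ?s" using powr_ge_1[of "max 1 aI"] by simp
  have sd: "cmod sd \<le> ?s" using sqrt_powr_mono[of 1 "max 1 aI"] \<rho> by simp
  have sI: "cmod sI \<le> ?s" by (intro order_trans[OF cmod_amplitudes(2)] sqrt_powr_mono) simp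
  have "cmod (C.Y wd wu \<omega> (1, t, i)) \<le> ?s * row_norm 0 i Mdl * ?E + ?s * row_norm 2 i Mul * ?E + ?s * ?E"
    unfolding Y1[OF assms]
  proof (intro order_trans[OF norm_triangle_ineq] add_mono scaled_row_bound energy_main(1,2) sd sI E)
    show "cmod (\<omega> (1, t, i)) \<le> ?s * ?E"
      using energy_main(4)[OF assms(2), of \<omega> t wd wu] mult_right_mono[OF s1 E] by simp
  qed
  also have "\<dots> = ?s * (1 + row_norm 0 i Mdl + row_norm 2 i Mul) * ?E" by (simp add: algebra_simps)
  also have "\<dots> \<le> ?s * R1 i * ?E"
    using R1_parts(1) s1 E by (intro mult_right_mono mult_left_mono) auto
  finally show ?thesis .
qed

text \<open>For the bound that treats the uplink message as known: the interference is subtracted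
  exactly and the downlink signal sets the scale.\<close>

lemma Y1_clean_bound:
  assumes "t < n" "i < Ndl"
  shows "cmod (C.Y wd wu \<omega> (1, t, i) - sI * (\<Sum>q<Mul. h (2, i, q) * xul wu t q)) \<le> sqrt \<rho> * R1 i * sqrt (C.main_energy wd wu t \<omega>)"
proof -
  let ?E = "sqrt (C.main_energy wd wu t \<omega>)"
  have E: "0 \<le> ?E" using C.main_energy_nonneg by simp
  have s1: "1 \<le> sqrt \<rho>" using \<rho> by simp
  have "cmod (sd * (\<Sum>q<Mdl. h (0, i, q) * xdl wd wu \<omega> t q) + \<omega> (1, t, i)) \<le> sqrt \<rho> * row_norm 0 i Mdl * ?E + sqrt \<rho> * ?E"
  proof (intro order_trans[OF norm_triangle_ineq] add_mono scaled_row_bound energy_main(1) E)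
    show "cmod sd \<le> sqrt \<rho>" using cmod_amplitudes(4) by simp
    show "cmod (\<omega> (1, t, i)) \<le> sqrt \<rho> * ?E"
      using energy_main(4)[OF assms(2), of \<omega> t wd wu] mult_right_mono[OF s1 E] by simp
  qed
  also have "\<dots> = sqrt \<rho> * (1 + row_norm 0 i Mdl) * ?E" by (simp add: algebra_simps)
  also have "\<dots> \<le> sqrt \<rho> * R1 i * ?E"
    using R1_parts(1)[of i] row_norm_nonneg[of 2 i Mul] s1 E by (intro mult_right_mono mult_left_mono) auto
  finally show ?thesis unfolding Y1[OF assms] by (simp add: algebra_simps)
qed

text \<open>The combination of the first \<open>m\<close> antennas removes the interference but not
  the downlink signal, so the scale is the square root of \<rho>, whatever \<open>aI\<close>
  is.\<close>

lemma Y1_tail: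
  assumes "t < n" "m \<le> i" "i < Ndl"
  shows "cmod (C.Y wd wu \<omega> (1, t, i) - (\<Sum>l<m. coef_I i l * C.Y wd wu \<omega> (1, t, l))) \<le> sqrt \<rho> * R1 i * sqrt (C.main_energy wd wu t \<omega>)"
proof -
  let ?E = "sqrt (C.main_energy wd wu t \<omega>)"
  let ?w = "\<lambda>i. sd * (\<Sum>q<Mdl. h (0, i, q) * xdl wd wu \<omega> t q) + \<omega> (1, t, i)"
  have E: "0 \<le> ?E" using C.main_energy_nonneg by simp
  have s1: "1 \<le> sqrt \<rho>" using \<rho> by simp
  have eq: "C.Y wd wu \<omega> (1, t, i) - (\<Sum>l<m. coef_I i l * C.Y wd wu \<omega> (1, t, l)) = ?w i - (\<Sum>l<m. coef_I i l * ?w l)"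
  proof (rule combination_residual[of "\<lambda>i. C.Y wd wu \<omega> (1, t, i)" i "\<lambda>i. sI * (\<Sum>q<Mul. h (2, i, q) * xul wu t q)"])
    show "sI * (\<Sum>q<Mul. h (2, i, q) * xul wu t q) = (\<Sum>l<m. coef_I i l * (sI * (\<Sum>q<Mul. h (2, l, q) * xul wu t q)))"
      using combination_rows[of Mul "\<lambda>q. h (2, i, q)" "coef_I i" "\<lambda>l q. h (2, l, q)" m "xul wu t", OF row_I[OF assms(2,3)]]
      by (simp add: sum_distrib_left mult.left_commute)
    show "C.Y wd wu \<omega> (1, t, i) = sI * (\<Sum>q<Mul. h (2, i, q) * xul wu t q) + ?w i"
      unfolding Y1[OF assms(1,3)] by simp
    fix l assume "l < m"
    then have "l < Ndl" using m_le by simp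
    then show "C.Y wd wu \<omega> (1, t, l) = sI * (\<Sum>q<Mul. h (2, l, q) * xul wu t q) + ?w l"
      unfolding Y1[OF assms(1) \<open>l < Ndl\<close>] by simp
  qed
  have w: "cmod (?w l) \<le> sqrt \<rho> * (1 + row_norm 0 l Mdl) * ?E" if "l < Ndl" for l
  proof -
    have "cmod (?w l) \<le> sqrt \<rho> * row_norm 0 l Mdl * ?E + sqrt \<rho> * ?E"
    proof (intro order_trans[OF norm_triangle_ineq] add_mono scaled_row_bound energy_main(1) E)
      show "cmod sd \<le> sqrt \<rho>" using cmod_amplitudes(4) by simp
      show "cmod (\<omega> (1, t, l)) \<le> sqrt \<rho> * ?E"
        using energy_main(4)[OF that, of \<omega> t wd wu] mult_right_mono[OF s1 E] by simp
    qed
    then show ?thesis by (simp add: algebra_simps)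
  qed
  have "cmod (\<Sum>l<m. coef_I i l * ?w l) \<le> (\<Sum>l<m. cmod (coef_I i l) * (sqrt \<rho> * (1 + row_norm 0 l Mdl) * ?E))"
    using w m_le by (intro order_trans[OF norm_sum] sum_mono) (auto simp: norm_mult intro!: mult_left_mono)
  also have "\<dots> = sqrt \<rho> * (\<Sum>l<m. cmod (coef_I i l) * (1 + row_norm 0 l Mdl)) * ?E"
    by (simp add: sum_distrib_left sum_distrib_right ac_simps)
  finally have "cmod (?w i - (\<Sum>l<m. coef_I i l * ?w l)) \<le> sqrt \<rho> * (1 + row_norm 0 i Mdl) * ?E + sqrt \<rho> * (\<Sum>l<m. cmod (coef_I i l) * (1 + row_norm 0 l Mdl)) * ?E"
    using w[OF assms(3)] by (intro order_trans[OF norm_triangle_ineq4] add_mono)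
  also have "\<dots> = sqrt \<rho> * (1 + row_norm 0 i Mdl + (\<Sum>l<m. cmod (coef_I i l) * (1 + row_norm 0 l Mdl))) * ?E"
    by (simp add: algebra_simps)
  also have "\<dots> \<le> sqrt \<rho> * R1 i * ?E"
    using R1_parts(2) s1 E by (intro mult_right_mono mult_left_mono) auto
  finally show ?thesis unfolding eq .
qed

lemma Y2_bound:
  assumes "t < side_len (net \<rho>) n" "i < Ndl"
  shows "cmod (C.Y wd wu \<omega> (2, t, i)) \<le> sqrt (\<rho> powr aS) * R2 i * sqrt (C.side_energy wu t \<omega>)"
proof -
  let ?E = "sqrt (C.side_energy wu t \<omega>)" and ?s = "sqrt (\<rho> powr aS)"
  have E: "0 \<le> ?E" using C.side_energy_nonneg by simp
  have s1: "1 \<le> ?s" using powr_ge_1[of aS] params by simp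
  have "cmod (C.Y wd wu \<omega> (2, t, i)) \<le> ?s * row_norm 3 i Mul * ?E + ?s * ?E"
    unfolding Y2[OF assms]
  proof (intro order_trans[OF norm_triangle_ineq] add_mono scaled_row_bound energy_side(1) E cmod_amplitudes(3))
    show "cmod (\<omega> (2, t, i)) \<le> ?s * ?E"
      using energy_side(2)[OF assms(2), of \<omega> t wu] mult_right_mono[OF s1 E] by simp
  qed
  also have "\<dots> = ?s * (1 + row_norm 3 i Mul) * ?E" by (simp add: algebra_simps)
  also have "\<dots> \<le> ?s * R2 i * ?E"
    unfolding R2_def using s1 E by (intro mult_right_mono mult_left_mono) (auto intro: sum_nonneg)
  finally show ?thesis .
qed

lemma Y2_tail:
  assumes "t < side_len (net \<rho>) n" "m \<le> i" "i < Ndl"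
  shows "cmod (C.Y wd wu \<omega> (2, t, i) - (\<Sum>l<m. coef_S i l * C.Y wd wu \<omega> (2, t, l))) \<le> sqrt 1 * R2 i * sqrt (C.side_energy wu t \<omega>)"
proof -
  let ?E = "sqrt (C.side_energy wu t \<omega>)"
  have E: "0 \<le> ?E" using C.side_energy_nonneg by simp
  have eq: "C.Y wd wu \<omega> (2, t, i) - (\<Sum>l<m. coef_S i l * C.Y wd wu \<omega> (2, t, l)) = \<omega> (2, t, i) - (\<Sum>l<m. coef_S i l * \<omega> (2, t, l))"
  proof (rule combination_residual[of "\<lambda>i. C.Y wd wu \<omega> (2, t, i)" i "\<lambda>i. sS * (\<Sum>q<Mul. h (3, i, q) * xs wu t q)"])
    show "sS * (\<Sum>q<Mul. h (3, i, q) * xs wu t q) = (\<Sum>l<m. coef_S i l * (sS * (\<Sum>q<Mul. h (3, l, q) * xs wu t q)))"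
      using combination_rows[of Mul "\<lambda>q. h (3, i, q)" "coef_S i" "\<lambda>l q. h (3, l, q)" m "xs wu t", OF row_S[OF assms(2,3)]]
      by (simp add: sum_distrib_left mult.left_commute)
  qed (use assms m_le in \<open>auto intro!: Y2\<close>)
  have "cmod (\<omega> (2, t, i) - (\<Sum>l<m. coef_S i l * \<omega> (2, t, l))) \<le> ?E + (\<Sum>l<m. cmod (coef_S i l)) * ?E"
    using assms m_le
    by (intro order_trans[OF norm_triangle_ineq4] add_mono cmod_sum_le energy_side(2)) auto
  also have "\<dots> = (1 + (\<Sum>l<m. cmod (coef_S i l))) * ?E" by (simp add: algebra_simps)
  also have "\<dots> \<le> R2 i * ?E"
    unfolding R2_def using E row_norm_nonneg by (intro mult_right_mono) auto
  finally show ?thesis by (simp add: eq)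
qed

end

section \<open>Rate bounds for codes of fixed block length and their limits\<close>

lemma sum_if_prefix:
  assumes "a \<le> b" "b \<le> k"
  shows "(\<Sum>j<k. if j < a then x else if j < b then y else (0 :: real)) = real a * x + real (b - a) * y"
proof -
  have prefix: "(\<Sum>j<k. if j < a then c else 0) = real (min a k) * c" for a k and c :: real
    by (induction k) (auto simp: min_def algebra_simps not_less le_Suc_eq)
  have "(\<Sum>j<k. if j < a then x else if j < b then y else 0)
      = (\<Sum>j<k. (if j < a then x - y else 0) + (if j < b then y else 0))"
    using assms(1) by (intro sum.cong) auto
  also have "\<dots> = real a * (x - y) + real b * y"
    using assms by (simp add: sum.distrib prefix)
  finally show ?thesis using assms by (simp add: of_nat_diff algebra_simps)
qed

lemma x_dl_cong:
  assumes "\<And>t' j. t' < t \<Longrightarrow> y t' j = z t' j"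
  shows "x_dl f y t = x_dl f z t"
proof -
  have "(\<lambda>t' i. if t' < t then y t' i else 0) = (\<lambda>t' i. if t' < t then z t' i else 0)"
    using assms by (auto simp: fun_eq_iff)
  then show ?thesis by (simp add: x_dl_def)
qed

text \<open>The additive 1 disappears as the block length grows, the factor
  \<open>1 - \<epsilon>\<close> as the error probability tends to 0.\<close>

lemma asymptotic_rate_le:
  fixes X Y :: real
  assumes "0 \<le> Y" and "\<And>\<epsilon>. 0 < \<epsilon> \<Longrightarrow> \<epsilon> < 1 \<Longrightarrow> \<exists>n0. \<forall>n\<ge>n0. (1 - \<epsilon>) * (real n * X) \<le> 1 + real n * Y"
  shows "X \<le> Y"
proof (rule ccontr)
  assume "\<not> X \<le> Y"
  then have X: "Y < X" "0 < X" using assms(1) by auto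
  \<comment> \<open>Chosen so that \<open>(1 - \<epsilon>) * X\<close> is the midpoint of
    \<open>X\<close> and \<open>Y\<close>, which leaves a gap that is linear in
    \<open>n\<close>.\<close>
  define \<epsilon> where "\<epsilon> = (X - Y) / (2 * X)"
  have \<epsilon>: "0 < \<epsilon>" "\<epsilon> < 1" using X assms(1) by (auto simp: \<epsilon>_def field_simps)
  have e: "(1 - \<epsilon>) * X = (X + Y) / 2" using X by (simp add: \<epsilon>_def field_simps)
  obtain n0 where n0: "\<And>n. n0 \<le> n \<Longrightarrow> (1 - \<epsilon>) * (real n * X) \<le> 1 + real n * Y"
    using assms(2)[OF \<epsilon>] by blast
  obtain k :: nat where k: "2 / (X - Y) < real k" using reals_Archimedean2 by blast
  define n where "n = max n0 k"
  have "(1 - \<epsilon>) * (real n * X) = real n * ((X + Y) / 2)"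
    unfolding e[symmetric] by simp
  then have "real n * ((X + Y) / 2) \<le> 1 + real n * Y"
    using n0[of n, OF max.cobounded1[of n0 k, folded n_def]] by (simp only:)
  then have "real n * ((X + Y) / 2) - real n * Y \<le> 1" by simp
  moreover have "real n * ((X + Y) / 2) - real n * Y = real n * (X - Y) / 2" by (simp add: field_simps)
  ultimately have "real n * (X - Y) \<le> 2" by simp
  moreover have "2 < real k * (X - Y)" using k X by (simp add: field_simps)
  moreover have "real k * (X - Y) \<le> real n * (X - Y)" using X by (intro mult_right_mono) (auto simp: n_def)
  ultimately show False by linarith
qed

context channel_code
begin

lemma component_measurable_kti:
  "t < n \<Longrightarrow> j < Nul \<Longrightarrow> (\<lambda>y. y (0, t, j)) \<in> borel_measurable (lborel_PiM C.I)"
  "t < n \<Longrightarrow> j < Ndl \<Longrightarrow> (\<lambda>y. y (1, t, j)) \<in> borel_measurable (lborel_PiM C.I)"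
  "t < side_len (net \<rho>) n \<Longrightarrow> j < Ndl \<Longrightarrow> (\<lambda>y. y (2, t, j)) \<in> borel_measurable (lborel_PiM C.I)"
  by (auto intro!: C.component_measurable simp: C.idx_iff)

text \<open>The coefficient of ln \<rho> adds the exponents of the reference variances. Uplink:
  \<open>Mul - m\<close> antennas at full power, then \<open>m\<close> predicted through M2's
  outputs by \<open>Y0_mid\<close>, the rest predicted up to noise. M2: \<open>m\<close> antennas at
  the stronger of signal and interference, the rest freed of interference. Side channel:
  \<open>m\<close> antennas, the rest predicted up to noise.\<close>

lemma sum_rate_code_bound:
  assumes err: "error_prob (net \<rho>) n Kd Ku xul xs fdl gul gdl \<le> \<epsilon>"
  shows "(1 - \<epsilon>) * ln (real Kd * real Ku) \<le> 1
     + (real n * ((real (Mul - m) + real m * max 0 (1 - aI) + (real m * max 1 aI + real (Ndl - m))) * ln \<rho>)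
        + real (side_len (net \<rho>) n) * (real m * aS * ln \<rho>))
     + B * C.energy_const * (real n + real (side_len (net \<rho>) n))"
proof -
  define \<sigma> :: "nat \<times> nat \<times> nat \<Rightarrow> real" where "\<sigma> = (\<lambda>(k, t, i).
     if k = 0 then (if i < Mul - m then \<rho> else if i < Mul then max 1 (\<rho> powr (1 - aI)) else 1)
     else if k = 1 then (if i < m then \<rho> powr max 1 aI else \<rho>)
     else W * (if i < m then \<rho> powr aS else 1))"
  define \<mu> :: "nat \<Rightarrow> nat \<times> nat \<times> nat \<Rightarrow> (nat \<times> nat \<times> nat \<Rightarrow> complex) \<Rightarrow> complex" where "\<mu> wd = (\<lambda>(k, t, i) y.
     if k = 0 then (if i < Mul - m then 0 else if i < Mul then
         (\<Sum>l<m. coef_V i l * (\<kappa> * (y (1, t, l) - sd * (\<Sum>q<Mdl. h (0, l, q) * x_dl (fdl wd) (C.YU y) t q))))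
          + (\<Sum>l<Mul - m. coef_V i (m + l) * y (0, t, l))
       else (\<Sum>l<Mul. coef_U i l * y (0, t, l)))
     else if k = 1 then (if i < m then 0 else (\<Sum>l<m. coef_I i l * y (1, t, l)))
     else (if i < m then 0 else (\<Sum>l<m. coef_S i l * y (2, t, l))))" for wd
  \<comment> \<open>Time comes first for the uplink because the mean at time \<open>t\<close>
    contains the base station's input, which reads all earlier uplink outputs. Means of M2's outputs
    read only lower antennas of the same slot, so the antenna index is enough there.\<close>
  define r :: "nat \<times> nat \<times> nat \<Rightarrow> nat" where "r = (\<lambda>(k, t, i). if k = 0 then t * Nul + i else i)"
  have dims': "m \<le> Mul" "m \<le> Ndl" "Mul \<le> Nul" using m_le dims by auto
  have main: "(1 - \<epsilon>) * ln (real Kd * real Ku) \<le> 1 + (\<Sum>i\<in>C.I. ln (\<sigma> i / C.var i)) + B * C.energy_const * (real n + real (side_len (net \<rho>) n))"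
  proof (rule C.joint_bound[OF B_props(1) _ _ _ _ _ _ err])
    show "C.var i \<le> \<sigma> i" if "i \<in> C.I" for i
      using that \<rho> params powr_ge_1[of aS] powr_ge_1[of "max 1 aI"]
      by (cases rule: C.idx_cases) (auto simp: C.var_def \<sigma>_def mult_le_cancel_left1)
  next
    fix wd i assume "wd < Kd" "i \<in> C.I"
    show "\<mu> wd i \<in> borel_measurable (lborel_PiM C.I)"
      using \<open>i \<in> C.I\<close>
    proof (cases rule: C.idx_cases)
      case (ul t j)
      have [measurable]: "(\<lambda>y. x_dl (fdl wd) (C.YU y) t q) \<in> borel_measurable (lborel_PiM C.I)" if "q \<in> {..<Mdl}" for q
        using C.x_dl_measurable[OF \<open>wd < Kd\<close> ul(2), of q] that by simp
      have [measurable]: "(\<lambda>y. y (Suc 0, t, l)) \<in> borel_measurable (lborel_PiM C.I)" if "l \<in> {..<m}" for l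
        using component_measurable_kti(2)[OF ul(2), of l] that dims' by simp
      have [measurable]: "(\<lambda>y. y (0, t, l)) \<in> borel_measurable (lborel_PiM C.I)" if "l \<in> {..<Mul}" for l
        using component_measurable_kti(1)[OF ul(2), of l] that dims' by simp
      have [measurable]: "(\<lambda>y. y (0, t, l)) \<in> borel_measurable (lborel_PiM C.I)" if "l \<in> {..<Mul - m}" for l
        using component_measurable_kti(1)[OF ul(2), of l] that dims' by simp
      show ?thesis unfolding \<mu>_def ul(1) by (cases "j < Mul - m"; cases "j < Mul"; simp)
    next
      case (dl t j)
      have [measurable]: "(\<lambda>y. y (Suc 0, t, l)) \<in> borel_measurable (lborel_PiM C.I)" if "l \<in> {..<m}" for l
        using component_measurable_kti(2)[OF dl(2), of l] that dims' by simp
      show ?thesis unfolding \<mu>_def dl(1) by (cases "j < m"; simp)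
    next
      case (side t j)
      have [measurable]: "(\<lambda>y. y (2, t, l)) \<in> borel_measurable (lborel_PiM C.I)" if "l \<in> {..<m}" for l
        using component_measurable_kti(3)[OF side(2), of l] that dims' by simp
      show ?thesis unfolding \<mu>_def side(1) by (cases "j < m"; simp)
    qed
  next
    fix wd wd' i and x y :: "nat \<times> nat \<times> nat \<Rightarrow> complex"
    assume i: "i \<in> C.I" "fst i \<noteq> 0" and eq: "\<And>j. j \<in> C.I \<Longrightarrow> fst j \<noteq> 0 \<Longrightarrow> r j < r i \<Longrightarrow> x j = y j"
    show "\<mu> wd i x = \<mu> wd' i y"
      using i(1)
    proof (cases rule: C.idx_cases)
      case (ul t j)
      then show ?thesis using i(2) by simp
    next
      case (dl t j)
      have "x (1, t, l) = y (1, t, l)" if "l < m" "m \<le> j" for l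
        using that dl dims' by (intro eq) (auto simp: C.idx_iff r_def)
      then show ?thesis unfolding \<mu>_def dl(1) by (auto intro!: sum.cong)
    next
      case (side t j)
      have "x (2, t, l) = y (2, t, l)" if "l < m" "m \<le> j" for l
        using that side dims' by (intro eq) (auto simp: C.idx_iff r_def)
      then show ?thesis unfolding \<mu>_def side(1) by (auto intro!: sum.cong)
    qed
  next
    fix wd i and x y :: "nat \<times> nat \<times> nat \<Rightarrow> complex"
    assume i: "i \<in> C.I" "fst i = 0" and eq: "\<And>j. j \<in> C.I \<Longrightarrow> fst j \<noteq> 0 \<Longrightarrow> x j = y j"
      and eq0: "\<And>j. j \<in> C.I \<Longrightarrow> fst j = 0 \<Longrightarrow> r j < r i \<Longrightarrow> x j = y j"
    show "\<mu> wd i x = \<mu> wd i y"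
      using i(1)
    proof (cases rule: C.idx_cases)
      case (ul t j)
      have e0: "x (0, t, l) = y (0, t, l)" if "l < j" for l
        using that ul by (intro eq0) (auto simp: C.idx_iff r_def)
      have e1: "x (1, t, l) = y (1, t, l)" if "l < m" for l
        using that ul dims' by (intro eq) (auto simp: C.idx_iff)
      have "x (0, t', l) = y (0, t', l)" if "t' < t" "l < Nul" for t' l
      proof (rule eq0)
        have "t' * Nul + l < (t' + 1) * Nul" using that(2) by simp
        also have "\<dots> \<le> t * Nul" using that(1) by (intro mult_le_mono1) simp
        finally show "r (0, t', l) < r i" by (simp add: r_def ul(1))
      qed (use that ul in \<open>auto simp: C.idx_iff\<close>)
      then have xd: "x_dl (fdl wd) (C.YU x) t = x_dl (fdl wd) (C.YU y) t"
        by (intro x_dl_cong) (auto simp: C.YU_def)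
      have s1: "(\<Sum>l<m. coef_V j l * (\<kappa> * (x (1, t, l) - sd * (\<Sum>q<Mdl. h (0, l, q) * x_dl (fdl wd) (C.YU x) t q))))
         = (\<Sum>l<m. coef_V j l * (\<kappa> * (y (1, t, l) - sd * (\<Sum>q<Mdl. h (0, l, q) * x_dl (fdl wd) (C.YU y) t q))))"
        by (intro sum.cong refl) (use e1 xd in simp)
      have s2: "(\<Sum>l<Mul - m. coef_V j (m + l) * x (0, t, l)) = (\<Sum>l<Mul - m. coef_V j (m + l) * y (0, t, l))" if "\<not> j < Mul - m"
        by (intro sum.cong refl) (use e0 that in simp)
      have s3: "(\<Sum>l<Mul. coef_U j l * x (0, t, l)) = (\<Sum>l<Mul. coef_U j l * y (0, t, l))" if "\<not> j < Mul"
        by (intro sum.cong refl) (use e0 that in simp)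
      show ?thesis unfolding \<mu>_def ul(1) split using s1 s2 s3 by (simp only: if_True refl) (simp split: if_splits)
    qed (use i(2) in auto)
  next
    fix k wd wu t j \<omega> assume w: "k < (2 :: nat)" "wd < Kd" "wu < Ku" "(k, t, j) \<in> C.I"
    show "(cmod (C.Y wd wu \<omega> (k, t, j) - \<mu> wd (k, t, j) (C.Y wd wu \<omega>)))\<^sup>2 \<le> \<sigma> (k, t, j) * (B * C.main_energy wd wu t \<omega>)"
    proof (cases "k = 0")
      case True
      then have tj: "t < n" "j < Nul" using w(4) by (simp_all add: C.idx_iff)
      have R: "0 \<le> R0 j" "R0 j \<le> A" using R_ge_1(1)[of j] R_le_A(1)[OF tj(2)] by linarith+
      note sq = square_bound[OF _ _ R C.main_energy_nonneg]
      consider "j < Mul - m" | "\<not> j < Mul - m" "j < Mul" | "\<not> j < Mul - m" "\<not> j < Mul" by blast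
      then show ?thesis
      proof cases
        case 1
        then show ?thesis using sq[OF Y0_bound[OF tj]] \<rho> True by (simp add: \<mu>_def \<sigma>_def)
      next
        case 2
        then show ?thesis using sq[OF Y0_mid_bound[OF tj]] True by (simp add: \<mu>_def \<sigma>_def C.YU_Y)
      next
        case 3
        then show ?thesis using sq[OF Y0_tail_bound[OF tj]] True by (simp add: \<mu>_def \<sigma>_def)
      qed
    next
      case False
      then have k: "k = 1" using w(1) by simp
      then have tj: "t < n" "j < Ndl" using w(4) by (simp_all add: C.idx_iff)
      have R: "0 \<le> R1 j" "R1 j \<le> A" using R_ge_1(2)[of j] R_le_A(2)[OF tj(2)] by linarith+
      note sq = square_bound[OF _ _ R C.main_energy_nonneg]
      show ?thesis
      proof (cases "j < m")
        case True
        then show ?thesis using sq[OF Y1_bound[OF tj]] \<rho> k by (simp add: \<mu>_def \<sigma>_def)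
      next
        case False
        then show ?thesis using sq[OF Y1_tail[OF tj(1) _ tj(2)]] \<rho> k by (simp add: \<mu>_def \<sigma>_def)
      qed
    qed
  next
    fix wd wu t j \<omega> assume w: "wd < Kd" "wu < Ku" "(2, t, j) \<in> C.I"
    then have tj: "t < side_len (net \<rho>) n" "j < Ndl" by (simp_all add: C.idx_iff)
    have R: "0 \<le> R2 j" "R2 j \<le> A" using R_ge_1(3)[of j] R_le_A(3)[OF tj(2)] by linarith+
    have W: "0 < W" using C.var_pos[OF w(3)] by (simp add: C.var_def)
    note sq = square_bound_side[OF _ _ R C.side_energy_nonneg W]
    show "(cmod (C.Y wd wu \<omega> (2, t, j) - \<mu> wd (2, t, j) (C.Y wd wu \<omega>)))\<^sup>2 \<le> \<sigma> (2, t, j) * (B * C.side_energy wu t \<omega>)"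
    proof (cases "j < m")
      case True
      then show ?thesis using sq[OF Y2_bound[OF tj]] by (simp add: \<mu>_def \<sigma>_def)
    next
      case False
      then show ?thesis using sq[OF Y2_tail[OF tj(1) _ tj(2)]] by (simp add: \<mu>_def \<sigma>_def)
    qed
  qed
  have lnr: "ln (\<rho> powr x) = x * ln \<rho>" for x using \<rho> by (simp add: ln_powr)
  have s0: "(\<Sum>j<Nul. ln (\<sigma> (0, t, j) / C.var (0, t, j))) = (real (Mul - m) + real m * max 0 (1 - aI)) * ln \<rho>" for t
  proof -
    have "ln (max 1 (\<rho> powr (1 - aI))) = max 0 (1 - aI) * ln \<rho>"
    proof (cases "aI \<le> 1")
      case True
      then show ?thesis using powr_ge_1[of "1 - aI"] lnr by (simp add: max_def)
    next
      case False
      then have "\<rho> powr (1 - aI) \<le> 1" using powr_mono[of "1 - aI" 0 \<rho>] \<rho> by simp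
      then show ?thesis using False by (simp add: max_def)
    qed
    then have "(\<Sum>j<Nul. ln (\<sigma> (0, t, j) / C.var (0, t, j)))
        = (\<Sum>j<Nul. if j < Mul - m then ln \<rho> else if j < Mul then max 0 (1 - aI) * ln \<rho> else 0)"
      by (intro sum.cong) (auto simp: \<sigma>_def C.var_def)
    also have "\<dots> = real (Mul - m) * ln \<rho> + real (Mul - (Mul - m)) * (max 0 (1 - aI) * ln \<rho>)"
      using dims' by (intro sum_if_prefix) auto
    finally show ?thesis using dims' by (simp add: algebra_simps)
  qed
  have s1: "(\<Sum>j<Ndl. ln (\<sigma> (1, t, j) / C.var (1, t, j))) = (real m * max 1 aI + real (Ndl - m)) * ln \<rho>" for t
  proof -
    have "(\<Sum>j<Ndl. ln (\<sigma> (1, t, j) / C.var (1, t, j))) = (\<Sum>j<Ndl. if j < m then max 1 aI * ln \<rho> else if j < Ndl then ln \<rho> else 0)"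
      by (intro sum.cong) (auto simp: \<sigma>_def C.var_def lnr)
    also have "\<dots> = real m * (max 1 aI * ln \<rho>) + real (Ndl - m) * ln \<rho>"
      using dims' by (intro sum_if_prefix) auto
    finally show ?thesis by (simp add: algebra_simps)
  qed
  have s2: "(\<Sum>t<side_len (net \<rho>) n. \<Sum>j<Ndl. ln (\<sigma> (2, t, j) / C.var (2, t, j))) = real (side_len (net \<rho>) n) * (real m * aS * ln \<rho>)"
  \<comment> \<open>For \<open>W = 0\<close> the quotient of variances carries no information, but
    then there are no side-channel uses to sum over.\<close>
  proof (cases "W = 0")
    case False
    have "(\<Sum>j<Ndl. ln (\<sigma> (2, t, j) / C.var (2, t, j))) = (\<Sum>j<Ndl. if j < m then aS * ln \<rho> else if j < Ndl then 0 else 0)" for t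
      using False by (intro sum.cong) (auto simp: \<sigma>_def C.var_def lnr)
    also have "\<dots> = real m * (aS * ln \<rho>) + real (Ndl - m) * 0"
      using dims' by (intro sum_if_prefix) auto
    finally show ?thesis by simp
  next
    case True
    have "Wr (net \<rho>) = 0" by (rule trans[OF net_simps(6) True])
    then have "side_len (net \<rho>) n = 0" unfolding side_len_def by (simp only: mult_zero_left floor_zero nat_0)
    then show ?thesis by simp
  qed
  have "(\<Sum>i\<in>C.I. ln (\<sigma> i / C.var i)) = real n * ((real (Mul - m) + real m * max 0 (1 - aI) + (real m * max 1 aI + real (Ndl - m))) * ln \<rho>)
        + real (side_len (net \<rho>) n) * (real m * aS * ln \<rho>)"
    unfolding C.sum_I net_simps s0 s1 s2 by (simp add: algebra_simps)
  with main show ?thesis by (simp only:)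
qed

text \<open>With \<open>wu\<close> known, uplink, interference and side-channel signals are
  subtracted exactly. Only the \<open>Ndl\<close> downlink antennas keep a signal, of variance of
  order \<rho>.\<close>

lemma downlink_rate_code_bound:
  assumes err: "error_prob (net \<rho>) n Kd Ku xul xs fdl gul gdl \<le> \<epsilon>"
  shows "(1 - \<epsilon>) * ln (real Kd) \<le> 1 + real n * (real Ndl * ln \<rho>)
     + B * C.energy_const * (real n + real (side_len (net \<rho>) n))"
proof -
  define \<sigma> :: "nat \<times> nat \<times> nat \<Rightarrow> real" where "\<sigma> = (\<lambda>(k, t, i). if k = 0 then 1 else if k = 1 then \<rho> else W)"
  define c :: "nat \<Rightarrow> nat \<times> nat \<times> nat \<Rightarrow> complex" where "c wu = (\<lambda>(k, t, i).
     if k = 0 then sx * (\<Sum>q<Mul. h (1, i, q) * xul wu t q)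
     else if k = 1 then sI * (\<Sum>q<Mul. h (2, i, q) * xul wu t q)
     else sS * (\<Sum>q<Mul. h (3, i, q) * xs wu t q))" for wu
  have main: "(1 - \<epsilon>) * ln (real Kd) \<le> 1 + (\<Sum>i\<in>C.I. ln (\<sigma> i / C.var i)) + B * C.energy_const * (real n + real (side_len (net \<rho>) n))"
  proof (rule C.downlink_bound[OF B_props(1) _ _ _ err])
    show "C.var i \<le> \<sigma> i" if "i \<in> C.I" for i
      using that \<rho> by (cases rule: C.idx_cases) (auto simp: C.var_def \<sigma>_def)
  next
    fix k wd wu t j \<omega> assume w: "k < (2 :: nat)" "wd < Kd" "wu < Ku" "(k, t, j) \<in> C.I"
    show "(cmod (C.Y wd wu \<omega> (k, t, j) - c wu (k, t, j)))\<^sup>2 \<le> \<sigma> (k, t, j) * (B * C.main_energy wd wu t \<omega>)"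
    proof (cases "k = 0")
      case True
      then have tj: "t < n" "j < Nul" using w(4) by (simp_all add: C.idx_iff)
      have "(cmod (\<omega> (0, t, j)))\<^sup>2 \<le> 1 * (B * C.main_energy wd wu t \<omega>)"
        using energy_main(3)[OF tj(2), of \<omega> t wd wu] A_ge_1 by (intro square_bound[of _ 1 1]) (auto simp: C.main_energy_nonneg)
      then show ?thesis using True Y0[OF tj] by (simp add: c_def \<sigma>_def)
    next
      case False
      then have k: "k = 1" using w(1) by simp
      then have tj: "t < n" "j < Ndl" using w(4) by (simp_all add: C.idx_iff)
      have R: "0 \<le> R1 j" "R1 j \<le> A" using R_ge_1(2)[of j] R_le_A(2)[OF tj(2)] by linarith+
      show ?thesis
        using square_bound[OF Y1_clean_bound[OF tj] _ R C.main_energy_nonneg] \<rho> k by (simp add: c_def \<sigma>_def)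
    qed
  next
    fix wd wu t j \<omega> assume w: "wd < Kd" "wu < Ku" "(2, t, j) \<in> C.I"
    then have tj: "t < side_len (net \<rho>) n" "j < Ndl" by (simp_all add: C.idx_iff)
    have W: "0 < W" using C.var_pos[OF w(3)] by (simp add: C.var_def)
    have "(cmod (\<omega> (2, t, j)))\<^sup>2 \<le> (W * 1) * (B * C.side_energy wu t \<omega>)"
      using energy_side(2)[OF tj(2), of \<omega> t wu] A_ge_1 by (intro square_bound_side[of _ 1 1] W) (auto simp: C.side_energy_nonneg)
    then show "(cmod (C.Y wd wu \<omega> (2, t, j) - c wu (2, t, j)))\<^sup>2 \<le> \<sigma> (2, t, j) * (B * C.side_energy wu t \<omega>)"
      using Y2[OF tj] by (simp add: c_def \<sigma>_def)
  qed
  have "(\<Sum>i\<in>C.I. ln (\<sigma> i / C.var i)) = real n * (real Ndl * ln \<rho>)"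
    unfolding C.sum_I net_simps by (simp add: \<sigma>_def C.var_def)
  with main show ?thesis by (simp only:)
qed

text \<open>Only the first \<open>Mul\<close> base station antennas are unpredicted; the others
  follow from them through \<open>coef_U\<close> up to noise.\<close>

lemma uplink_rate_code_bound:
  assumes err: "error_prob (net \<rho>) n Kd Ku xul xs fdl gul gdl \<le> \<epsilon>"
  shows "(1 - \<epsilon>) * ln (real Ku) \<le> 1 + real n * (real Mul * ln \<rho>)
     + B * C.energy_const * (real n + real (side_len (net \<rho>) n))"
proof -
  define \<sigma> :: "nat \<times> nat \<times> nat \<Rightarrow> real" where "\<sigma> = (\<lambda>(k, t, i). if k = 0 then if i < Mul then \<rho> else 1 else if k = 1 then 1 else W)"
  define \<nu> :: "nat \<times> nat \<times> nat \<Rightarrow> (nat \<times> nat \<times> nat \<Rightarrow> complex) \<Rightarrow> complex" where "\<nu> = (\<lambda>(k, t, i) y.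
     if i < Mul then 0 else (\<Sum>l<Mul. coef_U i l * y (0, t, l)))"
  define r :: "nat \<times> nat \<times> nat \<Rightarrow> nat" where "r = (\<lambda>(k, t, i). i)"
  have main: "(1 - \<epsilon>) * ln (real Ku) \<le> 1 + (\<Sum>i\<in>C.I. ln (\<sigma> i / C.var i)) + B * C.energy_const * (real n + real (side_len (net \<rho>) n))"
  proof (rule C.uplink_bound[OF B_props(1) _ _ B_props(2) _ _ _ _ err])
    show "1 \<le> B * Wr (net \<rho>) \<or> Wr (net \<rho>) = 0" using B_props(3) by simp
    show "C.var i \<le> \<sigma> i" if "i \<in> C.I" for i
      using that \<rho> by (cases rule: C.idx_cases) (auto simp: C.var_def \<sigma>_def)
    show "\<sigma> i = C.var i" if "i \<in> C.I" "fst i \<noteq> 0" for i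
      using that by (cases rule: C.idx_cases) (auto simp: C.var_def \<sigma>_def)
  next
    fix i assume i: "i \<in> C.I" "fst i = 0"
    then obtain t j where tj: "i = (0, t, j)" "t < n" "j < Nul" by (cases rule: C.idx_cases) auto
    have [measurable]: "(\<lambda>y. y (0, t, l)) \<in> borel_measurable (lborel_PiM C.I)" if "l \<in> {..<Mul}" for l
      using component_measurable_kti(1)[OF tj(2), of l] that dims by simp
    show "\<nu> i \<in> borel_measurable (lborel_PiM C.I)" unfolding \<nu>_def tj(1) by simp
  next
    fix i and x y :: "nat \<times> nat \<times> nat \<Rightarrow> complex"
    assume i: "i \<in> C.I" "fst i = 0" and eq: "\<And>j. j \<in> C.I \<Longrightarrow> fst j = 0 \<Longrightarrow> r j < r i \<Longrightarrow> x j = y j"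
    then obtain t j where tj: "i = (0, t, j)" "t < n" "j < Nul" by (cases rule: C.idx_cases) auto
    have "x (0, t, l) = y (0, t, l)" if "l < j" for l
      using that tj by (intro eq) (auto simp: C.idx_iff r_def)
    then show "\<nu> i x = \<nu> i y" unfolding \<nu>_def tj(1) by (auto intro!: sum.cong)
  next
    fix wd wu t j \<omega> assume w: "wd < Kd" "wu < Ku" "(0, t, j) \<in> C.I"
    then have tj: "t < n" "j < Nul" by (simp_all add: C.idx_iff)
    have R: "0 \<le> R0 j" "R0 j \<le> A" using R_ge_1(1)[of j] R_le_A(1)[OF tj(2)] by linarith+
    note sq = square_bound[OF _ _ R C.main_energy_nonneg]
    show "(cmod (C.Y wd wu \<omega> (0, t, j) - \<nu> (0, t, j) (C.Y wd wu \<omega>)))\<^sup>2 \<le> \<sigma> (0, t, j) * (B * C.main_energy wd wu t \<omega>)"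
    proof (cases "j < Mul")
      case True
      then show ?thesis using sq[OF Y0_bound[OF tj]] \<rho> by (simp add: \<nu>_def \<sigma>_def)
    next
      case False
      then show ?thesis using sq[OF Y0_tail_bound[OF tj]] by (simp add: \<nu>_def \<sigma>_def)
    qed
  qed
  have "(\<Sum>j<Nul. ln (\<sigma> (0, t, j) / C.var (0, t, j))) = real Mul * ln \<rho>" for t
  proof -
    have "(\<Sum>j<Nul. ln (\<sigma> (0, t, j) / C.var (0, t, j))) = (\<Sum>j<Nul. if j < Mul then ln \<rho> else if j < Mul then 0 else 0)"
      by (intro sum.cong) (auto simp: \<sigma>_def C.var_def)
    also have "\<dots> = real Mul * ln \<rho> + real (Mul - Mul) * 0"
      using dims by (intro sum_if_prefix) auto
    finally show ?thesis by simp
  qed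
  then have "(\<Sum>i\<in>C.I. ln (\<sigma> i / C.var i)) = real n * (real Mul * ln \<rho>)"
    unfolding C.sum_I net_simps by (simp add: \<sigma>_def C.var_def)
  with main show ?thesis by (simp only:)
qed

end

context channel
begin

text \<open>All SNR-independent terms per main-channel use. The factor \<open>1 + W\<close> bounds
  the number of main and side uses per main use.\<close>

definition E0 :: real where
  "E0 = B * (real (Nul + Ndl) * (2 + real (Nul + Ndl)) + real Ndl * (1 + real Ndl * W)) * (1 + W)"

text \<open>The exponents in order: uplink streams hidden from M2, visible uplink streams given M2's
  outputs, M2's outputs, side channel.\<close>

definition sum_dof_bound :: real where
  "sum_dof_bound = real (Mul - m) + real m * max 0 (1 - aI) + (real m * max 1 aI + real (Ndl - m)) + W * (real m * aS)"

lemma E0_nonneg: "0 \<le> E0"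
  unfolding E0_def using B_props(1) params by simp

lemma sum_dof_bound_nonneg: "0 \<le> sum_dof_bound"
  unfolding sum_dof_bound_def using params by simp

lemma side_len_le: "real (side_len (net \<rho>) n) \<le> W * real n"
  using params by (simp add: side_len_def)

text \<open>The factor \<open>ln 2 / wm\<close> converts bits per second into nats per main-channel
  use, the unit of the code bounds.\<close>

lemma achievable_bounds:
  assumes ach: "achievable (net \<rho>) R" and \<rho>: "1 < \<rho>"
  shows "fst R * (ln 2 / wm) \<le> real Ndl * ln \<rho> + E0"
    and "snd R * (ln 2 / wm) \<le> real Mul * ln \<rho> + E0"
    and "(fst R + snd R) * (ln 2 / wm) \<le> sum_dof_bound * ln \<rho> + E0"
proof -
  have ln\<rho>: "0 \<le> ln \<rho>" using \<rho> by simp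
  have code: "\<exists>n0. \<forall>n\<ge>n0. (1 - \<epsilon>) * (real n * (fst R * (ln 2 / wm))) \<le> 1 + real n * (real Ndl * ln \<rho> + E0)
      \<and> (1 - \<epsilon>) * (real n * (snd R * (ln 2 / wm))) \<le> 1 + real n * (real Mul * ln \<rho> + E0)
      \<and> (1 - \<epsilon>) * (real n * ((fst R + snd R) * (ln 2 / wm))) \<le> 1 + real n * (sum_dof_bound * ln \<rho> + E0)"
    if \<epsilon>: "0 < \<epsilon>" "\<epsilon> < 1" for \<epsilon>
  proof -
    obtain n0 where n0: "\<And>n. n0 \<le> n \<Longrightarrow> \<exists>Kd Ku xul xs fdl gul gdl.
        real Kd \<ge> 2 powr (real n * fst R / wm) \<and> real Ku \<ge> 2 powr (real n * snd R / wm) \<and>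
        valid_code (net \<rho>) n Kd Ku xul xs fdl gul gdl \<and> error_prob (net \<rho>) n Kd Ku xul xs fdl gul gdl \<le> \<epsilon>"
      using ach \<epsilon> unfolding achievable_def net_simps by meson
    show ?thesis
    proof (intro exI[of _ n0] allI impI)
      fix n assume "n0 \<le> n"
      then obtain Kd Ku xul xs fdl gul gdl where
        K: "2 powr (real n * fst R / wm) \<le> real Kd" "2 powr (real n * snd R / wm) \<le> real Ku"
        and v: "valid_code (net \<rho>) n Kd Ku xul xs fdl gul gdl" and err: "error_prob (net \<rho>) n Kd Ku xul xs fdl gul gdl \<le> \<epsilon>"
        using n0 by blast
      have pos: "0 < Kd" "0 < Ku"
      proof -
        have "0 < real Kd" "0 < real Ku"
          by (rule less_le_trans[OF _ K(1)], simp) (rule less_le_trans[OF _ K(2)], simp)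
        then show "0 < Kd" "0 < Ku" by simp_all
      qed
      interpret cc: channel_code Mdl Nul Mul Ndl wm W lam aI aS h V U S D \<rho> n Kd Ku xul xs fdl gul gdl
      proof unfold_locales
        show "0 \<le> Wr (net \<rho>)" using params by simp
      qed (fact v pos \<rho>)+
      have K1: "real n * (fst R * (ln 2 / wm)) \<le> ln (real Kd)" "real n * (snd R * (ln 2 / wm)) \<le> ln (real Ku)"
      proof -
        have eq: "real n * (x * (ln 2 / wm)) = ln (2 powr (real n * x / wm))" for x :: real
          by (simp add: ln_powr)
        show "real n * (fst R * (ln 2 / wm)) \<le> ln (real Kd)" "real n * (snd R * (ln 2 / wm)) \<le> ln (real Ku)"
          unfolding eq using pos by (subst ln_le_cancel_iff; simp add: K)+
      qed
      have K2: "real n * ((fst R + snd R) * (ln 2 / wm)) \<le> ln (real Kd * real Ku)"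
      proof -
        have "ln (real Kd * real Ku) = ln (real Kd) + ln (real Ku)" using pos by (simp add: ln_mult)
        then show ?thesis using add_mono[OF K1] by (simp only: distrib_left distrib_right)
      qed
      have ec: "B * cc.C.energy_const * (real n + real (side_len (net \<rho>) n)) \<le> real n * E0"
      proof -
        have e0: "0 \<le> B * cc.C.energy_const" using B_props(1) params by (simp add: cc.C.energy_const_def)
        have "real n + real (side_len (net \<rho>) n) \<le> (1 + W) * real n" using side_len_le[of \<rho> n] by (simp add: algebra_simps)
        from mult_left_mono[OF this e0] show ?thesis by (simp add: E0_def cc.C.energy_const_def ac_simps)
      qed
      have mono: "(1 - \<epsilon>) * x \<le> (1 - \<epsilon>) * y" if "x \<le> y" for x y :: real
        using that \<epsilon> by (intro mult_left_mono) auto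
      have "real (side_len (net \<rho>) n) * (real m * aS * ln \<rho>) \<le> (W * real n) * (real m * aS * ln \<rho>)"
        using params ln\<rho> by (intro mult_right_mono side_len_le) simp
      then have s: "real n * ((real (Mul - m) + real m * max 0 (1 - aI) + (real m * max 1 aI + real (Ndl - m))) * ln \<rho>)
          + real (side_len (net \<rho>) n) * (real m * aS * ln \<rho>) \<le> real n * (sum_dof_bound * ln \<rho>)"
        by (simp add: sum_dof_bound_def algebra_simps)
      show "(1 - \<epsilon>) * (real n * (fst R * (ln 2 / wm))) \<le> 1 + real n * (real Ndl * ln \<rho> + E0)
        \<and> (1 - \<epsilon>) * (real n * (snd R * (ln 2 / wm))) \<le> 1 + real n * (real Mul * ln \<rho> + E0)
        \<and> (1 - \<epsilon>) * (real n * ((fst R + snd R) * (ln 2 / wm))) \<le> 1 + real n * (sum_dof_bound * ln \<rho> + E0)"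
        using cc.downlink_rate_code_bound[OF err] cc.uplink_rate_code_bound[OF err] cc.sum_rate_code_bound[OF err]
          mono[OF K1(1)] mono[OF K1(2)] mono[OF K2] ec s unfolding distrib_left[of "real n"] by linarith
    qed
  qed
  show "fst R * (ln 2 / wm) \<le> real Ndl * ln \<rho> + E0"
    by (rule asymptotic_rate_le) (use code ln\<rho> E0_nonneg in \<open>simp, meson\<close>)
  show "snd R * (ln 2 / wm) \<le> real Mul * ln \<rho> + E0"
    by (rule asymptotic_rate_le) (use code ln\<rho> E0_nonneg in \<open>simp, meson\<close>)
  show "(fst R + snd R) * (ln 2 / wm) \<le> sum_dof_bound * ln \<rho> + E0"
    by (rule asymptotic_rate_le) (use code ln\<rho> E0_nonneg sum_dof_bound_nonneg in \<open>simp, meson\<close>)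
qed

text \<open>The capacity region is a closure, and the three inequalities describe closed
  half-planes, so they survive it.\<close>

lemma capacity_bounds:
  assumes "R \<in> capacity_region (net \<rho>)" and \<rho>: "1 < \<rho>"
  shows "fst R * (ln 2 / wm) \<le> real Ndl * ln \<rho> + E0 \<and> snd R * (ln 2 / wm) \<le> real Mul * ln \<rho> + E0
    \<and> (fst R + snd R) * (ln 2 / wm) \<le> sum_dof_bound * ln \<rho> + E0"
proof -
  let ?P = "{R :: real \<times> real. fst R * (ln 2 / wm) \<le> real Ndl * ln \<rho> + E0} \<inter> {R. snd R * (ln 2 / wm) \<le> real Mul * ln \<rho> + E0}
    \<inter> {R. (fst R + snd R) * (ln 2 / wm) \<le> sum_dof_bound * ln \<rho> + E0}"
  have "closed ?P"
    by (intro closed_Int closed_Collect_le continuous_intros)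
  moreover have "{R. achievable (net \<rho>) R} \<subseteq> ?P" using achievable_bounds[OF _ \<rho>] by auto
  ultimately have "capacity_region (net \<rho>) \<subseteq> ?P"
    unfolding capacity_region_def by (rule closure_minimal[rotated])
  then show ?thesis using assms(1) by auto
qed

lemma dof_limit_le:
  fixes f :: "real \<Rightarrow> real"
  assumes "((\<lambda>\<rho>. f \<rho> / (wm * log 2 \<rho>)) \<longlongrightarrow> d) at_top"
    and "\<And>\<rho>. 1 < \<rho> \<Longrightarrow> f \<rho> * (ln 2 / wm) \<le> c * ln \<rho> + E0"
  shows "d \<le> c"
proof (rule tendsto_le[OF _ _ assms(1)])
  have "((\<lambda>\<rho>. E0 / ln \<rho>) \<longlongrightarrow> 0) at_top"
    by (intro real_tendsto_divide_at_top[OF tendsto_const] ln_at_top)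
  then show "((\<lambda>\<rho>. c + E0 / ln \<rho>) \<longlongrightarrow> c) at_top"
    using tendsto_add[OF tendsto_const, of _ 0 at_top c] by simp
  show "\<forall>\<^sub>F \<rho> in at_top. f \<rho> / (wm * log 2 \<rho>) \<le> c + E0 / ln \<rho>"
    using eventually_gt_at_top[of 1]
  proof eventually_elim
    fix \<rho> :: real assume \<rho>: "1 < \<rho>"
    then have l: "0 < ln \<rho>" by simp
    have "f \<rho> / (wm * log 2 \<rho>) = (f \<rho> * (ln 2 / wm)) / ln \<rho>" by (simp add: log_def field_simps)
    also have "\<dots> \<le> (c * ln \<rho> + E0) / ln \<rho>" using assms(2)[OF \<rho>] l by (intro divide_right_mono) auto
    also have "\<dots> = c + E0 / ln \<rho>" using l by (simp add: field_simps)
    finally show "f \<rho> / (wm * log 2 \<rho>) \<le> c + E0 / ln \<rho>" .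
  qed
qed simp

theorem gdof_converse:
  assumes "d \<in> gdof_region net wm"
  shows "fst d + snd d \<le> min (real Mul + real Ndl) sum_dof_bound"
proof -
  obtain R where R: "\<And>\<rho>. 1 < \<rho> \<Longrightarrow> R \<rho> \<in> capacity_region (net \<rho>)"
    and l1: "((\<lambda>\<rho>. fst (R \<rho>) / (wm * log 2 \<rho>)) \<longlongrightarrow> fst d) at_top"
    and l2: "((\<lambda>\<rho>. snd (R \<rho>) / (wm * log 2 \<rho>)) \<longlongrightarrow> snd d) at_top"
    using assms unfolding gdof_region_def by (cases d) (simp, blast)
  have "fst d \<le> real Ndl" "snd d \<le> real Mul"
    using dof_limit_le[OF l1] dof_limit_le[OF l2] capacity_bounds[OF R] by auto
  moreover have "fst d + snd d \<le> sum_dof_bound"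
  proof (rule dof_limit_le)
    show "((\<lambda>\<rho>. (fst (R \<rho>) + snd (R \<rho>)) / (wm * log 2 \<rho>)) \<longlongrightarrow> fst d + snd d) at_top"
      using tendsto_add[OF l1 l2] by (simp add: add_divide_distrib)
  qed (use capacity_bounds[OF R] in auto)
  ultimately show ?thesis by simp
qed

end

section \<open>Outer codes\<close>

definition hdist :: "nat \<Rightarrow> (nat \<Rightarrow> 'a) \<Rightarrow> (nat \<Rightarrow> 'a) \<Rightarrow> nat" where
  "hdist n x y = card {t. t < n \<and> x t \<noteq> y t}"

lemma hdist_triangle: "hdist n x z \<le> hdist n y x + hdist n y z"
proof -
  have "hdist n x z \<le> card ({t. t < n \<and> y t \<noteq> x t} \<union> {t. t < n \<and> y t \<noteq> z t})"
    unfolding hdist_def by (rule card_mono) auto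
  also have "\<dots> \<le> hdist n y x + hdist n y z"
    unfolding hdist_def by (rule card_Un_le)
  finally show ?thesis .
qed

text \<open>A crude count: choose the set of deviating positions, then the symbols there. The factor
  \<open>2 ^ n\<close> costs one bit per symbol, which is harmless because the alphabets grow with
  the SNR.\<close>

lemma card_hamming_ball_le:
  assumes "finite A" "A \<noteq> {}" "c \<in> PiE {..<n} (\<lambda>_. A)"
  shows "card {w \<in> PiE {..<n} (\<lambda>_. A). hdist n w c \<le> r} \<le> 2 ^ n * card A ^ r"
proof -
  have q: "1 \<le> card A" using assms(1,2) by (simp add: Suc_le_eq card_gt_0_iff)
  let ?W = "PiE {..<n} (\<lambda>_. A)"
  let ?Ts = "{T. T \<subseteq> {..<n} \<and> card T \<le> r}"
  \<comment> \<open>Words that agree with \<open>c\<close> outside \<open>T\<close>; such a word is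
    determined by its restriction to \<open>T\<close>.\<close>
  define Q where "Q T = {w \<in> ?W. \<forall>t\<in>{..<n} - T. w t = c t}" for T
  have finW: "finite ?W" using assms(1) by (intro finite_PiE) auto
  have "{w \<in> ?W. hdist n w c \<le> r} \<subseteq> (\<Union>T\<in>?Ts. Q T)"
  proof safe
    fix w assume w: "w \<in> ?W" "hdist n w c \<le> r"
    show "w \<in> (\<Union>T\<in>?Ts. Q T)"
      by (rule UN_I[of "{t. t < n \<and> w t \<noteq> c t}"]) (use w in \<open>auto simp: hdist_def Q_def\<close>)
  qed
  then have "card {w \<in> ?W. hdist n w c \<le> r} \<le> card (\<Union>T\<in>?Ts. Q T)"
    using finW by (intro card_mono finite_UN_I) (auto simp: Q_def)
  also have "\<dots> \<le> (\<Sum>T\<in>?Ts. card (Q T))" by (rule card_UN_le) auto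
  also have "\<dots> \<le> (\<Sum>T\<in>?Ts. card A ^ r)"
  proof (rule sum_mono)
    fix T assume T: "T \<in> ?Ts"
    then have finT: "finite T" using finite_subset by blast
    have "card (Q T) = card ((\<lambda>w. restrict w T) ` Q T)"
    proof (rule card_image[symmetric], rule inj_onI)
      fix w w' assume w: "w \<in> Q T" "w' \<in> Q T" and eq: "restrict w T = restrict w' T"
      show "w = w'"
      proof (rule PiE_ext)
        show "w \<in> ?W" "w' \<in> ?W" using w by (auto simp: Q_def)
        fix t assume "t \<in> {..<n}"
        then show "w t = w' t" using w fun_cong[OF eq, of t] by (cases "t \<in> T") (auto simp: Q_def)
      qed
    qed
    also have "\<dots> \<le> card (PiE T (\<lambda>_. A))"
      using T finT assms(1) by (intro card_mono finite_PiE) (auto simp: Q_def)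
    also have "\<dots> = card A ^ card T" using finT by (simp add: card_PiE)
    also have "\<dots> \<le> card A ^ r" using T q by (intro power_increasing) auto
    finally show "card (Q T) \<le> card A ^ r" .
  qed
  also have "\<dots> = card ?Ts * card A ^ r" by simp
  also have "card ?Ts \<le> card (Pow {..<n})" by (rule card_mono) auto
  finally show ?thesis by (simp add: card_Pow)
qed

text \<open>In a code of maximal size the balls of radius \<open>r\<close> around the codewords
  cover all words, since an uncovered word could be added.\<close>

lemma gilbert_varshamov:
  assumes "finite A" "A \<noteq> {}"
  shows "\<exists>C. C \<subseteq> PiE {..<n} (\<lambda>_. A) \<and> (\<forall>c\<in>C. \<forall>c'\<in>C. c \<noteq> c' \<longrightarrow> r < hdist n c c') \<and>
    card A ^ n \<le> card C * (2 ^ n * card A ^ r)"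
proof -
  let ?W = "PiE {..<n} (\<lambda>_. A)"
  define P where "P C \<longleftrightarrow> C \<subseteq> ?W \<and> (\<forall>c\<in>C. \<forall>c'\<in>C. c \<noteq> c' \<longrightarrow> r < hdist n c c')" for C
  have finW: "finite ?W" using assms(1) by (intro finite_PiE) auto
  have "P {}" by (simp add: P_def)
  moreover have "\<forall>C. P C \<longrightarrow> card C < Suc (card ?W)"
    using finW by (auto simp: P_def less_Suc_eq_le intro: card_mono)
  ultimately obtain C where C: "P C" and max: "\<And>C'. P C' \<Longrightarrow> card C' \<le> card C"
    using ex_has_greatest_nat[of P "{}" card "Suc (card ?W)"] by auto
  have finC: "finite C" using C finW finite_subset unfolding P_def by blast
  have cover: "?W \<subseteq> (\<Union>c\<in>C. {w \<in> ?W. hdist n w c \<le> r})"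
  proof
    fix w assume w: "w \<in> ?W"
    show "w \<in> (\<Union>c\<in>C. {w \<in> ?W. hdist n w c \<le> r})"
    proof (rule ccontr)
      assume "w \<notin> (\<Union>c\<in>C. {w \<in> ?W. hdist n w c \<le> r})"
      then have far: "r < hdist n w c" if "c \<in> C" for c using w that by (auto simp: not_le)
      have sym: "hdist n x y = hdist n y x" for x y :: "nat \<Rightarrow> 'a" by (simp add: hdist_def eq_commute)
      have "w \<notin> C" using far[of w] by (auto simp: hdist_def)
      moreover have "P (insert w C)" using C w far unfolding P_def by (auto simp: sym)
      ultimately show False using max[of "insert w C"] finC by simp
    qed
  qed
  have "card A ^ n = card ?W" by (simp add: card_PiE)
  also have "\<dots> \<le> card (\<Union>c\<in>C. {w \<in> ?W. hdist n w c \<le> r})"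
    using cover finW finC by (intro card_mono) auto
  also have "\<dots> \<le> (\<Sum>c\<in>C. card {w \<in> ?W. hdist n w c \<le> r})" using finC by (rule card_UN_le)
  also have "\<dots> \<le> (\<Sum>c\<in>C. 2 ^ n * card A ^ r)"
    using C assms by (intro sum_mono card_hamming_ball_le) (auto simp: P_def)
  finally show ?thesis using C by (auto simp: P_def intro!: exI[of _ C])
qed

text \<open>Bits per symbol of the code below: the fraction \<open>2 / L\<close> pays for the
  minimum distance, the 1 for the factor \<open>2 ^ n\<close> in the ball count. When nothing is
  left, a code with a single word serves.\<close>

definition code_rate :: "nat \<Rightarrow> 'a set \<Rightarrow> real" where
  "code_rate L A = max 0 ((1 - 2 / real L) * log 2 (real (card A)) - 1)"

lemma code_rate_nonneg: "0 \<le> code_rate L A" by (simp add: code_rate_def)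

lemma exists_code:
  assumes "finite A" "A \<noteq> {}" "0 < L"
  shows "\<exists>K (cw :: nat \<Rightarrow> nat \<Rightarrow> 'a). 0 < K \<and> 2 powr (real n * code_rate L A) \<le> real K \<and>
    (\<forall>i<K. \<forall>t<n. cw i t \<in> A) \<and> (\<forall>i<K. \<forall>j<K. i \<noteq> j \<longrightarrow> 2 * (n div L) < hdist n (cw i) (cw j))"
proof -
  let ?e = "n div L" and ?q = "real (card A)"
  obtain C where C: "C \<subseteq> PiE {..<n} (\<lambda>_. A)" "\<And>c c'. c \<in> C \<Longrightarrow> c' \<in> C \<Longrightarrow> c \<noteq> c' \<Longrightarrow> 2 * ?e < hdist n c c'"
    "card A ^ n \<le> card C * (2 ^ n * card A ^ (2 * ?e))"
    using gilbert_varshamov[OF assms(1,2), of n "2 * ?e"] by blast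
  have q: "1 \<le> ?q" using assms by (simp add: Suc_le_eq card_gt_0_iff)
  have "finite C" using C(1) assms(1) finite_subset[OF _ finite_PiE] by blast
  then obtain cw where bij: "bij_betw cw {0..<card C} C" using ex_bij_betw_nat_finite by blast
  have K: "0 < card C"
  proof (rule ccontr)
    assume "\<not> 0 < card C"
    then show False using C(3) q by simp
  qed
  have "2 powr (real n * code_rate L A) \<le> real (card C)"
  proof (cases "(1 - 2 / real L) * log 2 ?q - 1 \<le> 0")
    case True
    then show ?thesis using K by (simp add: code_rate_def)
  next
    case False
    have "?q ^ n \<le> real (card C) * (2 ^ n * ?q ^ (2 * ?e))"
      using C(3)[folded of_nat_le_iff[where ?'a = real]] by simp
    also have "?q ^ (2 * ?e) \<le> ?q powr (2 * real n / real L)"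
    proof -
      have "real (2 * ?e) \<le> 2 * real n / real L"
      proof -
        have "real (?e * L) \<le> real n" by (simp only: of_nat_le_iff) simp
        then show ?thesis using assms(3) by (simp add: pos_le_divide_eq)
      qed
      then show ?thesis using q by (subst powr_realpow[symmetric]) (auto intro: powr_mono)
    qed
    finally have *: "?q powr real n \<le> real (card C) * (2 powr real n * ?q powr (2 * real n / real L))"
      using q by (simp add: powr_realpow mult_left_mono)
    have "2 powr (real n * code_rate L A) = 2 powr (log 2 ?q * (real n - 2 * real n / real L) - real n)"
      using False by (simp add: code_rate_def algebra_simps)
    also have "\<dots> = ?q powr (real n - 2 * real n / real L) / 2 powr real n"
      using q by (simp add: powr_diff powr_powr[symmetric])
    also have "\<dots> = ?q powr real n / (2 powr real n * ?q powr (2 * real n / real L))"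
      using q by (simp add: powr_diff)
    also have "\<dots> \<le> real (card C)" using * q by (simp add: pos_divide_le_eq)
    finally show ?thesis .
  qed
  moreover have "\<forall>i<card C. \<forall>t<n. cw i t \<in> A"
    using bij C(1) by (auto simp: bij_betw_def PiE_iff dest!: subsetD)
  moreover have "\<forall>i<card C. \<forall>j<card C. i \<noteq> j \<longrightarrow> 2 * ?e < hdist n (cw i) (cw j)"
    using bij C(2) by (fastforce simp: bij_betw_def inj_on_def)
  ultimately show ?thesis using K by blast
qed

section \<open>Decoding, measurability and tail bounds\<close>

definition decode :: "nat \<Rightarrow> nat \<Rightarrow> nat \<Rightarrow> (nat \<Rightarrow> nat \<Rightarrow> 'a) \<Rightarrow> (nat \<Rightarrow> 'a) \<Rightarrow> nat" where
  "decode n e K cw s = (SOME i. i < K \<and> hdist n s (cw i) \<le> e)"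

lemma decode_eq:
  assumes "i < K" "hdist n s (cw i) \<le> e" "\<And>j. j < K \<Longrightarrow> j \<noteq> i \<Longrightarrow> 2 * e < hdist n (cw i) (cw j)"
  shows "decode n e K cw s = i"
  unfolding decode_def
proof (rule some_equality)
  fix j assume j: "j < K \<and> hdist n s (cw j) \<le> e"
  have "hdist n (cw i) (cw j) \<le> 2 * e"
    using hdist_triangle[of n "cw i" "cw j" s] assms(2) j by simp
  then show "j = i" using assms(3)[of j] j by force
qed (use assms in auto)

text \<open>The decoders use Hilbert choice and are arbitrary functions, but they depend on the
  outputs only through finitely many threshold tests. Hence measurability of the tests is enough for
  the error event.\<close>

lemma sets_Collect_finite_dependence:
  assumes "finite X" "\<And>x. x \<in> X \<Longrightarrow> {\<omega> \<in> space M. P x \<omega>} \<in> sets M"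
  shows "{\<omega> \<in> space M. Q {x \<in> X. P x \<omega>}} \<in> sets M"
proof -
  have "{\<omega> \<in> space M. Q {x \<in> X. P x \<omega>}} = (\<Union>Z\<in>{Z \<in> Pow X. Q Z}. {\<omega> \<in> space M. \<forall>x\<in>X. P x \<omega> \<longleftrightarrow> x \<in> Z})"
  proof (intro equalityI subsetI)
    fix \<omega> assume "\<omega> \<in> {\<omega> \<in> space M. Q {x \<in> X. P x \<omega>}}"
    then show "\<omega> \<in> (\<Union>Z\<in>{Z \<in> Pow X. Q Z}. {\<omega> \<in> space M. \<forall>x\<in>X. P x \<omega> \<longleftrightarrow> x \<in> Z})"
      by (intro UN_I[of "{x \<in> X. P x \<omega>}"]) auto
  next
    fix \<omega> assume "\<omega> \<in> (\<Union>Z\<in>{Z \<in> Pow X. Q Z}. {\<omega> \<in> space M. \<forall>x\<in>X. P x \<omega> \<longleftrightarrow> x \<in> Z})"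
    then obtain Z where Z: "Z \<subseteq> X" "Q Z" "\<omega> \<in> space M" "\<forall>x\<in>X. P x \<omega> \<longleftrightarrow> x \<in> Z" by auto
    then have "{x \<in> X. P x \<omega>} = Z" by auto
    then show "\<omega> \<in> {\<omega> \<in> space M. Q {x \<in> X. P x \<omega>}}" using Z by simp
  qed
  also have "\<dots> \<in> sets M"
  proof (intro sets.finite_UN)
    fix Z assume "Z \<in> {Z \<in> Pow X. Q Z}"
    show "{\<omega> \<in> space M. \<forall>x\<in>X. P x \<omega> \<longleftrightarrow> x \<in> Z} \<in> sets M"
    proof (rule sets.sets_Collect_finite_All[OF _ assms(1)])
      fix x assume x: "x \<in> X"
      show "{\<omega> \<in> space M. P x \<omega> \<longleftrightarrow> x \<in> Z} \<in> sets M"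
        using assms(2)[OF x] sets.sets_Collect_neg[OF assms(2)[OF x]] by (cases "x \<in> Z") auto
    qed
  qed (use assms(1) in auto)
  finally show ?thesis .
qed

text \<open>Union bound over the sets of \<open>e + 1\<close> coordinates that may be large: there
  are at most \<open>2 ^ card J\<close> of them, and by independence each has probability at most
  \<open>p ^ Suc e\<close>.\<close>

lemma PiM_many_large_coordinates:
  fixes s :: "'i \<Rightarrow> real"
  assumes "finite I" "J \<subseteq> I" "\<And>i. i \<in> I \<Longrightarrow> 0 < s i" "0 < g" "0 \<le> p" "\<And>i. i \<in> J \<Longrightarrow> s i / g\<^sup>2 \<le> p"
  shows "{\<omega> \<in> space (PiM I (\<lambda>i. cgauss (s i))). e < card {i \<in> J. g < cmod (\<omega> i)}} \<in> sets (PiM I (\<lambda>i. cgauss (s i)))"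
    and "measure (PiM I (\<lambda>i. cgauss (s i))) {\<omega> \<in> space (PiM I (\<lambda>i. cgauss (s i))). e < card {i \<in> J. g < cmod (\<omega> i)}}
      \<le> 2 ^ card J * p ^ Suc e"
proof -
  define M where "M = (\<lambda>i. cgauss (if i \<in> I then s i else 1))"
  have PM: "PiM I (\<lambda>i. cgauss (s i)) = PiM I M" unfolding M_def by (rule PiM_cong) auto
  have psM: "prob_space (M i)" for i unfolding M_def using assms(3) by (intro prob_space_cgauss) auto
  interpret product_prob_space M I
    using psM unfolding product_prob_space_def product_sigma_finite_def product_prob_space_axioms_def
    by (auto intro: prob_space_imp_sigma_finite)
  interpret F: finite_product_prob_space M I by unfold_locales (rule assms(1))
  interpret P: prob_space "PiM I M" by (rule prob_space_PiM) (rule psM)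
  have finJ: "finite J" using assms(1,2) finite_subset by blast
  have big: "{z. g < cmod z} \<in> sets (M i)" for i unfolding M_def by (simp add: open_Collect_less)
  have comp: "{\<omega> \<in> space (PiM I M). g < cmod (\<omega> i)} \<in> sets (PiM I M)" if "i \<in> J" for i
  proof -
    have "(\<lambda>\<omega>. \<omega> i) -` {z. g < cmod z} \<inter> space (PiM I M) \<in> sets (PiM I M)"
      using that assms(2) by (intro measurable_sets[OF measurable_component_singleton[of i I M] big]) auto
    then show ?thesis by (simp add: vimage_def Int_def conj_commute)
  qed
  from sets_Collect_finite_dependence[OF finJ comp, where Q = "\<lambda>Z. e < card Z"]
  show "{\<omega> \<in> space (PiM I (\<lambda>i. cgauss (s i))). e < card {i \<in> J. g < cmod (\<omega> i)}} \<in> sets (PiM I (\<lambda>i. cgauss (s i)))"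
    unfolding PM .
  let ?Ts = "{T. T \<subseteq> J \<and> card T = Suc e}"
  define box where "box T = PiE I (\<lambda>i. if i \<in> T then {z. g < cmod z} else UNIV)" for T
  have box_sets: "box T \<in> sets (PiM I M)" for T
    unfolding box_def using assms(1) big by (intro sets_PiM_I_finite) (auto simp: M_def)
  have "{\<omega> \<in> space (PiM I M). e < card {i \<in> J. g < cmod (\<omega> i)}} \<subseteq> (\<Union>T\<in>?Ts. box T)"
  proof safe
    fix \<omega> assume \<omega>: "\<omega> \<in> space (PiM I M)" "e < card {i \<in> J. g < cmod (\<omega> i)}"
    then obtain T where T: "T \<subseteq> {i \<in> J. g < cmod (\<omega> i)}" "card T = Suc e"
      using obtain_subset_with_card_n[of "Suc e"] by (metis Suc_leI)
    then show "\<omega> \<in> (\<Union>T\<in>?Ts. box T)"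
      using \<omega>(1) by (intro UN_I[of T]) (auto simp: box_def space_PiM PiE_iff M_def)
  qed
  then have "P.prob {\<omega> \<in> space (PiM I M). e < card {i \<in> J. g < cmod (\<omega> i)}} \<le> P.prob (\<Union>T\<in>?Ts. box T)"
    using box_sets finJ by (intro P.finite_measure_mono sets.finite_UN) auto
  also have "\<dots> \<le> (\<Sum>T\<in>?Ts. P.prob (box T))"
    using box_sets finJ by (intro P.finite_measure_subadditive_finite) auto
  also have "\<dots> \<le> (\<Sum>T\<in>?Ts. p ^ Suc e)"
  proof (rule sum_mono)
    fix T assume T: "T \<in> ?Ts"
    have "P.prob (box T) = (\<Prod>i\<in>I. measure (M i) (if i \<in> T then {z. g < cmod z} else UNIV))"
      unfolding box_def using big by (intro F.prob_times) (auto simp: M_def)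
    also have "\<dots> = (\<Prod>i\<in>T. measure (M i) {z. g < cmod z})"
    proof -
      have "measure (M i) UNIV = 1" for i
        using prob_space.prob_space[OF psM[of i]] by (simp add: M_def)
      then have "(\<Prod>i\<in>I. measure (M i) (if i \<in> T then {z. g < cmod z} else UNIV)) = (\<Prod>i\<in>I. if i \<in> T then measure (M i) {z. g < cmod z} else 1)"
        by (intro prod.cong) auto
      also have "\<dots> = (\<Prod>i\<in>I \<inter> T. measure (M i) {z. g < cmod z})"
        using assms(1) by (rule prod.inter_restrict[symmetric])
      also have "I \<inter> T = T" using T assms(2) by auto
      finally show ?thesis .
    qed
    also have "\<dots> \<le> (\<Prod>i\<in>T. p)"
    proof (rule prod_mono, intro conjI)
      fix i assume "i \<in> T"
      then have i: "i \<in> I" "i \<in> J" using T assms(2) by auto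
      have "emeasure (M i) {z. g < cmod z} \<le> ennreal (s i / g\<^sup>2)"
        unfolding M_def using cgauss_tail[OF assms(3)[OF i(1)] assms(4)] i by simp
      then have "measure (M i) {z. g < cmod z} \<le> s i / g\<^sup>2"
        using assms(3)[OF i(1)] assms(4) unfolding measure_def by (intro enn2real_leI) auto
      then show "measure (M i) {z. g < cmod z} \<le> p" using assms(6)[OF i(2)] by simp
    qed simp
    also have "\<dots> = p ^ Suc e" using T by simp
    finally show "P.prob (box T) \<le> p ^ Suc e" .
  qed
  also have "\<dots> = card ?Ts * p ^ Suc e" by simp
  also have "\<dots> \<le> 2 ^ card J * p ^ Suc e"
  proof (rule mult_right_mono)
    have "card ?Ts \<le> card (Pow J)" using finJ by (intro card_mono) auto
    then have "card ?Ts \<le> 2 ^ card J" using finJ by (simp add: card_Pow)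
    then show "real (card ?Ts) \<le> 2 ^ card J" by (metis of_nat_le_iff of_nat_numeral of_nat_power)
  qed (use assms(5) in simp)
  finally show "measure (PiM I (\<lambda>i. cgauss (s i))) {\<omega> \<in> space (PiM I (\<lambda>i. cgauss (s i))). e < card {i \<in> J. g < cmod (\<omega> i)}}
      \<le> 2 ^ card J * p ^ Suc e" unfolding PM .
qed

text \<open>Symbol alphabets: \<open>SD\<close> for the downlink, \<open>SA\<close> and
  \<open>SB\<close> for the two digits of the uplink, \<open>SS\<close> for the side channel. In
  \<open>sep_dl\<close> both candidates share the symbol \<open>b\<close>, which M2 learns over the
  side channel, and \<open>a\<close> need not be recovered. \<open>noise_level\<close> is tuned so
  that a fraction \<open>1 / L\<close> of large noise coordinates beats the count of their possible
  positions, with \<open>n_Nul N + n_Ndl N\<close> coordinates per slot.\<close>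

locale scheme =
  fixes N :: fdnet and L :: nat and g :: real
    and SD :: "'d set" and SA :: "'a set" and SB :: "'b set" and SS :: "'s set"
    and xd :: "'d \<Rightarrow> nat \<Rightarrow> complex" and xu :: "'a \<Rightarrow> 'b \<Rightarrow> nat \<Rightarrow> complex" and xside :: "'s \<Rightarrow> nat \<Rightarrow> complex"
    and sD :: "'d \<Rightarrow> nat \<Rightarrow> complex" and sU sI :: "'a \<Rightarrow> 'b \<Rightarrow> nat \<Rightarrow> complex" and sS :: "'s \<Rightarrow> nat \<Rightarrow> complex"
  assumes W: "0 \<le> Wr N" and Wm: "0 < Wm N" and L: "0 < L" and g: "0 < g"
    and noise_level: "max 1 (Wr N) / g\<^sup>2 \<le> (1 / 2) ^ (L * (n_Nul N + n_Ndl N + 1))"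
    and finite_sets: "finite SD" "finite SA" "finite SB" "finite SS"
    and nonempty: "SD \<noteq> {}" "SA \<noteq> {}" "SB \<noteq> {}" "SS \<noteq> {}"
    and power_d: "\<And>d. d \<in> SD \<Longrightarrow> sqnorm (n_Mdl N) (xd d) \<le> 1"
    and power_u: "\<And>a b. a \<in> SA \<Longrightarrow> b \<in> SB \<Longrightarrow> sqnorm (n_Mul N) (xu a b) \<le> 1"
    and power_s: "\<And>s. s \<in> SS \<Longrightarrow> sqnorm (n_Mul N) (xside s) \<le> 1"
    and sD_def: "\<And>d i. sD d i = complex_of_real (sqrt (snr_dl N)) * (\<Sum>j<n_Mdl N. H_dl N i j * xd d j)"
    and sU_def: "\<And>a b i. sU a b i = complex_of_real (sqrt ((1 - lam N) * snr_ul N)) * (\<Sum>j<n_Mul N. H_ul N i j * xu a b j)"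
    and sI_def: "\<And>a b i. sI a b i = complex_of_real (sqrt ((1 - lam N) * snr_I N)) * (\<Sum>j<n_Mul N. H_I N i j * xu a b j)"
    and sS_def: "\<And>s i. sS s i = complex_of_real (sqrt (lam N * snr_S N)) * (\<Sum>j<n_Mul N. H_S N i j * xside s j)"
    and sep_ul: "\<And>a b a' b'. a \<in> SA \<Longrightarrow> b \<in> SB \<Longrightarrow> a' \<in> SA \<Longrightarrow> b' \<in> SB \<Longrightarrow>
        (\<And>i. i < n_Nul N \<Longrightarrow> cmod (sU a b i - sU a' b' i) \<le> 2 * g) \<Longrightarrow> a = a' \<and> b = b'"
    and sep_dl: "\<And>d d' a a' b. d \<in> SD \<Longrightarrow> d' \<in> SD \<Longrightarrow> a \<in> SA \<Longrightarrow> a' \<in> SA \<Longrightarrow> b \<in> SB \<Longrightarrow>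
        (\<And>i. i < n_Ndl N \<Longrightarrow> cmod ((sD d i + sI a b i) - (sD d' i + sI a' b i)) \<le> 2 * g) \<Longrightarrow> d = d'"
    and sep_side: "\<And>s s'. s \<in> SS \<Longrightarrow> s' \<in> SS \<Longrightarrow>
        (\<And>i. i < n_Ndl N \<Longrightarrow> cmod (sS s i - sS s' i) \<le> 2 * g) \<Longrightarrow> s = s'"

text \<open>The uplink message is the pair \<open>(wu mod KA, wu div KA)\<close>. Its second
  component is encoded twice, by \<open>cB\<close> on the main channel and by \<open>cS\<close> on
  the side channel, so both codes have the same number \<open>KB\<close> of words.\<close>

locale scheme_code = scheme N L g SD SA SB SS xd xu xside sD sU sI sS + noise_model N n
  for N :: fdnet and L :: nat and g :: real
    and SD :: "'d set" and SA :: "'a set" and SB :: "'b set" and SS :: "'s set"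
    and xd :: "'d \<Rightarrow> nat \<Rightarrow> complex" and xu :: "'a \<Rightarrow> 'b \<Rightarrow> nat \<Rightarrow> complex" and xside :: "'s \<Rightarrow> nat \<Rightarrow> complex"
    and sD :: "'d \<Rightarrow> nat \<Rightarrow> complex" and sU sI :: "'a \<Rightarrow> 'b \<Rightarrow> nat \<Rightarrow> complex" and sS :: "'s \<Rightarrow> nat \<Rightarrow> complex"
    and n :: nat +
  fixes KD KA KB :: nat and cD :: "nat \<Rightarrow> nat \<Rightarrow> 'd" and cA :: "nat \<Rightarrow> nat \<Rightarrow> 'a" and cB :: "nat \<Rightarrow> nat \<Rightarrow> 'b" and cS :: "nat \<Rightarrow> nat \<Rightarrow> 's"
  assumes K_pos: "0 < KD" "0 < KA" "0 < KB"
    and cD: "\<And>i t. i < KD \<Longrightarrow> t < n \<Longrightarrow> cD i t \<in> SD"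
      "\<And>i j. i < KD \<Longrightarrow> j < KD \<Longrightarrow> i \<noteq> j \<Longrightarrow> 2 * (n div L) < hdist n (cD i) (cD j)"
    and cA: "\<And>i t. i < KA \<Longrightarrow> t < n \<Longrightarrow> cA i t \<in> SA"
      "\<And>i j. i < KA \<Longrightarrow> j < KA \<Longrightarrow> i \<noteq> j \<Longrightarrow> 2 * (n div L) < hdist n (cA i) (cA j)"
    and cB: "\<And>i t. i < KB \<Longrightarrow> t < n \<Longrightarrow> cB i t \<in> SB"
      "\<And>i j. i < KB \<Longrightarrow> j < KB \<Longrightarrow> i \<noteq> j \<Longrightarrow> 2 * (n div L) < hdist n (cB i) (cB j)"
    and cS: "\<And>i t. i < KB \<Longrightarrow> t < side_len N n \<Longrightarrow> cS i t \<in> SS"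
      "\<And>i j. i < KB \<Longrightarrow> j < KB \<Longrightarrow> i \<noteq> j \<Longrightarrow> 2 * (side_len N n div L) < hdist (side_len N n) (cS i) (cS j)"
begin

definition xul :: "nat \<Rightarrow> nat \<Rightarrow> nat \<Rightarrow> complex" where
  "xul wu t = xu (cA (wu mod KA) t) (cB (wu div KA) t)"
definition xs :: "nat \<Rightarrow> nat \<Rightarrow> nat \<Rightarrow> complex" where
  "xs wu t = xside (cS (wu div KA) t)"
definition fdl :: "nat \<Rightarrow> nat \<Rightarrow> (nat \<Rightarrow> nat \<Rightarrow> complex) \<Rightarrow> nat \<Rightarrow> complex" where
  "fdl wd t _ = xd (cD wd t)"

definition okU :: "(nat \<Rightarrow> nat \<Rightarrow> complex) \<Rightarrow> nat \<times> 'a \<times> 'b \<Rightarrow> bool" where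
  "okU y = (\<lambda>(t, a, b). \<forall>i<n_Nul N. cmod (y t i - sU a b i) \<le> g)"
definition okD :: "(nat \<Rightarrow> nat \<Rightarrow> complex) \<Rightarrow> nat \<times> 'a \<times> 'b \<times> 'd \<Rightarrow> bool" where
  "okD y = (\<lambda>(t, a, b, d). \<forall>i<n_Ndl N. cmod (y t i - (sD d i + sI a b i)) \<le> g)"
definition okS :: "(nat \<Rightarrow> nat \<Rightarrow> complex) \<Rightarrow> nat \<times> 's \<Rightarrow> bool" where
  "okS y = (\<lambda>(t, s). \<forall>i<n_Ndl N. cmod (y t i - sS s i) \<le> g)"

abbreviation "XU \<equiv> {..<n} \<times> SA \<times> SB"
abbreviation "XD \<equiv> {..<n} \<times> SA \<times> SB \<times> SD"
abbreviation "XS \<equiv> {..<side_len N n} \<times> SS"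

text \<open>Decoders receive only the finite set of candidates that pass the threshold test, the
  form in which \<open>sets_Collect_finite_dependence\<close> applies.\<close>

definition decU :: "(nat \<times> 'a \<times> 'b) set \<Rightarrow> nat" where
  "decU Z = decode n (n div L) KA cA (\<lambda>t. fst (SOME p. (t, p) \<in> Z)) + KA * decode n (n div L) KB cB (\<lambda>t. snd (SOME p. (t, p) \<in> Z))"
definition decS :: "(nat \<times> 's) set \<Rightarrow> nat" where
  "decS Z = decode (side_len N n) (side_len N n div L) KB cS (\<lambda>t. SOME s. (t, s) \<in> Z)"
text \<open>\<open>w\<close> is the uplink component obtained from the side channel. Its codeword
  fixes the digit \<open>b\<close> of every slot, while the digit \<open>a\<close> is only required
  to exist.\<close>

definition decD :: "nat \<Rightarrow> (nat \<times> 'a \<times> 'b \<times> 'd) set \<Rightarrow> nat" where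
  "decD w Z = decode n (n div L) KD cD (\<lambda>t. SOME d. \<exists>a. (t, a, cB w t, d) \<in> Z)"

definition gul :: "nat \<Rightarrow> (nat \<Rightarrow> nat \<Rightarrow> complex) \<Rightarrow> nat" where
  "gul wd y = decU {x \<in> XU. okU y x}"
definition gdl :: "(nat \<Rightarrow> nat \<Rightarrow> complex) \<Rightarrow> (nat \<Rightarrow> nat \<Rightarrow> complex) \<Rightarrow> nat" where
  "gdl y ys = decD (decS {x \<in> XS. okS ys x}) {x \<in> XD. okD y x}"

definition bad_main :: "(nat \<times> nat \<times> nat \<Rightarrow> complex) set" where
  "bad_main = {\<omega> \<in> space (noise_space N n). n div L < card {i \<in> {i \<in> I. fst i \<noteq> 2}. g < cmod (\<omega> i)}}"
definition bad_side :: "(nat \<times> nat \<times> nat \<Rightarrow> complex) set" where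
  "bad_side = {\<omega> \<in> space (noise_space N n). side_len N n div L < card {i \<in> {i \<in> I. fst i = 2}. g < cmod (\<omega> i)}}"

lemma msg:
  assumes "wu < KA * KB"
  shows "wu mod KA < KA" "wu div KA < KB" "wu mod KA + KA * (wu div KA) = wu"
  using assms K_pos by (auto simp: less_mult_imp_div_less mult.commute)

text \<open>A symbol can be wrong only in a slot with some large noise coordinate, so the number of
  symbol errors is at most the number of large coordinates.\<close>

lemma hdist_bad_times:
  assumes "card {i \<in> {i \<in> I. P (fst i)}. g < cmod (\<omega> i)} \<le> e"
    and "\<And>t. t < k \<Longrightarrow> (\<And>i. i \<in> I \<Longrightarrow> P (fst i) \<Longrightarrow> fst (snd i) = t \<Longrightarrow> cmod (\<omega> i) \<le> g) \<Longrightarrow> x t = y t"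
  shows "hdist k x y \<le> e"
proof -
  let ?S = "{i \<in> {i \<in> I. P (fst i)}. g < cmod (\<omega> i)}"
  have fin: "finite ?S" using finite_I by simp
  have "{t. t < k \<and> x t \<noteq> y t} \<subseteq> (\<lambda>i. fst (snd i)) ` ?S"
  proof
    fix t assume t: "t \<in> {t. t < k \<and> x t \<noteq> y t}"
    then obtain i where "i \<in> I" "P (fst i)" "fst (snd i) = t" "\<not> cmod (\<omega> i) \<le> g"
      using assms(2)[of t] by auto
    then show "t \<in> (\<lambda>i. fst (snd i)) ` ?S" by (intro image_eqI[of _ _ i]) auto
  qed
  then have "hdist k x y \<le> card ((\<lambda>i. fst (snd i)) ` ?S)"
    unfolding hdist_def using fin by (intro card_mono) auto
  also have "\<dots> \<le> card ?S" using fin by (rule card_image_le)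
  finally show ?thesis using assms(1) by simp
qed

lemma triangle_sep: "cmod (y - u) \<le> g \<Longrightarrow> cmod (y - v) \<le> g \<Longrightarrow> cmod (u - v) \<le> 2 * g"
  using norm_triangle_ineq4[of "y - v" "y - u"] by simp

lemma yul_eq:
  "t < n \<Longrightarrow> i < n_Nul N \<Longrightarrow> y_ul N n (xul wu) \<omega> t i = sU (cA (wu mod KA) t) (cB (wu div KA) t) i + \<omega> (0, t, i)"
  by (simp add: y_ul_def sU_def xul_def)

lemma ydl_eq:
  "t < n \<Longrightarrow> i < n_Ndl N \<Longrightarrow> y_dl N n (x_dl (fdl wd) yu) (xul wu) \<omega> t i
     = (sD (cD wd t) i + sI (cA (wu mod KA) t) (cB (wu div KA) t) i) + \<omega> (1, t, i)"
  by (simp add: y_dl_def sD_def sI_def xul_def x_dl_def fdl_def)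

lemma yS_eq:
  "t < side_len N n \<Longrightarrow> i < n_Ndl N \<Longrightarrow> y_S N n (xs wu) \<omega> t i = sS (cS (wu div KA) t) i + \<omega> (2, t, i)"
  by (simp add: y_S_def sS_def xs_def)

lemma gul_correct:
  assumes wu: "wu < KA * KB" and "\<omega> \<in> space (noise_space N n)" "\<omega> \<notin> bad_main"
  shows "gul wd (y_ul N n (xul wu) \<omega>) = wu"
proof -
  let ?Z = "{x \<in> XU. okU (y_ul N n (xul wu) \<omega>) x}"
  let ?a = "wu mod KA" and ?b = "wu div KA"
  have few: "card {i \<in> {i \<in> I. fst i \<noteq> 2}. g < cmod (\<omega> i)} \<le> n div L"
    using assms(2,3) by (auto simp: bad_main_def)
  \<comment> \<open>In a slot without large noise the transmitted pair passes the test, and by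
    \<open>sep_ul\<close> no other pair does, so the choice is forced.\<close>
  have pick: "(SOME p. (t, p) \<in> ?Z) = (cA ?a t, cB ?b t)"
    if t: "t < n" and good: "\<And>i. i \<in> I \<Longrightarrow> fst i \<noteq> 2 \<Longrightarrow> fst (snd i) = t \<Longrightarrow> cmod (\<omega> i) \<le> g" for t
  proof (rule some_equality)
    have \<omega>: "cmod (\<omega> (0, t, i)) \<le> g" if "i < n_Nul N" for i using good[of "(0, t, i)"] t that by (simp add: idx_iff)
    have in_sets: "cA ?a t \<in> SA" "cB ?b t \<in> SB" using cA(1) cB(1) msg[OF wu] t by auto
    then show "(t, cA ?a t, cB ?b t) \<in> ?Z" using t \<omega> by (simp add: okU_def yul_eq)
    fix p assume p: "(t, p) \<in> ?Z"
    obtain a b where ab: "p = (a, b)" by (cases p)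
    have "a = cA ?a t \<and> b = cB ?b t"
    proof (rule sep_ul)
      fix i assume i: "i < n_Nul N"
      show "cmod (sU a b i - sU (cA ?a t) (cB ?b t) i) \<le> 2 * g"
        by (rule triangle_sep[of "y_ul N n (xul wu) \<omega> t i"]) (use p ab i \<omega>[OF i] t in \<open>auto simp: okU_def yul_eq\<close>)
    qed (use p ab in_sets in auto)
    then show "p = (cA ?a t, cB ?b t)" by (simp add: ab)
  qed
  have "decode n (n div L) KA cA (\<lambda>t. fst (SOME p. (t, p) \<in> ?Z)) = ?a"
  proof (rule decode_eq)
    show "hdist n (\<lambda>t. fst (SOME p. (t, p) \<in> ?Z)) (cA ?a) \<le> n div L"
    proof (rule hdist_bad_times[OF few])
      fix t assume t: "t < n" and good: "\<And>i. i \<in> I \<Longrightarrow> fst i \<noteq> 2 \<Longrightarrow> fst (snd i) = t \<Longrightarrow> cmod (\<omega> i) \<le> g"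
      have "(SOME p. (t, p) \<in> ?Z) = (cA ?a t, cB ?b t)" using t good by (rule pick)
      then show "fst (SOME p. (t, p) \<in> ?Z) = cA ?a t" by (simp only: fst_conv snd_conv)
    qed
  qed (use cA(2) msg[OF wu] in auto)
  moreover have "decode n (n div L) KB cB (\<lambda>t. snd (SOME p. (t, p) \<in> ?Z)) = ?b"
  proof (rule decode_eq)
    show "hdist n (\<lambda>t. snd (SOME p. (t, p) \<in> ?Z)) (cB ?b) \<le> n div L"
    proof (rule hdist_bad_times[OF few])
      fix t assume t: "t < n" and good: "\<And>i. i \<in> I \<Longrightarrow> fst i \<noteq> 2 \<Longrightarrow> fst (snd i) = t \<Longrightarrow> cmod (\<omega> i) \<le> g"
      have "(SOME p. (t, p) \<in> ?Z) = (cA ?a t, cB ?b t)" using t good by (rule pick)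
      then show "snd (SOME p. (t, p) \<in> ?Z) = cB ?b t" by (simp only: fst_conv snd_conv)
    qed
  qed (use cB(2) msg[OF wu] in auto)
  ultimately show ?thesis unfolding gul_def decU_def using msg[OF wu] by simp
qed

lemma decS_correct:
  assumes wu: "wu < KA * KB" and "\<omega> \<in> space (noise_space N n)" "\<omega> \<notin> bad_side"
  shows "decS {x \<in> XS. okS (y_S N n (xs wu) \<omega>) x} = wu div KA"
proof -
  let ?Z = "{x \<in> XS. okS (y_S N n (xs wu) \<omega>) x}"
  let ?b = "wu div KA"
  have few: "card {i \<in> {i \<in> I. fst i = 2}. g < cmod (\<omega> i)} \<le> side_len N n div L"
    using assms(2,3) by (auto simp: bad_side_def)
  have pick: "(SOME s. (t, s) \<in> ?Z) = cS ?b t"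
    if t: "t < side_len N n" and good: "\<And>i. i \<in> I \<Longrightarrow> fst i = 2 \<Longrightarrow> fst (snd i) = t \<Longrightarrow> cmod (\<omega> i) \<le> g" for t
  proof (rule some_equality)
    have \<omega>: "cmod (\<omega> (2, t, i)) \<le> g" if "i < n_Ndl N" for i using good[of "(2, t, i)"] t that by (simp add: idx_iff)
    have in_sets: "cS ?b t \<in> SS" using cS(1) msg[OF wu] t by auto
    then show "(t, cS ?b t) \<in> ?Z" using t \<omega> by (simp add: okS_def yS_eq)
    fix s assume s: "(t, s) \<in> ?Z"
    show "s = cS ?b t"
    proof (rule sep_side)
      fix i assume i: "i < n_Ndl N"
      show "cmod (sS s i - sS (cS ?b t) i) \<le> 2 * g"
        by (rule triangle_sep[of "y_S N n (xs wu) \<omega> t i"]) (use s i \<omega>[OF i] t in \<open>auto simp: okS_def yS_eq\<close>)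
    qed (use s in_sets in auto)
  qed
  show ?thesis unfolding decS_def
  proof (rule decode_eq)
    show "hdist (side_len N n) (\<lambda>t. SOME s. (t, s) \<in> ?Z) (cS ?b) \<le> side_len N n div L"
    proof (rule hdist_bad_times[where P = "\<lambda>k. k = 2", OF few])
      fix t assume t: "t < side_len N n" and good: "\<And>i. i \<in> I \<Longrightarrow> fst i = 2 \<Longrightarrow> fst (snd i) = t \<Longrightarrow> cmod (\<omega> i) \<le> g"
      have "(SOME s. (t, s) \<in> ?Z) = cS ?b t" using t good by (rule pick)
      then show "(SOME s. (t, s) \<in> ?Z) = cS ?b t" .
    qed
  qed (use cS(2) msg[OF wu] in auto)
qed

lemma gdl_correct:
  assumes wu: "wu < KA * KB" and wd: "wd < KD" and "\<omega> \<in> space (noise_space N n)" "\<omega> \<notin> bad_main" "\<omega> \<notin> bad_side"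
  shows "gdl (y_dl N n (x_dl (fdl wd) yu) (xul wu) \<omega>) (y_S N n (xs wu) \<omega>) = wd"
proof -
  let ?y = "y_dl N n (x_dl (fdl wd) yu) (xul wu) \<omega>"
  let ?Z = "{x \<in> XD. okD ?y x}"
  let ?a = "wu mod KA" and ?b = "wu div KA"
  have few: "card {i \<in> {i \<in> I. fst i \<noteq> 2}. g < cmod (\<omega> i)} \<le> n div L"
    using assms(3,4) by (auto simp: bad_main_def)
  have pick: "(SOME d. \<exists>a. (t, a, cB ?b t, d) \<in> ?Z) = cD wd t"
    if t: "t < n" and good: "\<And>i. i \<in> I \<Longrightarrow> fst i \<noteq> 2 \<Longrightarrow> fst (snd i) = t \<Longrightarrow> cmod (\<omega> i) \<le> g" for t
  proof (rule some_equality)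
    have \<omega>: "cmod (\<omega> (1, t, i)) \<le> g" if "i < n_Ndl N" for i using good[of "(1, t, i)"] t that by (simp add: idx_iff)
    have in_sets: "cA ?a t \<in> SA" "cB ?b t \<in> SB" "cD wd t \<in> SD" using cA(1) cB(1) cD(1) msg[OF wu] t wd by auto
    then show "\<exists>a. (t, a, cB ?b t, cD wd t) \<in> ?Z" using t \<omega>[unfolded One_nat_def]
      by (intro exI[of _ "cA ?a t"]) (simp add: okD_def ydl_eq)
    fix d assume "\<exists>a. (t, a, cB ?b t, d) \<in> ?Z"
    then obtain a where d: "(t, a, cB ?b t, d) \<in> ?Z" by blast
    \<comment> \<open>The candidate \<open>a\<close> may differ from the transmitted symbol;
      \<open>sep_dl\<close> still forces the downlink symbol.\<close>
    show "d = cD wd t"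
    proof (rule sep_dl)
      fix i assume i: "i < n_Ndl N"
      show "cmod ((sD d i + sI a (cB ?b t) i) - (sD (cD wd t) i + sI (cA ?a t) (cB ?b t) i)) \<le> 2 * g"
        by (rule triangle_sep[of "?y t i"]) (use d i \<omega>[OF i] t in \<open>auto simp: okD_def ydl_eq\<close>)
    qed (use d in_sets in auto)
  qed
  have "decD ?b ?Z = wd" unfolding decD_def
  proof (rule decode_eq)
    show "hdist n (\<lambda>t. SOME d. \<exists>a. (t, a, cB ?b t, d) \<in> ?Z) (cD wd) \<le> n div L"
    proof (rule hdist_bad_times[OF few])
      fix t assume t: "t < n" and good: "\<And>i. i \<in> I \<Longrightarrow> fst i \<noteq> 2 \<Longrightarrow> fst (snd i) = t \<Longrightarrow> cmod (\<omega> i) \<le> g"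
      have "(SOME d. \<exists>a. (t, a, cB ?b t, d) \<in> ?Z) = cD wd t" using t good by (rule pick)
      then show "(SOME d. \<exists>a. (t, a, cB ?b t, d) \<in> ?Z) = cD wd t" .
    qed
  qed (use cD(2) wd in auto)
  then show ?thesis unfolding gdl_def decS_correct[OF wu assms(3,5)] .
qed

lemma err_subset:
  assumes "wd < KD" "wu < KA * KB"
  shows "err_event N n xul xs fdl gul gdl wd wu \<subseteq> bad_main \<union> bad_side"
  using gul_correct[OF assms(2)] gdl_correct[OF assms(2,1)] unfolding err_event_def by auto

lemma component_measurable': "i \<in> I \<Longrightarrow> (\<lambda>\<omega>. \<omega> i) \<in> borel_measurable (noise_space N n)"
  using component_measurable by (simp add: measurable_cong_sets[OF sets_noise refl])

lemma err_measurable: "err_event N n xul xs fdl gul gdl wd wu \<in> sets (noise_space N n)"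
proof -
  \<comment> \<open>The three families of threshold tests become one finite family by tagging, so
    that the error event is a predicate of the set of tests passed.\<close>
  define P where "P x \<omega> = (case x of Inl p \<Rightarrow> okU (y_ul N n (xul wu) \<omega>) p
     | Inr (Inl p) \<Rightarrow> okS (y_S N n (xs wu) \<omega>) p
     | Inr (Inr p) \<Rightarrow> okD (y_dl N n (x_dl (fdl wd) (y_ul N n (xul wu) \<omega>)) (xul wu) \<omega>) p)" for x \<omega>
  define X where "X = XU <+> (XS <+> XD)"
  define Q where "Q Z = (decU {p. Inl p \<in> Z} \<noteq> wu \<or> decD (decS {p. Inr (Inl p) \<in> Z}) {p. Inr (Inr p) \<in> Z} \<noteq> wd)" for Z
  have meas: "{\<omega> \<in> space (noise_space N n). \<forall>i<k. cmod (f \<omega> i - c i) \<le> g} \<in> sets (noise_space N n)"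
    if "\<And>i. i < k \<Longrightarrow> (\<lambda>\<omega>. f \<omega> i) \<in> borel_measurable (noise_space N n)" for f :: "_ \<Rightarrow> nat \<Rightarrow> complex" and k c
  proof -
    have "{\<omega> \<in> space (noise_space N n). \<forall>i\<in>{..<k}. cmod (f \<omega> i - c i) \<le> g} \<in> sets (noise_space N n)"
    proof (rule sets.sets_Collect_finite_All)
      fix i assume "i \<in> {..<k}"
      then have [measurable]: "(\<lambda>\<omega>. f \<omega> i) \<in> borel_measurable (noise_space N n)" using that by simp
      show "{\<omega> \<in> space (noise_space N n). cmod (f \<omega> i - c i) \<le> g} \<in> sets (noise_space N n)" by measurable
    qed simp
    then show ?thesis by (simp only: Ball_def lessThan_iff)
  qed
  have "{\<omega> \<in> space (noise_space N n). Q {x \<in> X. P x \<omega>}} \<in> sets (noise_space N n)"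
  proof (rule sets_Collect_finite_dependence)
    show "finite X" unfolding X_def using finite_sets by auto
    fix x assume x: "x \<in> X"
    show "{\<omega> \<in> space (noise_space N n). P x \<omega>} \<in> sets (noise_space N n)"
    proof (cases x)
      case (Inl p)
      obtain t a b where p: "p = (t, a, b)" by (cases p) auto
      have t: "t < n" using x by (auto simp: X_def Inl p)
      have "(\<lambda>\<omega>. y_ul N n (xul wu) \<omega> t i) \<in> borel_measurable (noise_space N n)" if "i < n_Nul N" for i
        using component_measurable'[of "(0, t, i)"] t that by (simp add: yul_eq idx_iff)
      then have "{\<omega> \<in> space (noise_space N n). \<forall>i<n_Nul N. cmod (y_ul N n (xul wu) \<omega> t i - sU a b i) \<le> g} \<in> sets (noise_space N n)"
        by (rule meas)
      moreover have "P x \<omega> = (\<forall>i<n_Nul N. cmod (y_ul N n (xul wu) \<omega> t i - sU a b i) \<le> g)" for \<omega>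
        unfolding Inl P_def p by (simp add: okU_def)
      ultimately show ?thesis by (simp only:)
    next
      case (Inr q)
      show ?thesis
      proof (cases q)
        case (Inl p)
        obtain t s where p: "p = (t, s)" by (cases p) auto
        have t: "t < side_len N n" using x by (auto simp: X_def Inr Inl p)
        have "(\<lambda>\<omega>. y_S N n (xs wu) \<omega> t i) \<in> borel_measurable (noise_space N n)" if "i < n_Ndl N" for i
          using component_measurable'[of "(2, t, i)"] t that by (simp add: yS_eq idx_iff)
        then have "{\<omega> \<in> space (noise_space N n). \<forall>i<n_Ndl N. cmod (y_S N n (xs wu) \<omega> t i - sS s i) \<le> g} \<in> sets (noise_space N n)"
        by (rule meas)
      moreover have "P x \<omega> = (\<forall>i<n_Ndl N. cmod (y_S N n (xs wu) \<omega> t i - sS s i) \<le> g)" for \<omega>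
        unfolding Inr Inl P_def p by (simp add: okS_def)
      ultimately show ?thesis by (simp only:)
      next
        case Inr': (Inr p)
        obtain t a b d where p: "p = (t, a, b, d)" by (cases p) auto
        have t: "t < n" using x by (auto simp: X_def Inr Inr' p)
        have "(\<lambda>\<omega>. y_dl N n (x_dl (fdl wd) (y_ul N n (xul wu) \<omega>)) (xul wu) \<omega> t i) \<in> borel_measurable (noise_space N n)" if "i < n_Ndl N" for i
          using component_measurable'[of "(1, t, i)"] t that by (simp add: ydl_eq idx_iff)
        then have "{\<omega> \<in> space (noise_space N n). \<forall>i<n_Ndl N. cmod (y_dl N n (x_dl (fdl wd) (y_ul N n (xul wu) \<omega>)) (xul wu) \<omega> t i - (sD d i + sI a b i)) \<le> g} \<in> sets (noise_space N n)"
        by (rule meas)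
      moreover have "P x \<omega> = (\<forall>i<n_Ndl N. cmod (y_dl N n (x_dl (fdl wd) (y_ul N n (xul wu) \<omega>)) (xul wu) \<omega> t i - (sD d i + sI a b i)) \<le> g)" for \<omega>
        unfolding Inr Inr' P_def p by (simp add: okD_def)
      ultimately show ?thesis by (simp only:)
      qed
    qed
  qed
  moreover have "Q {x \<in> X. P x \<omega>} \<longleftrightarrow> gul wd (y_ul N n (xul wu) \<omega>) \<noteq> wu \<or>
      gdl (y_dl N n (x_dl (fdl wd) (y_ul N n (xul wu) \<omega>)) (xul wu) \<omega>) (y_S N n (xs wu) \<omega>) \<noteq> wd" for \<omega>
  proof -
    have "{p. Inl p \<in> {x \<in> X. P x \<omega>}} = {x \<in> XU. okU (y_ul N n (xul wu) \<omega>) x}"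
      "{p. Inr (Inl p) \<in> {x \<in> X. P x \<omega>}} = {x \<in> XS. okS (y_S N n (xs wu) \<omega>) x}"
      "{p. Inr (Inr p) \<in> {x \<in> X. P x \<omega>}} = {x \<in> XD. okD (y_dl N n (x_dl (fdl wd) (y_ul N n (xul wu) \<omega>)) (xul wu) \<omega>) x}"
      by (auto simp: X_def P_def)
    then show ?thesis unfolding Q_def gul_def gdl_def by (simp only:)
  qed
  ultimately show ?thesis unfolding err_event_def by simp
qed

lemma valid: "valid_code N n KD (KA * KB) xul xs fdl gul gdl"
proof -
  interpret P: prob_space "noise_space N n" by (rule prob_noise)
  have "(\<Sum>t<n. \<Sum>wu<KA * KB. sqnorm (n_Mul N) (xul wu t)) \<le> (\<Sum>t<n. \<Sum>wu<KA * KB. 1)"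
    using cA(1) cB(1) msg by (intro sum_mono) (simp add: xul_def power_u)
  moreover have "(\<Sum>t<side_len N n. \<Sum>wu<KA * KB. sqnorm (n_Mul N) (xs wu t)) \<le> (\<Sum>t<side_len N n. \<Sum>wu<KA * KB. 1)"
    using cS(1) msg by (intro sum_mono) (simp add: xs_def power_s)
  moreover have "(\<Sum>t<n. \<Sum>wd<KD. \<Sum>wu<KA * KB.
      \<integral>\<^sup>+\<omega>. ennreal (sqnorm (n_Mdl N) (x_dl (fdl wd) (y_ul N n (xul wu) \<omega>) t)) \<partial>noise_space N n)
      \<le> (\<Sum>t<n. \<Sum>wd<KD. \<Sum>wu<KA * KB. 1)"
  proof (intro sum_mono)
    fix t wd wu assume "t \<in> {..<n}" "wd \<in> {..<KD}"
    then have "sqnorm (n_Mdl N) (xd (cD wd t)) \<le> 1" using cD(1) by (simp add: power_d)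
    then have "(\<integral>\<^sup>+\<omega>. ennreal (sqnorm (n_Mdl N) (x_dl (fdl wd) (y_ul N n (xul wu) \<omega>) t)) \<partial>noise_space N n) \<le> (\<integral>\<^sup>+\<omega>. 1 \<partial>noise_space N n)"
      by (intro nn_integral_mono) (simp add: x_dl_def fdl_def)
    also have "\<dots> = 1" using P.emeasure_space_1 by simp
    finally show "(\<integral>\<^sup>+\<omega>. ennreal (sqnorm (n_Mdl N) (x_dl (fdl wd) (y_ul N n (xul wu) \<omega>) t)) \<partial>noise_space N n) \<le> 1" .
  qed
  moreover have "(\<Sum>t<n. \<Sum>wd<KD. \<Sum>wu<KA * KB. 1 :: ennreal) = ennreal (real n * real KD * real (KA * KB))"
    by (simp add: ennreal_of_nat_eq_real_of_nat ennreal_mult mult.assoc)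
  ultimately show ?thesis
    unfolding valid_code_def using err_measurable by (simp add: x_dl_def fdl_def)
qed

text \<open>Without side-channel uses the bad event of the side channel is empty. It must be set to
  0 explicitly, because the zeroth power would be the useless value 1.\<close>

lemma error_bound:
  "error_prob N n KD (KA * KB) xul xs fdl gul gdl \<le> (1 / 2) ^ n + (if side_len N n = 0 then 0 else (1 / 2) ^ side_len N n)"
proof -
  interpret P: prob_space "noise_space N n" by (rule prob_noise)
  let ?k = "n_Nul N + n_Ndl N"
  define p where "p = (1 / 2 :: real) ^ (L * (?k + 1))"
  have p: "0 \<le> p" "max 1 (Wr N) / g\<^sup>2 \<le> p" using noise_level by (simp_all add: p_def)
  have var: "var i / g\<^sup>2 \<le> p" for i
  proof -
    have "var i / g\<^sup>2 \<le> max 1 (Wr N) / g\<^sup>2" by (intro divide_right_mono) (auto simp: var_def)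
    then show ?thesis using p(2) by simp
  qed
  \<comment> \<open>Since \<open>k \<le> L * Suc (k div L)\<close>, the exponent
    \<open>L * (?k + 1)\<close> in \<open>p\<close> yields \<open>k * (?k + 1)\<close> halvings. Of
    these, \<open>k * ?k\<close> cancel the number of sets in the union bound and \<open>k\<close>
    remain.\<close>
  have pow: "2 ^ c * p ^ Suc (k div L) \<le> (1 / 2) ^ k" if "c \<le> k * ?k" for c k
  proof -
    have "k \<le> L * Suc (k div L)" using L dividend_less_times_div[of L k] by simp
    then have "k * (?k + 1) \<le> (L * Suc (k div L)) * (?k + 1)" by (rule mult_le_mono1)
    then have "k * (?k + 1) \<le> L * (?k + 1) * Suc (k div L)" by (simp only: ac_simps)
    then have "p ^ Suc (k div L) \<le> (1 / 2) ^ (k * (?k + 1))"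
      unfolding p_def power_mult[symmetric] by (rule power_decreasing) auto
    then have "2 ^ c * p ^ Suc (k div L) \<le> 2 ^ (k * ?k) * (1 / 2) ^ (k * (?k + 1))"
      using that p(1) by (intro mult_mono power_increasing) auto
    also have "\<dots> = (1 / 2) ^ k" by (simp add: power_add power_one_over)
    finally show ?thesis .
  qed
  have J: "{i \<in> I. fst i \<noteq> 2} \<subseteq> I" "{i \<in> I. fst i = 2} \<subseteq> I" by auto
  have tail_main: "bad_main \<in> sets (noise_space N n)" "P.prob bad_main \<le> 2 ^ card {i \<in> I. fst i \<noteq> 2} * p ^ Suc (n div L)"
    unfolding bad_main_def noise_space_eq
    by (rule PiM_many_large_coordinates[OF finite_I J(1) var_pos g p(1) var]; assumption)+
  have tail_side: "bad_side \<in> sets (noise_space N n)" "P.prob bad_side \<le> 2 ^ card {i \<in> I. fst i = 2} * p ^ Suc (side_len N n div L)"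
    unfolding bad_side_def noise_space_eq
    by (rule PiM_many_large_coordinates[OF finite_I J(2) var_pos g p(1) var]; assumption)+
  have c1: "card {i \<in> I. fst i \<noteq> 2} \<le> n * ?k"
  proof -
    have "{i \<in> I. fst i \<noteq> 2} = ({0} \<times> {..<n} \<times> {..<n_Nul N}) \<union> ({1} \<times> {..<n} \<times> {..<n_Ndl N})"
      unfolding noise_idx_def by auto
    also have "card \<dots> \<le> card ({0 :: nat} \<times> {..<n} \<times> {..<n_Nul N}) + card ({1 :: nat} \<times> {..<n} \<times> {..<n_Ndl N})"
      by (rule card_Un_le)
    finally show ?thesis by (simp add: card_cartesian_product distrib_left)
  qed
  have c2: "card {i \<in> I. fst i = 2} \<le> side_len N n * ?k"
  proof -
    have "{i \<in> I. fst i = 2} = {2} \<times> {..<side_len N n} \<times> {..<n_Ndl N}"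
      unfolding noise_idx_def by auto
    then show ?thesis by (simp add: card_cartesian_product distrib_left)
  qed
  have main: "P.prob bad_main \<le> (1 / 2) ^ n"
    using tail_main(2) pow[OF c1] by linarith
  have side: "P.prob bad_side \<le> (if side_len N n = 0 then 0 else (1 / 2) ^ side_len N n)"
  proof (cases "side_len N n = 0")
    case True
    then have none: "{i \<in> I. fst i = 2} = {}" unfolding noise_idx_def by auto
    have "bad_side = {}" unfolding bad_side_def none by simp
    then show ?thesis by simp
  next
    case False
    then show ?thesis using tail_side(2) pow[OF c2] by simp
  qed
  let ?b = "(1 / 2) ^ n + (if side_len N n = 0 then 0 else (1 / 2) ^ side_len N n) :: real"
  have "P.prob (err_event N n xul xs fdl gul gdl wd wu) \<le> ?b" if "wd < KD" "wu < KA * KB" for wd wu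
  proof -
    have "P.prob (err_event N n xul xs fdl gul gdl wd wu) \<le> P.prob (bad_main \<union> bad_side)"
      using err_subset[OF that] tail_main(1) tail_side(1) by (intro P.finite_measure_mono) auto
    also have "\<dots> \<le> P.prob bad_main + P.prob bad_side"
      using tail_main(1) tail_side(1) by (intro measure_Un_le) auto
    finally show ?thesis using main side by linarith
  qed
  then have "(\<Sum>wd<KD. \<Sum>wu<KA * KB. P.prob (err_event N n xul xs fdl gul gdl wd wu)) \<le> (\<Sum>wd<KD. \<Sum>wu<KA * KB. ?b)"
    by (intro sum_mono) simp
  also have "\<dots> = ?b * (real KD * real (KA * KB))" by simp
  finally show ?thesis
    unfolding error_prob_def using K_pos by (simp add: pos_divide_le_eq)
qed

end

context scheme
begin

text \<open>Rounding loses at most one side-channel use, which the fraction \<open>1 / L\<close> of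
  \<open>Wr N * n\<close> absorbs for large \<open>n\<close>. The bound by \<open>k\<close> makes
  the side-channel error term small.\<close>

lemma side_len_eventually:
  "\<exists>n0. \<forall>n\<ge>n0. (side_len N n = 0 \<and> Wr N = 0 \<or> k \<le> side_len N n) \<and>
     real n * ((1 - 1 / real L) * Wr N) \<le> real (side_len N n)"
proof (cases "Wr N = 0")
  case True
  then show ?thesis by (intro exI[of _ 0]) (simp add: side_len_def)
next
  case False
  with W have W0: "0 < Wr N" by simp
  obtain n0 :: nat where n0: "(real k + 1 + real L) / Wr N < real n0" using reals_Archimedean2 by blast
  show ?thesis
  proof (intro exI[of _ n0] allI impI)
    fix n assume "n0 \<le> n"
    then have "(real k + 1 + real L) / Wr N < real n" using n0 by (meson le_less_trans less_le_trans of_nat_le_iff)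
    then have n: "real k + 1 + real L < Wr N * real n" using W0 by (simp add: pos_divide_less_eq mult.commute)
    have fl: "Wr N * real n - 1 \<le> real (side_len N n)" unfolding side_len_def by linarith
    have one: "1 \<le> Wr N * real n / real L" using n L by (simp add: pos_le_divide_eq)
    have "real n * ((1 - 1 / real L) * Wr N) = Wr N * real n - Wr N * real n / real L"
      by (simp add: algebra_simps)
    also have "\<dots> \<le> Wr N * real n - 1" using one by (rule diff_left_mono)
    also note fl
    finally have "real n * ((1 - 1 / real L) * Wr N) \<le> real (side_len N n)" .
    moreover have "real k \<le> real (side_len N n)" using fl n by linarith
    ultimately show "(side_len N n = 0 \<and> Wr N = 0 \<or> k \<le> side_len N n) \<and> real n * ((1 - 1 / real L) * Wr N) \<le> real (side_len N n)"
      by simp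
  qed
qed

theorem achievable_rates:
  "achievable N (Wm N * code_rate L SD,
     Wm N * (code_rate L SA + min (code_rate L SB) ((1 - 1 / real L) * Wr N * code_rate L SS)))"
  (is "achievable N (Wm N * ?rD, Wm N * (?rA + ?rB))")
  unfolding achievable_def fst_conv snd_conv
proof (intro conjI allI impI)
  have "0 \<le> 1 - 1 / real L" using L by simp
  then have rB: "0 \<le> ?rB" using W by (simp add: code_rate_nonneg)
  show "0 \<le> Wm N * ?rD" "0 \<le> Wm N * (?rA + ?rB)"
    using Wm rB code_rate_nonneg[of L SD] code_rate_nonneg[of L SA] by simp_all
  fix \<epsilon> :: real assume \<epsilon>: "0 < \<epsilon>"
  obtain k where k: "(1 / 2 :: real) ^ k < \<epsilon> / 2"
    using real_arch_pow_inv[of "\<epsilon> / 2" "1 / 2"] \<epsilon> by auto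
  obtain n1 where n1: "\<And>n. n1 \<le> n \<Longrightarrow> (side_len N n = 0 \<and> Wr N = 0 \<or> k \<le> side_len N n) \<and>
     real n * ((1 - 1 / real L) * Wr N) \<le> real (side_len N n)"
    using side_len_eventually[of k] by blast
  show "\<exists>n0. \<forall>n\<ge>n0. \<exists>Kd Ku xul xs fdl gul gdl.
        2 powr (real n * (Wm N * ?rD) / Wm N) \<le> real Kd \<and>
        2 powr (real n * (Wm N * (?rA + ?rB)) / Wm N) \<le> real Ku \<and>
        valid_code N n Kd Ku xul xs fdl gul gdl \<and> error_prob N n Kd Ku xul xs fdl gul gdl \<le> \<epsilon>"
  proof (rule exI[of _ "max n1 k"], intro allI impI)
    fix n assume "max n1 k \<le> n"
    then have n: "n1 \<le> n" "k \<le> n" by auto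
    let ?s = "side_len N n"
    obtain KD cD where D: "0 < KD" "2 powr (real n * ?rD) \<le> real KD" "\<forall>i<KD. \<forall>t<n. cD i t \<in> SD"
      "\<forall>i<KD. \<forall>j<KD. i \<noteq> j \<longrightarrow> 2 * (n div L) < hdist n (cD i) (cD j)"
      using exists_code[OF finite_sets(1) nonempty(1) L, of n] by blast
    obtain KA cA where A: "0 < KA" "2 powr (real n * ?rA) \<le> real KA" "\<forall>i<KA. \<forall>t<n. cA i t \<in> SA"
      "\<forall>i<KA. \<forall>j<KA. i \<noteq> j \<longrightarrow> 2 * (n div L) < hdist n (cA i) (cA j)"
      using exists_code[OF finite_sets(2) nonempty(2) L, of n] by blast
    obtain K1 cB where B: "0 < K1" "2 powr (real n * code_rate L SB) \<le> real K1" "\<forall>i<K1. \<forall>t<n. cB i t \<in> SB"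
      "\<forall>i<K1. \<forall>j<K1. i \<noteq> j \<longrightarrow> 2 * (n div L) < hdist n (cB i) (cB j)"
      using exists_code[OF finite_sets(3) nonempty(3) L, of n] by blast
    obtain K2 cS where S: "0 < K2" "2 powr (real ?s * code_rate L SS) \<le> real K2" "\<forall>i<K2. \<forall>t<?s. cS i t \<in> SS"
      "\<forall>i<K2. \<forall>j<K2. i \<noteq> j \<longrightarrow> 2 * (?s div L) < hdist ?s (cS i) (cS j)"
      using exists_code[OF finite_sets(4) nonempty(4) L, of ?s] by blast
    \<comment> \<open>The second uplink component must be decodable on both channels, so surplus
      words of the larger code are dropped. This is the origin of the minimum in the rate.\<close>
    define KB where "KB = min K1 K2"
    have KB: "0 < KB" "KB \<le> K1" "KB \<le> K2" using B(1) S(1) by (auto simp: KB_def)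
    interpret c: scheme_code N L g SD SA SB SS xd xu xside sD sU sI sS n KD KA KB cD cA cB cS
    proof unfold_locales
      show "0 \<le> Wr N" by (rule W)
      show "0 < KD" "0 < KA" "0 < KB" by (fact D(1) A(1) KB(1))+
    qed (use D(3,4) A(3,4) B(3,4) S(3,4) KB in \<open>meson less_le_trans\<close>)+
    have "real n * ?rB \<le> real n * code_rate L SB" by (intro mult_left_mono) auto
    then have "2 powr (real n * ?rB) \<le> 2 powr (real n * code_rate L SB)" by simp
    then have b1: "2 powr (real n * ?rB) \<le> real K1" using B(2) by (rule order_trans)
    have "real n * ?rB \<le> real n * ((1 - 1 / real L) * Wr N * code_rate L SS)" by (intro mult_left_mono) auto
    also have "\<dots> = (real n * ((1 - 1 / real L) * Wr N)) * code_rate L SS" by simp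
    also have "\<dots> \<le> real ?s * code_rate L SS"
      using n1[OF n(1)] code_rate_nonneg by (intro mult_right_mono) auto
    finally have "2 powr (real n * ?rB) \<le> 2 powr (real ?s * code_rate L SS)" by simp
    then have b2: "2 powr (real n * ?rB) \<le> real K2" using S(2) by (rule order_trans)
    have KBr: "2 powr (real n * ?rB) \<le> real KB" using b1 b2 by (simp add: KB_def min_def)
    have "2 powr (real n * (?rA + ?rB)) = 2 powr (real n * ?rA) * 2 powr (real n * ?rB)"
      by (simp add: distrib_left powr_add)
    also have "\<dots> \<le> real KA * real KB" using A(2) KBr by (intro mult_mono) auto
    finally have Ku: "2 powr (real n * (?rA + ?rB)) \<le> real (KA * KB)" by simp
    have err: "error_prob N n KD (KA * KB) c.xul c.xs c.fdl c.gul c.gdl \<le> \<epsilon>"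
    proof -
      have p: "(1 / 2 :: real) ^ j < \<epsilon> / 2" if "k \<le> j" for j
        by (rule le_less_trans[OF power_decreasing[OF that] k]) simp_all
      have "(if ?s = 0 then 0 else (1 / 2 :: real) ^ ?s) \<le> \<epsilon> / 2"
        using n1[OF n(1)] p[of ?s] \<epsilon> by auto
      then show ?thesis using c.error_bound p[OF n(2)] by linarith
    qed
    have div: "real n * (Wm N * x) / Wm N = real n * x" for x using Wm by simp
    show "\<exists>Kd Ku xul xs fdl gul gdl.
        2 powr (real n * (Wm N * ?rD) / Wm N) \<le> real Kd \<and>
        2 powr (real n * (Wm N * (?rA + ?rB)) / Wm N) \<le> real Ku \<and>
        valid_code N n Kd Ku xul xs fdl gul gdl \<and> error_prob N n Kd Ku xul xs fdl gul gdl \<le> \<epsilon>"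
      unfolding div using D(2) Ku c.valid err by blast
  qed
qed

end

section \<open>Grid constellations and achievability\<close>

text \<open>A QAM square with its corner at 0. Nonnegative integer coordinates make digit expansions
  unique, and \<open>nat \<lfloor>y\<rfloor> + 1\<close> points per side guarantee nonemptiness and,
  for \<open>y \<ge> 0\<close>, at least y squared points.\<close>

definition grid :: "real \<Rightarrow> complex set" where
  "grid y = (\<lambda>(a, b). Complex (real a) (real b)) ` ({..nat \<lfloor>y\<rfloor>} \<times> {..nat \<lfloor>y\<rfloor>})"

definition gaussian_int :: "complex \<Rightarrow> bool" where
  "gaussian_int z \<longleftrightarrow> Re z \<in> \<int> \<and> Im z \<in> \<int>"

text \<open>Minimum distance 1 of the grid; the detection arguments below reduce to it.\<close>

lemma gaussian_int_small:
  assumes "gaussian_int z" "cmod z < 1"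
  shows "z = 0"
proof -
  have "\<bar>Re z\<bar> < 1" "\<bar>Im z\<bar> < 1" using assms(2) abs_Re_le_cmod[of z] abs_Im_le_cmod[of z] by linarith+
  then have "Re z = 0" "Im z = 0" using assms(1) Ints_nonzero_abs_less1 unfolding gaussian_int_def by blast+
  then show ?thesis by (simp add: complex_eq_iff)
qed

lemma gaussian_int_diff: "gaussian_int z \<Longrightarrow> gaussian_int w \<Longrightarrow> gaussian_int (z - w)"
  by (simp add: gaussian_int_def)

lemma gaussian_int_add: "gaussian_int z \<Longrightarrow> gaussian_int w \<Longrightarrow> gaussian_int (z + w)"
  by (simp add: gaussian_int_def)

lemma gaussian_int_scale: "gaussian_int z \<Longrightarrow> gaussian_int (of_nat k * z)"
  by (simp add: gaussian_int_def)

lemma gaussian_int_grid: "z \<in> grid y \<Longrightarrow> gaussian_int z"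
  by (auto simp: grid_def gaussian_int_def)

lemma finite_grid: "finite (grid y)"
  unfolding grid_def by simp

lemma grid_nonempty: "grid y \<noteq> {}"
  unfolding grid_def by auto

lemma card_grid: "card (grid y) = (nat \<lfloor>y\<rfloor> + 1)\<^sup>2"
proof -
  have "inj_on (\<lambda>(a, b). Complex (real a) (real b)) ({..nat \<lfloor>y\<rfloor>} \<times> {..nat \<lfloor>y\<rfloor>})"
    by (auto simp: inj_on_def)
  then show ?thesis unfolding grid_def by (simp add: card_image card_cartesian_product power2_eq_square)
qed

lemma square_le_card_grid: "0 \<le> y \<Longrightarrow> y\<^sup>2 \<le> real (card (grid y))"
proof -
  assume "0 \<le> y"
  moreover have "y \<le> real (nat \<lfloor>y\<rfloor> + 1)" by linarith
  ultimately have "y\<^sup>2 \<le> (real (nat \<lfloor>y\<rfloor> + 1))\<^sup>2" by (intro power_mono)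
  then show ?thesis by (simp only: card_grid of_nat_power)
qed

lemma grid_bounds:
  assumes "z \<in> grid y" "0 \<le> y"
  shows "0 \<le> Re z" "Re z \<le> y" "0 \<le> Im z" "Im z \<le> y"
  using assms by (auto simp: grid_def) linarith+

lemma cmod_grid: "z \<in> grid y \<Longrightarrow> 0 \<le> y \<Longrightarrow> cmod z \<le> 2 * y"
  using grid_bounds[of z y] cmod_le[of z] by simp

lemma cmod_grid_diff: "z \<in> grid y \<Longrightarrow> w \<in> grid y \<Longrightarrow> 0 \<le> y \<Longrightarrow> cmod (z - w) \<le> 2 * y"
  using grid_bounds[of z y] grid_bounds[of w y] cmod_le[of "z - w"] by simp

text \<open>Uniqueness of two-digit expansions in base \<open>Q\<close>, applied to real and
  imaginary parts separately.\<close>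

lemma grid_radix:
  assumes "a \<in> grid y" "a' \<in> grid y" "b \<in> grid y'" "b' \<in> grid y'" "Q = nat \<lfloor>y\<rfloor> + 1"
    and "a + of_nat Q * b = a' + of_nat Q * b'"
  shows "a = a' \<and> b = b'"
proof -
  have radix: "k = k' \<and> l = l'" if "k < Q" "k' < Q" "real k + real Q * real l = real k' + real Q * real l'" for k k' l l' :: nat
  proof -
    have eq: "k + Q * l = k' + Q * l'" using that(3) by (metis of_nat_add of_nat_eq_iff of_nat_mult)
    have "(k + Q * l) mod Q = k" "(k' + Q * l') mod Q = k'" "(k + Q * l) div Q = l" "(k' + Q * l') div Q = l'"
      using that(1,2) by auto
    with eq show ?thesis by metis
  qed
  obtain k1 k2 k1' k2' l1 l2 l1' l2' where
    ab: "a = Complex (real k1) (real k2)" "a' = Complex (real k1') (real k2')" "b = Complex (real l1) (real l2)" "b' = Complex (real l1') (real l2')"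
    and le: "k1 \<le> nat \<lfloor>y\<rfloor>" "k2 \<le> nat \<lfloor>y\<rfloor>" "k1' \<le> nat \<lfloor>y\<rfloor>" "k2' \<le> nat \<lfloor>y\<rfloor>"
    using assms(1-4) unfolding grid_def by auto
  have "real k1 + real Q * real l1 = real k1' + real Q * real l1'" "real k2 + real Q * real l2 = real k2' + real Q * real l2'"
    using arg_cong[OF assms(6), of Re] arg_cong[OF assms(6), of Im] by (simp_all add: ab)
  then have "k1 = k1' \<and> l1 = l1'" "k2 = k2' \<and> l2 = l2'"
    using radix[of k1 k1' l1 l1'] radix[of k2 k2' l2 l2'] le assms(5) by simp_all
  then show ?thesis by (simp add: ab)
qed

lemma inverse_pair_apply:
  assumes "inverse_pair k A B" "i < k"
  shows "(\<Sum>l<k. A i l * (\<Sum>p<k. B l p * w p)) = w i"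
proof -
  have "(\<Sum>l<k. A i l * (\<Sum>p<k. B l p * w p)) = (\<Sum>l<k. \<Sum>p<k. (A i l * B l p) * w p)"
    by (simp add: sum_distrib_left mult.assoc)
  also have "\<dots> = (\<Sum>p<k. (\<Sum>l<k. A i l * B l p) * w p)"
    by (subst sum.swap) (simp add: sum_distrib_right)
  also have "\<dots> = (\<Sum>p<k. (if i = p then 1 else 0) * w p)"
    using assms by (intro sum.cong) (auto simp: inverse_pair_def)
  also have "\<dots> = (\<Sum>p<k. if i = p then w p else 0)" by (intro sum.cong) auto
  also have "\<dots> = w i" using assms(2) by simp
  finally show ?thesis .
qed

lemma inverse_pair_sym: "inverse_pair k A B \<Longrightarrow> inverse_pair k B A"
  by (auto simp: inverse_pair_def)

section \<open>Digit streams over the inverted channel\<close>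

context channel
begin

definition Mp :: "nat \<Rightarrow> nat \<Rightarrow> complex" where
  "Mp i j = (if i < m then h (2, i, j) else h (1, i - m, j))"

lemma V_Mp: "inverse_pair Mul Mp V"
  using V unfolding Mp_def [abs_def] m_def .

text \<open>One SNR-independent bound for the matrix norms that matter: noise amplification when the
  base station inverts its channel, leakage to M2's antennas beyond \<open>m\<close>, and growth of
  the inputs by the three precoders.\<close>

definition cap :: real where
  "cap = 1 + (\<Sum>l<Mul. \<Sum>j<Mul. cmod (Mp l j) * (\<Sum>i<Mul. cmod (U j i))) + (\<Sum>i<Ndl. \<Sum>l<m. cmod (coef_I i l))
     + (\<Sum>j<Mul. \<Sum>i<Mul. cmod (V j i)) + (\<Sum>j<Ndl. \<Sum>i<Ndl. cmod (D j i)) + (\<Sum>j<m. \<Sum>i<m. cmod (S j i))"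

lemma cap_bounds:
  "1 \<le> cap"
  "l < Mul \<Longrightarrow> (\<Sum>j<Mul. cmod (Mp l j) * (\<Sum>i<Mul. cmod (U j i))) \<le> cap"
  "i < Ndl \<Longrightarrow> 1 + (\<Sum>l<m. cmod (coef_I i l)) \<le> cap"
  "j < Mul \<Longrightarrow> (\<Sum>i<Mul. cmod (V j i)) \<le> cap"
  "j < Ndl \<Longrightarrow> (\<Sum>i<Ndl. cmod (D j i)) \<le> cap"
  "j < m \<Longrightarrow> (\<Sum>i<m. cmod (S j i)) \<le> cap"
proof -
  define f1 f2 f3 f4 f5 where "f1 l = (\<Sum>j<Mul. cmod (Mp l j) * (\<Sum>i<Mul. cmod (U j i)))" and "f2 i = (\<Sum>l<m. cmod (coef_I i l))"
    and "f3 j = (\<Sum>i<Mul. cmod (V j i))" and "f4 j = (\<Sum>i<Ndl. cmod (D j i))" and "f5 j = (\<Sum>i<m. cmod (S j i))" for l i j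
  have nn: "0 \<le> f1 k" "0 \<le> f2 k" "0 \<le> f3 k" "0 \<le> f4 k" "0 \<le> f5 k" for k
    unfolding f1_def f2_def f3_def f4_def f5_def by (auto intro!: sum_nonneg mult_nonneg_nonneg)
  have cap: "cap = 1 + sum f1 {..<Mul} + sum f2 {..<Ndl} + sum f3 {..<Mul} + sum f4 {..<Ndl} + sum f5 {..<m}"
    unfolding cap_def f1_def f2_def f3_def f4_def f5_def ..
  have s: "0 \<le> sum f1 {..<Mul}" "0 \<le> sum f2 {..<Ndl}" "0 \<le> sum f3 {..<Mul}" "0 \<le> sum f4 {..<Ndl}" "0 \<le> sum f5 {..<m}"
    using nn by (auto intro: sum_nonneg)
  have le: "f k \<le> sum f {..<q}" if "k < q" "\<And>k. 0 \<le> f k" for f :: "nat \<Rightarrow> real" and k q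
    using that by (intro member_le_sum) auto
  show "1 \<le> cap" using s unfolding cap by linarith
  show "l < Mul \<Longrightarrow> (\<Sum>j<Mul. cmod (Mp l j) * (\<Sum>i<Mul. cmod (U j i))) \<le> cap"
    using le[of l Mul f1] nn s unfolding cap f1_def[symmetric] by simp
  show "i < Ndl \<Longrightarrow> 1 + (\<Sum>l<m. cmod (coef_I i l)) \<le> cap"
    using le[of i Ndl f2] nn s unfolding cap f2_def[symmetric] by simp
  show "j < Mul \<Longrightarrow> (\<Sum>i<Mul. cmod (V j i)) \<le> cap"
    using le[of j Mul f3] nn s unfolding cap f3_def[symmetric] by simp
  show "j < Ndl \<Longrightarrow> (\<Sum>i<Ndl. cmod (D j i)) \<le> cap"
    using le[of j Ndl f4] nn s unfolding cap f4_def[symmetric] by simp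
  show "j < m \<Longrightarrow> (\<Sum>i<m. cmod (S j i)) \<le> cap"
    using le[of j m f5] nn s unfolding cap f5_def[symmetric] by simp
qed

end

text \<open>\<open>\<Gamma>\<close> is the grid spacing at the receivers, up to the factors of the
  power split; \<open>g\<close> is the noise threshold; \<open>\<kappa>\<close> limits grid sizes so
  that the power constraint holds. \<open>ya\<close> and \<open>yb\<close> are the ranges of the two
  digits with place values \<open>Pa\<close> and \<open>Pb\<close>, \<open>yf\<close> and
  \<open>ys\<close> those of undivided streams and of the side channel. \<open>separation\<close> is
  what one antenna of M2 sees after removing the known digit \<open>b\<close>.\<close>

locale grid_scheme = channel Mdl Nul Mul Ndl wm W lam aI aS h V U S D
  for Mdl Nul Mul Ndl :: nat and wm W lam aI aS :: real and h V U S D +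
  fixes \<rho> g \<Gamma> \<kappa> ya yb yf ys :: real and L Pa Pb :: nat
  assumes \<rho>: "1 < \<rho>" and L: "0 < L" and g: "0 < g"
    and noise_level: "max 1 W / g\<^sup>2 \<le> (1 / 2) ^ (L * (Nul + Ndl + 1))"
    and big: "2 * g * cap < sqrt (1 - lam) * \<Gamma>" "2 * g * cap < \<Gamma>" "2 * g < sqrt lam * \<Gamma>" "0 < \<Gamma>"
    and y_nonneg: "0 \<le> ya" "0 \<le> yb" "0 \<le> yf" "0 \<le> ys"
    and amplitude: "real Pa * (2 * ya) + real Pb * (2 * yb) \<le> \<kappa> * sqrt \<rho>" "2 * yf \<le> \<kappa> * sqrt \<rho>" "2 * ys \<le> \<kappa> * sqrt (\<rho> powr aS)"
      "\<kappa> * \<Gamma> * cap * real Mdl \<le> 1" "0 \<le> \<kappa>"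
    and radix: "\<And>a a' b b'. a \<in> grid ya \<Longrightarrow> a' \<in> grid ya \<Longrightarrow> b \<in> grid yb \<Longrightarrow> b' \<in> grid yb \<Longrightarrow>
      of_nat Pa * a + of_nat Pb * b = of_nat Pa * a' + of_nat Pb * b' \<Longrightarrow> a = a' \<and> b = b'"
    and separation: "\<And>d d' a a'. d \<in> grid yf \<Longrightarrow> d' \<in> grid yf \<Longrightarrow> a \<in> grid ya \<Longrightarrow> a' \<in> grid ya \<Longrightarrow>
      cmod (complex_of_real \<Gamma> * (d - d') + complex_of_real (sqrt ((1 - lam) * \<rho> powr aI) * (\<Gamma> / sqrt \<rho>)) * (of_nat Pa * (a - a'))) \<le> 2 * g \<Longrightarrow> d = d'"
begin

definition SD :: "(nat \<Rightarrow> complex) set" where "SD = PiE {..<Ndl} (\<lambda>_. grid yf)"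
text \<open>Only streams below \<open>m\<close> disturb M2 and are split into digits. The hidden
  streams use the full range at once and are counted with the first digit.\<close>

definition SA :: "(nat \<Rightarrow> complex) set" where "SA = PiE {..<Mul} (\<lambda>i. grid (if i < m then ya else yf))"
definition SB :: "(nat \<Rightarrow> complex) set" where "SB = PiE {..<m} (\<lambda>_. grid yb)"
definition SS :: "(nat \<Rightarrow> complex) set" where "SS = PiE {..<m} (\<lambda>_. grid ys)"

definition stream :: "(nat \<Rightarrow> complex) \<Rightarrow> (nat \<Rightarrow> complex) \<Rightarrow> nat \<Rightarrow> complex" where
  "stream a b i = (if i < m then of_nat Pa * a i + of_nat Pb * b i else a i)"

abbreviation "amp \<equiv> complex_of_real (\<Gamma> / sqrt \<rho>)"
abbreviation "amp_S \<equiv> complex_of_real (\<Gamma> / sqrt (\<rho> powr aS))"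
abbreviation "\<theta> \<equiv> complex_of_real (sqrt ((1 - lam) * \<rho> powr aI) * (\<Gamma> / sqrt \<rho>))"

text \<open>Precoding by \<open>V\<close>: each of M2's first \<open>m\<close> antennas receives
  exactly one stream, and the streams from \<open>m\<close> on are nulled there. The base station
  can still separate all of them through \<open>U\<close>.\<close>

definition xu :: "(nat \<Rightarrow> complex) \<Rightarrow> (nat \<Rightarrow> complex) \<Rightarrow> nat \<Rightarrow> complex" where
  "xu a b j = amp * (\<Sum>i<Mul. V j i * stream a b i)"
definition xd :: "(nat \<Rightarrow> complex) \<Rightarrow> nat \<Rightarrow> complex" where
  "xd d j = (if j < Ndl then amp * (\<Sum>i<Ndl. D j i * d i) else 0)"
definition xside :: "(nat \<Rightarrow> complex) \<Rightarrow> nat \<Rightarrow> complex" where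
  "xside s j = (if j < m then amp_S * (\<Sum>i<m. S j i * s i) else 0)"

definition sU :: "(nat \<Rightarrow> complex) \<Rightarrow> (nat \<Rightarrow> complex) \<Rightarrow> nat \<Rightarrow> complex" where
  "sU a b i = complex_of_real (sqrt ((1 - lam) * \<rho>)) * (\<Sum>j<Mul. h (1, i, j) * xu a b j)"
definition sI :: "(nat \<Rightarrow> complex) \<Rightarrow> (nat \<Rightarrow> complex) \<Rightarrow> nat \<Rightarrow> complex" where
  "sI a b i = complex_of_real (sqrt ((1 - lam) * \<rho> powr aI)) * (\<Sum>j<Mul. h (2, i, j) * xu a b j)"
definition sD :: "(nat \<Rightarrow> complex) \<Rightarrow> nat \<Rightarrow> complex" where
  "sD d i = complex_of_real (sqrt \<rho>) * (\<Sum>j<Mdl. h (0, i, j) * xd d j)"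
definition sS :: "(nat \<Rightarrow> complex) \<Rightarrow> nat \<Rightarrow> complex" where
  "sS s i = complex_of_real (sqrt (lam * \<rho> powr aS)) * (\<Sum>j<Mul. h (3, i, j) * xside s j)"

lemma sum_prefix:
  fixes f :: "nat \<Rightarrow> complex"
  assumes "k \<le> n" "\<And>j. k \<le> j \<Longrightarrow> j < n \<Longrightarrow> f j = 0"
  shows "(\<Sum>j<n. f j) = (\<Sum>j<k. f j)"
  using assms by (intro sum.mono_neutral_right) auto

lemma sU_eq: "sU a b i = complex_of_real (sqrt (1 - lam) * \<Gamma>) * (\<Sum>j<Mul. h (1, i, j) * (\<Sum>l<Mul. V j l * stream a b l))"
proof -
  have "sqrt ((1 - lam) * \<rho>) * (\<Gamma> / sqrt \<rho>) = sqrt (1 - lam) * \<Gamma>"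
    using \<rho> by (simp add: real_sqrt_mult)
  moreover have "sU a b i = complex_of_real (sqrt ((1 - lam) * \<rho>) * (\<Gamma> / sqrt \<rho>)) * (\<Sum>j<Mul. h (1, i, j) * (\<Sum>l<Mul. V j l * stream a b l))"
    unfolding sU_def xu_def of_real_mult by (simp only: mult.assoc sum_distrib_left mult.left_commute)
  ultimately show ?thesis by simp
qed

lemma sD_eq:
  assumes "i < Ndl"
  shows "sD d i = complex_of_real \<Gamma> * d i"
proof -
  have "(\<Sum>j<Mdl. h (0, i, j) * xd d j) = (\<Sum>j<Ndl. h (0, i, j) * xd d j)"
    using dims by (intro sum_prefix) (auto simp: xd_def)
  also have "\<dots> = (\<Sum>j<Ndl. amp * (h (0, i, j) * (\<Sum>l<Ndl. D j l * d l)))"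
    by (intro sum.cong) (auto simp: xd_def)
  also have "\<dots> = amp * (\<Sum>j<Ndl. h (0, i, j) * (\<Sum>l<Ndl. D j l * d l))" by (rule sum_distrib_left[symmetric])
  also have "\<dots> = amp * d i" by (simp only: inverse_pair_apply[OF D assms])
  finally have "sD d i = complex_of_real (sqrt \<rho> * (\<Gamma> / sqrt \<rho>)) * d i" by (simp add: sD_def)
  then show ?thesis using \<rho> by simp
qed

lemma sS_eq:
  assumes "i < m"
  shows "sS s i = complex_of_real (sqrt lam * \<Gamma>) * s i"
proof -
  have "(\<Sum>j<Mul. h (3, i, j) * xside s j) = (\<Sum>j<m. h (3, i, j) * xside s j)"
    using m_le by (intro sum_prefix) (auto simp: xside_def)
  also have "\<dots> = (\<Sum>j<m. amp_S * (h (3, i, j) * (\<Sum>l<m. S j l * s l)))"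
    by (intro sum.cong) (auto simp: xside_def)
  also have "\<dots> = amp_S * (\<Sum>j<m. h (3, i, j) * (\<Sum>l<m. S j l * s l))" by (rule sum_distrib_left[symmetric])
  also have "\<dots> = amp_S * s i" by (simp only: inverse_pair_apply[OF S[folded m_def] assms])
  finally have "sS s i = complex_of_real (sqrt (lam * \<rho> powr aS) * (\<Gamma> / sqrt (\<rho> powr aS))) * s i" by (simp add: sS_def)
  moreover have "sqrt (lam * \<rho> powr aS) * (\<Gamma> / sqrt (\<rho> powr aS)) = sqrt lam * \<Gamma>"
    using \<rho> by (simp add: real_sqrt_mult)
  ultimately show ?thesis by (simp only:)
qed

lemma sI_eq:
  assumes "i < m"
  shows "sI a b i = \<theta> * stream a b i"
proof -
  have i: "i < Mul" using assms m_le by simp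
  have "(\<Sum>j<Mul. h (2, i, j) * xu a b j) = amp * (\<Sum>j<Mul. Mp i j * (\<Sum>l<Mul. V j l * stream a b l))"
    using assms unfolding xu_def Mp_def by (simp add: sum_distrib_left mult.left_commute)
  also have "\<dots> = amp * stream a b i" by (simp only: inverse_pair_apply[OF V_Mp i])
  finally show ?thesis unfolding sI_def by (simp add: mult.assoc)
qed

lemma sI_tail:
  assumes "m \<le> i" "i < Ndl"
  shows "sI a b i = (\<Sum>l<m. coef_I i l * sI a b l)"
  unfolding sI_def using combination_rows[of Mul "\<lambda>q. h (2, i, q)" "coef_I i" "\<lambda>l q. h (2, l, q)" m "xu a b", OF row_I[OF assms]]
  by (simp add: sum_distrib_left mult.left_commute)

lemma SA_mem: "a \<in> SA \<Longrightarrow> i < m \<Longrightarrow> a i \<in> grid ya" "a \<in> SA \<Longrightarrow> i < Mul \<Longrightarrow> \<not> i < m \<Longrightarrow> a i \<in> grid yf"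
  using PiE_mem[of a "{..<Mul}" "\<lambda>i. grid (if i < m then ya else yf)" i] m_le by (simp_all add: SA_def)

lemma SB_mem: "b \<in> SB \<Longrightarrow> i < m \<Longrightarrow> b i \<in> grid yb"
  by (auto simp: SB_def)

lemma stream_gaussian_int: "a \<in> SA \<Longrightarrow> b \<in> SB \<Longrightarrow> i < Mul \<Longrightarrow> gaussian_int (stream a b i)"
  using gaussian_int_grid[OF SA_mem(1)] gaussian_int_grid[OF SA_mem(2)] gaussian_int_grid[OF SB_mem]
  by (simp add: stream_def gaussian_int_add gaussian_int_scale)

text \<open>Inverting with \<open>U\<close> recovers the input difference with error of order
  \<open>g / \<Gamma>\<close>, and \<open>Mp\<close> maps it back to stream differences. These are
  Gaussian integers smaller than 1, hence 0, and \<open>radix\<close> splits the streams into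
  digits.\<close>

lemma separation_uplink:
  assumes ab: "a \<in> SA" "b \<in> SB" "a' \<in> SA" "b' \<in> SB"
    and close: "\<And>i. i < Nul \<Longrightarrow> cmod (sU a b i - sU a' b' i) \<le> 2 * g"
  shows "a = a' \<and> b = b'"
proof -
  define w where "w l = stream a b l - stream a' b' l" for l
  define v where "v j = (\<Sum>l<Mul. V j l * w l)" for j
  define u where "u i = (\<Sum>j<Mul. h (1, i, j) * v j)" for i
  define c where "c = sqrt (1 - lam) * \<Gamma>"
  have c: "0 < c" using params big by (simp add: c_def)
  have diff: "sU a b i - sU a' b' i = complex_of_real c * u i" for i
    unfolding sU_eq u_def v_def w_def c_def
    by (simp only: right_diff_distrib sum_subtractf)
  have u: "cmod (u i) \<le> 2 * g / c" if "i < Mul" for i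
  proof -
    have "c * cmod (u i) \<le> 2 * g"
      using close[of i] that dims c unfolding diff by (simp add: norm_mult)
    then show ?thesis using c by (simp add: pos_le_divide_eq mult.commute)
  qed
  have v: "cmod (v j) \<le> (\<Sum>i<Mul. cmod (U j i)) * (2 * g / c)" if "j < Mul" for j
    using cmod_sum_le[of Mul u "2 * g / c" "U j", OF u] inverse_pair_apply[OF inverse_pair_sym[OF U] that, of v]
    by (simp add: u_def)
  have "w l = 0" if l: "l < Mul" for l
  proof (rule gaussian_int_small)
    show "gaussian_int (w l)"
      unfolding w_def using ab l by (intro gaussian_int_diff stream_gaussian_int)
    have "w l = (\<Sum>j<Mul. Mp l j * v j)"
      using inverse_pair_apply[OF V_Mp l, of w] by (simp add: v_def)
    also have "cmod \<dots> \<le> (\<Sum>j<Mul. cmod (Mp l j) * ((\<Sum>i<Mul. cmod (U j i)) * (2 * g / c)))"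
    proof (intro order_trans[OF norm_sum] sum_mono)
      fix j assume "j \<in> {..<Mul}"
      then have "j < Mul" by simp
      then show "cmod (Mp l j * v j) \<le> cmod (Mp l j) * ((\<Sum>i<Mul. cmod (U j i)) * (2 * g / c))"
        unfolding norm_mult by (intro mult_left_mono v) simp_all
    qed
    also have "\<dots> = (\<Sum>j<Mul. cmod (Mp l j) * (\<Sum>i<Mul. cmod (U j i))) * (2 * g / c)"
      unfolding sum_distrib_right[of _ _ "2 * g / c"] mult.assoc ..
    also have "\<dots> \<le> cap * (2 * g / c)"
      using cap_bounds(2)[OF l] g c by (intro mult_right_mono) auto
    also have "\<dots> < 1" using big(1) c by (simp add: c_def pos_divide_less_eq ac_simps)
    finally show "cmod (w l) < 1" .
  qed
  then have eq: "stream a b l = stream a' b' l" if "l < Mul" for l using that by (simp add: w_def)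
  have low: "a l = a' l \<and> b l = b' l" if l: "l < m" for l
  proof (rule radix)
    show "of_nat Pa * a l + of_nat Pb * b l = of_nat Pa * a' l + of_nat Pb * b' l"
      using eq[of l] l m_le by (simp add: stream_def)
  qed (use ab SA_mem(1) SB_mem l in auto)
  have high: "a l = a' l" if "l < Mul" "\<not> l < m" for l
    using eq[OF that(1)] that(2) by (simp add: stream_def)
  have "a = a'"
    using ab(1,3) low high unfolding SA_def by (intro PiE_ext) auto
  moreover have "b = b'"
    using ab(2,4) low unfolding SB_def by (intro PiE_ext) auto
  ultimately show ?thesis by simp
qed

text \<open>On the first \<open>m\<close> antennas \<open>separation\<close> gives the downlink
  symbol, and with it the interference difference \<open>z\<close> is at most \<open>2 * g\<close>.
  On the other antennas the interference is a fixed combination of these \<open>z\<close>, hence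
  small enough for direct detection.\<close>

lemma separation_downlink:
  assumes d: "d \<in> SD" "d' \<in> SD" "a \<in> SA" "a' \<in> SA"
    and close: "\<And>i. i < Ndl \<Longrightarrow> cmod ((sD d i + sI a b i) - (sD d' i + sI a' b i)) \<le> 2 * g"
  shows "d = d'"
proof -
  define z where "z i = sI a b i - sI a' b i" for i
  have low: "d i = d' i \<and> cmod (z i) \<le> 2 * g" if i: "i < m" for i
  proof -
    have iN: "i < Ndl" using i m_le by simp
    have z: "z i = \<theta> * (of_nat Pa * (a i - a' i))"
    proof -
      have gen: "t * (p * x + y) - t * (p * x' + y) = t * (p * (x - x'))" for t p x y x' :: complex
        by (simp add: algebra_simps)
      have st: "stream e b i = of_nat Pa * e i + of_nat Pb * b i" for e using i by (simp add: stream_def)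
      show ?thesis unfolding z_def sI_eq[OF i] st by (rule gen)
    qed
    have c: "cmod (complex_of_real \<Gamma> * (d i - d' i) + z i) \<le> 2 * g"
      using close[OF iN] unfolding sD_eq[OF iN] z_def by (simp add: algebra_simps)
    then have "d i = d' i"
      using separation[of "d i" "d' i" "a i" "a' i"] d SA_mem(1)[OF _ i] iN unfolding z by (auto simp: SD_def)
    then show ?thesis using c by simp
  qed
  have high: "d i = d' i" if i: "i < Ndl" "m \<le> i" for i
  proof -
    have z: "z i = (\<Sum>l<m. coef_I i l * z l)"
      unfolding z_def sI_tail[OF i(2,1)] by (simp add: sum_subtractf right_diff_distrib)
    have zb: "cmod (z i) \<le> (\<Sum>l<m. cmod (coef_I i l)) * (2 * g)"
      unfolding z using low by (intro cmod_sum_le) auto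
    have c: "cmod (complex_of_real \<Gamma> * (d i - d' i) + z i) \<le> 2 * g"
      using close[OF i(1)] unfolding sD_eq[OF i(1)] z_def by (simp add: algebra_simps)
    have "cmod (complex_of_real \<Gamma> * (d i - d' i)) \<le> cmod (complex_of_real \<Gamma> * (d i - d' i) + z i) + cmod (z i)"
      using norm_triangle_ineq4[of "complex_of_real \<Gamma> * (d i - d' i) + z i" "z i"] by simp
    also have "\<dots> \<le> (1 + (\<Sum>l<m. cmod (coef_I i l))) * (2 * g)" using c zb by (simp add: distrib_right)
    also have "\<dots> \<le> cap * (2 * g)" using cap_bounds(3)[OF i(1)] g by (intro mult_right_mono) auto
    also have "\<dots> < \<Gamma>" using big(2) by (simp add: ac_simps)
    finally have "cmod (d i - d' i) < 1" using big(4) by (simp add: norm_mult)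
    moreover have "gaussian_int (d i - d' i)"
      using d i by (intro gaussian_int_diff gaussian_int_grid[of _ yf]) (auto simp: SD_def)
    ultimately have "d i - d' i = 0" by (rule gaussian_int_small[rotated])
    then show ?thesis by simp
  qed
  have "d i = d' i" if "i < Ndl" for i
    using low[of i] high[OF that] by (cases "i < m") auto
  then show ?thesis using d(1,2) unfolding SD_def by (intro PiE_ext) auto
qed

lemma separation_side:
  assumes s: "s \<in> SS" "s' \<in> SS" and close: "\<And>i. i < Ndl \<Longrightarrow> cmod (sS s i - sS s' i) \<le> 2 * g"
  shows "s = s'"
proof -
  have pos: "0 < sqrt lam * \<Gamma>" using params big by simp
  have "s i = s' i" if i: "i < m" for i
  proof -
    have "(sqrt lam * \<Gamma>) * cmod (s i - s' i) \<le> 2 * g"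
    proof -
      have "sS s i - sS s' i = complex_of_real (sqrt lam * \<Gamma>) * (s i - s' i)"
        unfolding sS_eq[OF i] by (simp only: right_diff_distrib)
      then have "cmod (complex_of_real (sqrt lam * \<Gamma>) * (s i - s' i)) \<le> 2 * g" using close[of i] i m_le by simp
      then show ?thesis unfolding norm_mult norm_of_real abs_of_pos[OF pos] .
    qed
    also have "\<dots> < (sqrt lam * \<Gamma>) * 1" using big(3) by simp
    finally have "cmod (s i - s' i) < 1" by (simp only: mult_less_cancel_left_pos[OF pos])
    moreover have "gaussian_int (s i - s' i)"
      using s i by (intro gaussian_int_diff gaussian_int_grid[of _ ys]) (auto simp: SS_def)
    ultimately have "s i - s' i = 0" by (rule gaussian_int_small[rotated])
    then show ?thesis by simp
  qed
  then show ?thesis using s unfolding SS_def by (intro PiE_ext) auto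
qed

lemma sqnorm_le_1:
  assumes "k \<le> q" "0 < q" "\<And>j. j < k \<Longrightarrow> real q * cmod (x j) \<le> 1"
  shows "sqnorm k x \<le> 1"
proof -
  have "sqnorm k x \<le> (\<Sum>j<k. 1 / real q)"
    unfolding sqnorm_def
  proof (rule sum_mono)
    fix j assume "j \<in> {..<k}"
    then have le: "cmod (x j) \<le> 1 / real q" using assms(2,3) by (simp add: pos_le_divide_eq mult.commute)
    also have "\<dots> \<le> 1" using assms(2) by simp
    finally have "(cmod (x j))\<^sup>2 \<le> cmod (x j)" by (simp add: power2_eq_square mult_left_le_one_le)
    then show "(cmod (x j))\<^sup>2 \<le> 1 / real q" using le by simp
  qed
  also have "\<dots> = real k / real q" by simp
  also have "\<dots> \<le> 1" using assms(1,2) by simp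
  finally show ?thesis .
qed

lemma input_bound:
  fixes k :: nat
  assumes "\<And>i. i < k \<Longrightarrow> cmod (x i) \<le> \<kappa> * r" "(\<Sum>i<k. cmod (M i)) \<le> cap" "0 < r"
  shows "real Mdl * cmod (complex_of_real (\<Gamma> / r) * (\<Sum>i<k. M i * x i)) \<le> 1"
proof -
  have "cmod (\<Sum>i<k. M i * x i) \<le> (\<Sum>i<k. cmod (M i)) * (\<kappa> * r)" by (rule cmod_sum_le) (rule assms(1))
  also have "\<dots> \<le> cap * (\<kappa> * r)" using assms amplitude by (intro mult_right_mono) auto
  finally have sum_le: "cmod (\<Sum>i<k. M i * x i) \<le> cap * (\<kappa> * r)" .
  have pos: "0 \<le> \<Gamma> / r" using big(4) assms(3) by simp
  have "cmod (complex_of_real (\<Gamma> / r)) * cmod (\<Sum>i<k. M i * x i) \<le> (\<Gamma> / r) * (cap * (\<kappa> * r))"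
    unfolding norm_of_real abs_of_nonneg[OF pos] by (rule mult_left_mono[OF sum_le pos])
  also have "\<dots> = \<kappa> * \<Gamma> * cap" using assms(3) by simp
  finally have "real Mdl * cmod (complex_of_real (\<Gamma> / r) * (\<Sum>i<k. M i * x i)) \<le> real Mdl * (\<kappa> * \<Gamma> * cap)"
    unfolding norm_mult by (intro mult_left_mono) auto
  also have "\<dots> \<le> 1" using amplitude(4) by (simp add: ac_simps)
  finally show ?thesis .
qed

lemma stream_bound:
  assumes "a \<in> SA" "b \<in> SB" "i < Mul"
  shows "cmod (stream a b i) \<le> \<kappa> * sqrt \<rho>"
proof (cases "i < m")
  case True
  have "cmod (stream a b i) \<le> real Pa * cmod (a i) + real Pb * cmod (b i)"
    using True norm_triangle_ineq[of "of_nat Pa * a i" "of_nat Pb * b i"] by (simp add: stream_def norm_mult)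
  also have "\<dots> \<le> real Pa * (2 * ya) + real Pb * (2 * yb)"
    using cmod_grid[OF SA_mem(1)[OF assms(1) True] y_nonneg(1)] cmod_grid[OF SB_mem[OF assms(2) True] y_nonneg(2)]
    by (intro add_mono mult_left_mono) auto
  finally show ?thesis using amplitude(1) by simp
next
  case False
  then show ?thesis using cmod_grid[OF SA_mem(2)[OF assms(1,3) False] y_nonneg(3)] amplitude(2) by (simp add: stream_def)
qed

lemma is_scheme: "scheme (net \<rho>) L g SD SA SB SS xd xu xside sD sU sI sS"
proof
  have Mdl: "0 < Mdl" "Mul \<le> Mdl" "m \<le> Mdl" using dims m_le by auto
  show "0 \<le> Wr (net \<rho>)" "0 < Wm (net \<rho>)" "0 < L" "0 < g" using params L g by simp_all
  show "max 1 (Wr (net \<rho>)) / g\<^sup>2 \<le> (1 / 2) ^ (L * (n_Nul (net \<rho>) + n_Ndl (net \<rho>) + 1))"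
    using noise_level by simp
  show "finite SD" "finite SA" "finite SB" "finite SS"
    unfolding SD_def SA_def SB_def SS_def by (auto intro!: finite_PiE finite_grid)
  show "SD \<noteq> {}" "SA \<noteq> {}" "SB \<noteq> {}" "SS \<noteq> {}"
    unfolding SD_def SA_def SB_def SS_def by (auto simp: PiE_eq_empty_iff grid_nonempty)
  show "sqnorm (n_Mdl (net \<rho>)) (xd d) \<le> 1" if "d \<in> SD" for d
  proof (rule sqnorm_le_1[of _ Mdl])
    fix j assume "j < n_Mdl (net \<rho>)"
    have "real Mdl * cmod (amp * (\<Sum>i<Ndl. D j i * d i)) \<le> 1" if j: "j < Ndl"
    proof (rule input_bound)
      fix i assume "i < Ndl"
      then have "d i \<in> grid yf" using \<open>d \<in> SD\<close> by (auto simp: SD_def)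
      from cmod_grid[OF this y_nonneg(3)] show "cmod (d i) \<le> \<kappa> * sqrt \<rho>" using amplitude(2) by simp
    qed (use cap_bounds(5)[OF j] \<rho> in auto)
    then show "real Mdl * cmod (xd d j) \<le> 1" by (simp add: xd_def)
  qed (use Mdl in auto)
  show "sqnorm (n_Mul (net \<rho>)) (xu a b) \<le> 1" if "a \<in> SA" "b \<in> SB" for a b
  proof (rule sqnorm_le_1[of _ Mdl])
    fix j assume "j < n_Mul (net \<rho>)"
    then have j: "j < Mul" by simp
    show "real Mdl * cmod (xu a b j) \<le> 1"
      unfolding xu_def using cap_bounds(4)[OF j] \<rho> by (intro input_bound stream_bound that) auto
  qed (use Mdl in auto)
  show "sqnorm (n_Mul (net \<rho>)) (xside s) \<le> 1" if "s \<in> SS" for s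
  proof (rule sqnorm_le_1[of _ Mdl])
    fix j assume "j < n_Mul (net \<rho>)"
    have "real Mdl * cmod (amp_S * (\<Sum>i<m. S j i * s i)) \<le> 1" if j: "j < m"
    proof (rule input_bound)
      fix i assume "i < m"
      then have "s i \<in> grid ys" using \<open>s \<in> SS\<close> by (auto simp: SS_def)
      from cmod_grid[OF this y_nonneg(4)] show "cmod (s i) \<le> \<kappa> * sqrt (\<rho> powr aS)" using amplitude(3) by simp
    qed (use cap_bounds(6)[OF j] \<rho> in auto)
    then show "real Mdl * cmod (xside s j) \<le> 1" by (simp add: xside_def)
  qed (use Mdl in auto)
  show "sD d i = complex_of_real (sqrt (snr_dl (net \<rho>))) * (\<Sum>j<n_Mdl (net \<rho>). H_dl (net \<rho>) i j * xd d j)" for d i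
    by (simp add: sD_def)
  show "sU a b i = complex_of_real (sqrt ((1 - fdnet.lam (net \<rho>)) * snr_ul (net \<rho>))) * (\<Sum>j<n_Mul (net \<rho>). H_ul (net \<rho>) i j * xu a b j)" for a b i
    by (simp add: sU_def)
  show "sI a b i = complex_of_real (sqrt ((1 - fdnet.lam (net \<rho>)) * snr_I (net \<rho>))) * (\<Sum>j<n_Mul (net \<rho>). H_I (net \<rho>) i j * xu a b j)" for a b i
    by (simp add: sI_def)
  show "sS s i = complex_of_real (sqrt (fdnet.lam (net \<rho>) * snr_S (net \<rho>))) * (\<Sum>j<n_Mul (net \<rho>). H_S (net \<rho>) i j * xside s j)" for s i
    by (simp add: sS_def)
  show "a = a' \<and> b = b'" if "a \<in> SA" "b \<in> SB" "a' \<in> SA" "b' \<in> SB"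
    "\<And>i. i < n_Nul (net \<rho>) \<Longrightarrow> cmod (sU a b i - sU a' b' i) \<le> 2 * g" for a b a' b'
    using that(1-4) by (rule separation_uplink) (simp add: that(5))
  show "d = d'" if "d \<in> SD" "d' \<in> SD" "a \<in> SA" "a' \<in> SA"
    "\<And>i. i < n_Ndl (net \<rho>) \<Longrightarrow> cmod ((sD d i + sI a b i) - (sD d' i + sI a' b i)) \<le> 2 * g" for d d' a a' b
    using that(1-4) by (rule separation_downlink[where b = b]) (simp add: that(5))
  show "s = s'" if "s \<in> SS" "s' \<in> SS" "\<And>i. i < n_Ndl (net \<rho>) \<Longrightarrow> cmod (sS s i - sS s' i) \<le> 2 * g" for s s'
    using that(1,2) by (rule separation_side) (simp add: that(3))
qed

lemma log_card_grid:
  assumes "0 < \<tau>" "\<tau> * \<rho> powr (x / 2) \<le> y"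
  shows "x * log 2 \<rho> - 2 * \<bar>log 2 \<tau>\<bar> \<le> log 2 (real (card (grid y)))"
proof -
  have pos: "0 < \<tau> * \<rho> powr (x / 2)" using assms \<rho> by simp
  then have y: "0 < y" using assms(2) by linarith
  have "x * log 2 \<rho> - 2 * \<bar>log 2 \<tau>\<bar> \<le> 2 * (log 2 \<tau> + x / 2 * log 2 \<rho>)" by simp
  also have "\<dots> = 2 * log 2 (\<tau> * \<rho> powr (x / 2))"
    using assms(1) \<rho> by (simp add: log_mult log_powr)
  also have "\<dots> \<le> 2 * log 2 y" using pos y assms(2) by simp
  also have "\<dots> = log 2 (y\<^sup>2)" using y by (simp add: log_nat_power)
  also have "\<dots> \<le> log 2 (real (card (grid y)))"
  proof -
    have "0 < real (card (grid y))" by (simp add: card_grid)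
    then show ?thesis using y square_le_card_grid[of y] by (subst log_le_cancel_iff) auto
  qed
  finally show ?thesis .
qed

lemma log_card_power:
  "log 2 (real (card (grid y) ^ k)) = real k * log 2 (real (card (grid y)))"
  by (simp add: log_nat_power card_grid)

text \<open>The alphabets have the intended exponents up to the loss \<open>c\<close>, which depends
  on \<open>\<tau>\<close> and the numbers of antennas but not on \<rho>.\<close>

lemma log_cards:
  assumes \<tau>: "0 < \<tau>" "\<tau> * \<rho> powr (xa / 2) \<le> ya" "\<tau> * \<rho> powr (xb / 2) \<le> yb" "\<tau> * \<rho> powr (1 / 2) \<le> yf" "\<tau> * \<rho> powr (aS / 2) \<le> ys"
  defines "c \<equiv> 2 * \<bar>log 2 \<tau>\<bar> * real (Mul + Ndl)"
  shows "real Ndl * log 2 \<rho> - c \<le> log 2 (real (card SD))"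
    "(real m * xa + real (Mul - m)) * log 2 \<rho> - c \<le> log 2 (real (card SA))"
    "real m * xb * log 2 \<rho> - c \<le> log 2 (real (card SB))"
    "real m * aS * log 2 \<rho> - c \<le> log 2 (real (card SS))"
proof -
  define k where "k = 2 * \<bar>log 2 \<tau>\<bar>"
  have k: "0 \<le> k" "c = k * real (Mul + Ndl)" by (simp_all add: k_def c_def)
  have kc: "real q * k \<le> c" if "q \<le> Mul + Ndl" for q
    using mult_right_mono[of "real q" "real (Mul + Ndl)" k] that k by (simp add: mult.commute)
  note lg = log_card_grid[OF \<tau>(1), folded k_def]
  have f: "log 2 \<rho> - k \<le> log 2 (real (card (grid yf)))" using lg[of 1 yf] \<tau>(4) by simp
  note gr = lg[OF \<tau>(2)] lg[OF \<tau>(3)] f lg[OF \<tau>(5)]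
  have mul: "real q * x - c \<le> real q * y" if "x - k \<le> y" "q \<le> Mul + Ndl" for q x y
  proof -
    have "real q * (x - k) \<le> real q * y" using that(1) by (rule mult_left_mono) simp
    then show ?thesis using kc[OF that(2)] by (simp add: right_diff_distrib)
  qed
  have m_sum: "m \<le> Mul + Ndl" using m_le by simp
  have "card SD = card (grid yf) ^ Ndl" by (simp add: SD_def card_PiE)
  then show "real Ndl * log 2 \<rho> - c \<le> log 2 (real (card SD))"
    using mul[OF f le_add2] by (simp only: log_card_power mult_1)
  have "card SB = card (grid yb) ^ m" by (simp add: SB_def card_PiE)
  then show "real m * xb * log 2 \<rho> - c \<le> log 2 (real (card SB))"
    using mul[OF gr(2) m_sum] by (simp only: log_card_power mult.assoc)
  have "card SS = card (grid ys) ^ m" by (simp add: SS_def card_PiE)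
  then show "real m * aS * log 2 \<rho> - c \<le> log 2 (real (card SS))"
    using mul[OF gr(4) m_sum] by (simp only: log_card_power mult.assoc)
  have "card SA = (\<Prod>i<Mul. if i < m then card (grid ya) else card (grid yf))"
    by (simp add: SA_def card_PiE if_distrib cong: if_cong)
  also have "\<dots> = card (grid ya) ^ m * card (grid yf) ^ (Mul - m)"
  proof -
    have "{..<Mul} = {..<m} \<union> {m..<Mul}" "{..<m} \<inter> {m..<Mul} = {}" using m_le by auto
    then show ?thesis by (simp add: prod.union_disjoint)
  qed
  finally have "log 2 (real (card SA)) = log 2 (real (card (grid ya) ^ m)) + log 2 (real (card (grid yf) ^ (Mul - m)))"
    by (simp add: log_mult card_grid)
  also have "\<dots> = real m * log 2 (real (card (grid ya))) + real (Mul - m) * log 2 (real (card (grid yf)))"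
    by (simp only: log_card_power)
  finally have SA: "log 2 (real (card SA)) = \<dots>" .
  have "real m * (xa * log 2 \<rho> - k) \<le> real m * log 2 (real (card (grid ya)))" by (intro mult_left_mono gr) simp
  moreover have "real (Mul - m) * (log 2 \<rho> - k) \<le> real (Mul - m) * log 2 (real (card (grid yf)))" by (intro mult_left_mono f) simp
  moreover have "real m * k + real (Mul - m) * k \<le> c" using kc[of Mul] m_le by (simp add: distrib_right[symmetric])
  ultimately show "(real m * xa + real (Mul - m)) * log 2 \<rho> - c \<le> log 2 (real (card SA))"
    unfolding SA by (simp add: algebra_simps)
qed

end

section \<open>From achievable rates to points of the GDoF region\<close>

lemma achievable_zero: "achievable N (0, 0)"
  unfolding achievable_def
proof (intro conjI allI impI)
  fix \<epsilon> :: real assume \<epsilon>: "0 < \<epsilon>"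
  have err: "err_event N n (\<lambda>_ _ _. 0) (\<lambda>_ _ _. 0) (\<lambda>_ _ _ _. 0) (\<lambda>_ _. 0) (\<lambda>_ _. 0) 0 0 = {}" for n
    by (simp add: err_event_def)
  have valid: "valid_code N n 1 1 (\<lambda>_ _ _. 0) (\<lambda>_ _ _. 0) (\<lambda>_ _ _ _. 0) (\<lambda>_ _. 0) (\<lambda>_ _. 0)" for n
    unfolding valid_code_def by (simp add: err x_dl_def sqnorm_def)
  have "error_prob N n 1 1 (\<lambda>_ _ _. 0) (\<lambda>_ _ _. 0) (\<lambda>_ _ _ _. 0) (\<lambda>_ _. 0) (\<lambda>_ _. 0) \<le> \<epsilon>" for n
    using \<epsilon> by (simp add: error_prob_def err)
  moreover have "2 powr (real n * fst (0, 0) / Wm N) \<le> real 1" "2 powr (real n * snd (0, 0) / Wm N) \<le> real 1" for n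
    by simp_all
  ultimately show "\<exists>n0. \<forall>n\<ge>n0. \<exists>Kd Ku xul xs fdl gul gdl.
        2 powr (real n * fst (0, 0) / Wm N) \<le> real Kd \<and> 2 powr (real n * snd (0, 0) / Wm N) \<le> real Ku \<and>
        valid_code N n Kd Ku xul xs fdl gul gdl \<and> error_prob N n Kd Ku xul xs fdl gul gdl \<le> \<epsilon>"
    using valid by blast
qed simp_all

lemma achievable_mono:
  assumes "achievable N R" "0 \<le> fst R'" "0 \<le> snd R'" "fst R' \<le> fst R" "snd R' \<le> snd R" "0 < Wm N"
  shows "achievable N R'"
  unfolding achievable_def
proof (intro conjI allI impI)
  fix \<epsilon> :: real assume "0 < \<epsilon>"
  then obtain n0 where n0: "\<And>n. n0 \<le> n \<Longrightarrow> \<exists>Kd Ku xul xs fdl gul gdl.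
        2 powr (real n * fst R / Wm N) \<le> real Kd \<and> 2 powr (real n * snd R / Wm N) \<le> real Ku \<and>
        valid_code N n Kd Ku xul xs fdl gul gdl \<and> error_prob N n Kd Ku xul xs fdl gul gdl \<le> \<epsilon>"
    using assms(1) unfolding achievable_def by meson
  have "2 powr (real n * fst R' / Wm N) \<le> 2 powr (real n * fst R / Wm N)"
    "2 powr (real n * snd R' / Wm N) \<le> 2 powr (real n * snd R / Wm N)" for n
    using assms by (auto intro!: powr_mono divide_right_mono mult_left_mono)
  then show "\<exists>n0. \<forall>n\<ge>n0. \<exists>Kd Ku xul xs fdl gul gdl.
        2 powr (real n * fst R' / Wm N) \<le> real Kd \<and> 2 powr (real n * snd R' / Wm N) \<le> real Ku \<and>
        valid_code N n Kd Ku xul xs fdl gul gdl \<and> error_prob N n Kd Ku xul xs fdl gul gdl \<le> \<epsilon>"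
    using n0 by (meson order_trans)
qed (use assms in auto)

text \<open>The region asks for one function of \<rho> with convergent normalised rates, whereas
  coding schemes provide, for each loss \<open>\<eta>\<close>, rates for all large \<rho>. Choosing
  an almost minimal loss at each \<rho> combines them.\<close>

lemma gdof_regionI:
  fixes net :: "real \<Rightarrow> fdnet"
  assumes wm: "0 < wm" "\<And>\<rho>. Wm (net \<rho>) = wm" and d: "0 \<le> d1" "0 \<le> d2"
    and ev: "\<And>\<eta>. 0 < \<eta> \<Longrightarrow> \<forall>\<^sub>F \<rho> in at_top. \<exists>R. achievable (net \<rho>) R \<and>
      (d1 - \<eta>) * (wm * log 2 \<rho>) \<le> fst R \<and> (d2 - \<eta>) * (wm * log 2 \<rho>) \<le> snd R"
  shows "(d1, d2) \<in> gdof_region net wm"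
proof -
  define rate where "rate \<rho> \<eta> = (max 0 (d1 - \<eta>) * (wm * log 2 \<rho>), max 0 (d2 - \<eta>) * (wm * log 2 \<rho>))" for \<rho> \<eta>
  define P where "P \<rho> \<eta> \<longleftrightarrow> 0 \<le> \<eta> \<and> achievable (net \<rho>) (rate \<rho> \<eta>)" for \<rho> \<eta>
  \<comment> \<open>The best possible loss at this SNR. The infimum need not be attained, which is
    why a slack of \<open>1 / \<rho>\<close> is allowed below.\<close>
  define e where "e \<rho> = Inf {\<eta>. P \<rho> \<eta>}" for \<rho>
  have bdd: "bdd_below {\<eta>. P \<rho> \<eta>}" for \<rho> by (rule bdd_belowI[of _ 0]) (simp add: P_def)
  \<comment> \<open>Giving up both rates is possible at every SNR, so a choice exists also for small
    \<rho>, where the hypothesis says nothing.\<close>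
  have "P \<rho> (max d1 d2)" for \<rho>
    using d achievable_zero by (simp add: P_def rate_def max_def)
  then have ne: "{\<eta>. P \<rho> \<eta>} \<noteq> {}" for \<rho> by blast
  have "\<exists>\<eta>. P \<rho> \<eta> \<and> \<eta> < e \<rho> + 1 / \<rho>" if "1 < \<rho>" for \<rho>
    using cInf_lessD[OF ne, of \<rho> "e \<rho> + 1 / \<rho>"] that by (auto simp: e_def)
  then obtain \<eta> where \<eta>: "\<And>\<rho>. 1 < \<rho> \<Longrightarrow> P \<rho> (\<eta> \<rho>)" "\<And>\<rho>. 1 < \<rho> \<Longrightarrow> \<eta> \<rho> < e \<rho> + 1 / \<rho>"
    by metis
  have evP: "\<forall>\<^sub>F \<rho> in at_top. P \<rho> \<delta>" if \<delta>: "0 < \<delta>" for \<delta>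
    using ev[OF \<delta>] eventually_gt_at_top[of 1]
  proof eventually_elim
    fix \<rho> :: real assume \<rho>: "1 < \<rho>" and "\<exists>R. achievable (net \<rho>) R \<and>
      (d1 - \<delta>) * (wm * log 2 \<rho>) \<le> fst R \<and> (d2 - \<delta>) * (wm * log 2 \<rho>) \<le> snd R"
    then obtain R where R: "achievable (net \<rho>) R" "(d1 - \<delta>) * (wm * log 2 \<rho>) \<le> fst R" "(d2 - \<delta>) * (wm * log 2 \<rho>) \<le> snd R"
      by blast
    have nn: "0 \<le> wm * log 2 \<rho>" using wm(1) \<rho> by simp
    have "0 \<le> fst R" "0 \<le> snd R" using R(1) by (auto simp: achievable_def)
    then have "achievable (net \<rho>) (rate \<rho> \<delta>)"
      using R nn wm by (intro achievable_mono[OF R(1)]) (auto simp: rate_def max_def)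
    then show "P \<rho> \<delta>" using \<delta> by (simp add: P_def)
  qed
  have lim: "(\<eta> \<longlongrightarrow> 0) at_top"
  proof (rule tendstoI)
    fix \<delta> :: real assume \<delta>: "0 < \<delta>"
    show "\<forall>\<^sub>F \<rho> in at_top. dist (\<eta> \<rho>) 0 < \<delta>"
      using evP[OF half_gt_zero[OF \<delta>]] eventually_gt_at_top[of "max 1 (2 / \<delta>)"]
    proof eventually_elim
      fix \<rho> :: real assume P: "P \<rho> (\<delta> / 2)" and "max 1 (2 / \<delta>) < \<rho>"
      then have \<rho>: "1 < \<rho>" "2 / \<delta> < \<rho>" by auto
      have "e \<rho> \<le> \<delta> / 2" unfolding e_def using P bdd by (intro cInf_lower) auto
      moreover have "1 / \<rho> < \<delta> / 2" using \<rho> \<delta> by (simp add: field_simps)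
      ultimately have "\<eta> \<rho> < \<delta>" using \<eta>(2)[OF \<rho>(1)] by linarith
      moreover have "0 \<le> \<eta> \<rho>" using \<eta>(1)[OF \<rho>(1)] by (simp add: P_def)
      ultimately show "dist (\<eta> \<rho>) 0 < \<delta>" by (simp add: dist_real_def)
    qed
  qed
  have lim0: "((\<lambda>\<rho>. max 0 (x - \<eta> \<rho>)) \<longlongrightarrow> max 0 (x - 0)) at_top" for x :: real
    by (intro tendsto_intros lim)
  have maxlim: "((\<lambda>\<rho>. max 0 (x - \<eta> \<rho>)) \<longlongrightarrow> x) at_top" if "0 \<le> x" for x
  proof -
    have "max 0 (x - 0) = x" using that by simp
    with lim0[of x] show ?thesis by (simp only:)
  qed
  have div: "\<forall>\<^sub>F \<rho> in at_top. max 0 (x - \<eta> \<rho>) = max 0 (x - \<eta> \<rho>) * (wm * log 2 \<rho>) / (wm * log 2 \<rho>)" for x :: real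
    using eventually_gt_at_top[of 1]
  proof eventually_elim
    fix \<rho> :: real assume "1 < \<rho>"
    then have "0 < log 2 \<rho>" by (subst zero_less_log_cancel_iff) auto
    then have "wm * log 2 \<rho> \<noteq> 0" using wm by simp
    then show "max 0 (x - \<eta> \<rho>) = max 0 (x - \<eta> \<rho>) * (wm * log 2 \<rho>) / (wm * log 2 \<rho>)" by simp
  qed
  show ?thesis
    unfolding gdof_region_def
  proof (simp only: mem_Collect_eq case_prod_conv, intro exI[of _ "\<lambda>\<rho>. rate \<rho> (\<eta> \<rho>)"] conjI allI impI)
    show "rate \<rho> (\<eta> \<rho>) \<in> capacity_region (net \<rho>)" if "1 < \<rho>" for \<rho>
      using \<eta>(1)[OF that] closure_subset unfolding P_def capacity_region_def by blast
    show "((\<lambda>\<rho>. fst (rate \<rho> (\<eta> \<rho>)) / (wm * log 2 \<rho>)) \<longlongrightarrow> d1) at_top"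
      using Lim_transform_eventually[OF maxlim[OF d(1)] div] by (simp add: rate_def)
    show "((\<lambda>\<rho>. snd (rate \<rho> (\<eta> \<rho>)) / (wm * log 2 \<rho>)) \<longlongrightarrow> d2) at_top"
      using Lim_transform_eventually[OF maxlim[OF d(2)] div] by (simp add: rate_def)
  qed
qed

lemma code_rate_ge:
  fixes c K l :: real
  assumes "c * l - K \<le> log 2 (real (card X))" "2 \<le> L" "0 \<le> c" "0 \<le> K" "0 \<le> l"
  shows "(1 - 2 / real L) * (c * l) - (K + 1) \<le> code_rate L X"
proof -
  have t: "0 \<le> 1 - 2 / real L" "1 - 2 / real L \<le> 1" using assms(2) by auto
  have "(1 - 2 / real L) * (c * l - K) \<le> (1 - 2 / real L) * log 2 (real (card X))"
    using assms(1) t(1) by (rule mult_left_mono)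
  moreover have "(1 - 2 / real L) * K \<le> K" using t assms(4) by (simp add: mult_left_le_one_le)
  ultimately show ?thesis unfolding code_rate_def right_diff_distrib by linarith
qed

section \<open>The two interference regimes and the choice of constants\<close>

context channel
begin

text \<open>Exponent of the digit with which M2 copes unaided. For aI < 1 it is the size 1 - aI at
  which interference arrives at noise level; otherwise it is the excess aI - 1 of interference over
  the downlink signal, at most a whole stream.\<close>

definition xa :: real where "xa = min 1 \<bar>1 - aI\<bar>"
definition xb :: real where "xb = 1 - xa"

lemma xa_xb: "0 \<le> xa" "xa \<le> 1" "0 \<le> xb" "xb \<le> 1"
  using params by (auto simp: xa_def xb_def)

text \<open>First digits of the visible streams, hidden streams, and second digits as far as the
  side channel can carry them.\<close>

definition dof_ul :: real where
  "dof_ul = real m * xa + real (Mul - m) + min (real m * xb) (W * (real m * aS))"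

lemma sqrt_eq_powr: "1 < \<rho> \<Longrightarrow> sqrt \<rho> = \<rho> powr (1 / 2)" "1 < \<rho> \<Longrightarrow> sqrt (\<rho> powr x) = \<rho> powr (x / 2)"
  by (simp_all add: powr_half_sqrt[symmetric] powr_powr)

text \<open>The digit \<open>a\<close> is the low one, with place value 1. At M2 it stays below the
  grid spacing \<open>\<Gamma>\<close>, so the downlink symbol is detected with \<open>a\<close>
  treated as additional noise.\<close>

lemma grid_scheme_weak:
  assumes aI: "aI < 1" and \<rho>: "1 < \<rho>" and L: "0 < L" and g: "0 < g"
    and noise: "max 1 W / g\<^sup>2 \<le> (1 / 2) ^ (L * (Nul + Ndl + 1))"
    and big: "2 * g * cap < sqrt (1 - lam) * \<Gamma>" "8 * g * cap < \<Gamma>" "2 * g < sqrt lam * \<Gamma>"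
    and \<kappa>: "\<kappa> * \<Gamma> * cap * real Mdl \<le> 1" and \<tau>: "0 < \<tau>" "\<tau> \<le> 1 / 16" "6 * \<tau> \<le> \<kappa>"
    and ya: "ya = \<tau> * \<rho> powr (xa / 2)" and yb: "yb = \<tau> * \<rho> powr (xb / 2)"
  shows "grid_scheme Mdl Nul Mul Ndl wm W lam aI aS h V U S D \<rho> g \<Gamma> \<kappa> ya yb
    (\<tau> * \<rho> powr (1 / 2)) (\<tau> * \<rho> powr (aS / 2)) L 1 (nat \<lfloor>ya\<rfloor> + 1)"
proof -
  have x: "xa = 1 - aI" "xb = aI" using aI params by (auto simp: xa_def xb_def)
  have cap1: "1 \<le> cap" by (rule cap_bounds(1))
  have g8: "8 * g < \<Gamma>"
  proof -
    have "8 * g * 1 \<le> 8 * g * cap" using g cap1 by (intro mult_left_mono) auto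
    then show ?thesis using big(2) by simp
  qed
  have \<Gamma>: "0 < \<Gamma>" using g8 g by simp
  have scale: "2 * (\<tau> * p) \<le> \<kappa> * p" if "0 \<le> p" for p
    using mult_right_mono[of "2 * \<tau>" \<kappa> p] \<tau>(1) \<tau>(3) that unfolding mult.assoc by linarith
  have mono: "\<rho> powr (y / 2) \<le> \<rho> powr (1 / 2)" if "y \<le> 1" for y using \<rho> that by simp
  have prod: "\<rho> powr (xa / 2) * \<rho> powr (xb / 2) = \<rho> powr (1 / 2)"
    by (simp add: xb_def powr_add[symmetric] diff_divide_distrib)
  have ynn: "0 \<le> ya" "0 \<le> yb" using \<tau> by (simp_all add: ya yb)
  show ?thesis
  proof (unfold_locales)
    have "2 * g * cap \<le> 8 * g * cap" using g cap1 by (intro mult_right_mono) auto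
    then show "2 * g * cap < \<Gamma>" using big(2) by linarith
    show "real 1 * (2 * ya) + real (nat \<lfloor>ya\<rfloor> + 1) * (2 * yb) \<le> \<kappa> * sqrt \<rho>"
    \<comment> \<open>There are three contributions, each at most 2 \<tau> times the square root of
      \<rho>: one from \<open>ya\<close>, two from \<open>(ya + 1) * (2 * yb)\<close>. This explains
      the 6 in the assumption on \<open>\<tau>\<close> and \<open>\<kappa>\<close>.\<close>
    proof -
      have "real (nat \<lfloor>ya\<rfloor> + 1) \<le> ya + 1" using ynn by simp
      then have "real (nat \<lfloor>ya\<rfloor> + 1) * (2 * yb) \<le> (ya + 1) * (2 * yb)" using ynn by (intro mult_right_mono) auto
      moreover have "(ya + 1) * (2 * yb) = 2 * \<tau> * (\<tau> * \<rho> powr (1 / 2)) + 2 * \<tau> * \<rho> powr (xb / 2)"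
        unfolding prod[symmetric] by (simp add: ya yb algebra_simps)
      moreover have "\<tau> * (\<tau> * \<rho> powr (1 / 2)) \<le> \<tau> * \<rho> powr (1 / 2)" using \<tau> by (simp add: mult_left_le_one_le)
      moreover have "\<tau> * \<rho> powr (xb / 2) \<le> \<tau> * \<rho> powr (1 / 2)" "ya \<le> \<tau> * \<rho> powr (1 / 2)"
        using \<tau> xa_xb unfolding ya by (intro mult_left_mono mono; simp)+
      moreover have "6 * (\<tau> * \<rho> powr (1 / 2)) \<le> \<kappa> * \<rho> powr (1 / 2)" using mult_right_mono[OF \<tau>(3), of "\<rho> powr (1 / 2)"] by simp
      ultimately show ?thesis unfolding sqrt_eq_powr(1)[OF \<rho>] by simp
    qed
    show "2 * (\<tau> * \<rho> powr (1 / 2)) \<le> \<kappa> * sqrt \<rho>"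
      unfolding sqrt_eq_powr(1)[OF \<rho>] by (rule scale) simp
    show "2 * (\<tau> * \<rho> powr (aS / 2)) \<le> \<kappa> * sqrt (\<rho> powr aS)"
      unfolding sqrt_eq_powr(2)[OF \<rho>] by (rule scale) simp
    show "a = a' \<and> b = b'" if "a \<in> grid ya" "a' \<in> grid ya" "b \<in> grid yb" "b' \<in> grid yb"
      "of_nat 1 * a + of_nat (nat \<lfloor>ya\<rfloor> + 1) * b = of_nat 1 * a' + of_nat (nat \<lfloor>ya\<rfloor> + 1) * b'" for a a' b b'
      using grid_radix[OF that(1-4) refl] that(5) by simp
    fix d d' a a'
    assume G: "d \<in> grid (\<tau> * \<rho> powr (1 / 2))" "d' \<in> grid (\<tau> * \<rho> powr (1 / 2))" "a \<in> grid ya" "a' \<in> grid ya"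
      and c: "cmod (complex_of_real \<Gamma> * (d - d') + complex_of_real (sqrt ((1 - lam) * \<rho> powr aI) * (\<Gamma> / sqrt \<rho>)) * (of_nat 1 * (a - a'))) \<le> 2 * g"
    define t where "t = sqrt ((1 - lam) * \<rho> powr aI) * (\<Gamma> / sqrt \<rho>)"
    have t: "0 \<le> t" using \<Gamma> params \<rho> unfolding t_def by (intro mult_nonneg_nonneg divide_nonneg_nonneg) auto
    have "sqrt ((1 - lam) * \<rho> powr aI) \<le> \<rho> powr (aI / 2)"
      using params \<rho> unfolding sqrt_eq_powr(2)[OF \<rho>, symmetric] by (intro real_sqrt_le_mono) (simp add: mult_left_le_one_le)
    then have "t \<le> \<rho> powr (aI / 2) * (\<Gamma> / \<rho> powr (1 / 2))"
      unfolding t_def sqrt_eq_powr(1)[OF \<rho>] using \<Gamma> by (intro mult_right_mono) auto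
    then have "t * ya \<le> \<rho> powr (aI / 2) * (\<Gamma> / \<rho> powr (1 / 2)) * ya" using ynn by (intro mult_right_mono)
    also have "\<dots> = \<tau> * \<Gamma> * ((\<rho> powr (xa / 2) * \<rho> powr (xb / 2)) / \<rho> powr (1 / 2))" by (simp add: ya x)
    also have "\<dots> = \<tau> * \<Gamma>" unfolding prod using \<rho> by simp
    \<comment> \<open>Grid differences are bounded by \<open>2 * ya\<close>, so \<open>a\<close>
      disturbs by at most \<open>\<Gamma> / 8\<close>. The threshold \<open>2 * g\<close> is below
      \<open>\<Gamma> / 4\<close>, and together they stay below one grid spacing.\<close>
    also have "\<dots> \<le> \<Gamma> / 16" using mult_right_mono[OF \<tau>(2), of \<Gamma>] \<Gamma> by simp
    finally have tya: "t * ya \<le> \<Gamma> / 16" .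
    have "cmod (complex_of_real t * (a - a')) \<le> t * (2 * ya)"
      unfolding norm_mult using cmod_grid_diff[OF G(3,4) ynn(1)] t by (intro mult_mono) auto
    then have ta: "cmod (complex_of_real t * (a - a')) \<le> \<Gamma> / 8" using tya by simp
    have "cmod (complex_of_real \<Gamma> * (d - d')) \<le> cmod (complex_of_real \<Gamma> * (d - d') + complex_of_real t * (a - a')) + cmod (complex_of_real t * (a - a'))"
      using norm_triangle_ineq4[of "complex_of_real \<Gamma> * (d - d') + complex_of_real t * (a - a')" "complex_of_real t * (a - a')"] by simp
    also have "\<dots> < \<Gamma>"
      using c ta g8 \<Gamma> unfolding t_def[symmetric] of_nat_1 mult_1_left by linarith
    finally have "cmod (d - d') < 1" using \<Gamma> by (simp add: norm_mult)
    moreover have "gaussian_int (d - d')" using G by (intro gaussian_int_diff gaussian_int_grid)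
    ultimately have "d - d' = 0" by (rule gaussian_int_small[rotated])
    then show "d = d'" by simp
  qed (use \<rho> L g noise big \<kappa> \<tau> \<Gamma> ynn in auto)
qed

text \<open>Now \<open>a\<close> is the high digit. At M2 its steps exceed twice the extent of the
  downlink signal, so \<open>a\<close> is detected first and removed, after which the downlink
  symbol is free of interference. The factor \<open>K\<close> makes up for the power fraction
  \<open>1 - lam\<close> of the interfering link.\<close>

lemma grid_scheme_strong:
  assumes aI: "1 \<le> aI" and \<rho>: "1 < \<rho>" and L: "0 < L" and g: "0 < g"
    and noise: "max 1 W / g\<^sup>2 \<le> (1 / 2) ^ (L * (Nul + Ndl + 1))"
    and big: "2 * g * cap < sqrt (1 - lam) * \<Gamma>" "8 * g * cap < \<Gamma>" "2 * g < sqrt lam * \<Gamma>"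
    and \<kappa>: "\<kappa> * \<Gamma> * cap * real Mdl \<le> 1" and \<tau>: "0 < \<tau>" "\<tau> \<le> 1 / 16" "6 * \<tau> * K \<le> \<kappa>"
    and K: "K = 4 / sqrt (1 - lam)" and \<tau>\<rho>: "1 \<le> \<tau> * \<rho> powr (1 / 2)"
    and ya: "ya = \<tau> * \<rho> powr (xa / 2)" and yb: "yb = \<tau> * K * \<rho> powr (xb / 2)"
  shows "grid_scheme Mdl Nul Mul Ndl wm W lam aI aS h V U S D \<rho> g \<Gamma> \<kappa> ya yb
    (\<tau> * \<rho> powr (1 / 2)) (\<tau> * \<rho> powr (aS / 2)) L (nat \<lfloor>yb\<rfloor> + 1) 1"
proof -
  \<comment> \<open>Equality for aI between 1 and 2. Above 2 the exponent \<open>xb\<close> is 0 and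
    the interference alone exceeds the downlink signal by enough.\<close>
  have x: "1 \<le> aI - 1 + xb" using aI by (auto simp: xa_def xb_def)
  have cap1: "1 \<le> cap" by (rule cap_bounds(1))
  have g8: "8 * g < \<Gamma>"
  proof -
    have "8 * g * 1 \<le> 8 * g * cap" using g cap1 by (intro mult_left_mono) auto
    then show ?thesis using big(2) by simp
  qed
  have \<Gamma>: "0 < \<Gamma>" using g8 g by simp
  have u: "0 < sqrt (1 - lam)" "sqrt (1 - lam) \<le> 1" using params by auto
  have K1: "1 \<le> K" unfolding K pos_le_divide_eq[OF u(1)] using u(2) by linarith
  have \<tau>K: "\<tau> \<le> \<tau> * K" using mult_left_mono[OF K1, of \<tau>] \<tau>(1) by simp
  have \<tau>6: "6 * \<tau> \<le> \<kappa>" using \<tau>(3) \<tau>K by simp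
  have scale: "2 * (\<tau> * p) \<le> \<kappa> * p" if "0 \<le> p" for p
    using mult_right_mono[of "2 * \<tau>" \<kappa> p] \<tau>(1) \<tau>6 that unfolding mult.assoc by linarith
  have mono: "\<rho> powr (y / 2) \<le> \<rho> powr (1 / 2)" if "y \<le> 1" for y using \<rho> that by simp
  have prod: "\<rho> powr (xa / 2) * \<rho> powr (xb / 2) = \<rho> powr (1 / 2)"
    by (simp add: xb_def powr_add[symmetric] diff_divide_distrib)
  have ynn: "0 \<le> ya" "0 \<le> yb" using \<tau> K1 by (simp_all add: ya yb)
  show ?thesis
  proof (unfold_locales)
    have "2 * g * cap \<le> 8 * g * cap" using g cap1 by (intro mult_right_mono) auto
    then show "2 * g * cap < \<Gamma>" using big(2) by linarith
    show "real (nat \<lfloor>yb\<rfloor> + 1) * (2 * ya) + real 1 * (2 * yb) \<le> \<kappa> * sqrt \<rho>"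
    proof -
      have "real (nat \<lfloor>yb\<rfloor> + 1) \<le> yb + 1" using ynn by simp
      then have "real (nat \<lfloor>yb\<rfloor> + 1) * (2 * ya) \<le> (yb + 1) * (2 * ya)" using ynn by (intro mult_right_mono) auto
      moreover have "(yb + 1) * (2 * ya) = 2 * (\<tau> * (\<tau> * K * \<rho> powr (1 / 2))) + 2 * ya"
        unfolding prod[symmetric] by (simp add: ya yb algebra_simps)
      moreover have "\<tau> * (\<tau> * K * \<rho> powr (1 / 2)) \<le> \<tau> * K * \<rho> powr (1 / 2)" using \<tau> K1 by (intro mult_left_le_one_le) auto
      moreover have "yb \<le> \<tau> * K * \<rho> powr (1 / 2)" "ya \<le> \<tau> * \<rho> powr (1 / 2)"
        using \<tau> K1 xa_xb unfolding ya yb by (intro mult_left_mono mono; simp)+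
      moreover have "\<tau> * \<rho> powr (1 / 2) \<le> \<tau> * K * \<rho> powr (1 / 2)" using \<tau>K by (intro mult_right_mono) auto
      moreover have "6 * (\<tau> * K * \<rho> powr (1 / 2)) \<le> \<kappa> * \<rho> powr (1 / 2)" using mult_right_mono[OF \<tau>(3), of "\<rho> powr (1 / 2)"] by simp
      ultimately show ?thesis unfolding sqrt_eq_powr(1)[OF \<rho>] by simp
    qed
    show "2 * (\<tau> * \<rho> powr (1 / 2)) \<le> \<kappa> * sqrt \<rho>"
      unfolding sqrt_eq_powr(1)[OF \<rho>] by (rule scale) simp
    show "2 * (\<tau> * \<rho> powr (aS / 2)) \<le> \<kappa> * sqrt (\<rho> powr aS)"
      unfolding sqrt_eq_powr(2)[OF \<rho>] by (rule scale) simp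
    show "a = a' \<and> b = b'" if "a \<in> grid ya" "a' \<in> grid ya" "b \<in> grid yb" "b' \<in> grid yb"
      "of_nat (nat \<lfloor>yb\<rfloor> + 1) * a + of_nat 1 * b = of_nat (nat \<lfloor>yb\<rfloor> + 1) * a' + of_nat 1 * b'" for a a' b b'
      using grid_radix[OF that(3,4,1,2) refl] that(5) by (simp add: add.commute)
    fix d d' a a'
    assume G: "d \<in> grid (\<tau> * \<rho> powr (1 / 2))" "d' \<in> grid (\<tau> * \<rho> powr (1 / 2))" "a \<in> grid ya" "a' \<in> grid ya"
      and c: "cmod (complex_of_real \<Gamma> * (d - d') + complex_of_real (sqrt ((1 - lam) * \<rho> powr aI) * (\<Gamma> / sqrt \<rho>)) * (of_nat (nat \<lfloor>yb\<rfloor> + 1) * (a - a'))) \<le> 2 * g"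
    define t where "t = sqrt ((1 - lam) * \<rho> powr aI) * (\<Gamma> / sqrt \<rho>)"
    let ?Q = "real (nat \<lfloor>yb\<rfloor> + 1)"
    have t: "0 \<le> t" using \<Gamma> params \<rho> unfolding t_def by (intro mult_nonneg_nonneg divide_nonneg_nonneg) auto
    have t_eq: "t = sqrt (1 - lam) * \<Gamma> * \<rho> powr ((aI - 1) / 2)"
      unfolding t_def real_sqrt_mult sqrt_eq_powr[OF \<rho>] by (simp add: diff_divide_distrib powr_diff)
    have "yb \<le> ?Q" by linarith
    then have "t * yb \<le> t * ?Q" using t by (rule mult_left_mono)
    moreover have "t * yb = 4 * \<Gamma> * \<tau> * \<rho> powr ((aI - 1 + xb) / 2)"
      unfolding t_eq yb K using u by (simp add: powr_add add_divide_distrib)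
    moreover have "4 * \<Gamma> * \<tau> * \<rho> powr (1 / 2) \<le> 4 * \<Gamma> * \<tau> * \<rho> powr ((aI - 1 + xb) / 2)"
      using x \<Gamma> \<tau> \<rho> by (intro mult_left_mono powr_mono) auto
    ultimately have tQ: "4 * (\<Gamma> * (\<tau> * \<rho> powr (1 / 2))) \<le> t * ?Q" by (simp add: mult.assoc)
    \<comment> \<open>This is at most half of the step \<open>t * ?Q\<close> of the digit
      \<open>a\<close>. By \<open>\<tau>\<rho>\<close> the other half is at least
      \<open>2 * \<Gamma>\<close>, far above the threshold.\<close>
    have \<Gamma>d: "cmod (complex_of_real \<Gamma> * (d - d')) \<le> \<Gamma> * (2 * (\<tau> * \<rho> powr (1 / 2)))"
      unfolding norm_mult using cmod_grid_diff[OF G(1,2)] \<Gamma> \<tau> by (intro mult_mono) auto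
    have "a - a' = 0"
    proof (rule gaussian_int_small)
      show "gaussian_int (a - a')" using G by (intro gaussian_int_diff gaussian_int_grid)
      show "cmod (a - a') < 1"
      proof (rule ccontr)
        assume "\<not> cmod (a - a') < 1"
        then have "t * ?Q * 1 \<le> t * ?Q * cmod (a - a')" using t by (intro mult_left_mono) auto
        also have "\<dots> = cmod (complex_of_real t * (of_nat (nat \<lfloor>yb\<rfloor> + 1) * (a - a')))"
          using t unfolding norm_mult norm_of_real norm_of_nat by simp
        also have "\<dots> \<le> cmod (complex_of_real \<Gamma> * (d - d') + complex_of_real t * (of_nat (nat \<lfloor>yb\<rfloor> + 1) * (a - a'))) + cmod (complex_of_real \<Gamma> * (d - d'))"
          using norm_triangle_ineq4[of "complex_of_real \<Gamma> * (d - d') + complex_of_real t * (of_nat (nat \<lfloor>yb\<rfloor> + 1) * (a - a'))" "complex_of_real \<Gamma> * (d - d')"] by simp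
        also have "\<dots> \<le> 2 * g + \<Gamma> * (2 * (\<tau> * \<rho> powr (1 / 2)))" using c \<Gamma>d unfolding t_def[symmetric] by (rule add_mono)
        finally have "2 * (\<Gamma> * (\<tau> * \<rho> powr (1 / 2))) \<le> 2 * g" using tQ by simp
        moreover have "\<Gamma> * 1 \<le> \<Gamma> * (\<tau> * \<rho> powr (1 / 2))" using \<tau>\<rho> \<Gamma> by (intro mult_left_mono) auto
        ultimately show False using g8 g by linarith
      qed
    qed
    then have "\<Gamma> * cmod (d - d') \<le> 2 * g" using c \<Gamma> by (simp add: norm_mult)
    also have "\<dots> < \<Gamma> * 1" using g8 g by simp
    finally have "cmod (d - d') < 1" by (simp only: mult_less_cancel_left_pos[OF \<Gamma>])
    moreover have "gaussian_int (d - d')" using G by (intro gaussian_int_diff gaussian_int_grid)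
    ultimately have "d - d' = 0" by (rule gaussian_int_small[rotated])
    then show "d = d'" by simp
  qed (use \<rho> L g noise big \<kappa> \<tau> \<tau>6 \<Gamma> ynn in auto)
qed

text \<open>The loss \<open>3 / L\<close> collects \<open>2 / L\<close> from the minimum distance of
  the outer codes and \<open>1 / L\<close> from rounding the number of side-channel uses. The
  constants are fixed in turn, all before \<rho>: \<open>g\<close> by the noise level,
  \<open>\<Gamma>\<close> by the required spacing, \<open>\<kappa>\<close> by the power constraint,
  \<open>\<tau>\<close> by \<open>\<kappa>\<close>.\<close>

lemma achievable_for_large_snr:
  assumes L: "2 \<le> L"
  shows "\<exists>c\<ge>0. \<forall>\<^sub>F \<rho> in at_top. \<exists>R. achievable (net \<rho>) R \<and>
    wm * ((1 - 3 / real L) * (real Ndl * log 2 \<rho>) - c) \<le> fst R \<and>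
    wm * ((1 - 3 / real L) * (dof_ul * log 2 \<rho>) - c) \<le> snd R"
proof -
  define e where "e = L * (Nul + Ndl + 1)"
  \<comment> \<open>At least \<open>max 1 W\<close> and at least \<open>2 ^ e\<close>, so its square
    dominates their product, as the noise level demands.\<close>
  define g where "g = max 1 W * 2 ^ e"
  define u where "u = sqrt (1 - lam)"
  define v where "v = sqrt lam"
  \<comment> \<open>Division by \<open>u * v\<close>, with both factors at most 1, serves the
    spacing on uplink, downlink and side channel at once.\<close>
  define \<Gamma> where "\<Gamma> = 1 + 8 * g * cap / (u * v)"
  define \<kappa> where "\<kappa> = 1 / (\<Gamma> * cap * real Mdl)"
  define K where "K = 4 / u"
  define \<tau> where "\<tau> = min (1 / 16) (\<kappa> / (6 * K))"
  have uv: "0 < u" "u \<le> 1" "0 < v" "v \<le> 1" using params by (auto simp: u_def v_def)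
  have W1: "1 \<le> max 1 W" by simp
  have g: "1 \<le> g" "max 1 W \<le> g" "2 ^ e \<le> g"
    using mult_mono[OF W1 one_le_power[of "2 :: real" e]] mult_left_mono[OF one_le_power[of "2 :: real" e], of "max 1 W"] mult_right_mono[OF W1, of "2 ^ e"]
    by (simp_all add: g_def)
  have "max 1 W * 2 ^ e \<le> g\<^sup>2" unfolding power2_eq_square using g by (intro mult_mono) auto
  then have noise: "max 1 W / g\<^sup>2 \<le> (1 / 2) ^ e"
    using g(1) by (simp add: pos_divide_le_eq power_one_over field_simps)
  have cap1: "1 \<le> cap" by (rule cap_bounds(1))
  have gc: "0 < 8 * g * cap" "g \<le> g * cap" using g cap1 by auto
  have uv1: "u * v \<le> 1" using uv by (simp add: mult_le_one)
  have "8 * g * cap \<le> 8 * g * cap / (u * v)" using gc(1) uv uv1 by (simp add: pos_le_divide_eq mult_left_le)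
  then have \<Gamma>8: "8 * g * cap < \<Gamma>" by (simp add: \<Gamma>_def)
  then have \<Gamma>: "0 < \<Gamma>" using gc by linarith
  have "8 * g * cap \<le> 8 * g * cap / v" "8 * g * cap \<le> 8 * g * cap / u" using gc(1) uv by (simp_all add: pos_le_divide_eq mult_left_le)
  moreover have "u * \<Gamma> = u + 8 * g * cap / v" "v * \<Gamma> = v + 8 * g * cap / u" using uv by (simp_all add: \<Gamma>_def field_simps)
  ultimately have big: "2 * g * cap < sqrt (1 - lam) * \<Gamma>" "2 * g < sqrt lam * \<Gamma>"
    using uv gc g unfolding u_def[symmetric] v_def[symmetric] by linarith+
  have Mdl: "0 < real Mdl" using dims by simp
  have \<kappa>: "0 < \<kappa>" "\<kappa> * \<Gamma> * cap * real Mdl \<le> 1" using \<Gamma> cap1 Mdl by (simp_all add: \<kappa>_def)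
  have K1: "1 \<le> K" unfolding K_def pos_le_divide_eq[OF uv(1)] using uv(2) by linarith
  have \<tau>: "0 < \<tau>" "\<tau> \<le> 1 / 16" "6 * \<tau> * K \<le> \<kappa>"
  proof -
    show "0 < \<tau>" "\<tau> \<le> 1 / 16" using \<kappa> K1 by (auto simp: \<tau>_def)
    have "\<tau> \<le> \<kappa> / (6 * K)" by (simp add: \<tau>_def)
    then show "6 * \<tau> * K \<le> \<kappa>" using K1 by (simp add: pos_le_divide_eq ac_simps)
  qed
  have \<tau>K: "\<tau> \<le> \<tau> * K" using mult_left_mono[OF K1, of \<tau>] \<tau>(1) by simp
  have \<tau>6: "6 * \<tau> \<le> \<kappa>" using \<tau>(3) \<tau>K by simp
  define c0 where "c0 = 2 * \<bar>log 2 \<tau>\<bar> * real (Mul + Ndl)"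
  \<comment> \<open>\<open>c0 + 1\<close> is lost on the first digits, and
    \<open>(c0 + 1) * (1 + W)\<close> covers the loss on the part shared by main and side
    channel.\<close>
  define c where "c = (c0 + 1) * (2 + W)"
  have c0: "0 \<le> c0" by (simp add: c0_def)
  have cc: "0 \<le> c" "c0 + 1 \<le> c" "(c0 + 1) + (c0 + 1) * (1 + W) \<le> c" using c0 params by (auto simp: c_def algebra_simps)
  have L0: "0 < L" using L by simp
  show ?thesis
  proof (intro exI[of _ c] conjI cc(1))
    show "\<forall>\<^sub>F \<rho> in at_top. \<exists>R. achievable (net \<rho>) R \<and>
      wm * ((1 - 3 / real L) * (real Ndl * log 2 \<rho>) - c) \<le> fst R \<and>
      wm * ((1 - 3 / real L) * (dof_ul * log 2 \<rho>) - c) \<le> snd R"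
      \<comment> \<open>The bound \<open>1 / \<tau>\<^sup>2\<close> ensures that \<tau> times the
        square root of \<rho> is at least 1, which the strong regime requires.\<close>
      using eventually_ge_at_top[of "max 2 (1 / \<tau>\<^sup>2)"]
    proof eventually_elim
      fix \<rho> :: real assume "max 2 (1 / \<tau>\<^sup>2) \<le> \<rho>"
      then have \<rho>: "1 < \<rho>" "1 / \<tau>\<^sup>2 \<le> \<rho>" by auto
      have "1 \<le> \<tau> * sqrt \<rho>"
      proof -
        have "1 \<le> \<tau>\<^sup>2 * \<rho>" using \<rho>(2) \<tau>(1) by (simp add: pos_divide_le_eq mult.commute)
        then have "sqrt 1 \<le> sqrt (\<tau>\<^sup>2 * \<rho>)" by (rule real_sqrt_le_mono)
        then show ?thesis using \<tau>(1) by (simp add: real_sqrt_mult)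
      qed
      then have \<tau>\<rho>: "1 \<le> \<tau> * \<rho> powr (1 / 2)" by (simp only: sqrt_eq_powr(1)[OF \<rho>(1)])
      obtain ya yb Pa Pb where gs: "grid_scheme Mdl Nul Mul Ndl wm W lam aI aS h V U S D \<rho> g \<Gamma> \<kappa> ya yb
          (\<tau> * \<rho> powr (1 / 2)) (\<tau> * \<rho> powr (aS / 2)) L Pa Pb"
        and y: "\<tau> * \<rho> powr (xa / 2) \<le> ya" "\<tau> * \<rho> powr (xb / 2) \<le> yb"
      proof (cases "aI < 1")
        case True
        show thesis
          by (rule that[OF grid_scheme_weak[OF True \<rho>(1) L0 _ noise[unfolded e_def] big(1) \<Gamma>8 big(2) \<kappa>(2) \<tau>(1,2) \<tau>6 refl refl]]) (use g in auto)
      next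
        case False
        then have aI1: "1 \<le> aI" by simp
        show thesis
          by (rule that[OF grid_scheme_strong[OF aI1 \<rho>(1) L0 _ noise[unfolded e_def] big(1) \<Gamma>8 big(2) \<kappa>(2) \<tau> K_def[unfolded u_def] \<tau>\<rho> refl refl]])
            (use g \<tau>K in \<open>auto intro: mult_right_mono\<close>)
      qed
      interpret gs: grid_scheme Mdl Nul Mul Ndl wm W lam aI aS h V U S D \<rho> g \<Gamma> \<kappa> ya yb
          "\<tau> * \<rho> powr (1 / 2)" "\<tau> * \<rho> powr (aS / 2)" L Pa Pb by (rule gs)
      interpret sc: scheme "net \<rho>" L g gs.SD gs.SA gs.SB gs.SS gs.xd gs.xu gs.xside gs.sD gs.sU gs.sI gs.sS
        by (rule gs.is_scheme)
      let ?l = "log 2 \<rho>"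
      have l: "0 \<le> ?l" using \<rho> by simp
      note cards = gs.log_cards[OF \<tau>(1) y order_refl order_refl, folded c0_def]
      have s: "(1 - 3 / real L) * x \<le> (1 - 2 / real L) * x" if "0 \<le> x" for x
        using that by (intro mult_right_mono diff_left_mono divide_right_mono) auto
      have rate: "(1 - 3 / real L) * (x * ?l) - (c0 + 1) \<le> code_rate L X"
        if "x * ?l - c0 \<le> log 2 (real (card X))" "0 \<le> x" for x X
        using code_rate_ge[OF that(1) L that(2) c0 l] s[of "x * ?l"] that(2) l by simp
      have rD: "(1 - 3 / real L) * (real Ndl * ?l) - (c0 + 1) \<le> code_rate L gs.SD" by (rule rate[OF cards(1)]) simp
      have rA: "(1 - 3 / real L) * ((real m * xa + real (Mul - m)) * ?l) - (c0 + 1) \<le> code_rate L gs.SA"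
        by (rule rate[OF cards(2)]) (use xa_xb in simp)
      have rB: "(1 - 3 / real L) * (real m * xb * ?l) - (c0 + 1) \<le> code_rate L gs.SB"
        by (rule rate[OF cards(3)]) (use xa_xb in simp)
      have rS: "(1 - 3 / real L) * (W * (real m * aS) * ?l) - (c0 + 1) * W \<le> (1 - 1 / real L) * W * code_rate L gs.SS"
      proof -
        define t where "t = 1 - 1 / real L"
        have t: "0 \<le> t" "t \<le> 1" using L by (auto simp: t_def)
        have x: "0 \<le> real m * aS * ?l" using params l by simp
        \<comment> \<open>The losses of the side channel multiply: (1 - 1 / L) (1 - 2 / L) is at
          least 1 - 3 / L.\<close>
        have "t * (1 - 2 / real L) = 1 - 3 / real L + 2 / (real L * real L)"
          unfolding t_def using L by (simp add: field_simps)
        then have "1 - 3 / real L \<le> t * (1 - 2 / real L)" by simp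
        from mult_right_mono[OF this x]
        have "(1 - 3 / real L) * (real m * aS * ?l) \<le> t * ((1 - 2 / real L) * (real m * aS * ?l))" by (simp only: mult.assoc)
        moreover have "t * (c0 + 1) \<le> 1 * (c0 + 1)" using c0 by (intro mult_right_mono t(2)) simp
        ultimately have "(1 - 3 / real L) * (real m * aS * ?l) - (c0 + 1) \<le> t * ((1 - 2 / real L) * (real m * aS * ?l)) - t * (c0 + 1)"
          unfolding mult_1_left by (rule diff_mono)
        also have "\<dots> = t * ((1 - 2 / real L) * (real m * aS * ?l) - (c0 + 1))" by (simp add: right_diff_distrib)
        also have "\<dots> \<le> t * code_rate L gs.SS"
          using code_rate_ge[OF cards(4) L _ c0 l] params t by (intro mult_left_mono) auto
        finally have "W * ((1 - 3 / real L) * (real m * aS * ?l) - (c0 + 1)) \<le> W * (t * code_rate L gs.SS)"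
          using params by (intro mult_left_mono) auto
        moreover have "W * ((1 - 3 / real L) * (real m * aS * ?l) - (c0 + 1)) =
            (1 - 3 / real L) * (W * (real m * aS) * ?l) - (c0 + 1) * W"
          by (simp add: algebra_simps)
        moreover have "W * (t * code_rate L gs.SS) = t * W * code_rate L gs.SS" by simp
        ultimately show ?thesis unfolding t_def[symmetric] by (simp only:)
      qed
      have "(1 - 3 / real L) * (min (real m * xb) (W * (real m * aS)) * ?l) - (c0 + 1) * (1 + W)
          \<le> min (code_rate L gs.SB) ((1 - 1 / real L) * W * code_rate L gs.SS)"
      \<comment> \<open>For \<open>L = 2\<close> the factor \<open>1 - 3 / L\<close> is negative and
        monotonicity fails, but then the left side is at most 0 and the rates are
        nonnegative.\<close>
      proof (cases "3 \<le> L")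
        case True
        have p: "0 \<le> 1 - 3 / real L" using True by simp
        have "(1 - 3 / real L) * (min (real m * xb) (W * (real m * aS)) * ?l) \<le> (1 - 3 / real L) * (real m * xb * ?l)"
          "(1 - 3 / real L) * (min (real m * xb) (W * (real m * aS)) * ?l) \<le> (1 - 3 / real L) * (W * (real m * aS) * ?l)"
          using p l by (intro mult_left_mono mult_right_mono; simp)+
        moreover have "(c0 + 1) * (1 + W) = (c0 + 1) + (c0 + 1) * W" "0 \<le> (c0 + 1) * W" using c0 params by (simp_all add: algebra_simps)
        ultimately show ?thesis using rB rS c0 by (simp only: min.bounded_iff) linarith
      next
        case False
        then have "1 - 3 / real L \<le> 0" using L by simp
        moreover have "0 \<le> min (real m * xb) (W * (real m * aS)) * ?l" using xa_xb params l by simp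
        ultimately have "(1 - 3 / real L) * (min (real m * xb) (W * (real m * aS)) * ?l) \<le> 0" by (rule mult_nonpos_nonneg)
        moreover have "0 \<le> (c0 + 1) * (1 + W)" using c0 params by simp
        moreover have "0 \<le> min (code_rate L gs.SB) ((1 - 1 / real L) * W * code_rate L gs.SS)"
          using code_rate_nonneg[of L gs.SB] code_rate_nonneg[of L gs.SS] params L by simp
        ultimately show ?thesis by linarith
      qed
      then have rU: "(1 - 3 / real L) * (dof_ul * ?l) - c \<le> code_rate L gs.SA + min (code_rate L gs.SB) ((1 - 1 / real L) * W * code_rate L gs.SS)"
        using rA cc(3) unfolding dof_ul_def distrib_right[of _ _ ?l] distrib_left[of "1 - 3 / real L"] by linarith
      show "\<exists>R. achievable (net \<rho>) R \<and> wm * ((1 - 3 / real L) * (real Ndl * ?l) - c) \<le> fst R \<and> wm * ((1 - 3 / real L) * (dof_ul * ?l) - c) \<le> snd R"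
      proof (intro exI conjI)
        show "achievable (net \<rho>) (wm * code_rate L gs.SD, wm * (code_rate L gs.SA + min (code_rate L gs.SB) ((1 - 1 / real L) * W * code_rate L gs.SS)))"
          using sc.achievable_rates by simp
        show "wm * ((1 - 3 / real L) * (real Ndl * ?l) - c) \<le> fst (wm * code_rate L gs.SD, wm * (code_rate L gs.SA + min (code_rate L gs.SB) ((1 - 1 / real L) * W * code_rate L gs.SS)))"
          using rD cc(2) params unfolding fst_conv by (intro mult_left_mono) linarith+
        show "wm * ((1 - 3 / real L) * (dof_ul * ?l) - c) \<le> snd (wm * code_rate L gs.SD, wm * (code_rate L gs.SA + min (code_rate L gs.SB) ((1 - 1 / real L) * W * code_rate L gs.SS)))"
          unfolding snd_conv using rU params by (intro mult_left_mono) auto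
      qed
    qed
  qed
qed

text \<open>The corner with full downlink attains the optimal sum, so one point of the region is
  enough.\<close>

theorem gdof_achievable: "(real Ndl, dof_ul) \<in> gdof_region net wm"
proof (rule gdof_regionI)
  have U: "0 \<le> dof_ul" unfolding dof_ul_def using xa_xb params by simp
  show "0 < wm" "0 \<le> real Ndl" "0 \<le> dof_ul" using params U by auto
  show "Wm (net \<rho>) = wm" for \<rho> by simp
  fix \<eta> :: real assume \<eta>: "0 < \<eta>"
  define s where "s = real Ndl + dof_ul"
  \<comment> \<open>One half of \<open>\<eta>\<close> pays for the relative loss
    \<open>3 / L\<close>, hence the 6; the other half pays for \<open>c\<close> divided by log
    \<rho>.\<close>
  obtain L0 :: nat where L0: "6 * s / \<eta> < real L0" using reals_Archimedean2 by blast
  define L where "L = max L0 2"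
  have L: "2 \<le> L" "6 * s / \<eta> < real L" using L0 by (auto simp: L_def)
  obtain c where c: "0 \<le> c" and ev: "\<forall>\<^sub>F \<rho> in at_top. \<exists>R. achievable (net \<rho>) R \<and>
    wm * ((1 - 3 / real L) * (real Ndl * log 2 \<rho>) - c) \<le> fst R \<and>
    wm * ((1 - 3 / real L) * (dof_ul * log 2 \<rho>) - c) \<le> snd R"
    using achievable_for_large_snr[OF L(1)] by blast
  show "\<forall>\<^sub>F \<rho> in at_top. \<exists>R. achievable (net \<rho>) R \<and>
      (real Ndl - \<eta>) * (wm * log 2 \<rho>) \<le> fst R \<and> (dof_ul - \<eta>) * (wm * log 2 \<rho>) \<le> snd R"
    using ev eventually_ge_at_top[of "max 1 (2 powr (2 * c / \<eta>))"]
  proof eventually_elim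
    fix \<rho> :: real
    assume "\<exists>R. achievable (net \<rho>) R \<and> wm * ((1 - 3 / real L) * (real Ndl * log 2 \<rho>) - c) \<le> fst R \<and>
      wm * ((1 - 3 / real L) * (dof_ul * log 2 \<rho>) - c) \<le> snd R" and r: "max 1 (2 powr (2 * c / \<eta>)) \<le> \<rho>"
    then obtain R where R: "achievable (net \<rho>) R" "wm * ((1 - 3 / real L) * (real Ndl * log 2 \<rho>) - c) \<le> fst R"
      "wm * ((1 - 3 / real L) * (dof_ul * log 2 \<rho>) - c) \<le> snd R" by blast
    let ?l = "log 2 \<rho>"
    have l0: "0 \<le> ?l" using r by simp
    have "2 * c / \<eta> \<le> ?l" using r by (subst le_log_iff) auto
    then have cl: "c \<le> \<eta> / 2 * ?l" using \<eta> by (simp add: field_simps)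
    have key: "(x - \<eta>) * ?l \<le> (1 - 3 / real L) * (x * ?l) - c" if "0 \<le> x" "x \<le> s" for x
    proof -
      have "6 * x / \<eta> \<le> 6 * s / \<eta>" using that \<eta> by (intro divide_right_mono) auto
      then have "6 * x / \<eta> < real L" using L(2) by linarith
      then have "3 / real L * x \<le> \<eta> / 2" using \<eta> L(1) by (simp add: field_simps)
      then have 1: "3 / real L * x * ?l \<le> \<eta> / 2 * ?l" using l0 by (rule mult_right_mono)
      have 2: "(1 - 3 / real L) * (x * ?l) = x * ?l - 3 / real L * x * ?l" by (simp add: left_diff_distrib)
      have 3: "(x - \<eta>) * ?l = x * ?l - (\<eta> / 2 * ?l + \<eta> / 2 * ?l)" by (simp add: left_diff_distrib)
      have "Z \<le> X - c" if "p \<le> q" "X = y - p" "Z = y - (q + q)" "c \<le> q" for p q X y Z c :: real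
        using that by linarith
      from this[OF 1 2 3 cl] show ?thesis .
    qed
    have "wm * ((real Ndl - \<eta>) * ?l) \<le> fst R" "wm * ((dof_ul - \<eta>) * ?l) \<le> snd R"
      using key[of "real Ndl"] key[of dof_ul] U R(2,3) params
      by (auto simp: s_def intro: order_trans[OF mult_left_mono])
    then show "\<exists>R. achievable (net \<rho>) R \<and>
      (real Ndl - \<eta>) * (wm * log 2 \<rho>) \<le> fst R \<and> (dof_ul - \<eta>) * (wm * log 2 \<rho>) \<le> snd R"
      using R(1) by (intro exI[of _ R]) (simp add: ac_simps)
  qed
qed

text \<open>For aI up to 2 both sides are the same minimum, taken over \<open>m * xb\<close> against
  the side-channel term. Above 2 no digit needs the side channel, and
  \<open>2 * m \<le> m * aI\<close> makes the full-rank bound \<open>Mul + Ndl\<close> the smaller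
  one.\<close>

lemma sum_dof_eq: "real Ndl + dof_ul = min (real Mul + real Ndl) sum_dof_bound"
proof -
  have r: "real (Mul - m) = real Mul - real m" "real (Ndl - m) = real Ndl - real m"
    by (simp_all add: m_def of_nat_diff)
  have S: "0 \<le> W * (real m * aS)" using params by simp
  show ?thesis
  proof (cases "aI < 1")
    case True
    then have x: "xa = 1 - aI" "xb = aI" "max 0 (1 - aI) = 1 - aI" "max 1 aI = 1"
      using params by (auto simp: xa_def xb_def)
    show ?thesis unfolding dof_ul_def sum_dof_bound_def r x by (simp add: min_def algebra_simps)
  next
    case aI: False
    then have b: "sum_dof_bound = real Mul - real m + (real m * aI + real Ndl - real m) + W * (real m * aS)"
      unfolding sum_dof_bound_def r by simp
    show ?thesis
    proof (cases "aI \<le> 2")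
      case True
      then have x: "xa = aI - 1" "xb = 2 - aI" using aI by (auto simp: xa_def xb_def)
      show ?thesis unfolding dof_ul_def b r x by (simp add: min_def algebra_simps)
    next
      case False
      then have x: "xa = 1" "xb = 0" by (auto simp: xa_def xb_def)
      have "real m * 2 \<le> real m * aI" using False by (intro mult_left_mono) auto
      then show ?thesis unfolding dof_ul_def b r x using S by simp
    qed
  qed
qed

text \<open>Division by \<open>m\<close>, using that maximum and minimum of \<open>Mul\<close> and
  \<open>Ndl\<close> add up to their sum.\<close>

lemma normalized_sum_dof:
  "min (real Mul + real Ndl) sum_dof_bound / real (min Mul Ndl) =
    (if aI < 1
     then min (real (max Mul Ndl) / real (min Mul Ndl) + 1)
              (real (max Mul Ndl) / real (min Mul Ndl) + 1 - aI + W * aS)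
     else min (real (max Mul Ndl) / real (min Mul Ndl) + 1)
              (real (max Mul Ndl) / real (min Mul Ndl) - 1 + aI + W * aS))"
proof -
  define M where "M = real (max Mul Ndl)"
  define k where "k = real m"
  have k: "0 < k" using dims by (simp add: k_def m_def)
  have sum: "real Mul + real Ndl = M + k" by (simp add: M_def k_def m_def max_def min_def)
  have r: "real (Mul - m) = real Mul - k" "real (Ndl - m) = real Ndl - k"
    by (simp_all add: m_def k_def of_nat_diff)
  have b: "sum_dof_bound = M - k + k * max 0 (1 - aI) + k * max 1 aI + W * (k * aS)"
    using sum unfolding sum_dof_bound_def r k_def[symmetric] by linarith
  have "(M - k + k * max 0 (1 - aI) + k * max 1 aI + W * (k * aS)) / k
      = M / k - 1 + max 0 (1 - aI) + max 1 aI + W * aS"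
    using k by (simp add: field_simps)
  moreover have "min x y / k = min (x / k) (y / k)" for x y
    using k by (simp add: min_divide_distrib_right)
  moreover have "(M + k) / k = M / k + 1" using k by (simp add: field_simps)
  ultimately have "min (real Mul + real Ndl) sum_dof_bound / k =
      min (M / k + 1) (M / k - 1 + max 0 (1 - aI) + max 1 aI + W * aS)"
    unfolding sum b by (simp only:)
  moreover have "M / k - 1 + max 0 (1 - aI) + max 1 aI + W * aS =
      (if aI < 1 then M / k + 1 - aI + W * aS else M / k - 1 + aI + W * aS)" by simp
  ultimately show ?thesis unfolding M_def[symmetric] m_def[symmetric] k_def[symmetric]
    by (simp only: if_distrib[of "min (M / k + 1)"])
qed

theorem max_sum_gdof: "is_max_sum (gdof_region net wm) (min (real Mul + real Ndl) sum_dof_bound)"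
  unfolding is_max_sum_def using gdof_achievable gdof_converse sum_dof_eq by (metis fst_conv snd_conv)

end

section \<open>Almost every channel is generic\<close>

lemma AE_channel:
  fixes Mdl Nul Mul Ndl :: nat and W lam aI aS :: real
  assumes "Mul \<le> Mdl" "Ndl \<le> Mdl" "Mul \<le> Nul" "Ndl \<le> Nul" "1 \<le> Mul" "1 \<le> Ndl"
    and "0 < lam" "lam < 1" "0 < wm" "0 \<le> W" "0 \<le> aI" "0 \<le> aS"
  shows "AE h in chan_measure Mdl Nul Mul Ndl. \<exists>V U S D. channel Mdl Nul Mul Ndl wm W lam aI aS h V U S D"
proof -
  let ?I = "chan_idx Mdl Nul Mul Ndl"
  \<comment> \<open>Rows of the interference matrix on top of rows of the uplink matrix. The entries
    sit at distinct indices and are independent, so the composed matrix is as generic as each of the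
    two.\<close>
  let ?v = "\<lambda>i j. if i < min Mul Ndl then (2, i, j) else (1, i - min Mul Ndl, j) :: nat \<times> nat \<times> nat"
  have fin: "finite ?I" by (simp add: chan_idx_def)
  have V: "AE h in chan_measure Mdl Nul Mul Ndl. \<exists>B. inverse_pair Mul (\<lambda>i j. h (?v i j)) B"
    unfolding chan_measure_def
  proof (rule AE_inverse_pair[OF fin])
    show "inj_on (\<lambda>(i, j). ?v i j) ({..<Mul} \<times> {..<Mul})"
      by (auto simp: inj_on_def split: if_splits)
    show "?v i j \<in> ?I" if "i < Mul" "j < Mul" for i j
      using that assms(3) by (auto simp: chan_idx_def)
  qed
  have U: "AE h in chan_measure Mdl Nul Mul Ndl. \<exists>B. inverse_pair Mul (\<lambda>i j. h (1, i, j)) B"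
    unfolding chan_measure_def
    by (rule AE_inverse_pair[OF fin]) (use assms(3) in \<open>auto simp: inj_on_def chan_idx_def\<close>)
  have S: "AE h in chan_measure Mdl Nul Mul Ndl. \<exists>B. inverse_pair (min Mul Ndl) (\<lambda>i j. h (3, i, j)) B"
    unfolding chan_measure_def
    by (rule AE_inverse_pair[OF fin]) (auto simp: inj_on_def chan_idx_def)
  have D: "AE h in chan_measure Mdl Nul Mul Ndl. \<exists>B. inverse_pair Ndl (\<lambda>i j. h (0, i, j)) B"
    unfolding chan_measure_def
    by (rule AE_inverse_pair[OF fin]) (use assms(2) in \<open>auto simp: inj_on_def chan_idx_def\<close>)
  from V U S D show ?thesis
  proof eventually_elim
    fix h
    assume "\<exists>B. inverse_pair Mul (\<lambda>i j. h (?v i j)) B" "\<exists>B. inverse_pair Mul (\<lambda>i j. h (1, i, j)) B"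
      "\<exists>B. inverse_pair (min Mul Ndl) (\<lambda>i j. h (3, i, j)) B" "\<exists>B. inverse_pair Ndl (\<lambda>i j. h (0, i, j)) B"
    then obtain V U S D where inv: "inverse_pair Mul (\<lambda>i j. h (?v i j)) V" "inverse_pair Mul (\<lambda>i j. h (1, i, j)) U"
      "inverse_pair (min Mul Ndl) (\<lambda>i j. h (3, i, j)) S" "inverse_pair Ndl (\<lambda>i j. h (0, i, j)) D" by blast
    have "channel Mdl Nul Mul Ndl wm W lam aI aS h V U S D"
    proof (unfold_locales)
      show "inverse_pair Mul (\<lambda>i j. if i < min Mul Ndl then h (2, i, j) else h (1, i - min Mul Ndl, j)) V"
        using inv(1) unfolding if_distrib[of h] .
    qed (fact assms inv)+
    then show "\<exists>V U S D. channel Mdl Nul Mul Ndl wm W lam aI aS h V U S D" by blast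
  qed
qed

theorem theorem3:
  fixes Mdl Nul Mul Ndl :: nat and Wm W lam aI aS :: real
  assumes "Mul \<le> Mdl" and "Ndl \<le> Mdl" and "Mul \<le> Nul" and "Ndl \<le> Nul"
    and "1 \<le> Mul" and "1 \<le> Ndl"
    and "0 < lam" and "lam < 1" and "0 < Wm" and "0 \<le> W" and "0 \<le> aI" and "0 \<le> aS"
  shows "AE h in chan_measure Mdl Nul Mul Ndl.
    \<exists>s. is_max_sum (gdof_region (net_at Mdl Nul Mul Ndl Wm W lam aI aS h) Wm) s \<and>
      s / real (min Mul Ndl) =
        (if aI < 1
         then min (real (max Mul Ndl) / real (min Mul Ndl) + 1)
                  (real (max Mul Ndl) / real (min Mul Ndl) + 1 - aI + W * aS)
         else min (real (max Mul Ndl) / real (min Mul Ndl) + 1)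
                  (real (max Mul Ndl) / real (min Mul Ndl) - 1 + aI + W * aS))"
  using AE_channel[OF assms]
proof eventually_elim
  fix h
  assume "\<exists>V U S D. channel Mdl Nul Mul Ndl Wm W lam aI aS h V U S D"
  then obtain V U S D where c: "channel Mdl Nul Mul Ndl Wm W lam aI aS h V U S D" by blast
  have net: "net_at Mdl Nul Mul Ndl Wm W lam aI aS h = channel.net Mdl Nul Mul Ndl Wm W lam aI aS h"
    by (intro ext) (simp add: channel.net_def[OF c])
  show "\<exists>s. is_max_sum (gdof_region (net_at Mdl Nul Mul Ndl Wm W lam aI aS h) Wm) s \<and>
      s / real (min Mul Ndl) =
        (if aI < 1
         then min (real (max Mul Ndl) / real (min Mul Ndl) + 1)
                  (real (max Mul Ndl) / real (min Mul Ndl) + 1 - aI + W * aS)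
         else min (real (max Mul Ndl) / real (min Mul Ndl) + 1)
                  (real (max Mul Ndl) / real (min Mul Ndl) - 1 + aI + W * aS))"
    unfolding net by (rule exI, rule conjI, rule channel.max_sum_gdof[OF c], rule channel.normalized_sum_dof[OF c])
qed

end
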